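(* For all nondeterministic expressions $E,F$ (possibly containing free variables): if $E = F$ is derivable from the axiom system described in the context, then $E \simeq F$ (weak congruence).
   Context: Fix a set $\mathsf{Act}$ of actions containing a distinguished internal action $\tau$, and a set $\mathsf{Var}$ of variables. Nondeterministic expressions $E$ and probabilistic expressions $P$ are generated by $E ::= 0 \mid X \mid \alpha.P \mid \mathrm{rec}\,X.E \mid E + E$ ($X \in \mathsf{Var}$, $\alpha \in \mathsf{Act}$) and $P ::= \partial(E) \mid P \oplus_p P$ ($0<p<1$). We write $\alpha.E$ for $\alpha.\partial(E)$. $\mathrm{rec}\,X$ binds $X$; an expression is closed if it has no free variables; $E[\vec F/\vec X]$ is simultaneous capture-avoiding substitution. $\sum_{i\in I} E_i$ denotes an iterated $+$; for probabilistic expressions $P_i$ and $p_i>0$ with $\sum_i p_i=1$, $\bigoplus_{i\in I} p_i P_i$ denotes an iterated $\oplus$ with weights chosen so that $P_i$ gets probability $p_i$, and $\bigoplus_{i} p_i E_i$ abbreviates $\bigoplus_i p_i \partial(E_i)$. A subdistribution over a set $S$ is $\mu:S\to\mathbb R_{\ge0}$ with $|\mu|:=\sum_s\mu(s)\le 1$; it is a distribution if $|\mu|=1$; $\delta_s$ is the Dirac distribution, $\emptyset$ the empty subdistribution; sums, differences, scalar multiples and $\le$ are pointwise. Operational semantics: $P\mapsto\mu$ and $E\xrightarrow{\alpha}\mu$ (with $\mu$ a distribution over expressions) are the least relations with: $\partial(E)\mapsto\delta_E$; if $P\mapsto\mu$ and $Q\mapsto\nu$ then $P\oplus_pQ\mapsto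 p\mu+(1-p)\nu$; if $P\mapsto\mu$ then $\alpha.P\xrightarrow{\alpha}\mu$; if $E[\mathrm{rec}\,X.E/X]\xrightarrow{\alpha}\mu$ then $\mathrm{rec}\,X.E\xrightarrow{\alpha}\mu$; if $E\xrightarrow{\alpha}\mu$ then $E+F\xrightarrow{\alpha}\mu$ and $F+E\xrightarrow{\alpha}\mu$. Combined transitions between subdistributions: the least relation with $\delta_E\xrightarrow{\alpha}\mu$ whenever $E\xrightarrow{\alpha}\mu$, and $\sum_i p_i\nu_i\xrightarrow{\alpha}\sum_ip_i\mu_i$ whenever $\nu_i\xrightarrow{\alpha}\mu_i$ for all $i\in I$ and $p_i\ge0$, $\sum_ip_i\le1$. A derivation is a sequence $(\mu_i^{\to},\mu_i^{\times})_{i\in\mathbb N}$ of subdistributions with $\mu_i^{\to}\xrightarrow{\tau}\mu_{i+1}^{\to}+\mu_{i+1}^{\times}$ (combined) for all $i$; $\mu\Rightarrow\nu$ iff there is a derivation with $\mu=\mu_0^{\to}+\mu_0^{\times}$ and $\nu=\sum_i\mu_i^{\times}$. $\mu\xRightarrow{\alpha}\nu$ means $\mu\Rightarrow\rho\xrightarrow{\alpha}\eta\Rightarrow\nu$ for some $\rho,\eta$; $\xRightarrow{\hat\alpha}$ is $\Rightarrow$ if $\alpha=\tau$ and $\xRightarrow{\alpha}$ otherwise. For an expression $E$, $E\Rightarrow\mu$ means $\delta_E\Rightarrow\mu$, etc. A relation $\mathcal R$ on expressions is lifted to subdistributions as the least relation with $\delta_E\,\mathcal R\,\delta_F$ whenever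 $E\mathcal RF$, closed under $\sum_ip_i\mu_i\,\mathcal R\,\sum_ip_i\nu_i$ when $\mu_i\mathcal R\nu_i$, $p_i\ge0$, $\sum p_i\le1$. A weak bisimulation is a relation $\mathcal R$ on closed expressions such that for $(E,F)\in\mathcal R$: if $E\xrightarrow{\alpha}\mu$ then $F\xRightarrow{\hat\alpha}\nu$ with $\mu\mathcal R\nu$, and if $F\xrightarrow{\alpha}\nu$ then $E\xRightarrow{\hat\alpha}\mu$ with $\mu\mathcal R\nu$; $E\approx F$ iff some weak bisimulation relates them. Closed $E,F$ are weakly congruent, $E\simeq F$, iff $E\xrightarrow{\alpha}\mu$ implies $F\xRightarrow{\alpha}\nu$ with $\mu\approx\nu$ (lifted), and $F\xrightarrow{\alpha}\nu$ implies $E\xRightarrow{\alpha}\mu$ with $\mu\approx\nu$. For expressions with free variables $\vec X$, $E\simeq F$ iff $E[\vec G/\vec X]\simeq F[\vec G/\vec X]$ for all closed $\vec G$. Probabilistic unguardedness: $E \rhd V$ (for $V\subseteq\mathsf{Var}$, also for probabilistic expressions) is the least relation with: $X\rhd\{X\}$; $\tau.P\rhd V$ if $P\rhd V$; $\mathrm{rec}\,X.E\rhd V\setminus\{X\}$ if $E\rhd V$ and $V\neq\{X\}$; $E+F\rhd V$ if $E\rhd V$; $E+F\rhd W$ if $F\rhd W$; $\partial(E)\rhd V$ if $E\rhd V$; $P\oplus_pQ\rhd V\cup W$ if $P\rhd V$ and $Q\rhd W$. $X$ is unguarded in $E$ ($E\rhd X$) iff $E\rhd\{X\}$, guarded otherwise.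 Provable equality $=$ is the least relation on expressions (of both categories) that is an equivalence, a congruence for all operators, allows renaming of bound variables, contains all instances of the axioms below, and is closed under rule R2: N1 $E+F=F+E$; N2 $E+(F+G)=(E+F)+G$; N3 $E+E=E$; N4 $E+0=E$; P1 $P\oplus_pQ=Q\oplus_{1-p}P$; P2 $P\oplus_p(Q\oplus_{q/(1-p)}R)=(P\oplus_{p/(p+q)}Q)\oplus_{p+q}R$; P3 $P\oplus_pP=P$; T1 $\alpha.(\partial(\tau.\partial(E))\oplus_pP)=\alpha.(\partial(E)\oplus_pP)$; T2 $\tau.\bigoplus_{i\in I}p_i(E_i+F)+F=\tau.\bigoplus_{i\in I}p_i(E_i+F)$; T3 $\tau.\bigoplus_{i}p_i(E_i+\alpha.P_i)+\alpha.\bigoplus_ip_iP_i=\tau.\bigoplus_ip_i(E_i+\alpha.P_i)$; T4 $\alpha.\bigoplus_ip_i(E_i+\tau.P_i)+\alpha.\bigoplus_ip_iP_i=\alpha.\bigoplus_ip_i(E_i+\tau.P_i)$; C $\alpha.P+\alpha.Q=\alpha.P+\alpha.(P\oplus_pQ)+\alpha.Q$; R1 $\mathrm{rec}\,X.E=E[\mathrm{rec}\,X.E/X]$; R2 if $F=E[F/X]$ and not $E\rhd X$, then $F=\mathrm{rec}\,X.E$; R3 $\mathrm{rec}\,X.(\tau.(\partial(X+E)\oplus_pP)+F)=\mathrm{rec}\,X.(\tau.(\partial(X+E)\oplus_pP)+\tau.P+F)$; R4 $\mathrm{rec}\,X.(X+E)=\mathrm{rec}\,X.E$; R5 $\mathrm{rec}\,X.(\tau.\partial(X)+E)=\mathrm{rec}\,X.\tau.\partial(E)$;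 R6 $\mathrm{rec}\,X.(\tau.\bigoplus_{i\in I}p_i(X+E_i)+F)=\mathrm{rec}\,X.(\tau.\partial(X)+\sum_{i\in I}E_i+F)$. *)

theory Defs
  imports "HOL-Analysis.Infinite_Sum" "HOL-Library.Infinite_Typeclass"
begin

datatype 'a act = Tau | Vis 'a

typedef prob = "{p::real. 0 < p \<and> p < 1}"
  by (rule exI[of _ "1/2"]) auto

datatype ('a, 'v) nexp =
    NNil
  | NVar 'v
  | NPre "'a act" "('a, 'v) pexp"
  | NRec 'v "('a, 'v) nexp"
  | NSum "('a, 'v) nexp" "('a, 'v) nexp"
and ('a, 'v) pexp =
    PDirac "('a, 'v) nexp"
  | PChoice "('a, 'v) pexp" prob "('a, 'v) pexp"

abbreviation npref :: "'a act \<Rightarrow> ('a, 'v) nexp \<Rightarrow> ('a, 'v) nexp" where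
  "npref a E \<equiv> NPre a (PDirac E)"

primrec fv_n :: "('a, 'v) nexp \<Rightarrow> 'v set" and fv_p :: "('a, 'v) pexp \<Rightarrow> 'v set" where
  "fv_n NNil = {}"
| "fv_n (NVar X) = {X}"
| "fv_n (NPre a P) = fv_p P"
| "fv_n (NRec X E) = fv_n E - {X}"
| "fv_n (NSum E F) = fv_n E \<union> fv_n F"
| "fv_p (PDirac E) = fv_n E"
| "fv_p (PChoice P p Q) = fv_p P \<union> fv_p Q"

definition closed_n :: "('a, 'v) nexp \<Rightarrow> bool" where
  "closed_n E \<longleftrightarrow> fv_n E = {}"

text \<open>A variable not in S (S is finite in all uses; the variable type is infinite);
  we keep X itself if possible.\<close>
definition fresh_var :: "'v \<Rightarrow> 'v set \<Rightarrow> 'v" where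
  "fresh_var X S = (if X \<notin> S then X else (SOME Y. Y \<notin> S))"

primrec subst_n :: "('v \<Rightarrow> ('a, 'v) nexp) \<Rightarrow> ('a, 'v) nexp \<Rightarrow> ('a, 'v) nexp"
  and subst_p :: "('v \<Rightarrow> ('a, 'v) nexp) \<Rightarrow> ('a, 'v) pexp \<Rightarrow> ('a, 'v) pexp" where
  "subst_n \<sigma> NNil = NNil"
| "subst_n \<sigma> (NVar X) = \<sigma> X"
| "subst_n \<sigma> (NPre a P) = NPre a (subst_p \<sigma> P)"
| "subst_n \<sigma> (NRec X E) =
     (let Y = fresh_var X (\<Union>Z \<in> fv_n E - {X}. fv_n (\<sigma> Z))
      in NRec Y (subst_n (\<sigma>(X := NVar Y)) E))"
| "subst_n \<sigma> (NSum E F) = NSum (subst_n \<sigma> E) (subst_n \<sigma> F)"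
| "subst_p \<sigma> (PDirac E) = PDirac (subst_n \<sigma> E)"
| "subst_p \<sigma> (PChoice P p Q) = PChoice (subst_p \<sigma> P) p (subst_p \<sigma> Q)"

definition subst1 :: "('a, 'v) nexp \<Rightarrow> 'v \<Rightarrow> ('a, 'v) nexp \<Rightarrow> ('a, 'v) nexp" where
  "subst1 E X F = subst_n (NVar(X := F)) E"

text \<open>Iterated probabilistic choice over a nonempty list of (weight, expression) pairs,
  with positive weights summing to 1: the i-th expression gets probability p_i.\<close>
function bigoplus :: "(real \<times> ('a, 'v) pexp) list \<Rightarrow> ('a, 'v) pexp" where
  "bigoplus [] = PDirac NNil"
| "bigoplus [(p, P)] = P"
| "bigoplus ((p, P) # y # ys) =
     PChoice P (Abs_prob p) (bigoplus (map (\<lambda>(q, Q). (q / (1 - p), Q)) (y # ys)))"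
  by pat_completeness auto
termination by (relation "measure length") auto

definition valid_weights :: "(real \<times> 'b) list \<Rightarrow> bool" where
  "valid_weights xs \<longleftrightarrow> xs \<noteq> [] \<and> (\<forall>x \<in> set xs. 0 < fst x) \<and> sum_list (map fst xs) = 1"

fun bigsum :: "('a, 'v) nexp list \<Rightarrow> ('a, 'v) nexp" where
  "bigsum [] = NNil"
| "bigsum [E] = E"
| "bigsum (E # F # Es) = NSum E (bigsum (F # Es))"

type_synonym 's subdist = "'s \<Rightarrow> real"

definition is_subdist :: "'s subdist \<Rightarrow> bool" where
  "is_subdist \<mu> \<longleftrightarrow> (\<forall>s. 0 \<le> \<mu> s) \<and> \<mu> summable_on UNIV \<and> infsum \<mu> UNIV \<le> 1"

definition dirac :: "'s \<Rightarrow> 's subdist" where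
  "dirac s = (\<lambda>t. if t = s then 1 else 0)"

text \<open>Convex combination (countable index set, encoded by nat; finite index sets
  are the special case of weights eventually 0).\<close>
definition comb_ok :: "(nat \<Rightarrow> real) \<Rightarrow> bool" where
  "comb_ok p \<longleftrightarrow> (\<forall>i. 0 \<le> p i) \<and> summable p \<and> suminf p \<le> 1"

definition combine :: "(nat \<Rightarrow> real) \<Rightarrow> (nat \<Rightarrow> 's subdist) \<Rightarrow> 's subdist" where
  "combine p \<mu> = (\<lambda>s. \<Sum>i. p i * \<mu> i s)"

inductive pstep :: "('a, 'v) pexp \<Rightarrow> ('a, 'v) nexp subdist \<Rightarrow> bool" where
  pstep_dirac: "pstep (PDirac E) (dirac E)"
| pstep_choice: "pstep P \<mu> \<Longrightarrow> pstep Q \<nu> \<Longrightarrow>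
     pstep (PChoice P p Q) (\<lambda>s. Rep_prob p * \<mu> s + (1 - Rep_prob p) * \<nu> s)"

inductive step :: "('a, 'v) nexp \<Rightarrow> 'a act \<Rightarrow> ('a, 'v) nexp subdist \<Rightarrow> bool" where
  step_pre: "pstep P \<mu> \<Longrightarrow> step (NPre a P) a \<mu>"
| step_rec: "step (subst1 E X (NRec X E)) a \<mu> \<Longrightarrow> step (NRec X E) a \<mu>"
| step_suml: "step E a \<mu> \<Longrightarrow> step (NSum E F) a \<mu>"
| step_sumr: "step E a \<mu> \<Longrightarrow> step (NSum F E) a \<mu>"

inductive cstep :: "('a, 'v) nexp subdist \<Rightarrow> 'a act \<Rightarrow> ('a, 'v) nexp subdist \<Rightarrow> bool" where
  cstep_base: "step E a \<mu> \<Longrightarrow> cstep (dirac E) a \<mu>"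
| cstep_comb: "(\<And>i. cstep (\<nu> i) a (\<mu> i)) \<Longrightarrow> comb_ok p \<Longrightarrow>
     cstep (combine p \<nu>) a (combine p \<mu>)"

definition wk :: "('a, 'v) nexp subdist \<Rightarrow> ('a, 'v) nexp subdist \<Rightarrow> bool" where
  "wk \<mu> \<nu> \<longleftrightarrow> (\<exists>mto mx :: nat \<Rightarrow> ('a, 'v) nexp subdist.
      (\<forall>i. is_subdist (mto i) \<and> is_subdist (mx i)) \<and>
      (\<forall>i. cstep (mto i) Tau (\<lambda>s. mto (Suc i) s + mx (Suc i) s)) \<and>
      \<mu> = (\<lambda>s. mto 0 s + mx 0 s) \<and>
      \<nu> = (\<lambda>s. \<Sum>i. mx i s))"

definition wtrans :: "('a, 'v) nexp subdist \<Rightarrow> 'a act \<Rightarrow> ('a, 'v) nexp subdist \<Rightarrow> bool" where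
  "wtrans \<mu> a \<nu> \<longleftrightarrow> (\<exists>\<rho> \<eta>. wk \<mu> \<rho> \<and> cstep \<rho> a \<eta> \<and> wk \<eta> \<nu>)"

definition wtrans_hat :: "('a, 'v) nexp subdist \<Rightarrow> 'a act \<Rightarrow> ('a, 'v) nexp subdist \<Rightarrow> bool" where
  "wtrans_hat \<mu> a \<nu> \<longleftrightarrow> (if a = Tau then wk \<mu> \<nu> else wtrans \<mu> a \<nu>)"

inductive lift :: "('s \<Rightarrow> 's \<Rightarrow> bool) \<Rightarrow> 's subdist \<Rightarrow> 's subdist \<Rightarrow> bool" for R where
  lift_base: "R E F \<Longrightarrow> lift R (dirac E) (dirac F)"
| lift_comb: "(\<And>i. lift R (\<mu> i) (\<nu> i)) \<Longrightarrow> comb_ok p \<Longrightarrow>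
     lift R (combine p \<mu>) (combine p \<nu>)"

definition weak_bisim :: "(('a, 'v) nexp \<Rightarrow> ('a, 'v) nexp \<Rightarrow> bool) \<Rightarrow> bool" where
  "weak_bisim R \<longleftrightarrow> (\<forall>E F. R E F \<longrightarrow> closed_n E \<and> closed_n F \<and>
     (\<forall>a \<mu>. step E a \<mu> \<longrightarrow> (\<exists>\<nu>. wtrans_hat (dirac F) a \<nu> \<and> lift R \<mu> \<nu>)) \<and>
     (\<forall>a \<nu>. step F a \<nu> \<longrightarrow> (\<exists>\<mu>. wtrans_hat (dirac E) a \<mu> \<and> lift R \<mu> \<nu>)))"

definition wbisim :: "('a, 'v) nexp \<Rightarrow> ('a, 'v) nexp \<Rightarrow> bool" where
  "wbisim E F \<longleftrightarrow> (\<exists>R. weak_bisim R \<and> R E F)"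

definition wcong_closed :: "('a, 'v) nexp \<Rightarrow> ('a, 'v) nexp \<Rightarrow> bool" where
  "wcong_closed E F \<longleftrightarrow>
     (\<forall>a \<mu>. step E a \<mu> \<longrightarrow> (\<exists>\<nu>. wtrans (dirac F) a \<nu> \<and> lift wbisim \<mu> \<nu>)) \<and>
     (\<forall>a \<nu>. step F a \<nu> \<longrightarrow> (\<exists>\<mu>. wtrans (dirac E) a \<mu> \<and> lift wbisim \<mu> \<nu>))"

definition wcong :: "('a, 'v) nexp \<Rightarrow> ('a, 'v) nexp \<Rightarrow> bool" where
  "wcong E F \<longleftrightarrow> (\<forall>\<sigma>. (\<forall>X. closed_n (\<sigma> X)) \<longrightarrow> wcong_closed (subst_n \<sigma> E) (subst_n \<sigma> F))"

inductive ung_n :: "('a, 'v) nexp \<Rightarrow> 'v set \<Rightarrow> bool"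
  and ung_p :: "('a, 'v) pexp \<Rightarrow> 'v set \<Rightarrow> bool" where
  ung_var: "ung_n (NVar X) {X}"
| ung_tau: "ung_p P V \<Longrightarrow> ung_n (NPre Tau P) V"
| ung_rec: "ung_n E V \<Longrightarrow> V \<noteq> {X} \<Longrightarrow> ung_n (NRec X E) (V - {X})"
| ung_suml: "ung_n E V \<Longrightarrow> ung_n (NSum E F) V"
| ung_sumr: "ung_n F W \<Longrightarrow> ung_n (NSum E F) W"
| ung_dirac: "ung_n E V \<Longrightarrow> ung_p (PDirac E) V"
| ung_choice: "ung_p P V \<Longrightarrow> ung_p Q W \<Longrightarrow> ung_p (PChoice P p Q) (V \<union> W)"

definition unguarded :: "'v \<Rightarrow> ('a, 'v) nexp \<Rightarrow> bool" where
  "unguarded X E \<longleftrightarrow> ung_n E {X}"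

inductive peq_n :: "('a, 'v::infinite) nexp \<Rightarrow> ('a, 'v) nexp \<Rightarrow> bool"
  and peq_p :: "('a, 'v) pexp \<Rightarrow> ('a, 'v) pexp \<Rightarrow> bool" where
  refl_n: "peq_n E E"
| sym_n: "peq_n E F \<Longrightarrow> peq_n F E"
| trans_n: "peq_n E F \<Longrightarrow> peq_n F G \<Longrightarrow> peq_n E G"
| refl_p: "peq_p P P"
| sym_p: "peq_p P Q \<Longrightarrow> peq_p Q P"
| trans_p: "peq_p P Q \<Longrightarrow> peq_p Q R \<Longrightarrow> peq_p P R"
| cong_pre: "peq_p P Q \<Longrightarrow> peq_n (NPre a P) (NPre a Q)"
| cong_rec: "peq_n E F \<Longrightarrow> peq_n (NRec X E) (NRec X F)"
| cong_sum: "peq_n E E' \<Longrightarrow> peq_n F F' \<Longrightarrow> peq_n (NSum E F) (NSum E' F')"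
| cong_dirac: "peq_n E F \<Longrightarrow> peq_p (PDirac E) (PDirac F)"
| cong_choice: "peq_p P P' \<Longrightarrow> peq_p Q Q' \<Longrightarrow> peq_p (PChoice P p Q) (PChoice P' p Q')"
| alpha: "Y \<notin> fv_n (NRec X E) \<Longrightarrow> peq_n (NRec X E) (NRec Y (subst1 E X (NVar Y)))"
| N1: "peq_n (NSum E F) (NSum F E)"
| N2: "peq_n (NSum E (NSum F G)) (NSum (NSum E F) G)"
| N3: "peq_n (NSum E E) E"
| N4: "peq_n (NSum E NNil) E"
| P1: "peq_p (PChoice P p Q) (PChoice Q (Abs_prob (1 - Rep_prob p)) P)"
| P2: "0 < p \<Longrightarrow> 0 < q \<Longrightarrow> p + q < 1 \<Longrightarrow>
     peq_p (PChoice P (Abs_prob p) (PChoice Q (Abs_prob (q / (1 - p))) R))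
           (PChoice (PChoice P (Abs_prob (p / (p + q))) Q) (Abs_prob (p + q)) R)"
| P3: "peq_p (PChoice P p P) P"
| T1: "peq_n (NPre a (PChoice (PDirac (npref Tau E)) p P)) (NPre a (PChoice (PDirac E) p P))"
| T2: "valid_weights xs \<Longrightarrow>
     peq_n (NSum (NPre Tau (bigoplus (map (\<lambda>(p, E). (p, PDirac (NSum E F))) xs))) F)
           (NPre Tau (bigoplus (map (\<lambda>(p, E). (p, PDirac (NSum E F))) xs)))"
| T3: "valid_weights xs \<Longrightarrow>
     peq_n (NSum (NPre Tau (bigoplus (map (\<lambda>(p, E, P). (p, PDirac (NSum E (NPre a P)))) xs)))
                 (NPre a (bigoplus (map (\<lambda>(p, E, P). (p, P)) xs))))
           (NPre Tau (bigoplus (map (\<lambda>(p, E, P). (p, PDirac (NSum E (NPre a P)))) xs)))"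
| T4: "valid_weights xs \<Longrightarrow>
     peq_n (NSum (NPre a (bigoplus (map (\<lambda>(p, E, P). (p, PDirac (NSum E (NPre Tau P)))) xs)))
                 (NPre a (bigoplus (map (\<lambda>(p, E, P). (p, P)) xs))))
           (NPre a (bigoplus (map (\<lambda>(p, E, P). (p, PDirac (NSum E (NPre Tau P)))) xs)))"
| C: "peq_n (NSum (NPre a P) (NPre a Q))
            (NSum (NSum (NPre a P) (NPre a (PChoice P p Q))) (NPre a Q))"
| R1: "peq_n (NRec X E) (subst1 E X (NRec X E))"
| R2: "peq_n F (subst1 E X F) \<Longrightarrow> \<not> unguarded X E \<Longrightarrow> peq_n F (NRec X E)"
| R3: "peq_n (NRec X (NSum (NPre Tau (PChoice (PDirac (NSum (NVar X) E)) p P)) F))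
             (NRec X (NSum (NSum (NPre Tau (PChoice (PDirac (NSum (NVar X) E)) p P)) (NPre Tau P)) F))"
| R4: "peq_n (NRec X (NSum (NVar X) E)) (NRec X E)"
| R5: "peq_n (NRec X (NSum (npref Tau (NVar X)) E)) (NRec X (npref Tau E))"
| R6: "valid_weights xs \<Longrightarrow>
     peq_n (NRec X (NSum (NPre Tau (bigoplus (map (\<lambda>(p, E). (p, PDirac (NSum (NVar X) E))) xs))) F))
           (NRec X (NSum (NSum (npref Tau (NVar X)) (bigsum (map snd xs))) F))"

end

theory Submission
  imports "HOL-Probability.Probability_Mass_Function" Defs
begin

text \<open>
  Every weak transition that matters here starts and ends in a full distribution, so the semantics can be
  transported to probability mass functions. There, weak transitions can be composed infinitely often as
  long as the mass still pending tends to 0.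

  Congruence for rec, and the recursion axioms, compare two closed instances of one expression whose holes
  are filled with pairs from a relation B. Every such pair of instances carries a potential, a bound on the
  probability of reaching a hole by internal moves alone. Where a hole is reached, its solution property
  is used to jump to a new pair of potential at most c. If c < 1, iterating jumps exhausts all mass and
  yields a matching weak transition. Guardedness of X in E is exactly what bounds the probability of
  reaching X away from 1, which gives unique solutions (R2). The axioms R3 to R6 reduce to showing that the
  recursion on one side solves the equation of the other side, together with the converse.
\<close>

section \<open>Flows and combined transitions\<close>

text \<open>A weak move is an infinite derivation, so it cannot be matched by induction on its
  length. It is analysed only up to an arbitrarily small mass; the unanalysed branches are again
  weak moves of related pairs and are left to the next round. The tolerances decrease geometrically,
  so the open mass vanishes, and the lifted relation survives the limit because it comes from an
  equivalence and is therefore determined by the masses of equivalence classes.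

  The two directions of a comparison with \<open>NRec X E\<close> differ in difficulty. A transition
  that the recursion makes inside a hole is made by its body with fewer unfoldings, so an induction
  on the number of unfoldings shows that any solution simulates the recursion. When two recursions
  solve each other's equations, this induction serves both directions; congruence for rec, renaming
  and R3 to R6 are obtained that way. That the recursion simulates a given solution has no such
  measure, because the solution answers by weak transitions that may run into holes again and again.
  This is the place where the potential and the bound below 1 do their work.\<close>

abbreviation nsum :: "('b \<Rightarrow> ennreal) \<Rightarrow> ennreal" where
  "nsum f \<equiv> (\<integral>\<^sup>+x. f x \<partial>count_space UNIV)"

abbreviation ep :: "'b pmf \<Rightarrow> 'b \<Rightarrow> ennreal" where
  "ep m x \<equiv> ennreal (pmf m x)"

text \<open>Tonelli for counting measures on arbitrary types. Free interchange of sums is the reason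
  for handling masses as \<open>ennreal\<close> functions and turning to reals only at the interface
  with the semantics.\<close>

lemma nsum_commute: "nsum (\<lambda>x. nsum (\<lambda>y. f x y)) = nsum (\<lambda>y. nsum (\<lambda>x. f x y))"
  using nn_integral_fst_count_space[of "\<lambda>(x,y). f x y"] nn_integral_snd_count_space[of "\<lambda>(x,y). f x y"]
  by simp

lemma nsum_add: "nsum (\<lambda>x. f x + g x) = nsum f + nsum g"
  by (rule nn_integral_add) auto

lemma nsum_cmult: "nsum (\<lambda>x. c * f x) = c * nsum f"
  by (rule nn_integral_cmult) auto

lemma nsum_multc: "nsum (\<lambda>x. f x * c) = nsum f * c"
  by (rule nn_integral_multc) auto

lemma nsum_single:
  assumes "\<And>x. x \<noteq> a \<Longrightarrow> f x = 0" shows "nsum f = f a"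
proof -
  have "nsum f = (\<Sum>x\<in>{a}. f x)" by (rule nn_integral_count_space') (use assms in auto)
  then show ?thesis by simp
qed

lemma nsum_mono: "(\<And>x. f x \<le> g x) \<Longrightarrow> nsum f \<le> nsum g"
  by (rule nn_integral_mono) auto

lemma nsum_cong: "(\<And>x. f x = g x) \<Longrightarrow> nsum f = nsum g"
  by simp

lemma nsum_ge: "f x \<le> nsum f"
  by (rule nn_integral_ge_point) auto

lemma nsum_eq_0D: "nsum f = 0 \<Longrightarrow> f x = 0"
  using nsum_ge[of f x] by auto

lemma nsum_ep: "nsum (ep m) = 1"
  by (simp add: nn_integral_pmf)

lemma nsum_ep_mult: "nsum (\<lambda>x. ep m x * f x) = (\<integral>\<^sup>+x. f x \<partial>measure_pmf m)"
  by (simp add: nn_integral_measure_pmf)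

lemma ep_bind: "ep (bind_pmf M f) u = nsum (\<lambda>x. ep M x * ep (f x) u)"
  by (simp add: ennreal_pmf_bind nsum_ep_mult)

lemma ep_return: "ep (return_pmf a) u = (if u = a then 1 else 0)"
  by (auto simp: pmf_return indicator_def)

lemma nsum_ep_return': "nsum (\<lambda>x. f x * ep (return_pmf x) u) = f u"
  by (subst nsum_single[of u]) (auto simp: ep_return)

lemma pmf_of_weights:
  assumes "nsum w = 1" shows "\<exists>m. \<forall>x. ep m x = w x"
proof -
  have fin: "w x \<noteq> top" for x using nsum_ge[of w x] assms by (metis ennreal_one_neq_top neq_top_trans)
  define m where "m = embed_pmf (\<lambda>x. enn2real (w x))"
  have "pmf m x = enn2real (w x)" for x unfolding m_def
    by (rule pmf_embed_pmf) (use fin assms in \<open>simp_all add: ennreal_enn2real_if\<close>)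
  then have "ep m x = w x" for x using fin by (simp add: ennreal_enn2real_if)
  then show ?thesis by blast
qed

lemma pmf_eqI_ep: "(\<And>x. ep m x = ep n x) \<Longrightarrow> m = n"
  by (rule pmf_eqI) (metis ennreal_inj pmf_nonneg)

lemma nsum_nat_split: "nsum (f::nat \<Rightarrow> ennreal) = f 0 + nsum (\<lambda>n. f (Suc n))"
  by (simp add: nn_integral_count_space_nat suminf_offset[of f 1] add.commute)

lemma ennreal_mult_div: "(c::ennreal) \<noteq> top \<Longrightarrow> (c = 0 \<Longrightarrow> t = 0) \<Longrightarrow> c * (t / c) = t"
  by (cases "c = 0") (simp_all add: ennreal_mult_divide_eq ennreal_times_divide mult.commute[of c])

text \<open>A mixture of base pairs with weights \<open>f\<close>. Combined transitions and lifted
  relations are both of this kind, for the base sets \<open>Bst a\<close> and \<open>Blift R\<close>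
  below. The two sides are arbitrary mass functions, since the stages of a derivation have mass
  below 1.\<close>

definition flow :: "('s pmf \<times> 't pmf) set \<Rightarrow> ('s \<Rightarrow> ennreal) \<Rightarrow> ('t \<Rightarrow> ennreal) \<Rightarrow> bool" where
  "flow B \<mu> \<nu> \<longleftrightarrow> (\<exists>f. (\<forall>b. f b \<noteq> 0 \<longrightarrow> b \<in> B) \<and>
     (\<forall>s. \<mu> s = nsum (\<lambda>b. f b * ep (fst b) s)) \<and> (\<forall>u. \<nu> u = nsum (\<lambda>b. f b * ep (snd b) u)))"

lemma flow_base: "b \<in> B \<Longrightarrow> flow B (ep (fst b)) (ep (snd b))"
  unfolding flow_def
proof (intro exI[of _ "\<lambda>x. if x = b then 1 else 0"] conjI allI)
  fix s show "ep (fst b) s = nsum (\<lambda>x. (if x = b then 1 else 0) * ep (fst x) s)"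
    by (subst nsum_single[of b]) auto
  fix u show "ep (snd b) u = nsum (\<lambda>x. (if x = b then 1 else 0) * ep (snd x) u)"
    by (subst nsum_single[of b]) auto
qed (auto split: if_splits)

text \<open>A mixture of mixtures is a mixture: the weights multiply and are summed over the outer
  index. This takes the place of the closure rule of the inductive definitions, now for any index
  type.\<close>

lemma flow_nsum:
  assumes "\<And>i. w i \<noteq> 0 \<Longrightarrow> flow B (\<alpha> i) (\<beta> i)"
  shows "flow B (\<lambda>s. nsum (\<lambda>i. w i * \<alpha> i s)) (\<lambda>u. nsum (\<lambda>i. w i * \<beta> i u))"
proof -
  have "\<forall>i. \<exists>f. w i \<noteq> 0 \<longrightarrow> ((\<forall>b. f b \<noteq> 0 \<longrightarrow> b \<in> B) \<and>
     (\<forall>s. \<alpha> i s = nsum (\<lambda>b. f b * ep (fst b) s)) \<and> (\<forall>u. \<beta> i u = nsum (\<lambda>b. f b * ep (snd b) u)))"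
    using assms unfolding flow_def by blast
  from choice[OF this] obtain F where F: "\<And>i. w i \<noteq> 0 \<Longrightarrow> (\<forall>b. F i b \<noteq> 0 \<longrightarrow> b \<in> B)"
     "\<And>i s. w i \<noteq> 0 \<Longrightarrow> \<alpha> i s = nsum (\<lambda>b. F i b * ep (fst b) s)"
     "\<And>i s. w i \<noteq> 0 \<Longrightarrow> \<beta> i s = nsum (\<lambda>b. F i b * ep (snd b) s)" by blast
  have *: "nsum (\<lambda>i. w i * \<gamma> i) = nsum (\<lambda>b. nsum (\<lambda>i. w i * F i b) * g b)"
    if "\<And>i. w i \<noteq> 0 \<Longrightarrow> \<gamma> i = nsum (\<lambda>b. F i b * g b)" for \<gamma> g
  proof -
    have "w i * \<gamma> i = nsum (\<lambda>b. w i * F i b * g b)" for i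
      by (cases "w i = 0") (auto simp: that nsum_cmult[symmetric] mult.assoc)
    then have "nsum (\<lambda>i. w i * \<gamma> i) = nsum (\<lambda>i. nsum (\<lambda>b. w i * F i b * g b))" by simp
    also have "\<dots> = nsum (\<lambda>b. nsum (\<lambda>i. w i * F i b * g b))" by (rule nsum_commute)
    finally show ?thesis by (simp add: nsum_multc)
  qed
  show ?thesis unfolding flow_def
  proof (intro exI[of _ "\<lambda>b. nsum (\<lambda>i. w i * F i b)"] conjI allI impI)
    fix b assume "nsum (\<lambda>i. w i * F i b) \<noteq> 0"
    moreover have "nsum (\<lambda>i. w i * F i b) = 0" if "\<And>i. w i * F i b = 0" using that by (subst nsum_cong[of _ "\<lambda>_. 0"]) auto
    ultimately have "\<exists>i. w i * F i b \<noteq> 0" by blast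
    then show "b \<in> B" using F(1) by (metis mult_eq_0_iff)
  next
    fix s show "nsum (\<lambda>i. w i * \<alpha> i s) = nsum (\<lambda>b. nsum (\<lambda>i. w i * F i b) * ep (fst b) s)" by (rule *) (rule F(2))
  next
    fix s show "nsum (\<lambda>i. w i * \<beta> i s) = nsum (\<lambda>b. nsum (\<lambda>i. w i * F i b) * ep (snd b) s)" by (rule *) (rule F(3))
  qed
qed

lemma flow_mass:
  assumes "flow B \<mu> \<nu>" shows "nsum \<mu> = nsum \<nu>"
proof -
  obtain f where f: "\<forall>s. \<mu> s = nsum (\<lambda>b. f b * ep (fst b) s)" "\<forall>u. \<nu> u = nsum (\<lambda>b. f b * ep (snd b) u)"
    using assms unfolding flow_def by blast
  have "nsum \<mu> = nsum (\<lambda>b. nsum (\<lambda>s. f b * ep (fst b) s))" using f(1) by (simp add: nsum_commute[of "\<lambda>s b. f b * ep (fst b) s"])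
  also have "\<dots> = nsum (\<lambda>b. nsum (\<lambda>s. f b * ep (snd b) s))" by (simp add: nsum_cmult nsum_ep)
  also have "\<dots> = nsum \<nu>" using f(2) by (simp add: nsum_commute[of "\<lambda>s b. f b * ep (snd b) s"])
  finally show ?thesis .
qed

text \<open>A family of weights of finite total is countably supported; this is how arbitrary index sets are
  brought into the form of the combinations of the semantics, which are indexed by naturals.\<close>
lemma weights_enum:
  fixes f :: "'b \<Rightarrow> ennreal"
  assumes "nsum f \<le> 1" "\<forall>b. f b \<noteq> 0 \<longrightarrow> b \<in> B" "b0 \<in> B"
  shows "\<exists>p g. comb_ok p \<and> (\<forall>i. g i \<in> B) \<and> (\<forall>h. nsum (\<lambda>b. f b * h b) = nsum (\<lambda>i::nat. ennreal (p i) * h (g i)))"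
proof -
  have fin: "nsum f \<noteq> top" using assms(1) by (metis ennreal_one_neq_top neq_top_trans)
  define A where "A = {b. f b \<noteq> 0}"
  have cA: "countable A"
  proof (cases "nsum f = 0")
    case True
    then have "A = {}" using nsum_eq_0D[OF True] by (auto simp: A_def)
    then show ?thesis by simp
  next
    case False
    \<comment> \<open>Normalising turns the weights into a pmf, whose support is known to be
      countable.\<close>
    have "nsum (\<lambda>b. f b / nsum f) = 1"
      using False fin unfolding divide_ennreal_def nsum_multc
      by (simp add: divide_ennreal_def[symmetric] less_top)
    then obtain m where m: "\<forall>x. ep m x = f x / nsum f" using pmf_of_weights by blast
    have "A \<subseteq> set_pmf m"
    proof
      fix b assume "b \<in> A"
      then have "f b / nsum f \<noteq> 0" using fin by (simp add: A_def)
      then have "ep m b \<noteq> 0" using m by metis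
      then show "b \<in> set_pmf m" by (simp add: set_pmf_iff)
    qed
    then show ?thesis using countable_set_pmf countable_subset by blast
  qed
  define N where "N = to_nat_on A ` A"
  \<comment> \<open>Outside \<open>N\<close> the weight is 0, and \<open>b0\<close> only provides
    some element of \<open>B\<close>.\<close>
  define g where "g i = (if i \<in> N then from_nat_into A i else b0)" for i
  define p where "p i = (if i \<in> N then enn2real (f (g i)) else 0)" for i
  have ffin: "f b \<noteq> top" for b using nsum_ge[of f b] fin by (metis neq_top_trans)
  have bij: "bij_betw (to_nat_on A) A N" unfolding N_def by (simp add: inj_on_to_nat_on[OF cA] inj_on_imp_bij_betw)
  have g: "g (to_nat_on A b) = b" if "b \<in> A" for b using that cA by (simp add: g_def N_def)
  have gB: "g i \<in> B" for i
    unfolding g_def N_def using assms(2,3) cA by (auto simp: A_def)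
  have key: "nsum (\<lambda>b. f b * h b) = nsum (\<lambda>i::nat. ennreal (p i) * h (g i))" for h
  proof -
    have "nsum (\<lambda>i::nat. ennreal (p i) * h (g i)) = (\<integral>\<^sup>+i. f (g i) * h (g i) * indicator N i \<partial>count_space UNIV)"
      by (rule nn_integral_cong) (simp add: p_def ffin ennreal_enn2real_if)
    also have "\<dots> = (\<integral>\<^sup>+i. f (g i) * h (g i) \<partial>count_space N)"
      by (simp add: nn_integral_count_space_indicator)
    also have "\<dots> = (\<integral>\<^sup>+b. f (g (to_nat_on A b)) * h (g (to_nat_on A b)) \<partial>count_space A)"
      by (rule nn_integral_bij_count_space[OF bij, symmetric])
    also have "\<dots> = (\<integral>\<^sup>+b. f b * h b \<partial>count_space A)"
      by (rule nn_integral_cong) (simp add: g)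
    also have "\<dots> = (\<integral>\<^sup>+b. f b * h b * indicator A b \<partial>count_space UNIV)"
      by (simp add: nn_integral_count_space_indicator)
    also have "\<dots> = nsum (\<lambda>b. f b * h b)"
      by (rule nn_integral_cong) (auto simp: A_def split: split_indicator)
    finally show ?thesis by simp
  qed
  have p1: "(\<Sum>i. ennreal (p i)) \<le> 1" using key[of "\<lambda>_. 1"] assms(1) by (simp add: nn_integral_count_space_nat)
  have p0: "0 \<le> p i" for i by (simp add: p_def)
  have sm: "summable p" by (rule summable_suminf_not_top) (use p0 p1 in \<open>auto simp: top_unique\<close>)
  have "comb_ok p" unfolding comb_ok_def using p0 sm p1 by (auto simp: suminf_ennreal2)
  then show ?thesis using key gB by blast
qed

section \<open>The semantics expressed through probability mass functions\<close>

definition stp :: "('a, 'v) nexp \<Rightarrow> 'a act \<Rightarrow> ('a, 'v) nexp pmf \<Rightarrow> bool" where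
  "stp E a t \<longleftrightarrow> step E a (pmf t)"

definition Bst :: "'a act \<Rightarrow> (('a, 'v) nexp pmf \<times> ('a, 'v) nexp pmf) set" where
  "Bst a = {(return_pmf s, t) | s t. stp s a t}"

definition Blift :: "('s \<Rightarrow> 's \<Rightarrow> bool) \<Rightarrow> ('s pmf \<times> 's pmf) set" where
  "Blift R = {(return_pmf x, return_pmf y) | x y. R x y}"

lemma dirac_pmf: "dirac s = pmf (return_pmf s)"
  by (auto simp: dirac_def pmf_return indicator_def)

primrec pdist :: "('a, 'v) pexp \<Rightarrow> ('a, 'v) nexp pmf" where
  "pdist (PDirac E) = return_pmf E"
| "pdist (PChoice P p Q) = bind_pmf (bernoulli_pmf (Rep_prob p)) (\<lambda>b. if b then pdist P else pdist Q)"

lemma Rep_prob_bounds: "0 < Rep_prob p" "Rep_prob p < 1"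
  using Rep_prob[of p] by auto

lemma pmf_pd_choice: "pmf (pdist (PChoice P p Q)) s = Rep_prob p * pmf (pdist P) s + (1 - Rep_prob p) * pmf (pdist Q) s"
  using Rep_prob_bounds[of p] by (simp add: pmf_bind)

lemma pstep_iff: "pstep P \<mu> \<longleftrightarrow> \<mu> = pmf (pdist P)"
proof
  show "pstep P \<mu> \<Longrightarrow> \<mu> = pmf (pdist P)"
    by (induction rule: pstep.induct) (auto simp: dirac_pmf pmf_pd_choice simp del: pdist.simps(2))
  have "pstep P (pmf (pdist P))"
  proof (induction P rule: pexp.induct[of "\<lambda>_. True"])
    case (PDirac x)
    then show ?case using pstep_dirac[of x] by (simp add: dirac_pmf del: pmf_return)
  next
    case (PChoice P p Q)
    show ?case using pstep_choice[OF PChoice, of p] by (simp add: pmf_pd_choice[symmetric] del: pdist.simps(2))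
  qed auto
  then show "\<mu> = pmf (pdist P) \<Longrightarrow> pstep P \<mu>" by simp
qed

lemma step_pmf: "step E a \<mu> \<Longrightarrow> \<exists>t. \<mu> = pmf t"
  by (induction rule: step.induct) (auto simp: pstep_iff)

definition subprob :: "('s \<Rightarrow> real) \<Rightarrow> bool" where
  "subprob \<mu> \<longleftrightarrow> (\<forall>s. 0 \<le> \<mu> s) \<and> nsum (\<lambda>s. ennreal (\<mu> s)) \<le> 1"

lemma subprob_pmf: "subprob (pmf m)"
  by (simp add: subprob_def nsum_ep)

lemma subprob_le1: "subprob \<mu> \<Longrightarrow> 0 \<le> \<mu> s \<and> \<mu> s \<le> 1"
  using nsum_ge[of "\<lambda>s. ennreal (\<mu> s)" s] by (auto simp: subprob_def dest: order_trans)

lemma combine_ennreal: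
  assumes "\<And>i. subprob (\<mu> i)" "comb_ok p"
  shows "ennreal (combine p \<mu> s) = nsum (\<lambda>i. ennreal (p i) * ennreal (\<mu> i s))" "0 \<le> combine p \<mu> s"
proof -
  have p: "0 \<le> p i" "summable p" for i using assms(2) by (auto simp: comb_ok_def)
  have b: "0 \<le> \<mu> i s \<and> \<mu> i s \<le> 1" for i using subprob_le1[OF assms(1)] by blast
  have sm: "summable (\<lambda>i. p i * \<mu> i s)"
    by (rule summable_comparison_test'[OF p(2), of 0]) (use b p in \<open>auto simp: abs_mult mult_left_le\<close>)
  have nn: "0 \<le> p i * \<mu> i s" for i using b p by simp
  show "0 \<le> combine p \<mu> s" by (simp add: combine_def suminf_nonneg[OF sm nn])
  show "ennreal (combine p \<mu> s) = nsum (\<lambda>i. ennreal (p i) * ennreal (\<mu> i s))"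
    using suminf_ennreal2[OF nn sm] p b by (simp add: combine_def nn_integral_count_space_nat ennreal_mult)
qed

lemma comb_ok_nsum: "comb_ok p \<Longrightarrow> nsum (\<lambda>i. ennreal (p i)) \<le> 1"
  by (auto simp: comb_ok_def nn_integral_count_space_nat suminf_ennreal2)

lemma subprob_combine:
  assumes "\<And>i. subprob (\<mu> i)" "comb_ok p" shows "subprob (combine p \<mu>)"
proof -
  have "nsum (\<lambda>s. ennreal (combine p \<mu> s)) = nsum (\<lambda>s. nsum (\<lambda>i. ennreal (p i) * ennreal (\<mu> i s)))"
    using combine_ennreal[OF assms] by simp
  also have "\<dots> = nsum (\<lambda>i. nsum (\<lambda>s. ennreal (p i) * ennreal (\<mu> i s)))" by (rule nsum_commute)
  also have "\<dots> = nsum (\<lambda>i. ennreal (p i) * nsum (\<lambda>s. ennreal (\<mu> i s)))" by (simp add: nsum_cmult)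
  also have "\<dots> \<le> nsum (\<lambda>i. ennreal (p i) * 1)"
    by (rule nsum_mono, rule mult_left_mono) (use assms in \<open>auto simp: subprob_def\<close>)
  also have "\<dots> \<le> 1" using comb_ok_nsum[OF assms(2)] by simp
  finally show ?thesis using combine_ennreal[OF assms] by (auto simp: subprob_def)
qed

lemma flow_combine:
  assumes "\<And>i. subprob (\<mu> i)" "\<And>i. subprob (\<nu> i)" "\<And>i. flow B (\<lambda>s. ennreal (\<mu> i s)) (\<lambda>s. ennreal (\<nu> i s))" "comb_ok p"
  shows "flow B (\<lambda>s. ennreal (combine p \<mu> s)) (\<lambda>s. ennreal (combine p \<nu> s))"
proof -
  note c = combine_ennreal(1)[of \<mu>, OF assms(1,4)] combine_ennreal(1)[of \<nu>, OF assms(2,4)]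
  show ?thesis unfolding c by (rule flow_nsum[OF assms(3)])
qed

text \<open>The way back to \<open>combine\<close>, as the rules \<open>cstep_comb\<close> and
  \<open>lift_comb\<close> demand it. Nonemptiness of \<open>B\<close> provides a pair for the
  indices of weight 0.\<close>

lemma flow_enum:
  assumes "flow B \<mu> \<nu>" "nsum \<mu> \<le> 1" "B \<noteq> {}"
  shows "\<exists>p g. comb_ok p \<and> (\<forall>i. g i \<in> B) \<and> (\<lambda>s. enn2real (\<mu> s)) = combine p (\<lambda>i. pmf (fst (g i))) \<and>
    (\<lambda>s. enn2real (\<nu> s)) = combine p (\<lambda>i. pmf (snd (g i)))"
proof -
  obtain f where f: "\<forall>b. f b \<noteq> 0 \<longrightarrow> b \<in> B" "\<And>s. \<mu> s = nsum (\<lambda>b. f b * ep (fst b) s)" "\<And>u. \<nu> u = nsum (\<lambda>b. f b * ep (snd b) u)"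
    using assms(1) unfolding flow_def by blast
  have "nsum \<mu> = nsum (\<lambda>b. nsum (\<lambda>s. f b * ep (fst b) s))" using f(2) by (simp add: nsum_commute[of "\<lambda>s b. f b * ep (fst b) s"])
  then have "nsum f \<le> 1" using assms(2) by (simp add: nsum_cmult nsum_ep)
  then obtain p g where pg: "comb_ok p" "\<forall>i. g i \<in> B"
    "\<forall>h. nsum (\<lambda>b. f b * h b) = nsum (\<lambda>i::nat. ennreal (p i) * h (g i))"
    using weights_enum[of f B] f(1) assms(3) by blast
  have *: "enn2real (nsum (\<lambda>b. f b * h b)) = c" if "0 \<le> c" "ennreal c = nsum (\<lambda>i. ennreal (p i) * h (g i))" for h c
    using that by (simp only: pg(3) that(2)[symmetric] enn2real_ennreal)
  have "(\<lambda>s. enn2real (\<mu> s)) = combine p (\<lambda>i. pmf (fst (g i)))"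
    unfolding f(2) by (intro ext * combine_ennreal[OF subprob_pmf pg(1)])
  moreover have "(\<lambda>s. enn2real (\<nu> s)) = combine p (\<lambda>i. pmf (snd (g i)))"
    unfolding f(3) by (intro ext * combine_ennreal[OF subprob_pmf pg(1)])
  ultimately show ?thesis using pg(1,2) by blast
qed

lemma Bst_ne: "Bst a \<noteq> {}"
proof -
  have "stp (NPre a (PDirac NNil)) a (return_pmf NNil)"
    unfolding stp_def by (rule step_pre) (simp add: pstep_iff)
  then show ?thesis by (auto simp: Bst_def)
qed

text \<open>With \<open>flow_cstep\<close> this identifies combined transitions with flows over
  \<open>Bst a\<close>: nested combinations collapse to one level.\<close>

lemma cstep_gen:
  "cstep \<mu> a \<nu> \<Longrightarrow> subprob \<mu> \<and> subprob \<nu> \<and> flow (Bst a) (\<lambda>s. ennreal (\<mu> s)) (\<lambda>s. ennreal (\<nu> s))"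
proof (induction rule: cstep.induct)
  case (cstep_base E a \<mu>)
  then obtain t where t: "\<mu> = pmf t" using step_pmf by blast
  with cstep_base have "(return_pmf E, t) \<in> Bst a" by (auto simp: Bst_def stp_def)
  from flow_base[OF this] show ?case by (simp add: t dirac_pmf subprob_pmf del: pmf_return)
next
  case (cstep_comb \<nu> a \<mu> p)
  then show ?case by (simp add: subprob_combine flow_combine)
qed

lemma flow_cstep:
  assumes "flow (Bst a) \<mu> \<nu>" "nsum \<mu> \<le> 1"
  shows "cstep (\<lambda>s. enn2real (\<mu> s)) a (\<lambda>s. enn2real (\<nu> s))"
proof -
  obtain p g where pg: "comb_ok p" "\<forall>i. g i \<in> Bst a" and eq: "(\<lambda>s. enn2real (\<mu> s)) = combine p (\<lambda>i. pmf (fst (g i)))"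
    "(\<lambda>s. enn2real (\<nu> s)) = combine p (\<lambda>i. pmf (snd (g i)))"
    using flow_enum[OF assms Bst_ne] by blast
  have "cstep (pmf (fst (g i))) a (pmf (snd (g i)))" for i
    using pg(2)[rule_format, of i] unfolding Bst_def stp_def by (auto simp: dirac_pmf[symmetric] intro: cstep_base)
  then show ?thesis unfolding eq by (rule cstep_comb) (rule pg(1))
qed

lemma lift_gen:
  "lift R \<mu> \<nu> \<Longrightarrow> subprob \<mu> \<and> subprob \<nu> \<and> flow (Blift R) (\<lambda>s. ennreal (\<mu> s)) (\<lambda>s. ennreal (\<nu> s))"
proof (induction rule: lift.induct)
  case (lift_base E F)
  then have "(return_pmf E, return_pmf F) \<in> Blift R" by (auto simp: Blift_def)
  from flow_base[OF this] show ?case by (simp add: dirac_pmf subprob_pmf del: pmf_return)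
next
  case (lift_comb \<mu> \<nu> p)
  then show ?case by (simp add: subprob_combine flow_combine)
qed

lemma flow_lift:
  assumes "flow (Blift R) \<mu> \<nu>" "nsum \<mu> = 1"
  shows "lift R (\<lambda>s. enn2real (\<mu> s)) (\<lambda>s. enn2real (\<nu> s))"
proof -
  have le: "nsum \<mu> \<le> 1" using assms(2) by simp
  have "Blift R \<noteq> {}"
  proof
    assume e: "Blift R = {}"
    obtain f where f: "\<forall>b. f b \<noteq> 0 \<longrightarrow> b \<in> Blift R" "\<And>s. \<mu> s = nsum (\<lambda>b. f b * ep (fst b) s)" "\<And>u. \<nu> u = nsum (\<lambda>b. f b * ep (snd b) u)"
      using assms(1) unfolding flow_def by blast
    have f0: "f b = 0" for b using f(1) e by blast
    have "\<mu> s = 0" for s by (simp only: f(2) f0) simp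
    with assms(2) show False by simp
  qed
  from flow_enum[OF assms(1) le this] obtain p g where pg: "comb_ok p" "\<forall>i. g i \<in> Blift R" and eq: "(\<lambda>s. enn2real (\<mu> s)) = combine p (\<lambda>i. pmf (fst (g i)))"
    "(\<lambda>s. enn2real (\<nu> s)) = combine p (\<lambda>i. pmf (snd (g i)))"
    by blast
  have "lift R (pmf (fst (g i))) (pmf (snd (g i)))" for i
    using pg(2)[rule_format, of i] unfolding Blift_def by (auto simp: dirac_pmf[symmetric] intro: lift_base)
  then show ?thesis unfolding eq by (rule lift_comb) (rule pg(1))
qed

lemma subprob_full_pmf:
  assumes "subprob \<nu>" "nsum (\<lambda>s. ennreal (\<nu> s)) = 1" shows "\<exists>n. \<nu> = pmf n"
proof -
  obtain n where "\<forall>x. ep n x = ennreal (\<nu> x)" using pmf_of_weights[OF assms(2)] by blast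
  then have "\<nu> = pmf n" using assms(1) by (intro ext) (metis ennreal_inj pmf_nonneg subprob_def)
  then show ?thesis by blast
qed

lemma lift_pmf_right:
  assumes "lift R (pmf m) \<nu>" shows "\<exists>n. \<nu> = pmf n"
  using lift_gen[OF assms] flow_mass[of "Blift R" "ep m" "\<lambda>s. ennreal (\<nu> s)"] by (intro subprob_full_pmf) (auto simp: nsum_ep)

lemma lift_pmf_left:
  assumes "lift R \<mu> (pmf n)" shows "\<exists>m. \<mu> = pmf m"
  using lift_gen[OF assms] flow_mass[of "Blift R" "\<lambda>s. ennreal (\<mu> s)" "ep n"] by (intro subprob_full_pmf) (auto simp: nsum_ep)

text \<open>Each base pair has a source of mass 1, so the weights sum to the mass of the source,
  which is 1, and themselves form a distribution on base pairs.\<close>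

lemma flow_ep_mixture:
  assumes "flow B (ep m) \<nu>"
  shows "\<exists>F. set_pmf F \<subseteq> B \<and> m = bind_pmf F fst \<and> (\<forall>u. \<nu> u = ep (bind_pmf F snd) u)"
proof -
  obtain f where f: "\<forall>b. f b \<noteq> 0 \<longrightarrow> b \<in> B" "\<And>s. ep m s = nsum (\<lambda>b. f b * ep (fst b) s)" "\<And>u. \<nu> u = nsum (\<lambda>b. f b * ep (snd b) u)"
    using assms(1) unfolding flow_def by blast
  have "nsum (ep m) = nsum (\<lambda>b. nsum (\<lambda>s. f b * ep (fst b) s))" using f(2) by (simp add: nsum_commute[of "\<lambda>s b. f b * ep (fst b) s"])
  then have "nsum f = 1" by (simp add: nsum_cmult nsum_ep)
  then obtain F where F: "\<And>x. ep F x = f x" using pmf_of_weights by blast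
  have "b \<in> B" if "b \<in> set_pmf F" for b
  proof -
    have "ep F b \<noteq> 0" using pmf_positive[OF that] by simp
    then show ?thesis using f(1) F by metis
  qed
  then have "set_pmf F \<subseteq> B" by blast
  moreover have "m = bind_pmf F fst" by (rule pmf_eqI_ep) (simp only: ep_bind F f)
  moreover have "\<forall>u. \<nu> u = ep (bind_pmf F snd) u" by (simp only: ep_bind F f) simp
  ultimately show ?thesis by blast
qed

text \<open>A mixture of Dirac pairs is a coupling supported on \<open>R\<close>, so on full
  distributions the lifting is \<open>rel_pmf\<close> and its theory becomes available.\<close>

lemma lift_rel_pmf: "lift R (pmf m) (pmf n) \<longleftrightarrow> rel_pmf R m n"
proof
  assume "lift R (pmf m) (pmf n)"
  then have "flow (Blift R) (ep m) (ep n)" using lift_gen by blast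
  from flow_ep_mixture[OF this] obtain F where F: "set_pmf F \<subseteq> Blift R" "m = bind_pmf F fst" "\<forall>u. ep n u = ep (bind_pmf F snd) u" by blast
  then have n: "n = bind_pmf F snd" by (intro pmf_eqI_ep) blast
  show "rel_pmf R m n" unfolding F(2) n
  proof (rule rel_pmf_bindI)
    show "rel_pmf (\<lambda>x y. x = y \<and> x \<in> set_pmf F) F F" by (rule rel_pmf_reflI) auto
    fix x y assume "x = y \<and> x \<in> set_pmf F"
    then show "rel_pmf R (fst x) (snd y)" using F(1) by (auto simp: Blift_def)
  qed
next
  assume "rel_pmf R m n"
  then obtain pq where pq: "\<And>x y. (x, y) \<in> set_pmf pq \<Longrightarrow> R x y" "map_pmf fst pq = m" "map_pmf snd pq = n"
    by (auto elim: rel_pmf.cases)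
  have "flow (Blift R) (\<lambda>s. nsum (\<lambda>b. ep pq b * ep (return_pmf (fst b)) s)) (\<lambda>s. nsum (\<lambda>b. ep pq b * ep (return_pmf (snd b)) s))"
  proof (rule flow_nsum)
    fix b assume "ep pq b \<noteq> 0"
    then have "b \<in> set_pmf pq" by (simp add: set_pmf_iff)
    then have "(return_pmf (fst b), return_pmf (snd b)) \<in> Blift R" using pq(1)[of "fst b" "snd b"] by (auto simp: Blift_def)
    from flow_base[OF this] show "flow (Blift R) (ep (return_pmf (fst b))) (ep (return_pmf (snd b)))" by simp
  qed
  then have "flow (Blift R) (ep m) (ep n)"
    unfolding ep_bind[symmetric] pq(2,3)[symmetric] map_pmf_def by simp
  from flow_lift[OF this nsum_ep] show "lift R (pmf m) (pmf n)" by simp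
qed

lemma is_subdist_iff: "is_subdist \<mu> \<longleftrightarrow> subprob \<mu>"
proof (cases "\<forall>s. 0 \<le> \<mu> s")
  case True
  have *: "\<mu> summable_on UNIV \<longleftrightarrow> integrable (count_space UNIV) \<mu>"
    using trans[OF summable_on_iff_abs_summable_on_real abs_summable_equivalent] unfolding abs_summable_on_def .
  have i: "integrable (count_space UNIV) \<mu> \<longleftrightarrow> nsum (\<lambda>s. ennreal (\<mu> s)) < top"
    using True by (simp add: integrable_iff_bounded)
  have "integrable (count_space UNIV) \<mu> \<Longrightarrow> nsum (\<lambda>s. ennreal (\<mu> s)) = ennreal (infsum \<mu> UNIV)"
    using True by (subst nn_integral_eq_integral) (auto simp: infsetsum_infsum[symmetric] infsetsum_def abs_summable_on_def)
  moreover have "nsum (\<lambda>s. ennreal (\<mu> s)) \<le> 1 \<Longrightarrow> nsum (\<lambda>s. ennreal (\<mu> s)) < top"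
    by (erule le_less_trans) simp
  ultimately show ?thesis
    by (cases "integrable (count_space UNIV) \<mu>") (use True * i in \<open>auto simp: is_subdist_def subprob_def\<close>)
next
  case False then show ?thesis by (auto simp: is_subdist_def subprob_def)
qed

section \<open>Derivations as sequences of flows\<close>

definition flow_seq :: "(nat \<Rightarrow> ('a, 'v) nexp \<Rightarrow> ennreal) \<Rightarrow> (nat \<Rightarrow> ('a, 'v) nexp \<Rightarrow> ennreal) \<Rightarrow> bool" where
  "flow_seq T X \<longleftrightarrow> (\<forall>j. flow (Bst Tau) (T j) (\<lambda>s. T (Suc j) s + X (Suc j) s))"

definition flow_star :: "(('a, 'v) nexp \<Rightarrow> ennreal) \<Rightarrow> (('a, 'v) nexp \<Rightarrow> ennreal) \<Rightarrow> bool" where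
  "flow_star \<mu> \<nu> \<longleftrightarrow> (\<exists>T X. flow_seq T X \<and> (\<forall>s. \<mu> s = T 0 s + X 0 s) \<and> (\<forall>s. \<nu> s = nsum (\<lambda>j. X j s)))"

lemma flow_seq_mass1: "flow_seq T X \<Longrightarrow> nsum (T j) = nsum (T (Suc j)) + nsum (X (Suc j))"
  unfolding flow_seq_def using flow_mass[of "Bst Tau" "T j" "\<lambda>s. T (Suc j) s + X (Suc j) s"] by (simp add: nsum_add)

lemma flow_seq_mass: "flow_seq T X \<Longrightarrow> nsum (T n) + (\<Sum>j\<le>n. nsum (X j)) = nsum (T 0) + nsum (X 0)"
proof (induction n)
  case (Suc n)
  then show ?case using flow_seq_mass1[of T X n] by (simp add: ac_simps)
qed simp

lemma flow_seq_total: "flow_seq T X \<Longrightarrow> nsum (\<lambda>j. nsum (X j)) \<le> nsum (T 0) + nsum (X 0)"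
  unfolding nn_integral_count_space_nat
proof (rule suminf_le_const)
  fix n assume d: "flow_seq T X"
  have "(\<Sum>j<n. nsum (X j)) \<le> (\<Sum>j\<le>n. nsum (X j))" by (rule sum_mono2) auto
  also have "\<dots> \<le> nsum (T n) + (\<Sum>j\<le>n. nsum (X j))" by simp
  finally show "(\<Sum>j<n. nsum (X j)) \<le> nsum (T 0) + nsum (X 0)" using flow_seq_mass[OF d, of n] by simp
qed auto

lemma flow_star_mass_le: "flow_star \<mu> \<nu> \<Longrightarrow> nsum \<nu> \<le> nsum \<mu>"
proof -
  assume "flow_star \<mu> \<nu>"
  then obtain T X where d: "flow_seq T X" "\<And>s. \<mu> s = T 0 s + X 0 s" "\<And>s. \<nu> s = nsum (\<lambda>j. X j s)"
    unfolding flow_star_def by blast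
  have "nsum \<nu> = nsum (\<lambda>j. nsum (X j))" unfolding d(3) by (rule nsum_commute)
  also have "\<dots> \<le> nsum (T 0) + nsum (X 0)" by (rule flow_seq_total[OF d(1)])
  also have "\<dots> = nsum \<mu>" unfolding d(2) nsum_add ..
  finally show ?thesis .
qed

lemma enn2real_nsum:
  fixes f :: "nat \<Rightarrow> ennreal"
  assumes "nsum f \<noteq> top" shows "enn2real (nsum f) = (\<Sum>j. enn2real (f j))"
proof -
  have "f j \<noteq> top" for j using nsum_ge[of f j] assms neq_top_trans by blast
  then have e: "ennreal (enn2real (f j)) = f j" for j by (simp add: ennreal_enn2real_if)
  have sm: "summable (\<lambda>j. enn2real (f j))"
    by (rule summable_suminf_not_top) (use assms in \<open>auto simp: e nn_integral_count_space_nat\<close>)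
  have "nsum f = ennreal (\<Sum>j. enn2real (f j))"
    using suminf_ennreal2[OF _ sm] by (simp add: e nn_integral_count_space_nat)
  then show ?thesis using suminf_nonneg[OF sm] by simp
qed

lemma flow_star_wk:
  assumes "flow_star \<mu> \<nu>" "nsum \<mu> \<le> 1"
  shows "wk (\<lambda>s. enn2real (\<mu> s)) (\<lambda>s. enn2real (\<nu> s))"
proof -
  obtain T X where d: "flow_seq T X" "\<And>s. \<mu> s = T 0 s + X 0 s" "\<And>s. \<nu> s = nsum (\<lambda>j. X j s)"
    using assms(1) unfolding flow_star_def by blast
  have "\<mu> = (\<lambda>s. T 0 s + X 0 s)" using d(2) by blast
  then have m0: "nsum (T 0) + nsum (X 0) \<le> 1" using assms(2) by (simp add: nsum_add)
  have mT: "nsum (T n) \<le> 1" for n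
    using flow_seq_mass[OF d(1), of n] m0 by (metis add.right_neutral add_left_mono order_trans zero_le)
  have mX: "nsum (X n) \<le> 1" for n
  proof -
    have "nsum (X n) \<le> (\<Sum>j\<le>n. nsum (X j))" by (rule member_le_sum) auto
    also have "\<dots> \<le> nsum (T n) + (\<Sum>j\<le>n. nsum (X j))" by simp
    finally show ?thesis using flow_seq_mass[OF d(1), of n] m0 by simp
  qed
  have fin: "f s \<noteq> top" if "nsum f \<le> 1" for f :: "('a,'b) nexp \<Rightarrow> ennreal" and s
  proof
    assume "f s = top"
    then have "nsum f = top" using nsum_ge[of f s] by (simp add: top_unique)
    then show False using that by (metis ennreal_one_neq_top neq_top_trans)
  qed
  note finT = fin[OF mT] and finX = fin[OF mX]
  have sd: "is_subdist (\<lambda>s. enn2real (f s))" if "nsum f \<le> 1" for f :: "('a,'b) nexp \<Rightarrow> ennreal"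
    unfolding is_subdist_iff subprob_def using that fin[OF that] by (simp add: ennreal_enn2real_if)
  have add: "enn2real (T n s + X n s) = enn2real (T n s) + enn2real (X n s)" for n s
    by (rule enn2real_plus) (use finT finX in \<open>auto simp: less_top[symmetric]\<close>)
  have tot: "nsum (\<lambda>j. X j s) \<noteq> top" for s
  proof -
    have "nsum (\<lambda>j. X j s) \<le> nsum (\<lambda>j. nsum (X j))" by (rule nsum_mono) (rule nsum_ge)
    also have "\<dots> \<le> 1" using flow_seq_total[OF d(1)] m0 by simp
    finally show ?thesis by (metis ennreal_one_neq_top neq_top_trans)
  qed
  have "cstep (\<lambda>s. enn2real (T i s)) Tau (\<lambda>s. enn2real (T (Suc i) s) + enn2real (X (Suc i) s))" for i
    using flow_cstep[OF d(1)[unfolded flow_seq_def, rule_format] mT, of i] by (simp add: add)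
  then show ?thesis unfolding wk_def
    by (intro exI[of _ "\<lambda>i s. enn2real (T i s)"] exI[of _ "\<lambda>i s. enn2real (X i s)"])
       (simp add: sd mT mX d(2,3) add enn2real_nsum[OF tot])
qed

lemma wk_der:
  assumes "wk \<mu> \<nu>" "\<forall>s. 0 \<le> \<mu> s" "nsum (\<lambda>s. ennreal (\<mu> s)) \<le> 1"
  shows "subprob \<nu> \<and> flow_star (\<lambda>s. ennreal (\<mu> s)) (\<lambda>s. ennreal (\<nu> s))"
proof -
  obtain T X where s: "\<And>i. is_subdist (T i)" "\<And>i. is_subdist (X i)" and
      c: "\<And>i. cstep (T i) Tau (\<lambda>s. T (Suc i) s + X (Suc i) s)" and
      mu: "\<mu> = (\<lambda>s. T 0 s + X 0 s)" and nu: "\<nu> = (\<lambda>s. \<Sum>i. X i s)"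
    using assms(1) unfolding wk_def by blast
  have nn: "0 \<le> T i s" "0 \<le> X i s" for i s using s by (auto simp: is_subdist_def)
  let ?T = "\<lambda>i s. ennreal (T i s)" and ?X = "\<lambda>i s. ennreal (X i s)"
  have d: "flow_seq ?T ?X" unfolding flow_seq_def using cstep_gen[OF c] nn by (simp add: ennreal_plus)
  have m: "(\<lambda>s. ennreal (\<mu> s)) = (\<lambda>s. ?T 0 s + ?X 0 s)" using mu nn by (simp add: ennreal_plus)
  then have m0: "nsum (?T 0) + nsum (?X 0) \<le> 1" using assms(3) by (simp add: nsum_add)
  have tot0: "nsum (\<lambda>j. nsum (?X j)) \<le> 1" using flow_seq_total[OF d] m0 by simp
  have tot: "nsum (\<lambda>j. ?X j s) \<noteq> top" for s
  proof -
    have "nsum (\<lambda>j. ?X j s) \<le> nsum (\<lambda>j. nsum (?X j))" by (rule nsum_mono) (rule nsum_ge)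
    also have "\<dots> \<le> 1" by (rule tot0)
    finally show ?thesis by (metis ennreal_one_neq_top neq_top_trans)
  qed
  have sm: "summable (\<lambda>i. X i s)" for s
    by (rule summable_suminf_not_top) (use tot nn in \<open>auto simp: nn_integral_count_space_nat\<close>)
  have n: "ennreal (\<nu> s) = nsum (\<lambda>j. ?X j s)" for s
    unfolding nu nn_integral_count_space_nat suminf_ennreal2[OF nn(2) sm] ..
  have "0 \<le> \<nu> s" for s unfolding nu by (rule suminf_nonneg[OF sm nn(2)])
  moreover have "nsum (\<lambda>s. ennreal (\<nu> s)) \<le> 1"
    unfolding n by (rule order_trans[OF eq_refl[OF nsum_commute] tot0])
  moreover have "flow_star (\<lambda>s. ennreal (\<mu> s)) (\<lambda>s. ennreal (\<nu> s))"
    unfolding flow_star_def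
  proof (intro exI conjI allI)
    show "flow_seq ?T ?X" by (rule d)
    show "ennreal (\<mu> s) = ?T 0 s + ?X 0 s" for s using fun_cong[OF m] .
  qed (rule n)
  ultimately show ?thesis by (simp add: subprob_def)
qed

text \<open>Conditioning on the source state: a base pair \<open>b\<close> contributes to the kernel
  at \<open>p\<close> with its share \<open>f b * ep (fst b) p / \<mu> p\<close>. As the sources in
  \<open>Bst a\<close> are Dirac, only pairs that start in \<open>p\<close> contribute.\<close>

lemma flow_kernel:
  assumes "flow (Bst a) \<mu> \<nu>" "\<And>s. \<mu> s \<noteq> top"
  shows "\<exists>K. (\<forall>p. \<mu> p \<noteq> 0 \<longrightarrow> flow (Bst a) (ep (return_pmf p)) (K p)) \<and> (\<forall>u. \<nu> u = nsum (\<lambda>p. \<mu> p * K p u))"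
proof -
  obtain f where f: "\<forall>b. f b \<noteq> 0 \<longrightarrow> b \<in> Bst a" "\<And>s. \<mu> s = nsum (\<lambda>b. f b * ep (fst b) s)" "\<And>u. \<nu> u = nsum (\<lambda>b. f b * ep (snd b) u)"
    using assms(1) unfolding flow_def by blast
  let ?K = "\<lambda>p u. nsum (\<lambda>b. (f b * ep (fst b) p / \<mu> p) * ep (snd b) u)"
  have z: "f b * ep (fst b) p = 0" if "\<mu> p = 0" for b p
    using that unfolding f(2) by (rule nsum_eq_0D)
  have "flow (Bst a) (ep (return_pmf p)) (?K p)" if p: "\<mu> p \<noteq> 0" for p
    unfolding flow_def
  proof (intro exI[of _ "\<lambda>b. f b * ep (fst b) p / \<mu> p"] conjI allI impI)
    fix b assume "f b * ep (fst b) p / \<mu> p \<noteq> 0"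
    then have "f b \<noteq> 0" by auto
    then show "b \<in> Bst a" using f(1) by blast
  next
    fix s
    have eq: "f b * ep (fst b) p / \<mu> p * ep (fst b) s = (if s = p then f b * ep (fst b) p / \<mu> p else 0)" for b
    proof (cases "f b = 0")
      case False
      then have "b \<in> Bst a" using f(1) by blast
      then obtain q t where "b = (return_pmf q, t)" by (auto simp: Bst_def)
      then show ?thesis by (auto simp: ep_return simp del: pmf_return)
    qed simp
    have "nsum (\<lambda>b. f b * ep (fst b) p / \<mu> p * ep (fst b) s) = (if s = p then \<mu> p / \<mu> p else 0)"
      unfolding eq by (simp add: divide_ennreal_def nsum_multc f(2)[symmetric])
    then show "ep (return_pmf p) s = nsum (\<lambda>b. f b * ep (fst b) p / \<mu> p * ep (fst b) s)"
      using p assms(2)[of p] by (simp add: ep_return less_top[symmetric] del: pmf_return)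
  qed simp
  moreover have "\<nu> u = nsum (\<lambda>p. \<mu> p * ?K p u)" for u
  proof -
    have "\<mu> p * (f b * ep (fst b) p / \<mu> p) = f b * ep (fst b) p" for p b
      by (rule ennreal_mult_div) (use assms(2) z in auto)
    then have "nsum (\<lambda>p. \<mu> p * ?K p u) = nsum (\<lambda>p. nsum (\<lambda>b. f b * ep (fst b) p * ep (snd b) u))"
      unfolding nsum_cmult[symmetric] by (simp add: mult.assoc[symmetric])
    also have "\<dots> = nsum (\<lambda>b. nsum (\<lambda>p. f b * ep (snd b) u * ep (fst b) p))"
      by (subst nsum_commute) (simp add: ac_simps)
    also have "\<dots> = \<nu> u" unfolding nsum_cmult nsum_ep f(3) by simp
    finally show ?thesis by simp
  qed
  ultimately show ?thesis by (intro exI[of _ ?K]) blast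
qed

text \<open>Disintegration of a derivation by its initial state. Once a kernel is fixed for every
  stage, and mass at a state moves on or stops in the overall proportion of \<open>T\<close> to
  \<open>X\<close>, the derivation is a Markov process. It can then be started from each state
  alone, and linearity recovers the original.\<close>

lemma flow_seq_split:
  assumes d: "flow_seq T X" and m0: "nsum (T 0) + nsum (X 0) \<le> 1"
  defines "c0 \<equiv> \<lambda>s. T 0 s + X 0 s"
  shows "\<exists>T' X'. (\<forall>s. c0 s \<noteq> 0 \<longrightarrow> flow_seq (T' s) (X' s) \<and> (\<forall>p. ep (return_pmf s) p = T' s 0 p + X' s 0 p)) \<and>
     (\<forall>j u. T j u = nsum (\<lambda>s. c0 s * T' s j u)) \<and> (\<forall>j u. X j u = nsum (\<lambda>s. c0 s * X' s j u))"
proof -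
  have mle: "nsum (T n) + nsum (X n) \<le> 1" for n
  proof (cases n)
    case (Suc k)
    have "nsum (T k) \<le> nsum (T k) + (\<Sum>j\<le>k. nsum (X j))" by simp
    also have "\<dots> \<le> 1" unfolding flow_seq_mass[OF d] by (rule m0)
    finally have "nsum (T k) \<le> 1" .
    then show ?thesis unfolding Suc flow_seq_mass1[OF d, of k] .
  qed (use m0 in simp)
  have fin: "T n s + X n s \<noteq> top" for n s
  proof -
    have "T n s + X n s \<le> nsum (\<lambda>s. T n s + X n s)" by (rule nsum_ge)
    also have "\<dots> \<le> 1" unfolding nsum_add by (rule mle)
    finally show ?thesis by (metis ennreal_one_neq_top neq_top_trans)
  qed
  let ?c = "\<lambda>n s. T n s + X n s"
  have "\<forall>j. \<exists>K. (\<forall>p. T j p \<noteq> 0 \<longrightarrow> flow (Bst Tau) (ep (return_pmf p)) (K p)) \<and> (\<forall>u. ?c (Suc j) u = nsum (\<lambda>p. T j p * K p u))"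
  proof
    fix j
    have "T j s \<noteq> top" for s using fin[of j s] by auto
    from flow_kernel[OF d[unfolded flow_seq_def, rule_format] this]
    show "\<exists>K. (\<forall>p. T j p \<noteq> 0 \<longrightarrow> flow (Bst Tau) (ep (return_pmf p)) (K p)) \<and> (\<forall>u. ?c (Suc j) u = nsum (\<lambda>p. T j p * K p u))" .
  qed
  from choice[OF this] obtain K where K: "\<And>j p. T j p \<noteq> 0 \<Longrightarrow> flow (Bst Tau) (ep (return_pmf p)) (K j p)"
     "\<And>j u. ?c (Suc j) u = nsum (\<lambda>p. T j p * K j p u)" by blast
  \<comment> \<open>\<open>C s n\<close> is the mass present at stage \<open>n\<close>, moving or
    stopping, when the process starts in \<open>s\<close>.\<close>
  define C where "C s n = rec_nat (ep (return_pmf s)) (\<lambda>j c u. nsum (\<lambda>p. c p * (T j p / ?c j p) * K j p u)) n" for s n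
  have C0: "C s 0 = ep (return_pmf s)" for s by (simp add: C_def)
  have CS: "C s (Suc j) u = nsum (\<lambda>p. C s j p * (T j p / ?c j p) * K j p u)" for s j u by (simp add: C_def)
  have cT: "?c j p * (T j p / ?c j p) = T j p" for j p by (rule ennreal_mult_div) (use fin in auto)
  have cX: "?c j p * (X j p / ?c j p) = X j p" for j p by (rule ennreal_mult_div) (use fin in auto)
  have claim: "nsum (\<lambda>s. c0 s * C s j p) = ?c j p" for j p
  proof (induction j arbitrary: p)
    case 0 show ?case unfolding C0 c0_def by (rule nsum_ep_return')
  next
    case (Suc j)
    have "nsum (\<lambda>s. c0 s * C s (Suc j) p) = nsum (\<lambda>s. nsum (\<lambda>q. c0 s * C s j q * (T j q / ?c j q * K j q p)))"
      unfolding CS nsum_cmult[symmetric] by (simp add: mult.assoc)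
    also have "\<dots> = nsum (\<lambda>q. ?c j q * (T j q / ?c j q * K j q p))"
      by (subst nsum_commute) (simp add: nsum_multc Suc)
    also have "\<dots> = ?c (Suc j) p" unfolding K(2) mult.assoc[symmetric] cT ..
    finally show ?case .
  qed
  \<comment> \<open>Where the overall mass is 0 the two shares do not add up to 1, so
    \<open>C\<close> has to vanish there too.\<close>
  have zero: "C s j p = 0" if "c0 s \<noteq> 0" "?c j p = 0" for s j p
    using claim[of j p] that nsum_eq_0D[of "\<lambda>s. c0 s * C s j p" s] by simp
  define T' where "T' s j p = C s j p * (T j p / ?c j p)" for s j p
  define X' where "X' s j p = C s j p * (X j p / ?c j p)" for s j p
  have sum: "T' s j p + X' s j p = C s j p" if "c0 s \<noteq> 0" for s j p
  proof (cases "?c j p = 0")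
    case False
    have "T j p / ?c j p + X j p / ?c j p = 1"
      unfolding divide_ennreal_def distrib_right[symmetric] using False fin[of j p]
      by (simp add: divide_ennreal_def[symmetric] less_top)
    then show ?thesis unfolding T'_def X'_def by (simp add: distrib_left[symmetric])
  qed (use zero[OF that] in \<open>auto simp: T'_def X'_def\<close>)
  have "flow_seq (T' s) (X' s)" if "c0 s \<noteq> 0" for s
    unfolding flow_seq_def
  proof
    fix j
    have "flow (Bst Tau) (\<lambda>u. nsum (\<lambda>p. T' s j p * ep (return_pmf p) u)) (\<lambda>u. nsum (\<lambda>p. T' s j p * K j p u))"
    proof (rule flow_nsum)
      fix p assume "T' s j p \<noteq> 0"
      then have "T j p \<noteq> 0" by (auto simp: T'_def)
      then show "flow (Bst Tau) (ep (return_pmf p)) (K j p)" by (rule K(1))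
    qed
    then show "flow (Bst Tau) (T' s j) (\<lambda>u. T' s (Suc j) u + X' s (Suc j) u)"
      unfolding sum[OF that] CS nsum_ep_return' by (simp add: T'_def[abs_def])
  qed
  moreover have "ep (return_pmf s) p = T' s 0 p + X' s 0 p" if "c0 s \<noteq> 0" for s p
    unfolding sum[OF that] C0 ..
  moreover have "T j u = nsum (\<lambda>s. c0 s * T' s j u)" for j u
    unfolding T'_def mult.assoc[symmetric] nsum_multc claim cT ..
  moreover have "X j u = nsum (\<lambda>s. c0 s * X' s j u)" for j u
    unfolding X'_def mult.assoc[symmetric] nsum_multc claim cX ..
  ultimately show ?thesis by (intro exI[of _ T'] exI[of _ X']) blast
qed

lemma flow_star_nsum:
  assumes "\<And>i. w i \<noteq> 0 \<Longrightarrow> flow_star (\<alpha> i) (\<beta> i)"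
  shows "flow_star (\<lambda>s. nsum (\<lambda>i. w i * \<alpha> i s)) (\<lambda>u. nsum (\<lambda>i. w i * \<beta> i u))"
proof -
  have "\<forall>i. \<exists>TX. w i \<noteq> 0 \<longrightarrow> flow_seq (fst TX) (snd TX) \<and> (\<forall>s. \<alpha> i s = fst TX 0 s + snd TX 0 s) \<and> (\<forall>s. \<beta> i s = nsum (\<lambda>j. snd TX j s))"
  proof
    fix i
    show "\<exists>TX. w i \<noteq> 0 \<longrightarrow> flow_seq (fst TX) (snd TX) \<and> (\<forall>s. \<alpha> i s = fst TX 0 s + snd TX 0 s) \<and> (\<forall>s. \<beta> i s = nsum (\<lambda>j. snd TX j s))"
    proof (cases "w i = 0")
      case False
      from assms[OF this] obtain T X where "flow_seq T X" "\<forall>s. \<alpha> i s = T 0 s + X 0 s" "\<forall>s. \<beta> i s = nsum (\<lambda>j. X j s)"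
        unfolding flow_star_def by blast
      then show ?thesis by (intro exI[of _ "(T, X)"]) simp
    qed simp
  qed
  from choice[OF this] obtain G where G: "\<And>i. w i \<noteq> 0 \<Longrightarrow> flow_seq (fst (G i)) (snd (G i))"
    "\<And>i s. w i \<noteq> 0 \<Longrightarrow> \<alpha> i s = fst (G i) 0 s + snd (G i) 0 s" "\<And>i s. w i \<noteq> 0 \<Longrightarrow> \<beta> i s = nsum (\<lambda>j. snd (G i) j s)" by blast
  let ?T = "\<lambda>j s. nsum (\<lambda>i. w i * fst (G i) j s)" and ?X = "\<lambda>j s. nsum (\<lambda>i. w i * snd (G i) j s)"
  have "flow_seq ?T ?X" unfolding flow_seq_def nsum_add[symmetric] distrib_left[symmetric]
    using G(1) unfolding flow_seq_def by (intro allI flow_nsum) blast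
  moreover have "nsum (\<lambda>i. w i * \<alpha> i s) = ?T 0 s + ?X 0 s" for s
    unfolding nsum_add[symmetric] distrib_left[symmetric]
  proof (rule nsum_cong)
    show "w i * \<alpha> i s = w i * (fst (G i) 0 s + snd (G i) 0 s)" for i by (cases "w i = 0") (auto simp: G(2))
  qed
  moreover have "nsum (\<lambda>i. w i * \<beta> i s) = nsum (\<lambda>j. ?X j s)" for s
  proof -
    have "w i * \<beta> i s = nsum (\<lambda>j. w i * snd (G i) j s)" for i
      by (cases "w i = 0") (auto simp: G(3) nsum_cmult)
    then show ?thesis by (simp only: nsum_commute[of "\<lambda>j i. w i * snd (G i) j s"])
  qed
  ultimately show ?thesis unfolding flow_star_def by blast
qed

section \<open>Concatenation of infinitely many derivations\<close>

lemma nsum_LIMSEQ: "(\<lambda>N. \<Sum>n<N. (f::nat \<Rightarrow> ennreal) n) \<longlonglongrightarrow> nsum f"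
  unfolding nn_integral_count_space_nat by (rule summable_LIMSEQ) simp

lemma nsum_eq_by_telescope:
  fixes f g r :: "nat \<Rightarrow> ennreal"
  assumes "\<And>N. (\<Sum>n<N. f n) = (\<Sum>n<N. g n) + r N" "r \<longlonglongrightarrow> 0"
  shows "nsum f = nsum g"
proof -
  have "(\<lambda>N. (\<Sum>n<N. g n) + r N) \<longlonglongrightarrow> nsum g + 0" by (intro tendsto_add nsum_LIMSEQ assms)
  moreover have "(\<lambda>N. (\<Sum>n<N. g n) + r N) \<longlonglongrightarrow> nsum f" unfolding assms(1)[symmetric] by (rule nsum_LIMSEQ)
  ultimately show ?thesis using LIMSEQ_unique by fastforce
qed

lemma flow_star_split:
  assumes "flow_star \<mu> \<nu>" "nsum \<mu> \<le> 1"
  shows "\<exists>T Y. (\<forall>s. \<mu> s \<noteq> 0 \<longrightarrow> flow_seq (T s) (Y s) \<and> (\<forall>p. ep (return_pmf s) p = T s 0 p + Y s 0 p)) \<and>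
    (\<forall>u. \<nu> u = nsum (\<lambda>s. \<mu> s * nsum (\<lambda>j. Y s j u)))"
proof -
  obtain T X where d: "flow_seq T X" "\<And>s. \<mu> s = T 0 s + X 0 s" "\<And>s. \<nu> s = nsum (\<lambda>j. X j s)"
    using assms(1) unfolding flow_star_def by blast
  have mu: "\<mu> = (\<lambda>s. T 0 s + X 0 s)" by (rule ext) (rule d(2))
  have m0: "nsum (T 0) + nsum (X 0) \<le> 1" using assms(2) unfolding mu nsum_add .
  obtain T' X' where s: "\<And>s. \<mu> s \<noteq> 0 \<Longrightarrow> flow_seq (T' s) (X' s) \<and> (\<forall>p. ep (return_pmf s) p = T' s 0 p + X' s 0 p)"
    "\<And>j u. X j u = nsum (\<lambda>s. \<mu> s * X' s j u)"
    using flow_seq_split[OF d(1) m0] unfolding d(2)[symmetric] by blast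
  have "\<nu> u = nsum (\<lambda>s. \<mu> s * nsum (\<lambda>j. X' s j u))" for u
    unfolding d(3) s(2) nsum_cmult[symmetric] by (rule nsum_commute)
  then show ?thesis using s(1) by blast
qed

text \<open>Convolution in time. If \<open>e a s\<close> is the mass entering \<open>s\<close> at
  time \<open>a\<close>, and \<open>W s b u\<close> the mass found at \<open>u\<close> after
  \<open>b\<close> further steps from \<open>s\<close>, the result is the mass found at
  \<open>u\<close> at time \<open>j\<close>. The indicator replaces a sum over
  \<open>b = j - a\<close>.\<close>

definition flow_conv :: "(nat \<Rightarrow> 's \<Rightarrow> ennreal) \<Rightarrow> ('s \<Rightarrow> nat \<Rightarrow> 's \<Rightarrow> ennreal) \<Rightarrow> nat \<Rightarrow> 's \<Rightarrow> ennreal" where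
  "flow_conv e W j u = nsum (\<lambda>a. nsum (\<lambda>b. (if a + b = j then 1 else 0) * nsum (\<lambda>s. e a s * W s b u)))"

lemma flow_conv_total: "nsum (\<lambda>j. flow_conv e W j u) = nsum (\<lambda>s. nsum (\<lambda>a. e a s) * nsum (\<lambda>b. W s b u))"
proof -
  have one: "nsum (\<lambda>j. if a + b = j then 1 else 0 :: ennreal) = 1" for a b :: nat
    by (subst nsum_single[of "a + b"]) auto
  have "nsum (\<lambda>j. flow_conv e W j u) = nsum (\<lambda>a. nsum (\<lambda>b. nsum (\<lambda>j. (if a + b = j then 1 else 0) * nsum (\<lambda>s. e a s * W s b u))))"
    unfolding flow_conv_def by (subst nsum_commute, rule nsum_cong, rule nsum_commute)
  also have "\<dots> = nsum (\<lambda>a. nsum (\<lambda>b. nsum (\<lambda>s. e a s * W s b u)))" unfolding nsum_multc one by simp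
  also have "\<dots> = nsum (\<lambda>a. nsum (\<lambda>s. nsum (\<lambda>b. e a s * W s b u)))" by (rule nsum_cong, rule nsum_commute)
  also have "\<dots> = nsum (\<lambda>s. nsum (\<lambda>a. nsum (\<lambda>b. e a s * W s b u)))" by (rule nsum_commute)
  finally show ?thesis by (simp add: nsum_cmult nsum_multc)
qed

lemma flow_conv_add: "flow_conv e (\<lambda>s b u. W s b u + V s b u) j u = flow_conv e W j u + flow_conv e V j u"
  unfolding flow_conv_def by (simp add: distrib_left nsum_add)

lemma flow_conv_0: "flow_conv e W 0 u = nsum (\<lambda>s. e 0 s * W s 0 u)"
  unfolding flow_conv_def
  by (subst nsum_single[of 0], simp, subst nsum_single[of 0]) simp_all

text \<open>Mass observed at time \<open>Suc j\<close> either has made at least one step since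
  entering or enters exactly then.\<close>

lemma flow_conv_Suc: "flow_conv e W (Suc j) u = flow_conv e (\<lambda>s b. W s (Suc b)) j u + nsum (\<lambda>s. e (Suc j) s * W s 0 u)"
proof -
  have "flow_conv e W (Suc j) u = nsum (\<lambda>a. (if a = Suc j then 1 else 0) * nsum (\<lambda>s. e a s * W s 0 u)
     + nsum (\<lambda>b. (if a + b = j then 1 else 0) * nsum (\<lambda>s. e a s * W s (Suc b) u)))"
    unfolding flow_conv_def by (subst nsum_nat_split) simp
  also have "\<dots> = nsum (\<lambda>a. (if a = Suc j then 1 else 0) * nsum (\<lambda>s. e a s * W s 0 u)) + flow_conv e (\<lambda>s b. W s (Suc b)) j u"
    unfolding nsum_add flow_conv_def ..
  also have "nsum (\<lambda>a. (if a = Suc j then 1 else 0) * nsum (\<lambda>s. e a s * W s 0 u)) = nsum (\<lambda>s. e (Suc j) s * W s 0 u)"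
    by (subst nsum_single[of "Suc j"]) auto
  finally show ?thesis by (simp add: add.commute)
qed

lemma flow_conv:
  assumes "\<And>a s b. e a s \<noteq> 0 \<Longrightarrow> flow B (W s b) (V s b)"
  shows "flow B (flow_conv e W j) (flow_conv e V j)"
proof -
  have "flow B (\<lambda>u. nsum (\<lambda>a. 1 * nsum (\<lambda>b. (if a + b = j then 1 else 0) * nsum (\<lambda>s. e a s * W s b u))))
     (\<lambda>u. nsum (\<lambda>a. 1 * nsum (\<lambda>b. (if a + b = j then 1 else 0) * nsum (\<lambda>s. e a s * V s b u))))"
    by (intro flow_nsum assms)
  then show ?thesis unfolding flow_conv_def[abs_def] by simp
qed

lemma ennreal_div_sum: "(a::ennreal) + b \<noteq> 0 \<Longrightarrow> a + b \<noteq> top \<Longrightarrow> a / (a + b) + b / (a + b) = 1"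
  unfolding divide_ennreal_def distrib_right[symmetric]
  by (simp only: divide_ennreal_def[symmetric]) (simp add: less_top)

text \<open>Each stage may itself be an infinite derivation, so the stages cannot be run one after
  the other. They are overlaid in time: at time \<open>j\<close> the combined derivation contains,
  for every \<open>n\<close>, the mass that is inside stage \<open>n\<close> at that time. The limit
  hypothesis excludes mass that changes stage forever.\<close>

lemma flow_star_infinite_concat:
  fixes \<eta> x :: "nat \<Rightarrow> ('a, 'v) nexp \<Rightarrow> ennreal"
  assumes d: "\<And>i. flow_star (\<eta> i) (\<lambda>u. \<eta> (Suc i) u + x (Suc i) u)"
    and m0: "nsum (\<eta> 0) \<le> 1" and lim: "(\<lambda>i. nsum (\<eta> i)) \<longlonglongrightarrow> 0"
  shows "flow_star (\<eta> 0) (\<lambda>u. nsum (\<lambda>i. x (Suc i) u))"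
proof -
  have mle: "nsum (\<eta> i) \<le> 1" for i
  proof (induction i)
    case (Suc i)
    have "nsum (\<eta> (Suc i)) \<le> nsum (\<eta> (Suc i)) + nsum (x (Suc i))" by simp
    also have "\<dots> \<le> nsum (\<eta> i)" using flow_star_mass_le[OF d, of i] unfolding nsum_add .
    finally show ?case using Suc by simp
  qed (rule m0)
  have "\<forall>i. \<exists>TY. (\<forall>s. \<eta> i s \<noteq> 0 \<longrightarrow> flow_seq (fst TY s) (snd TY s) \<and> (\<forall>p. ep (return_pmf s) p = fst TY s 0 p + snd TY s 0 p)) \<and>
    (\<forall>u. \<eta> (Suc i) u + x (Suc i) u = nsum (\<lambda>s. \<eta> i s * nsum (\<lambda>j. snd TY s j u)))"
  proof
    fix i
    from flow_star_split[OF d mle, of i] obtain T Y where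
      "(\<forall>s. \<eta> i s \<noteq> 0 \<longrightarrow> flow_seq (T s) (Y s) \<and> (\<forall>p. ep (return_pmf s) p = T s 0 p + Y s 0 p))"
      "(\<forall>u. \<eta> (Suc i) u + x (Suc i) u = nsum (\<lambda>s. \<eta> i s * nsum (\<lambda>j. Y s j u)))" by blast
    then show "\<exists>TY. (\<forall>s. \<eta> i s \<noteq> 0 \<longrightarrow> flow_seq (fst TY s) (snd TY s) \<and> (\<forall>p. ep (return_pmf s) p = fst TY s 0 p + snd TY s 0 p)) \<and>
       (\<forall>u. \<eta> (Suc i) u + x (Suc i) u = nsum (\<lambda>s. \<eta> i s * nsum (\<lambda>j. snd TY s j u)))"
      by (intro exI[of _ "(T, Y)"]) simp
  qed
  from choice[OF this] obtain G where G: "\<And>i s. \<eta> i s \<noteq> 0 \<Longrightarrow> flow_seq (fst (G i) s) (snd (G i) s)"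
    "\<And>i s p. \<eta> i s \<noteq> 0 \<Longrightarrow> ep (return_pmf s) p = fst (G i) s 0 p + snd (G i) s 0 p"
    "\<And>i u. \<eta> (Suc i) u + x (Suc i) u = nsum (\<lambda>s. \<eta> i s * nsum (\<lambda>j. snd (G i) s j u))" by blast
  define T where "T i = fst (G i)" for i
  define Y where "Y i = snd (G i)" for i
  have G1: "flow_seq (T i s) (Y i s)" if "\<eta> i s \<noteq> 0" for i s using G(1)[OF that] by (simp add: T_def Y_def)
  have G2: "T i s 0 p + Y i s 0 p = ep (return_pmf s) p" if "\<eta> i s \<noteq> 0" for i s p using G(2)[OF that] by (simp add: T_def Y_def)
  define z where "z i u = \<eta> (Suc i) u + x (Suc i) u" for i u
  have G3: "nsum (\<lambda>s. \<eta> i s * nsum (\<lambda>j. Y i s j u)) = z i u" for i u using G(3) by (simp add: z_def Y_def)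
  have zfin: "z i u \<noteq> top" for i u
  proof -
    have "z i u \<le> nsum (z i)" by (rule nsum_ge)
    also have "\<dots> \<le> 1" using flow_star_mass_le[OF d, of i] mle[of i] unfolding z_def[abs_def] by (rule order_trans)
    finally show ?thesis by (metis ennreal_one_neq_top neq_top_trans)
  qed
  \<comment> \<open>Of the mass that ends stage \<open>i\<close> in \<open>u\<close>, the share
    \<open>al\<close> enters stage \<open>i + 1\<close> and the share \<open>be\<close> is
    finished.\<close>
  define al where "al i u = \<eta> (Suc i) u / z i u" for i u
  define be where "be i u = x (Suc i) u / z i u" for i u
  have zal: "z i u * al i u = \<eta> (Suc i) u" for i u unfolding al_def
    by (rule ennreal_mult_div) (use zfin in \<open>auto simp: z_def\<close>)
  have zbe: "z i u * be i u = x (Suc i) u" for i u unfolding be_def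
    by (rule ennreal_mult_div) (use zfin in \<open>auto simp: z_def\<close>)
  \<comment> \<open>\<open>e n j u\<close> is the mass that enters stage \<open>n\<close> at state
    \<open>u\<close> and global time \<open>j\<close>. Passing to the next stage takes no
    time.\<close>
  define e where "e n = rec_nat (\<lambda>a s. if a = 0 then \<eta> 0 s else 0) (\<lambda>n f j u. flow_conv f (Y n) j u * al n u) n" for n
  have e0: "e 0 a s = (if a = 0 then \<eta> 0 s else 0)" for a s by (simp add: e_def)
  have eS: "e (Suc n) j u = flow_conv (e n) (Y n) j u * al n u" for n j u by (simp add: e_def)
  have te: "nsum (\<lambda>a. e n a s) = \<eta> n s" for n s
  proof (induction n arbitrary: s)
    case 0 show ?case by (subst nsum_single[of 0]) (auto simp: e0)
  next
    case (Suc n) show ?case unfolding eS nsum_multc flow_conv_total Suc G3 zal ..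
  qed
  have tY: "nsum (\<lambda>j. flow_conv (e n) (Y n) j u) = z n u" for n u unfolding flow_conv_total te G3 ..
  have en: "\<eta> n s \<noteq> 0" if "e n a s \<noteq> 0" for n a s
    using te[of n s] nsum_eq_0D[of "\<lambda>a. e n a s" a] that by metis
  define y where "y n j u = flow_conv (e n) (Y n) j u * be n u" for n j u
  have ey: "y n j u + e (Suc n) j u = flow_conv (e n) (Y n) j u" for n j u
  proof (cases "z n u = 0")
    case True
    then have "flow_conv (e n) (Y n) j u = 0" using tY[of n u] nsum_eq_0D[of "\<lambda>j. flow_conv (e n) (Y n) j u" j] by simp
    then show ?thesis by (simp add: y_def eS)
  next
    case False
    have "al n u + be n u = 1" unfolding al_def be_def z_def
      by (rule ennreal_div_sum) (use False zfin[of n u] in \<open>auto simp: z_def\<close>)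
    then show ?thesis unfolding y_def eS distrib_left[symmetric] by (simp add: add.commute)
  qed
  have start: "nsum (\<lambda>s. e n a s * (T n s 0 u + Y n s 0 u)) = e n a u" for n a u
  proof -
    have "e n a s * (T n s 0 u + Y n s 0 u) = e n a s * ep (return_pmf s) u" for s
      by (cases "e n a s = 0") (auto simp: G2 en simp del: pmf_return)
    then show ?thesis using nsum_ep_return'[of "e n a" u] by simp
  qed
  let ?S = "\<lambda>n. flow_conv (e n) (\<lambda>s b u. T n s (Suc b) u + Y n s (Suc b) u)"
  let ?dT = "\<lambda>n. flow_conv (e n) (T n)"
  \<comment> \<open>Balance of stage \<open>n\<close> at one instant: what enters or has just made a
    step either keeps moving, is finished, or passes to stage \<open>n + 1\<close>.\<close>
  have rel0: "?dT n 0 u + y n 0 u + e (Suc n) 0 u = e n 0 u" for n u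
    unfolding add.assoc ey unfolding flow_conv_add[symmetric] unfolding flow_conv_0 start ..
  have relS: "?dT n (Suc j) u + y n (Suc j) u + e (Suc n) (Suc j) u = ?S n j u + e n (Suc j) u" for n j u
    unfolding add.assoc ey unfolding flow_conv_add[symmetric] unfolding flow_conv_Suc[of _ "\<lambda>s b u. T _ s b u + Y _ s b u"] start ..
  have elim: "(\<lambda>N. e N j u) \<longlonglongrightarrow> 0" for j u
  proof (rule tendsto_sandwich[OF _ _ tendsto_const lim])
    show "\<forall>\<^sub>F N in sequentially. e N j u \<le> nsum (\<eta> N)"
    proof (rule always_eventually, rule allI)
      fix N
      have "e N j u \<le> \<eta> N u" using nsum_ge[of "\<lambda>a. e N a u" j] unfolding te .
      also have "\<dots> \<le> nsum (\<eta> N)" by (rule nsum_ge)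
      finally show "e N j u \<le> nsum (\<eta> N)" .
    qed
  qed simp
  define TT where "TT j u = nsum (\<lambda>n. 1 * ?dT n j u)" for j u
  define XX where "XX j u = nsum (\<lambda>n. y n j u)" for j u
  have sum0: "(\<Sum>n<N. ?dT n 0 u + y n 0 u) + e N 0 u = \<eta> 0 u" for N u
  proof (induction N)
    case 0 show ?case by (simp add: e0)
  next
    case (Suc N)
    then show ?case using rel0[of N u] by (simp add: add.assoc)
  qed
  have init: "\<eta> 0 u = TT 0 u + XX 0 u" for u
  proof -
    have "(\<lambda>N. (\<Sum>n<N. ?dT n 0 u + y n 0 u) + e N 0 u) \<longlonglongrightarrow> nsum (\<lambda>n. ?dT n 0 u + y n 0 u) + 0"
      by (intro tendsto_add nsum_LIMSEQ elim)
    then have "\<eta> 0 u = nsum (\<lambda>n. ?dT n 0 u + y n 0 u)" unfolding sum0 by (simp add: LIMSEQ_const_iff)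
    then show ?thesis by (simp add: TT_def XX_def nsum_add)
  qed
  \<comment> \<open>Summed over the stages, the transfers between neighbouring stages cancel, except
    for the last one, which tends to 0 by \<open>elim\<close>.\<close>
  have sumS: "(\<Sum>n<N. ?S n j u) = (\<Sum>n<N. ?dT n (Suc j) u + y n (Suc j) u) + e N (Suc j) u" for N j u
  proof (induction N)
    case 0 show ?case by (simp add: e0)
  next
    case (Suc N)
    have "(\<Sum>n<Suc N. ?S n j u) = (\<Sum>n<N. ?dT n (Suc j) u + y n (Suc j) u) + (?S N j u + e N (Suc j) u)"
      by (simp add: Suc ac_simps)
    then show ?case unfolding relS[symmetric] by (simp add: ac_simps)
  qed
  have "flow (Bst Tau) (TT j) (\<lambda>u. TT (Suc j) u + XX (Suc j) u)" for j
  proof -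
    have "flow (Bst Tau) (TT j) (\<lambda>u. nsum (\<lambda>n. 1 * ?S n j u))" unfolding TT_def[abs_def]
    proof (intro flow_nsum flow_conv)
      fix n a s b assume "e n a s \<noteq> 0"
      from G1[OF en[OF this]] show "flow (Bst Tau) (T n s b) (\<lambda>u. T n s (Suc b) u + Y n s (Suc b) u)"
        unfolding flow_seq_def by blast
    qed
    moreover have "nsum (\<lambda>n. 1 * ?S n j u) = TT (Suc j) u + XX (Suc j) u" for u
      unfolding TT_def XX_def nsum_add[symmetric] using nsum_eq_by_telescope[OF sumS elim] by simp
    ultimately show ?thesis by simp
  qed
  then have "flow_seq TT XX" by (simp add: flow_seq_def)
  moreover have "nsum (\<lambda>i. x (Suc i) u) = nsum (\<lambda>j. XX j u)" for u
  proof -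
    have "nsum (\<lambda>j. XX j u) = nsum (\<lambda>n. nsum (\<lambda>j. y n j u))" unfolding XX_def by (rule nsum_commute)
    then show ?thesis unfolding y_def nsum_multc tY zbe by simp
  qed
  ultimately show ?thesis unfolding flow_star_def using init by blast
qed

lemma nsum_range: "inj f \<Longrightarrow> nsum (\<lambda>x. w x * indicator (range f) x) = nsum (\<lambda>y. w (f y))"
  using nn_integral_bij_count_space[of f UNIV "range f" w]
  by (simp add: nn_integral_count_space_indicator inj_on_imp_bij_betw)

lemma nsum_sum: "nsum (w :: 'a + 'b \<Rightarrow> ennreal) = nsum (\<lambda>a. w (Inl a)) + nsum (\<lambda>b. w (Inr b))"
proof -
  have "w x = w x * indicator (range Inl) x + w x * indicator (range Inr) x" for x
    by (cases x) (auto split: split_indicator)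
  then have "nsum w = nsum (\<lambda>x. w x * indicator (range Inl) x) + nsum (\<lambda>x. w x * indicator (range Inr) x)"
    unfolding nsum_add[symmetric] by (rule nsum_cong)
  then show ?thesis by (simp add: nsum_range)
qed

lemma nsum_option: "nsum (w :: 'a option \<Rightarrow> ennreal) = w None + nsum (\<lambda>b. w (Some b))"
proof -
  have "w x = w x * indicator {None} x + w x * indicator (range Some) x" for x
    by (cases x) (auto split: split_indicator)
  then have "nsum w = nsum (\<lambda>x. w x * indicator {None} x) + nsum (\<lambda>x. w x * indicator (range Some) x)"
    unfolding nsum_add[symmetric] by (rule nsum_cong)
  moreover have "nsum (\<lambda>x. w x * indicator {None} x) = w None" by (subst nsum_single[of None]) auto
  ultimately show ?thesis by (simp add: nsum_range)
qed

lemma nsum_pair: "nsum g = nsum (\<lambda>x. nsum (\<lambda>y. g (x, y)))"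
  by (rule nn_integral_fst_count_space[symmetric])

section \<open>Weak transitions between full distributions\<close>

definition WK :: "('a, 'v) nexp \<Rightarrow> ('a, 'v) nexp pmf \<Rightarrow> bool" where
  "WK s m \<longleftrightarrow> wk (dirac s) (pmf m)"

lemma WK_der: "WK s m \<longleftrightarrow> flow_star (ep (return_pmf s)) (ep m)"
proof
  assume "WK s m"
  then show "flow_star (ep (return_pmf s)) (ep m)"
    unfolding WK_def dirac_pmf using wk_der[of "pmf (return_pmf s)" "pmf m"] nsum_ep[of "return_pmf s"] by (auto simp del: pmf_return)
next
  assume "flow_star (ep (return_pmf s)) (ep m)"
  from flow_star_wk[OF this] show "WK s m" unfolding WK_def dirac_pmf by (simp add: nsum_ep del: pmf_return)
qed

text \<open>A weak move annotated with the mass \<open>e\<close> that one of its derivations still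
  moves at stage \<open>N\<close>, which is the part to be left unanalysed.\<close>

definition WKd :: "nat \<Rightarrow> ('a, 'v) nexp \<Rightarrow> ('a, 'v) nexp pmf \<Rightarrow> ennreal \<Rightarrow> bool" where
  "WKd N s m e \<longleftrightarrow> (\<exists>T X. flow_seq T X \<and> (\<forall>p. ep (return_pmf s) p = T 0 p + X 0 p) \<and> (\<forall>u. ep m u = nsum (\<lambda>j. X j u)) \<and> e = nsum (T N))"

lemma WKd_WK: "WKd N s m e \<Longrightarrow> WK s m"
  unfolding WKd_def WK_der flow_star_def by blast

text \<open>When no mass diverges overall, none diverges from any initial state of positive mass:
  the final masses \<open>g s\<close> are at most 1 and average to the full mass, so each equals 1.
  Every part is then a weak move to a distribution.\<close>

lemma flow_seq_kernel:
  assumes d: "flow_seq T X" and m0: "nsum (T 0) + nsum (X 0) \<le> 1"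
    and full: "nsum (\<lambda>u. nsum (\<lambda>j. X j u)) = nsum (T 0) + nsum (X 0)"
  shows "\<exists>k e. (\<forall>s. T 0 s + X 0 s \<noteq> 0 \<longrightarrow> WKd N s (k s) (e s)) \<and>
    (\<forall>u. nsum (\<lambda>j. X j u) = nsum (\<lambda>s. (T 0 s + X 0 s) * ep (k s) u)) \<and>
    nsum (T N) = nsum (\<lambda>s. (T 0 s + X 0 s) * e s)"
proof -
  define c where "c s = T 0 s + X 0 s" for s
  obtain T' X' where s: "\<And>s. c s \<noteq> 0 \<Longrightarrow> flow_seq (T' s) (X' s) \<and> (\<forall>p. ep (return_pmf s) p = T' s 0 p + X' s 0 p)"
    "\<And>j u. T j u = nsum (\<lambda>s. c s * T' s j u)" "\<And>j u. X j u = nsum (\<lambda>s. c s * X' s j u)"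
    using flow_seq_split[OF d m0] unfolding c_def[symmetric] by blast
  define g where "g s = nsum (\<lambda>u. nsum (\<lambda>j. X' s j u))" for s
  have Xu: "nsum (\<lambda>j. X j u) = nsum (\<lambda>s. c s * nsum (\<lambda>j. X' s j u))" for u
    unfolding s(3) nsum_cmult[symmetric] by (rule nsum_commute)
  have cm: "nsum c = nsum (T 0) + nsum (X 0)" unfolding c_def nsum_add ..
  have cfin: "nsum c \<noteq> top" using m0 unfolding cm by (metis ennreal_one_neq_top neq_top_trans)
  have gm: "nsum (\<lambda>s. c s * g s) = nsum c"
    unfolding cm full[symmetric] Xu g_def nsum_cmult[symmetric] by (rule nsum_commute)
  have gle: "g s \<le> 1" if "c s \<noteq> 0" for s
  proof -
    have "g s = nsum (\<lambda>j. nsum (X' s j))" unfolding g_def by (rule nsum_commute)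
    also have "\<dots> \<le> nsum (T' s 0) + nsum (X' s 0)" using s(1)[OF that] flow_seq_total by blast
    also have "\<dots> = nsum (ep (return_pmf s))" unfolding nsum_add[symmetric] using s(1)[OF that] by (simp del: pmf_return)
    finally show ?thesis unfolding nsum_ep .
  qed
  have "c s * (1 - g s) + c s * g s = c s" for s
  proof (cases "c s = 0")
    case False
    from gle[OF this] show ?thesis unfolding distrib_left[symmetric] by (simp add: diff_add_cancel_ennreal)
  qed simp
  then have "nsum (\<lambda>s. c s * (1 - g s)) + nsum (\<lambda>s. c s * g s) = nsum c"
    unfolding nsum_add[symmetric] by (rule nsum_cong)
  then have "nsum c + nsum (\<lambda>s. c s * (1 - g s)) = nsum c + 0"
    unfolding gm add_0_right by (subst add.commute)
  then have z: "nsum (\<lambda>s. c s * (1 - g s)) = 0"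
    using cfin unfolding ennreal_add_left_cancel infinity_ennreal_def by blast
  have g1: "g s = 1" if "c s \<noteq> 0" for s
  proof -
    have "c s * (1 - g s) = 0" using nsum_eq_0D[OF z] .
    then have "1 - g s = 0" using that by simp
    then show ?thesis using diff_add_cancel_ennreal[OF gle[OF that]] by simp
  qed
  have "\<forall>s. \<exists>m. c s \<noteq> 0 \<longrightarrow> (\<forall>u. ep m u = nsum (\<lambda>j. X' s j u))"
  proof
    fix s show "\<exists>m. c s \<noteq> 0 \<longrightarrow> (\<forall>u. ep m u = nsum (\<lambda>j. X' s j u))"
    proof (cases "c s = 0")
      case False
      from g1[OF this] pmf_of_weights[of "\<lambda>u. nsum (\<lambda>j. X' s j u)"] show ?thesis unfolding g_def by blast
    qed simp
  qed
  from choice[OF this] obtain k where k: "\<And>s u. c s \<noteq> 0 \<Longrightarrow> ep (k s) u = nsum (\<lambda>j. X' s j u)" by blast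
  define e where "e s = nsum (T' s N)" for s
  have "WKd N s (k s) (e s)" if "c s \<noteq> 0" for s
    unfolding WKd_def using s(1)[OF that] k[OF that] e_def by blast
  moreover have "nsum (\<lambda>j. X j u) = nsum (\<lambda>s. c s * ep (k s) u)" for u
    unfolding Xu
  proof (rule nsum_cong)
    fix s show "c s * nsum (\<lambda>j. X' s j u) = c s * ep (k s) u" by (cases "c s = 0") (auto simp: k)
  qed
  moreover have "nsum (T N) = nsum (\<lambda>s. c s * e s)"
    unfolding s(2) e_def nsum_cmult[symmetric] by (rule nsum_commute)
  ultimately show ?thesis unfolding c_def by blast
qed

text \<open>The first step of a weak move from \<open>s\<close> is a random choice \<open>M\<close>
  between stopping, \<open>None\<close>, and a transition to \<open>t\<close>,
  \<open>Some t\<close>. After the transition, weak moves remain whose tails lie one stage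
  earlier.\<close>

lemma flow_seq_unfold:
  assumes d: "flow_seq T X" and i: "\<forall>p. ep (return_pmf s) p = T 0 p + X 0 p" and mu: "\<forall>u. ep m u = nsum (\<lambda>j. X j u)"
  shows "\<exists>M k e. (\<forall>t. Some t \<in> set_pmf M \<longrightarrow> stp s Tau t \<and> (\<forall>p\<in>set_pmf t. WKd N p (k p) (e p))) \<and>
     m = bind_pmf M (\<lambda>x. case x of None \<Rightarrow> return_pmf s | Some t \<Rightarrow> bind_pmf t k) \<and>
     nsum (T 0) = (\<integral>\<^sup>+x. (case x of None \<Rightarrow> 0 | Some t \<Rightarrow> 1) \<partial>measure_pmf M) \<and>
     nsum (T (Suc N)) = (\<integral>\<^sup>+x. (case x of None \<Rightarrow> 0 | Some t \<Rightarrow> (\<integral>\<^sup>+p. e p \<partial>measure_pmf t)) \<partial>measure_pmf M)"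
proof -
  have m0: "nsum (T 0) + nsum (X 0) = 1" unfolding nsum_add[symmetric] using i nsum_ep[of "return_pmf s"] by (simp del: pmf_return)
  have z: "T 0 p = 0" "X 0 p = 0" if "p \<noteq> s" for p using i[rule_format, of p] that by (auto simp: ep_return simp del: pmf_return)
  have T0: "nsum (T 0) = T 0 s" and X0: "nsum (X 0) = X 0 s" by (auto intro: nsum_single z)
  have X0f: "X 0 s \<noteq> top" and T0f: "T 0 s \<noteq> top" using m0 unfolding T0 X0 by auto
  obtain f where f: "\<forall>b. f b \<noteq> 0 \<longrightarrow> b \<in> Bst Tau" "\<And>q. T 0 q = nsum (\<lambda>b. f b * ep (fst b) q)"
    "\<And>u. T 1 u + X 1 u = nsum (\<lambda>b. f b * ep (snd b) u)"
    using d unfolding flow_seq_def flow_def One_nat_def by blast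
  have fs: "f (x, t) = 0" if "x \<noteq> return_pmf s" for x t
  proof (rule ccontr)
    assume a: "f (x, t) \<noteq> 0"
    then obtain q where q: "x = return_pmf q" using f(1) by (auto simp: Bst_def)
    with that have "q \<noteq> s" by auto
    then have "f (x, t) * ep (fst (x, t)) q = 0" using nsum_eq_0D[OF z(1)[unfolded f(2)]] by blast
    with a q show False by simp
  qed
  define w where "w t = f (return_pmf s, t)" for t
  have pr: "nsum (\<lambda>b. f b * h (snd b)) = nsum (\<lambda>t. w t * h t)" for h
    unfolding nsum_pair[of "\<lambda>b. f b * h (snd b)"]
    by (subst nsum_single[of "return_pmf s"]) (auto simp: fs w_def)
  have T0w: "T 0 s = nsum w"
    unfolding f(2) nsum_pair[of "\<lambda>b. f b * ep (fst b) s"]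
    by (subst nsum_single[of "return_pmf s"]) (auto simp: fs w_def[abs_def])
  have c1: "T 1 u + X 1 u = nsum (\<lambda>t. w t * ep t u)" for u unfolding f(3) by (rule pr)
  \<comment> \<open>All initial mass sits in \<open>s\<close>, so the stopping mass and the weights
    of the transitions from \<open>s\<close> are the weights of a distribution.\<close>
  have "nsum (case_option (X 0 s) w) = 1" unfolding nsum_option using m0 T0 X0 T0w by (simp add: add.commute)
  then obtain M where M: "\<And>x. ep M x = case_option (X 0 s) w x" using pmf_of_weights by metis
  let ?T = "\<lambda>j. T (Suc j)" and ?X = "\<lambda>j. X (Suc j)"
  have d': "flow_seq ?T ?X" using d unfolding flow_seq_def by blast
  have m1: "nsum (?T 0) + nsum (?X 0) = T 0 s" using flow_seq_mass1[OF d, of 0] T0 by simp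
  have Xs: "nsum (\<lambda>j. X j u) = X 0 u + nsum (\<lambda>j. ?X j u)" for u by (rule nsum_nat_split)
  have "X 0 s + nsum (\<lambda>u. nsum (\<lambda>j. ?X j u)) = 1"
    using nsum_ep[of m] mu unfolding X0[symmetric] nsum_add[symmetric] Xs[symmetric] by simp
  also have "\<dots> = X 0 s + T 0 s" using m0 T0 X0 by (simp add: add.commute)
  finally have full: "nsum (\<lambda>u. nsum (\<lambda>j. ?X j u)) = nsum (?T 0) + nsum (?X 0)"
    unfolding m1 using X0f by (simp add: ennreal_add_left_cancel)
  have "nsum (?T 0) + nsum (?X 0) \<le> 1" unfolding m1 using m0 T0 by (metis add.right_neutral add_left_mono zero_le)
  from flow_seq_kernel[OF d' this full, of N] obtain k e where
    k: "\<And>p. T 1 p + X 1 p \<noteq> 0 \<Longrightarrow> WKd N p (k p) (e p)"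
    "\<And>u. nsum (\<lambda>j. ?X j u) = nsum (\<lambda>p. (T 1 p + X 1 p) * ep (k p) u)"
    "nsum (T (Suc N)) = nsum (\<lambda>p. (T 1 p + X 1 p) * e p)" by auto
  have c1h: "nsum (\<lambda>p. (T 1 p + X 1 p) * h p) = nsum (\<lambda>t. w t * nsum (\<lambda>p. ep t p * h p))" for h
    unfolding c1 nsum_multc[symmetric] nsum_cmult[symmetric] by (subst nsum_commute) (simp add: mult.assoc)
  have "stp s Tau t \<and> (\<forall>p\<in>set_pmf t. WKd N p (k p) (e p))" if "Some t \<in> set_pmf M" for t
  proof -
    have w: "w t \<noteq> 0" using M[of "Some t"] pmf_positive[OF that] by auto
    then have "(return_pmf s, t) \<in> Bst Tau" using f(1) by (auto simp: w_def)
    then have "stp s Tau t" by (auto simp: Bst_def)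
    moreover have "T 1 p + X 1 p \<noteq> 0" if "p \<in> set_pmf t" for p
    proof
      assume "T 1 p + X 1 p = 0"
      then have "w t * ep t p = 0" unfolding c1 by (rule nsum_eq_0D)
      then show False using w pmf_positive[OF that] by simp
    qed
    ultimately show ?thesis using k(1) by blast
  qed
  moreover have "m = bind_pmf M (\<lambda>x. case x of None \<Rightarrow> return_pmf s | Some t \<Rightarrow> bind_pmf t k)"
  proof (rule pmf_eqI_ep)
    fix u
    have "X 0 u = X 0 s * ep (return_pmf s) u" using z(2)[of u] by (auto simp: ep_return simp del: pmf_return)
    then show "ep m u = ep (bind_pmf M (\<lambda>x. case x of None \<Rightarrow> return_pmf s | Some t \<Rightarrow> bind_pmf t k)) u"
      unfolding mu[rule_format] Xs k(2) c1h ep_bind M nsum_option by (simp add: ep_bind del: pmf_return)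
  qed
  moreover have "nsum (T 0) = (\<integral>\<^sup>+x. (case x of None \<Rightarrow> 0 | Some t \<Rightarrow> 1) \<partial>measure_pmf M)"
    unfolding nsum_ep_mult[symmetric] M nsum_option T0 T0w by simp
  moreover have "nsum (T (Suc N)) = (\<integral>\<^sup>+x. (case x of None \<Rightarrow> 0 | Some t \<Rightarrow> (\<integral>\<^sup>+p. e p \<partial>measure_pmf t)) \<partial>measure_pmf M)"
    unfolding nsum_ep_mult[symmetric] M nsum_option k(3) c1h by simp
  ultimately show ?thesis by blast
qed

text \<open>\<open>unroll Z X P m e\<close>: the weak move from \<open>P\<close> to \<open>m\<close> is unrolled through finitely many internal steps,
  after which every branch either stops in the sense of \<open>Z\<close> or continues with an unanalysed move \<open>X\<close>;
  \<open>e\<close> is the mass of the unanalysed branches.\<close>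
inductive unroll :: "(('a, 'v) nexp \<Rightarrow> ('a, 'v) nexp pmf \<Rightarrow> bool) \<Rightarrow> (('a, 'v) nexp \<Rightarrow> ('a, 'v) nexp pmf \<Rightarrow> bool) \<Rightarrow>
    ('a, 'v) nexp \<Rightarrow> ('a, 'v) nexp pmf \<Rightarrow> ennreal \<Rightarrow> bool" for Z X where
  unroll_stop: "Z P m \<Longrightarrow> unroll Z X P m 0"
| unroll_left: "X P m \<Longrightarrow> unroll Z X P m 1"
| unroll_step: "stp P Tau t \<Longrightarrow> (\<And>p. p \<in> set_pmf t \<Longrightarrow> unroll Z X p (M p) (e p)) \<Longrightarrow>
     unroll Z X P (bind_pmf t M) (\<integral>\<^sup>+p. e p \<partial>measure_pmf t)"
| unroll_mix: "(\<And>y. y \<in> set_pmf N \<Longrightarrow> unroll Z X P (fst y) (snd y)) \<Longrightarrow>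
     unroll Z X P (bind_pmf N fst) (\<integral>\<^sup>+y. snd y \<partial>measure_pmf N)"

lemma unroll_bind:
  assumes "\<And>x. x \<in> set_pmf M \<Longrightarrow> unroll Z X P (f x) (e x)"
  shows "unroll Z X P (bind_pmf M f) (\<integral>\<^sup>+x. e x \<partial>measure_pmf M)"
proof -
  have "unroll Z X P (bind_pmf (map_pmf (\<lambda>x. (f x, e x)) M) fst) (\<integral>\<^sup>+y. snd y \<partial>measure_pmf (map_pmf (\<lambda>x. (f x, e x)) M))"
    by (rule unroll_mix) (use assms in auto)
  then show ?thesis by (simp add: bind_map_pmf)
qed

text \<open>\<open>T N\<close> is the mass that takes step \<open>N + 1\<close>. Thus one step is
  unrolled already for \<open>N = 0\<close>, and the unanalysed mass is exactly
  \<open>nsum (T N)\<close>.\<close>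

lemma WKd_app: "WKd N s m e \<Longrightarrow> unroll (\<lambda>P m. m = return_pmf P) WK s m e"
proof (induction N arbitrary: s m e)
  case 0
  then obtain T X where TX: "flow_seq T X" "\<forall>p. ep (return_pmf s) p = T 0 p + X 0 p" "\<forall>u. ep m u = nsum (\<lambda>j. X j u)" "e = nsum (T 0)"
    unfolding WKd_def by blast
  from flow_seq_unfold[OF TX(1-3), of 0] obtain M k where M:
    "\<And>t. Some t \<in> set_pmf M \<Longrightarrow> stp s Tau t \<and> (\<forall>p\<in>set_pmf t. WK p (k p))"
    "m = bind_pmf M (\<lambda>x. case x of None \<Rightarrow> return_pmf s | Some t \<Rightarrow> bind_pmf t k)"
    "nsum (T 0) = (\<integral>\<^sup>+x. (case x of None \<Rightarrow> 0 | Some t \<Rightarrow> 1) \<partial>measure_pmf M)" using WKd_WK by metis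
  show ?case unfolding M(2) TX(4) M(3)
  proof (rule unroll_bind)
    fix x assume x: "x \<in> set_pmf M"
    show "unroll (\<lambda>P m. m = return_pmf P) WK s (case x of None \<Rightarrow> return_pmf s | Some t \<Rightarrow> bind_pmf t k) (case x of None \<Rightarrow> 0 | Some t \<Rightarrow> 1)"
    proof (cases x)
      case None then show ?thesis by (simp add: unroll_stop)
    next
      case (Some t)
      have "unroll (\<lambda>P m. m = return_pmf P) WK s (bind_pmf t k) (\<integral>\<^sup>+p. 1 \<partial>measure_pmf t)"
        by (rule unroll_step) (use M(1)[of t] x Some in \<open>auto intro: unroll_left\<close>)
      then show ?thesis using Some by simp
    qed
  qed
next
  case (Suc N)
  then obtain T X where TX: "flow_seq T X" "\<forall>p. ep (return_pmf s) p = T 0 p + X 0 p" "\<forall>u. ep m u = nsum (\<lambda>j. X j u)" "e = nsum (T (Suc N))"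
    unfolding WKd_def by blast
  from flow_seq_unfold[OF TX(1-3), of N] obtain M k e' where M:
    "\<And>t. Some t \<in> set_pmf M \<Longrightarrow> stp s Tau t \<and> (\<forall>p\<in>set_pmf t. WKd N p (k p) (e' p))"
    "m = bind_pmf M (\<lambda>x. case x of None \<Rightarrow> return_pmf s | Some t \<Rightarrow> bind_pmf t k)"
    "nsum (T (Suc N)) = (\<integral>\<^sup>+x. (case x of None \<Rightarrow> 0 | Some t \<Rightarrow> (\<integral>\<^sup>+p. e' p \<partial>measure_pmf t)) \<partial>measure_pmf M)" by blast
  show ?case unfolding M(2) TX(4) M(3)
  proof (rule unroll_bind)
    fix x assume x: "x \<in> set_pmf M"
    show "unroll (\<lambda>P m. m = return_pmf P) WK s (case x of None \<Rightarrow> return_pmf s | Some t \<Rightarrow> bind_pmf t k)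
       (case x of None \<Rightarrow> 0 | Some t \<Rightarrow> (\<integral>\<^sup>+p. e' p \<partial>measure_pmf t))"
    proof (cases x)
      case None then show ?thesis by (simp add: unroll_stop)
    next
      case (Some t)
      have "unroll (\<lambda>P m. m = return_pmf P) WK s (bind_pmf t k) (\<integral>\<^sup>+p. e' p \<partial>measure_pmf t)"
        by (rule unroll_step) (use M(1)[of t] x Some Suc.IH in auto)
      then show ?thesis using Some by simp
    qed
  qed
qed

text \<open>The target has mass 1, so all mass stops eventually and the mass still moving at stage
  \<open>N\<close> tends to 0.\<close>

lemma WK_app:
  assumes "WK s m" "0 < \<epsilon>" shows "\<exists>e<\<epsilon>. unroll (\<lambda>P m. m = return_pmf P) WK s m e"
proof -
  obtain T X where TX: "flow_seq T X" "\<forall>p. ep (return_pmf s) p = T 0 p + X 0 p" "\<forall>u. ep m u = nsum (\<lambda>j. X j u)"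
    using assms(1) unfolding WK_der flow_star_def by blast
  have m0: "nsum (T 0) + nsum (X 0) = 1" unfolding nsum_add[symmetric] using TX(2) nsum_ep[of "return_pmf s"] by (simp del: pmf_return)
  have tot: "nsum (\<lambda>j. nsum (X j)) = 1"
    unfolding nsum_ep[of m, symmetric] TX(3)[rule_format] by (rule nsum_commute)
  have "(\<lambda>n. \<Sum>j\<le>n. nsum (X j)) \<longlonglongrightarrow> 1"
    using nsum_LIMSEQ[of "\<lambda>j. nsum (X j)"] unfolding tot by (simp add: LIMSEQ_lessThan_iff_atMost)
  then have "(\<lambda>n. 1 - (\<Sum>j\<le>n. nsum (X j))) \<longlonglongrightarrow> 1 - 1"
    by (rule tendsto_diff_ennreal[OF tendsto_const]) auto
  moreover have "1 - (\<Sum>j\<le>n. nsum (X j)) = nsum (T n)" for n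
  proof -
    have eq: "nsum (T n) + (\<Sum>j\<le>n. nsum (X j)) = 1" using flow_seq_mass[OF TX(1), of n] m0 by simp
    then have "(\<Sum>j\<le>n. nsum (X j)) \<noteq> top" by (metis ennreal_add_eq_top ennreal_one_neq_top)
    then show ?thesis unfolding eq[symmetric] by simp
  qed
  ultimately have "(\<lambda>n. nsum (T n)) \<longlonglongrightarrow> 0" by simp
  from order_tendstoD(2)[OF this assms(2)] obtain N where "nsum (T N) < \<epsilon>" by (auto simp: eventually_sequentially)
  then show ?thesis using WKd_app[of N s m "nsum (T N)"] TX unfolding WKd_def by blast
qed

declare pmf_return[simp del]

lemma flow_star_zero: "flow_star (\<lambda>_. 0) (\<lambda>_. 0)"
  using flow_star_nsum[of "\<lambda>_::nat. 0"] by simp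

lemma flow_zero: "flow B (\<lambda>_. 0) (\<lambda>_. 0)"
  using flow_nsum[of "\<lambda>_::nat. 0"] by simp

lemma WK_return: "WK s (return_pmf s)"
  unfolding WK_der flow_star_def
proof (intro exI conjI allI)
  let ?X = "\<lambda>j::nat. if j = 0 then ep (return_pmf s) else (\<lambda>_. 0)"
  show "flow_seq (\<lambda>_ _. 0) ?X" unfolding flow_seq_def by (simp add: flow_zero)
  show "ep (return_pmf s) p = 0 + ?X 0 p" for p by simp
  show "ep (return_pmf s) u = nsum (\<lambda>j. ?X j u)" for u by (subst nsum_single[of 0]) auto
qed

lemma WK_step: "stp s Tau t \<Longrightarrow> WK s t"
  unfolding WK_der flow_star_def
proof (intro exI conjI allI)
  assume a: "stp s Tau t"
  let ?T = "\<lambda>j::nat. if j = 0 then ep (return_pmf s) else (\<lambda>_. 0)" and ?X = "\<lambda>j::nat. if j = 1 then ep t else (\<lambda>_. 0)"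
  have "flow (Bst Tau) (ep (return_pmf s)) (ep t)" using flow_base[of "(return_pmf s, t)" "Bst Tau"] a by (auto simp: Bst_def)
  then show "flow_seq ?T ?X" unfolding flow_seq_def by (simp add: flow_zero)
  show "ep (return_pmf s) p = ?T 0 p + ?X 0 p" for p by simp
  show "ep t u = nsum (\<lambda>j. ?X j u)" for u by (subst nsum_single[of 1]) auto
qed

lemma ep_nz: "ep m x \<noteq> 0 \<longleftrightarrow> x \<in> set_pmf m"
  by (simp add: set_pmf_iff)

lemma ep_bind_const: "nsum (\<lambda>x. ep M x * c) = c"
  by (simp add: nsum_multc nsum_ep)

lemma WK_mix: "(\<And>x. x \<in> set_pmf N \<Longrightarrow> WK s (f x)) \<Longrightarrow> WK s (bind_pmf N f)"
proof -
  assume a: "\<And>x. x \<in> set_pmf N \<Longrightarrow> WK s (f x)"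
  have "flow_star (\<lambda>u. nsum (\<lambda>x. ep N x * ep (return_pmf s) u)) (\<lambda>u. nsum (\<lambda>x. ep N x * ep (f x) u))"
    by (rule flow_star_nsum) (simp only: ep_nz WK_der[symmetric] a)
  then show ?thesis unfolding ep_bind_const ep_bind[symmetric] WK_der .
qed

lemma flow_star_pmfI:
  assumes "\<And>s. s \<in> set_pmf m \<Longrightarrow> WK s (k s)" shows "flow_star (ep m) (ep (bind_pmf m k))"
proof -
  have "flow_star (\<lambda>u. nsum (\<lambda>s. ep m s * ep (return_pmf s) u)) (\<lambda>u. nsum (\<lambda>s. ep m s * ep (k s) u))"
    by (rule flow_star_nsum) (simp only: ep_nz WK_der[symmetric] assms)
  then show ?thesis unfolding nsum_ep_return' ep_bind[symmetric] .
qed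

lemma flow_star_pmfD:
  assumes "flow_star (ep m) (ep n)" shows "\<exists>k. (\<forall>s\<in>set_pmf m. WK s (k s)) \<and> n = bind_pmf m k"
proof -
  obtain T X where d: "flow_seq T X" "\<And>s. ep m s = T 0 s + X 0 s" "\<And>s. ep n s = nsum (\<lambda>j. X j s)"
    using assms unfolding flow_star_def by blast
  have m0: "nsum (T 0) + nsum (X 0) = 1" unfolding nsum_add[symmetric] d(2)[symmetric] by (rule nsum_ep)
  have "nsum (\<lambda>u. nsum (\<lambda>j. X j u)) = nsum (T 0) + nsum (X 0)" unfolding m0 d(3)[symmetric] by (rule nsum_ep)
  from flow_seq_kernel[OF d(1) _ this, of 0] m0 obtain k e where k: "\<And>s. ep m s \<noteq> 0 \<Longrightarrow> WKd 0 s (k s) (e s)"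
    "\<And>u. ep n u = nsum (\<lambda>s. ep m s * ep (k s) u)"
    unfolding d(2)[symmetric] d(3)[symmetric] by auto
  have "n = bind_pmf m k" by (rule pmf_eqI_ep) (simp only: k(2) ep_bind)
  moreover have "\<forall>s\<in>set_pmf m. WK s (k s)" using k(1) WKd_WK by (metis ep_nz)
  ultimately show ?thesis by blast
qed

text \<open>Infinite concatenation in the case where only two stages carry mass:
  \<open>\<eta>\<close> is empty from stage 2 on, and everything is emitted there.\<close>

lemma WK_trans:
  assumes "WK s m" "\<And>p. p \<in> set_pmf m \<Longrightarrow> WK p (k p)" shows "WK s (bind_pmf m k)"
proof -
  define \<eta> where "\<eta> i = (if i = 0 then ep (return_pmf s) else if i = Suc 0 then ep m else (\<lambda>_. 0))" for i :: nat
  define x where "x i = (if i = Suc (Suc 0) then ep (bind_pmf m k) else (\<lambda>_. 0))" for i :: nat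
  have "flow_star (\<eta> i) (\<lambda>u. \<eta> (Suc i) u + x (Suc i) u)" for i
    using assms(1) flow_star_pmfI[OF assms(2)] flow_star_zero
    by (cases i rule: nat.exhaust; cases "i = Suc 0") (auto simp: \<eta>_def x_def WK_der)
  moreover have "nsum (\<eta> 0) \<le> 1" by (simp add: \<eta>_def nsum_ep)
  moreover have "(\<lambda>i. nsum (\<eta> i)) \<longlonglongrightarrow> 0"
    by (rule tendsto_eventually) (auto simp: eventually_sequentially \<eta>_def intro!: exI[of _ "Suc (Suc 0)"])
  ultimately have "flow_star (\<eta> 0) (\<lambda>u. nsum (\<lambda>i. x (Suc i) u))" by (rule flow_star_infinite_concat)
  moreover have "nsum (\<lambda>i. x (Suc i) u) = ep (bind_pmf m k) u" for u
    by (subst nsum_single[of "Suc 0"]) (auto simp: x_def)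
  ultimately show ?thesis by (simp add: WK_der \<eta>_def)
qed

text \<open>A process on labels: \<open>Inl\<close> labels are finished, and round \<open>n\<close>
  replaces an open label \<open>l\<close> by a sample of \<open>K n l\<close>. Only the states below
  the labels make weak moves; the labels carry bookkeeping through the limit. \<open>U\<close>
  collects the finished labels of all rounds.\<close>

lemma WK_iterate:
  fixes K :: "nat \<Rightarrow> 'l \<Rightarrow> ('o + 'l) pmf" and st :: "'l \<Rightarrow> ('a, 'v) nexp"
  assumes D0: "D 0 = return_pmf (Inr l0)"
    and DS: "\<And>n. D (Suc n) = bind_pmf (D n) (case_sum (\<lambda>x. return_pmf (Inl x)) (K n))"
    and WK: "\<And>n l. Inr l \<in> set_pmf (D n) \<Longrightarrow> WK (st l) (map_pmf (case_sum so st) (K n l))"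
    and lim: "(\<lambda>n. nsum (\<lambda>l. ep (D n) (Inr l))) \<longlonglongrightarrow> 0"
  shows "\<exists>U. WK (st l0) (map_pmf so U) \<and> (\<forall>n x. ep (D n) (Inl x) \<le> ep U x) \<and> (\<forall>x\<in>set_pmf U. \<exists>n. Inl x \<in> set_pmf (D n))"
proof -
  \<comment> \<open>The mass that becomes finished with label \<open>x\<close> in round
    \<open>n\<close>.\<close>
  define dl where "dl n x = nsum (\<lambda>l. ep (D n) (Inr l) * ep (K n l) (Inl x))" for n x
  have DSl: "ep (D (Suc n)) (Inl x) = ep (D n) (Inl x) + dl n x" for n x
  proof -
    have "nsum (\<lambda>y. ep (D n) (Inl y) * ep (return_pmf (Inl y :: 'o + 'l)) (Inl x)) = ep (D n) (Inl x)"
      by (subst nsum_single[of x]) (auto simp: ep_return)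
    then show ?thesis unfolding DS ep_bind nsum_sum dl_def by simp
  qed
  have DSr: "ep (D (Suc n)) (Inr l') = nsum (\<lambda>l. ep (D n) (Inr l) * ep (K n l) (Inr l'))" for n l'
    unfolding DS ep_bind nsum_sum by (simp add: ep_return)
  define \<eta> where "\<eta> n u = nsum (\<lambda>l. ep (D n) (Inr l) * ep (return_pmf (st l)) u)" for n u
  define x where "x n u = (case n of 0 \<Rightarrow> 0 | Suc n \<Rightarrow> nsum (\<lambda>y. dl n y * ep (return_pmf (so y)) u))" for n u
  have m\<eta>: "nsum (\<eta> n) = nsum (\<lambda>l. ep (D n) (Inr l))" for n
    unfolding \<eta>_def by (subst nsum_commute) (simp add: nsum_cmult nsum_ep)
  have "flow_star (\<eta> n) (\<lambda>u. \<eta> (Suc n) u + x (Suc n) u)" for n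
  proof -
    have "flow_star (\<eta> n) (\<lambda>u. nsum (\<lambda>l. ep (D n) (Inr l) * ep (map_pmf (case_sum so st) (K n l)) u))"
      unfolding \<eta>_def by (rule flow_star_nsum) (simp only: ep_nz WK_der[symmetric] WK)
    moreover have "nsum (\<lambda>l. ep (D n) (Inr l) * ep (map_pmf (case_sum so st) (K n l)) u) = \<eta> (Suc n) u + x (Suc n) u" for u
    proof -
      have "nsum (\<lambda>l. ep (D n) (Inr l) * ep (map_pmf (case_sum so st) (K n l)) u) =
        nsum (\<lambda>l. ep (D n) (Inr l) * (nsum (\<lambda>y. ep (K n l) (Inl y) * ep (return_pmf (so y)) u)
           + nsum (\<lambda>l'. ep (K n l) (Inr l') * ep (return_pmf (st l')) u)))"
        unfolding map_pmf_def ep_bind nsum_sum by (simp)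
      also have "\<dots> = nsum (\<lambda>l. nsum (\<lambda>y. ep (D n) (Inr l) * ep (K n l) (Inl y) * ep (return_pmf (so y)) u))
          + nsum (\<lambda>l. nsum (\<lambda>l'. ep (D n) (Inr l) * ep (K n l) (Inr l') * ep (return_pmf (st l')) u))"
        unfolding distrib_left nsum_add nsum_cmult[symmetric] by (simp only: mult.assoc)
      also have "nsum (\<lambda>l. nsum (\<lambda>y. ep (D n) (Inr l) * ep (K n l) (Inl y) * ep (return_pmf (so y)) u)) = x (Suc n) u"
        unfolding x_def dl_def nat.case nsum_multc[symmetric] by (rule nsum_commute)
      also have "nsum (\<lambda>l. nsum (\<lambda>l'. ep (D n) (Inr l) * ep (K n l) (Inr l') * ep (return_pmf (st l')) u)) = \<eta> (Suc n) u"
        unfolding \<eta>_def DSr nsum_multc[symmetric] by (rule nsum_commute)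
      finally show ?thesis by (simp only: add.commute)
    qed
    ultimately show ?thesis by simp
  qed
  moreover have e0: "ep (D 0) (Inr l) = (if l = l0 then 1 else 0)" for l unfolding D0 by (auto simp: ep_return)
  have \<eta>0: "\<eta> 0 = ep (return_pmf (st l0))"
    unfolding \<eta>_def[abs_def] e0 by (rule ext) (subst nsum_single[of l0], auto)
  have "nsum (\<eta> 0) \<le> 1" unfolding \<eta>0 nsum_ep by simp
  moreover have "(\<lambda>i. nsum (\<eta> i)) \<longlonglongrightarrow> 0" unfolding m\<eta> by (rule lim)
  ultimately have flow_star: "flow_star (\<eta> 0) (\<lambda>u. nsum (\<lambda>i. x (Suc i) u))" by (rule flow_star_infinite_concat)
  define w where "w y = nsum (\<lambda>n. dl n y)" for y
  have part: "ep (D n) (Inl y) = (\<Sum>i<n. dl i y)" for n y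
  proof (induction n)
    case 0 show ?case unfolding D0 by (simp add: ep_return)
  qed (simp add: DSl)
  have tot: "(\<Sum>i<n. nsum (dl i)) + nsum (\<lambda>l. ep (D n) (Inr l)) = 1" for n
  proof -
    have "nsum (\<lambda>y. \<Sum>i<n. dl i y) = (\<Sum>i<n. nsum (dl i))" by (induction n) (simp_all add: nsum_add)
    then show ?thesis using nsum_ep[of "D n"] unfolding nsum_sum part by simp
  qed
  have "(\<lambda>n. (\<Sum>i<n. nsum (dl i)) + nsum (\<lambda>l. ep (D n) (Inr l))) \<longlonglongrightarrow> nsum (\<lambda>i. nsum (dl i)) + 0"
    by (intro tendsto_add nsum_LIMSEQ lim)
  then have "nsum (\<lambda>i. nsum (dl i)) = 1" unfolding tot by (simp add: LIMSEQ_const_iff)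
  then have "nsum w = 1" unfolding w_def using nsum_commute[of "\<lambda>i y. dl i y"] by metis
  then obtain U where U: "\<And>y. ep U y = w y" using pmf_of_weights by blast
  have "nsum (\<lambda>i. x (Suc i) u) = ep (map_pmf so U) u" for u
    unfolding map_pmf_def ep_bind U w_def x_def nat.case nsum_multc[symmetric] by (rule nsum_commute)
  then have "WK (st l0) (map_pmf so U)" using flow_star unfolding WK_der \<eta>0 by simp
  moreover have "ep (D n) (Inl y) \<le> ep U y" for n y
    unfolding part U w_def nn_integral_count_space_nat by (rule sum_le_suminf) auto
  moreover have "\<exists>n. Inl y \<in> set_pmf (D n)" if "y \<in> set_pmf U" for y
  proof -
    have "nsum (\<lambda>n. dl n y) \<noteq> 0" using that unfolding w_def[symmetric] U[symmetric] by (simp only: ep_nz)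
    then have "\<exists>n. dl n y \<noteq> 0" by (rule contrapos_np) simp
    then obtain n where "dl n y \<noteq> 0" by blast
    then have "ep (D (Suc n)) (Inl y) \<noteq> 0" unfolding DSl by simp
    then show ?thesis by (auto simp only: ep_nz)
  qed
  ultimately show ?thesis by blast
qed

definition combined_stp :: "'a act \<Rightarrow> ('a, 'v) nexp \<Rightarrow> ('a, 'v) nexp pmf \<Rightarrow> bool" where
  "combined_stp a s \<eta> \<longleftrightarrow> (\<exists>M. (\<forall>t\<in>set_pmf M. stp s a t) \<and> \<eta> = bind_pmf M (\<lambda>t. t))"

lemma flow_pmfI:
  assumes "\<And>s. s \<in> set_pmf m \<Longrightarrow> stp s a (k s)" shows "flow (Bst a) (ep m) (ep (bind_pmf m k))"
proof -
  have "flow (Bst a) (\<lambda>u. nsum (\<lambda>s. ep m s * ep (return_pmf s) u)) (\<lambda>u. nsum (\<lambda>s. ep m s * ep (k s) u))"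
  proof (rule flow_nsum)
    fix s assume "ep m s \<noteq> 0"
    then have "s \<in> set_pmf m" by (simp only: ep_nz)
    then have "(return_pmf s, k s) \<in> Bst a" using assms by (auto simp: Bst_def)
    from flow_base[OF this] show "flow (Bst a) (ep (return_pmf s)) (ep (k s))" by simp
  qed
  then show ?thesis unfolding nsum_ep_return' ep_bind[symmetric] .
qed

lemma flow_pmfD:
  assumes "flow (Bst a) (ep m) (ep n)" shows "\<exists>k. (\<forall>s\<in>set_pmf m. combined_stp a s (k s)) \<and> n = bind_pmf m k"
proof -
  obtain K where K: "\<And>p. ep m p \<noteq> 0 \<Longrightarrow> flow (Bst a) (ep (return_pmf p)) (K p)" "\<And>u. ep n u = nsum (\<lambda>p. ep m p * K p u)"
    using flow_kernel[OF assms] by auto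
  have "\<forall>p. \<exists>k. p \<in> set_pmf m \<longrightarrow> combined_stp a p k \<and> (\<forall>u. K p u = ep k u)"
  proof
    fix p show "\<exists>k. p \<in> set_pmf m \<longrightarrow> combined_stp a p k \<and> (\<forall>u. K p u = ep k u)"
    proof (cases "p \<in> set_pmf m")
      case True
      then have "flow (Bst a) (ep (return_pmf p)) (K p)" by (intro K(1)) (simp only: ep_nz)
      from flow_ep_mixture[OF this] obtain F where F: "set_pmf F \<subseteq> Bst a" "return_pmf p = bind_pmf F fst" "\<forall>u. K p u = ep (bind_pmf F snd) u" by blast
      have "stp p a (snd b)" if "b \<in> set_pmf F" for b
      proof -
        from that F(1) obtain q t where b: "b = (return_pmf q, t)" "stp q a t" by (auto simp: Bst_def)
        have "set_pmf (fst b) \<subseteq> set_pmf (bind_pmf F fst)" using that by auto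
        then have "q = p" unfolding F(2)[symmetric] b by simp
        with b show ?thesis by simp
      qed
      then have "combined_stp a p (bind_pmf F snd)" unfolding combined_stp_def
        by (intro exI[of _ "map_pmf snd F"]) (auto simp: bind_map_pmf)
      then show ?thesis using F(3) by blast
    qed simp
  qed
  from choice[OF this] obtain k where k: "\<And>p. p \<in> set_pmf m \<Longrightarrow> combined_stp a p (k p) \<and> (\<forall>u. K p u = ep (k p) u)" by blast
  have "n = bind_pmf m k"
  proof (rule pmf_eqI_ep)
    fix u
    have "ep m p * K p u = ep m p * ep (k p) u" for p
      using k[of p] by (cases "p \<in> set_pmf m") (auto simp: set_pmf_iff)
    then show "ep n u = ep (bind_pmf m k) u" unfolding K(2) ep_bind by (rule nsum_cong)
  qed
  then show ?thesis using k by blast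
qed

definition WT :: "'a act \<Rightarrow> ('a, 'v) nexp \<Rightarrow> ('a, 'v) nexp pmf \<Rightarrow> bool" where
  "WT a s m \<longleftrightarrow> wtrans (dirac s) a (pmf m)"

text \<open>Weak moves never gain mass and combined steps preserve it, so a full target forces both
  intermediate subdistributions to be full.\<close>

lemma WT_iff: "WT a s m \<longleftrightarrow> (\<exists>\<rho> \<eta>. WK s \<rho> \<and> flow (Bst a) (ep \<rho>) (ep \<eta>) \<and> flow_star (ep \<eta>) (ep m))"
proof
  assume "WT a s m"
  then obtain \<rho> \<eta> where w: "wk (dirac s) \<rho>" "cstep \<rho> a \<eta>" "wk \<eta> (pmf m)" unfolding WT_def wtrans_def by blast
  have s1: "subprob \<rho>" using wk_der[OF w(1)] by (simp add: dirac_pmf nsum_ep)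
  have s2: "subprob \<eta>" and g: "flow (Bst a) (\<lambda>s. ennreal (\<rho> s)) (\<lambda>s. ennreal (\<eta> s))" using cstep_gen[OF w(2)] by auto
  have d: "flow_star (\<lambda>s. ennreal (\<eta> s)) (ep m)" using wk_der[OF w(3)] s2 by (auto simp: subprob_def)
  have "1 \<le> nsum (\<lambda>s. ennreal (\<eta> s))" using flow_star_mass_le[OF d] by (simp add: nsum_ep)
  then have m2: "nsum (\<lambda>s. ennreal (\<eta> s)) = 1" using s2 by (auto simp: subprob_def)
  then have m1: "nsum (\<lambda>s. ennreal (\<rho> s)) = 1" using flow_mass[OF g] by simp
  obtain \<rho>' \<eta>' where "\<rho> = pmf \<rho>'" "\<eta> = pmf \<eta>'" using subprob_full_pmf[OF s1 m1] subprob_full_pmf[OF s2 m2] by blast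
  then show "\<exists>\<rho> \<eta>. WK s \<rho> \<and> flow (Bst a) (ep \<rho>) (ep \<eta>) \<and> flow_star (ep \<eta>) (ep m)" using w(1) g d unfolding WK_def by blast
next
  assume "\<exists>\<rho> \<eta>. WK s \<rho> \<and> flow (Bst a) (ep \<rho>) (ep \<eta>) \<and> flow_star (ep \<eta>) (ep m)"
  then obtain \<rho> \<eta> where w: "WK s \<rho>" "flow (Bst a) (ep \<rho>) (ep \<eta>)" "flow_star (ep \<eta>) (ep m)" by blast
  show "WT a s m" unfolding WT_def wtrans_def
    using w(1) flow_cstep[OF w(2)] flow_star_wk[OF w(3)] unfolding WK_def by (intro exI[of _ "pmf \<rho>"] exI[of _ "pmf \<eta>"]) (simp add: nsum_ep)
qed

lemma flow_star_trans_pmf: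
  assumes "flow_star (ep \<eta>) (ep m)" "\<And>p. p \<in> set_pmf m \<Longrightarrow> WK p (k p)" shows "flow_star (ep \<eta>) (ep (bind_pmf m k))"
proof -
  obtain h where h: "\<forall>s\<in>set_pmf \<eta>. WK s (h s)" "m = bind_pmf \<eta> h" using flow_star_pmfD[OF assms(1)] by blast
  have "flow_star (ep \<eta>) (ep (bind_pmf \<eta> (\<lambda>s. bind_pmf (h s) k)))"
    by (rule flow_star_pmfI, rule WK_trans) (use h assms(2) in auto)
  then show ?thesis unfolding h(2) bind_assoc_pmf .
qed

lemma WT_step: "stp s a t \<Longrightarrow> WT a s t"
  unfolding WT_iff
  using flow_pmfI[of "return_pmf s" a "\<lambda>_. t"] flow_star_pmfI[of t return_pmf] WK_return
  by (intro exI[of _ "return_pmf s"] exI[of _ t]) (auto simp: bind_return_pmf bind_return_pmf')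

lemma WT_WK: "WT a s m \<Longrightarrow> (\<And>p. p \<in> set_pmf m \<Longrightarrow> WK p (k p)) \<Longrightarrow> WT a s (bind_pmf m k)"
  unfolding WT_iff using flow_star_trans_pmf by metis

lemma WT_mix:
  assumes "\<And>x. x \<in> set_pmf N \<Longrightarrow> WT a s (f x)" shows "WT a s (bind_pmf N f)"
proof -
  have "\<forall>x. \<exists>rh. x \<in> set_pmf N \<longrightarrow> WK s (fst rh) \<and> flow (Bst a) (ep (fst rh)) (ep (snd rh)) \<and> flow_star (ep (snd rh)) (ep (f x))"
    using assms unfolding WT_iff by (metis fst_conv snd_conv)
  from choice[OF this] obtain G where G: "\<And>x. x \<in> set_pmf N \<Longrightarrow> WK s (fst (G x)) \<and> flow (Bst a) (ep (fst (G x))) (ep (snd (G x))) \<and> flow_star (ep (snd (G x))) (ep (f x))"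
    by blast
  have "WK s (bind_pmf N (\<lambda>x. fst (G x)))" by (rule WK_mix) (use G in blast)
  moreover have "flow (Bst a) (ep (bind_pmf N (\<lambda>x. fst (G x)))) (ep (bind_pmf N (\<lambda>x. snd (G x))))"
    unfolding ep_bind by (rule flow_nsum) (simp only: ep_nz G)
  moreover have "flow_star (ep (bind_pmf N (\<lambda>x. snd (G x)))) (ep (bind_pmf N f))"
    unfolding ep_bind by (rule flow_star_nsum) (simp only: ep_nz G)
  ultimately show ?thesis unfolding WT_iff by blast
qed

lemma WK_WT:
  assumes "WK s m" "\<And>p. p \<in> set_pmf m \<Longrightarrow> WT a p (k p)" shows "WT a s (bind_pmf m k)"
proof -
  have "\<forall>x. \<exists>rh. x \<in> set_pmf m \<longrightarrow> WK x (fst rh) \<and> flow (Bst a) (ep (fst rh)) (ep (snd rh)) \<and> flow_star (ep (snd rh)) (ep (k x))"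
    using assms(2) unfolding WT_iff by (metis fst_conv snd_conv)
  from choice[OF this] obtain G where G: "\<And>x. x \<in> set_pmf m \<Longrightarrow> WK x (fst (G x)) \<and> flow (Bst a) (ep (fst (G x))) (ep (snd (G x))) \<and> flow_star (ep (snd (G x))) (ep (k x))"
    by blast
  have "WK s (bind_pmf m (\<lambda>x. fst (G x)))" by (rule WK_trans[OF assms(1)]) (use G in blast)
  moreover have "flow (Bst a) (ep (bind_pmf m (\<lambda>x. fst (G x)))) (ep (bind_pmf m (\<lambda>x. snd (G x))))"
    unfolding ep_bind by (rule flow_nsum) (simp only: ep_nz G)
  moreover have "flow_star (ep (bind_pmf m (\<lambda>x. snd (G x)))) (ep (bind_pmf m k))"
    unfolding ep_bind by (rule flow_star_nsum) (simp only: ep_nz G)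
  ultimately show ?thesis unfolding WT_iff by blast
qed

lemma combined_stp_WK: "combined_stp Tau s t \<Longrightarrow> WK s t"
  unfolding combined_stp_def using WK_mix[of _ s "\<lambda>t. t"] WK_step by blast

lemma WT_Tau_WK: assumes "WT Tau s m" shows "WK s m"
proof -
  obtain \<rho> \<eta> where w: "WK s \<rho>" "flow (Bst Tau) (ep \<rho>) (ep \<eta>)" "flow_star (ep \<eta>) (ep m)" using assms unfolding WT_iff by blast
  obtain k where k: "\<forall>s\<in>set_pmf \<rho>. combined_stp Tau s (k s)" "\<eta> = bind_pmf \<rho> k" using flow_pmfD[OF w(2)] by blast
  obtain h where h: "\<forall>s\<in>set_pmf \<eta>. WK s (h s)" "m = bind_pmf \<eta> h" using flow_star_pmfD[OF w(3)] by blast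
  have "WK s \<eta>" unfolding k(2) by (rule WK_trans[OF w(1)]) (use k(1) combined_stp_WK in blast)
  then show ?thesis unfolding h(2) by (rule WK_trans) (use h(1) in blast)
qed

definition WTH :: "'a act \<Rightarrow> ('a, 'v) nexp \<Rightarrow> ('a, 'v) nexp pmf \<Rightarrow> bool" where
  "WTH a s m \<longleftrightarrow> (if a = Tau then WK s m else WT a s m)"

lemma WTH_wtrans_hat: "WTH a s m \<longleftrightarrow> wtrans_hat (dirac s) a (pmf m)"
  by (simp add: WTH_def WK_def WT_def wtrans_hat_def)

lemma WT_WTH: "WT a s m \<Longrightarrow> WTH a s m"
  using WT_Tau_WK by (auto simp: WTH_def)

lemma WK_WTH: "WK s m \<Longrightarrow> (\<And>p. p \<in> set_pmf m \<Longrightarrow> WTH a p (k p)) \<Longrightarrow> WTH a s (bind_pmf m k)"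
  by (auto simp: WTH_def intro: WK_trans WK_WT)

text \<open>Once an internal step has really been made, the continuation may be empty without the
  whole move becoming empty.\<close>

lemma WT_Tau_WTH: "WT Tau s m \<Longrightarrow> (\<And>p. p \<in> set_pmf m \<Longrightarrow> WTH a p (k p)) \<Longrightarrow> WT a s (bind_pmf m k)"
  by (cases "a = Tau") (auto simp: WTH_def intro: WT_WK WK_WT WT_Tau_WK)

text \<open>The weak transitions whose first step is a single uncombined one; all others are mixtures of these.\<close>
definition item :: "'a act \<Rightarrow> ('a, 'v) nexp \<Rightarrow> ('a, 'v) nexp pmf \<Rightarrow> bool" where
  "item a s m \<longleftrightarrow> (\<exists>t k. m = bind_pmf t k \<and>
     (stp s Tau t \<and> (\<forall>p\<in>set_pmf t. WTH a p (k p)) \<or> stp s a t \<and> (\<forall>p\<in>set_pmf t. WK p (k p))))"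

lemma item_WT: "item a s m \<Longrightarrow> WT a s m"
  unfolding item_def using WT_Tau_WTH[OF WT_step] WT_WK[OF WT_step] by metis

text \<open>The internal prefix is unfolded by one step. If it stops at once (\<open>None\<close>),
  the \<open>a\<close>-step is the first step; otherwise (\<open>Some t\<close>) the first step is
  internal and the rest is a weak \<open>a\<close>-move.\<close>

lemma WT_items:
  assumes "WT a s m" shows "\<exists>M. (\<forall>x\<in>set_pmf M. item a s x) \<and> m = bind_pmf M (\<lambda>x. x)"
proof -
  obtain \<rho> \<eta> where w: "WK s \<rho>" "flow (Bst a) (ep \<rho>) (ep \<eta>)" "flow_star (ep \<eta>) (ep m)" using assms unfolding WT_iff by blast
  obtain k1 where k: "\<forall>s\<in>set_pmf \<rho>. combined_stp a s (k1 s)" "\<eta> = bind_pmf \<rho> k1" using flow_pmfD[OF w(2)] by blast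
  obtain k2 where h: "\<forall>s\<in>set_pmf \<eta>. WK s (k2 s)" "m = bind_pmf \<eta> k2" using flow_star_pmfD[OF w(3)] by blast
  obtain T X where TX: "flow_seq T X" "\<forall>p. ep (return_pmf s) p = T 0 p + X 0 p" "\<forall>u. ep \<rho> u = nsum (\<lambda>j. X j u)"
    using w(1) unfolding WK_der flow_star_def by blast
  from flow_seq_unfold[OF TX, of 0] obtain M k0 where M:
    "\<And>t. Some t \<in> set_pmf M \<Longrightarrow> stp s Tau t \<and> (\<forall>p\<in>set_pmf t. WK p (k0 p))"
    "\<rho> = bind_pmf M (\<lambda>x. case x of None \<Rightarrow> return_pmf s | Some t \<Rightarrow> bind_pmf t k0)" using WKd_WK by metis
  define g where "g q = bind_pmf (k1 q) k2" for q
  have meq: "m = bind_pmf M (\<lambda>x. case x of None \<Rightarrow> g s | Some t \<Rightarrow> bind_pmf t (\<lambda>p. bind_pmf (k0 p) g))"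
    unfolding h(2) k(2) M(2) g_def
    by (simp add: bind_assoc_pmf) (auto intro!: bind_pmf_cong simp: bind_return_pmf bind_assoc_pmf split: option.split)
  have "\<forall>x. \<exists>N. x \<in> set_pmf M \<longrightarrow> (\<forall>y\<in>set_pmf N. item a s y) \<and>
     (case x of None \<Rightarrow> g s | Some t \<Rightarrow> bind_pmf t (\<lambda>p. bind_pmf (k0 p) g)) = bind_pmf N (\<lambda>x. x)"
  proof (intro allI)
    fix x show "\<exists>N. x \<in> set_pmf M \<longrightarrow> (\<forall>y\<in>set_pmf N. item a s y) \<and>
     (case x of None \<Rightarrow> g s | Some t \<Rightarrow> bind_pmf t (\<lambda>p. bind_pmf (k0 p) g)) = bind_pmf N (\<lambda>x. x)"
    proof (cases "x \<in> set_pmf M")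
      case xM: True
      show ?thesis
      proof (cases x)
        case None
        then have s: "s \<in> set_pmf \<rho>" using xM unfolding M(2) by (force split: option.split)
        then obtain N where N: "\<forall>t\<in>set_pmf N. stp s a t" "k1 s = bind_pmf N (\<lambda>t. t)" using k(1) unfolding combined_stp_def by blast
        have "item a s (bind_pmf t k2)" if "t \<in> set_pmf N" for t
          unfolding item_def using N that h(1) s unfolding k(2) by (intro exI[of _ t] exI[of _ k2]) auto
        moreover have "g s = bind_pmf (map_pmf (\<lambda>t. bind_pmf t k2) N) (\<lambda>x. x)"
          unfolding g_def N(2) by (simp add: bind_assoc_pmf bind_map_pmf)
        ultimately show ?thesis using None by (intro exI[of _ "map_pmf (\<lambda>t. bind_pmf t k2) N"]) auto
      next
        case (Some t)
        have "WT a p (bind_pmf (k0 p) g)" if "p \<in> set_pmf t" for p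
        proof (rule WK_WT)
          show "WK p (k0 p)" using M(1) xM Some that by blast
          fix q assume "q \<in> set_pmf (k0 p)"
          then have q: "q \<in> set_pmf \<rho>" using xM that Some unfolding M(2) by (force split: option.split)
          then obtain N where N: "\<forall>t\<in>set_pmf N. stp q a t" "k1 q = bind_pmf N (\<lambda>t. t)" using k(1) unfolding combined_stp_def by blast
          have "WT a q (k1 q)" unfolding N(2) by (rule WT_mix) (use N(1) WT_step in blast)
          then show "WT a q (g q)" unfolding g_def by (rule WT_WK) (use h(1) q in \<open>auto simp: k(2)\<close>)
        qed
        then have "item a s (bind_pmf t (\<lambda>p. bind_pmf (k0 p) g))"
          unfolding item_def using M(1) xM Some WT_WTH by blast
        then show ?thesis using Some by (intro exI[of _ "return_pmf (bind_pmf t (\<lambda>p. bind_pmf (k0 p) g))"]) (auto simp: bind_return_pmf)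
      qed
    qed simp
  qed
  from choice[OF this] obtain N where N: "\<And>x. x \<in> set_pmf M \<Longrightarrow> (\<forall>y\<in>set_pmf (N x). item a s y) \<and>
     (case x of None \<Rightarrow> g s | Some t \<Rightarrow> bind_pmf t (\<lambda>p. bind_pmf (k0 p) g)) = bind_pmf (N x) (\<lambda>x. x)" by blast
  have "m = bind_pmf (bind_pmf M N) (\<lambda>x. x)" unfolding meq bind_assoc_pmf
    by (rule bind_pmf_cong[OF refl]) (use N in blast)
  then show ?thesis using N by (intro exI[of _ "bind_pmf M N"]) auto
qed

text \<open>Equal states may carry different labels with different continuations, so
  \<open>k\<close> need not be a function of the state. Splitting the combined derivation by states
  averages these continuations.\<close>

lemma WK_trans_label:
  assumes "WK s (map_pmf f \<zeta>)" "\<And>y. y \<in> set_pmf \<zeta> \<Longrightarrow> WK (f y) (k y)" shows "WK s (bind_pmf \<zeta> k)"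
proof -
  have "flow_star (\<lambda>u. nsum (\<lambda>y. ep \<zeta> y * ep (return_pmf (f y)) u)) (\<lambda>u. nsum (\<lambda>y. ep \<zeta> y * ep (k y) u))"
    by (rule flow_star_nsum) (simp only: ep_nz WK_der[symmetric] assms)
  then have "flow_star (ep (map_pmf f \<zeta>)) (ep (bind_pmf \<zeta> k))" unfolding map_pmf_def ep_bind .
  from flow_star_pmfD[OF this] obtain h where h: "\<forall>s\<in>set_pmf (map_pmf f \<zeta>). WK s (h s)" "bind_pmf \<zeta> k = bind_pmf (map_pmf f \<zeta>) h" by blast
  show ?thesis unfolding h(2) by (rule WK_trans[OF assms(1)]) (use h(1) in blast)
qed

lemma nn_integral_bind_pmf': "(\<integral>\<^sup>+x. f x \<partial>measure_pmf (bind_pmf M N)) = (\<integral>\<^sup>+y. (\<integral>\<^sup>+x. f x \<partial>measure_pmf (N y)) \<partial>measure_pmf M)"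
  by simp

lemma nn_integral_pmf_mono: "(\<And>x. x \<in> set_pmf M \<Longrightarrow> f x \<le> g x) \<Longrightarrow> (\<integral>\<^sup>+x. f x \<partial>measure_pmf M) \<le> (\<integral>\<^sup>+x. g x \<partial>measure_pmf M)"
  by (rule nn_integral_mono_AE) (simp add: AE_measure_pmf_iff)

lemma ennreal_geometric_lim:
  assumes b: "b \<noteq> top" and d: "(d::ennreal) < 1" shows "(\<lambda>n. b * d ^ n) \<longlonglongrightarrow> 0"
proof -
  from d obtain \<delta> where \<delta>: "0 \<le> \<delta>" "d = ennreal \<delta>" by (cases d) auto
  obtain \<beta> where \<beta>: "0 \<le> \<beta>" "b = ennreal \<beta>" using b by (cases b) auto
  have "\<delta> < 1" using d \<delta> by (simp add: ennreal_less_one_iff)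
  then have "(\<lambda>n. \<beta> * \<delta> ^ n) \<longlonglongrightarrow> \<beta> * 0" using \<delta> by (intro tendsto_mult tendsto_const LIMSEQ_power_zero) auto
  then have "(\<lambda>n. ennreal (\<beta> * \<delta> ^ n)) \<longlonglongrightarrow> ennreal 0" by (intro tendsto_ennrealI) simp
  then show ?thesis using \<delta> \<beta> by (simp add: ennreal_mult ennreal_power)
qed

section \<open>Iterated simulation with a potential\<close>

text \<open>A branch of a partially built answer is either finished (state and target) or still open (the
  state to be matched, the matching state, its potential, and the target).\<close>
type_synonym ('a, 'v) olab = "('a, 'v) nexp \<times> ('a, 'v) nexp pmf"
type_synonym ('a, 'v) rlab = "('a, 'v) nexp \<times> ('a, 'v) nexp \<times> ennreal \<times> ('a, 'v) nexp pmf"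

definition state_of :: "('a, 'v) olab + ('a, 'v) rlab \<Rightarrow> ('a, 'v) nexp" where
  "state_of = case_sum fst (\<lambda>l. fst (snd l))"
definition target_of :: "('a, 'v) olab + ('a, 'v) rlab \<Rightarrow> ('a, 'v) nexp pmf" where
  "target_of = case_sum snd (\<lambda>l. snd (snd (snd l)))"
definition potential :: "('a, 'v) olab + ('a, 'v) rlab \<Rightarrow> ennreal" where
  "potential = case_sum (\<lambda>_. 0) (\<lambda>l. fst (snd (snd l)))"
definition pending :: "('a, 'v) olab + ('a, 'v) rlab \<Rightarrow> ennreal" where
  "pending = case_sum (\<lambda>_. 0) (\<lambda>_. 1)"

lemma lab_simps[simp]: "state_of (Inl x) = fst x" "state_of (Inr l) = fst (snd l)" "target_of (Inl x) = snd x" "target_of (Inr l) = snd (snd (snd l))"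
  "potential (Inl x) = 0" "potential (Inr l) = fst (snd (snd l))" "pending (Inl x) = 0" "pending (Inr l) = 1"
  by (simp_all add: state_of_def target_of_def potential_def pending_def)

text \<open>\<open>X\<close> are the moves to be answered, \<open>Z\<close> those that end the
  analysis, \<open>Fin\<close> the finished answers, \<open>T\<close> the tolerance between targets.
  The third argument of \<open>Rel\<close> is the potential. By \<open>H1\<close> and
  \<open>H2\<close>, a pair either answers without raising the expected potential, or it has
  potential 1 and may jump to pairs of expected potential at most \<open>c\<close>.
  \<open>lab\<close> and \<open>Jump\<close> are parameters with a defining equation so that the
  assumptions can mention them.\<close>

locale sim_engine =
  fixes X Z :: "('a, 'v) nexp \<Rightarrow> ('a, 'v) nexp pmf \<Rightarrow> bool"
    and Rel :: "('a, 'v) nexp \<Rightarrow> ('a, 'v) nexp \<Rightarrow> ennreal \<Rightarrow> bool"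
    and Fin :: "('a, 'v) nexp \<Rightarrow> ('a, 'v) nexp pmf \<Rightarrow> bool"
    and T :: "('a, 'v) nexp \<Rightarrow> ('a, 'v) nexp \<Rightarrow> bool" and c :: ennreal
    and lab and Jump
  defines "lab \<equiv> case_sum (\<lambda>x. Fin (fst x) (snd x)) (\<lambda>l. Rel (fst l) (fst (snd l)) (fst (snd (snd l))) \<and> X (fst l) (snd (snd (snd l))))"
    and "Jump \<equiv> \<lambda>Q m. \<exists>W. (\<forall>x\<in>set_pmf W. lab x) \<and> WK Q (map_pmf state_of W) \<and> (\<integral>\<^sup>+x. potential x \<partial>measure_pmf W) \<le> c
       \<and> rel_pmf T m (bind_pmf W target_of)"
  assumes T: "equivp T" and c1: "c < 1"
    and unroll_ex: "\<And>P m \<epsilon>. X P m \<Longrightarrow> 0 < \<epsilon> \<Longrightarrow> \<exists>e<\<epsilon>. unroll Z X P m e"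
    and unroll_X: "\<And>P m e. unroll Z X P m e \<Longrightarrow> X P m"
    and Rel1: "\<And>P Q r. Rel P Q r \<Longrightarrow> r \<le> 1"
    and H1: "\<And>P Q r t. Rel P Q r \<Longrightarrow> stp P Tau t \<Longrightarrow>
       (\<exists>\<zeta>. (\<forall>y\<in>set_pmf \<zeta>. Rel (fst y) (fst (snd y)) (snd (snd y))) \<and> map_pmf fst \<zeta> = t \<and>
         WK Q (map_pmf (\<lambda>y. fst (snd y)) \<zeta>) \<and> (\<integral>\<^sup>+y. snd (snd y) \<partial>measure_pmf \<zeta>) \<le> r)
       \<or> (1 \<le> r \<and> (\<forall>M. (\<forall>p\<in>set_pmf t. X p (M p)) \<longrightarrow> Jump Q (bind_pmf t M)))"
    and H2: "\<And>P Q r m. Rel P Q r \<Longrightarrow> Z P m \<Longrightarrow> Fin Q m \<or> (1 \<le> r \<and> Jump Q m)"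
begin

lemma T_refl: "rel_pmf T m m"
  by (rule rel_pmf_reflI) (use T in \<open>auto simp: equivp_reflp\<close>)

lemma T_trans: "rel_pmf T m n \<Longrightarrow> rel_pmf T n k \<Longrightarrow> rel_pmf T m k"
  using transp_rel_pmf[of T] T by (auto simp: equivp_reflp_symp_transp dest: transpD)

lemma T_bind: "(\<And>x. x \<in> set_pmf M \<Longrightarrow> rel_pmf T (f x) (g x)) \<Longrightarrow> rel_pmf T (bind_pmf M f) (bind_pmf M g)"
  by (rule rel_pmf_bindI[of "\<lambda>x y. x = y \<and> x \<in> set_pmf M"]) (auto intro: rel_pmf_reflI)

text \<open>Jumps occur only at potential 1, and the expected potential never rises before a jump,
  so \<open>r\<close> bounds the probability of jumping. After one round the open branches are those
  that jumped, of mass at most \<open>r\<close> and contributing at most \<open>c * r\<close> to the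
  potential, and the unanalysed ones, contributing at most their mass \<open>e\<close>.\<close>

lemma stage:
  assumes "unroll Z X P m e" "Rel P Q r"
  shows "\<exists>W. (\<forall>x\<in>set_pmf W. lab x) \<and> WK Q (map_pmf state_of W) \<and> (\<integral>\<^sup>+x. potential x \<partial>measure_pmf W) \<le> c * r + e \<and>
    (\<integral>\<^sup>+x. pending x \<partial>measure_pmf W) \<le> r + e \<and> rel_pmf T m (bind_pmf W target_of)"
  using assms
proof (induction arbitrary: Q r rule: unroll.induct)
  case J: (unroll_stop P m)
  from H2[OF J(2,1)] show ?case
  proof
    assume "Fin Q m"
    then show ?case by (intro exI[of _ "return_pmf (Inl (Q, m))"]) (auto simp: lab_def WK_return bind_return_pmf T_refl)
  next
    assume a: "1 \<le> r \<and> Jump Q m"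
    then obtain W where W: "\<forall>x\<in>set_pmf W. lab x" "WK Q (map_pmf state_of W)" "(\<integral>\<^sup>+x. potential x \<partial>measure_pmf W) \<le> c" "rel_pmf T m (bind_pmf W target_of)"
      unfolding Jump_def by blast
    have r: "r = 1" using a Rel1[OF J(2)] by simp
    have "(\<integral>\<^sup>+x. pending x \<partial>measure_pmf W) \<le> (\<integral>\<^sup>+x. 1 \<partial>measure_pmf W)" by (rule nn_integral_mono) (auto simp: pending_def split: sum.split)
    then show ?case using W r by (intro exI[of _ W]) simp
  qed
next
  case (unroll_left P m)
  \<comment> \<open>An unanalysed branch stays open as it is; its potential \<open>r\<close> is paid
    for by its error mass 1.\<close>
  have "r \<le> c * r + 1" using Rel1[OF unroll_left(2)] by (metis add.commute add_increasing2 zero_le)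
  then show ?case using unroll_left
    by (intro exI[of _ "return_pmf (Inr (P, Q, r, m))"]) (auto simp: lab_def WK_return bind_return_pmf T_refl)
next
  case J: (unroll_step P t M e)
  from H1[OF J(4,1)] show ?case
  proof
    assume "1 \<le> r \<and> (\<forall>M. (\<forall>p\<in>set_pmf t. X p (M p)) \<longrightarrow> Jump Q (bind_pmf t M))"
    moreover have "\<forall>p\<in>set_pmf t. X p (M p)" using unroll_X[OF J(2)] by blast
    ultimately have a: "1 \<le> r" "Jump Q (bind_pmf t M)" by blast+
    then obtain W where W: "\<forall>x\<in>set_pmf W. lab x" "WK Q (map_pmf state_of W)" "(\<integral>\<^sup>+x. potential x \<partial>measure_pmf W) \<le> c" "rel_pmf T (bind_pmf t M) (bind_pmf W target_of)"
      unfolding Jump_def by blast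
    have r: "r = 1" using a Rel1[OF J(4)] by simp
    have "(\<integral>\<^sup>+x. pending x \<partial>measure_pmf W) \<le> (\<integral>\<^sup>+x. 1 \<partial>measure_pmf W)" by (rule nn_integral_mono) (auto simp: pending_def split: sum.split)
    also have "\<dots> \<le> 1 + (\<integral>\<^sup>+p. e p \<partial>measure_pmf t)" by simp
    finally have "(\<integral>\<^sup>+x. pending x \<partial>measure_pmf W) \<le> r + (\<integral>\<^sup>+p. e p \<partial>measure_pmf t)" unfolding r .
    moreover have "(\<integral>\<^sup>+x. potential x \<partial>measure_pmf W) \<le> c * r + (\<integral>\<^sup>+p. e p \<partial>measure_pmf t)"
      using W(3) unfolding r by (simp add: add_increasing2)
    ultimately show ?case using W by blast
  next
    assume "\<exists>\<zeta>. (\<forall>y\<in>set_pmf \<zeta>. Rel (fst y) (fst (snd y)) (snd (snd y))) \<and> map_pmf fst \<zeta> = t \<and>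
         WK Q (map_pmf (\<lambda>y. fst (snd y)) \<zeta>) \<and> (\<integral>\<^sup>+y. snd (snd y) \<partial>measure_pmf \<zeta>) \<le> r"
    then obtain \<zeta> where \<zeta>: "\<And>y. y \<in> set_pmf \<zeta> \<Longrightarrow> Rel (fst y) (fst (snd y)) (snd (snd y))" "t = map_pmf fst \<zeta>"
         "WK Q (map_pmf (\<lambda>y. fst (snd y)) \<zeta>)" "(\<integral>\<^sup>+y. snd (snd y) \<partial>measure_pmf \<zeta>) \<le> r" by blast
    have "\<forall>y. \<exists>W. y \<in> set_pmf \<zeta> \<longrightarrow> (\<forall>x\<in>set_pmf W. lab x) \<and> WK (fst (snd y)) (map_pmf state_of W) \<and>
      (\<integral>\<^sup>+x. potential x \<partial>measure_pmf W) \<le> c * snd (snd y) + e (fst y) \<and>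
      (\<integral>\<^sup>+x. pending x \<partial>measure_pmf W) \<le> snd (snd y) + e (fst y) \<and> rel_pmf T (M (fst y)) (bind_pmf W target_of)"
    proof
      fix y show "\<exists>W. y \<in> set_pmf \<zeta> \<longrightarrow> (\<forall>x\<in>set_pmf W. lab x) \<and> WK (fst (snd y)) (map_pmf state_of W) \<and>
      (\<integral>\<^sup>+x. potential x \<partial>measure_pmf W) \<le> c * snd (snd y) + e (fst y) \<and>
      (\<integral>\<^sup>+x. pending x \<partial>measure_pmf W) \<le> snd (snd y) + e (fst y) \<and> rel_pmf T (M (fst y)) (bind_pmf W target_of)"
      proof (cases "y \<in> set_pmf \<zeta>")
        case True
        then have "fst y \<in> set_pmf t" using \<zeta>(2) by simp
        from J(3)[OF this \<zeta>(1)[OF True]] show ?thesis by blast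
      qed simp
    qed
    from choice[OF this] obtain W where W: "\<And>y x. y \<in> set_pmf \<zeta> \<Longrightarrow> x \<in> set_pmf (W y) \<Longrightarrow> lab x"
      "\<And>y. y \<in> set_pmf \<zeta> \<Longrightarrow> WK (fst (snd y)) (map_pmf state_of (W y))"
      "\<And>y. y \<in> set_pmf \<zeta> \<Longrightarrow> (\<integral>\<^sup>+x. potential x \<partial>measure_pmf (W y)) \<le> c * snd (snd y) + e (fst y)"
      "\<And>y. y \<in> set_pmf \<zeta> \<Longrightarrow> (\<integral>\<^sup>+x. pending x \<partial>measure_pmf (W y)) \<le> snd (snd y) + e (fst y)"
      "\<And>y. y \<in> set_pmf \<zeta> \<Longrightarrow> rel_pmf T (M (fst y)) (bind_pmf (W y) target_of)" by blast
    have et: "(\<integral>\<^sup>+p. e p \<partial>measure_pmf t) = (\<integral>\<^sup>+y. e (fst y) \<partial>measure_pmf \<zeta>)" unfolding \<zeta>(2) by simp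
    have "\<forall>x\<in>set_pmf (bind_pmf \<zeta> W). lab x" using W(1) by auto
    moreover have "WK Q (map_pmf state_of (bind_pmf \<zeta> W))" unfolding map_bind_pmf
      by (rule WK_trans_label[OF \<zeta>(3)]) (rule W(2))
    moreover have "(\<integral>\<^sup>+x. potential x \<partial>measure_pmf (bind_pmf \<zeta> W)) \<le> c * r + (\<integral>\<^sup>+p. e p \<partial>measure_pmf t)"
    proof -
      have "(\<integral>\<^sup>+x. potential x \<partial>measure_pmf (bind_pmf \<zeta> W)) \<le> (\<integral>\<^sup>+y. c * snd (snd y) + e (fst y) \<partial>measure_pmf \<zeta>)"
        unfolding nn_integral_bind_pmf' by (rule nn_integral_pmf_mono) (rule W(3))
      also have "\<dots> = c * (\<integral>\<^sup>+y. snd (snd y) \<partial>measure_pmf \<zeta>) + (\<integral>\<^sup>+p. e p \<partial>measure_pmf t)"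
        unfolding et by (simp add: nn_integral_add nn_integral_cmult)
      also have "\<dots> \<le> c * r + (\<integral>\<^sup>+p. e p \<partial>measure_pmf t)" by (intro add_right_mono mult_left_mono \<zeta>(4)) simp
      finally show ?thesis .
    qed
    moreover have "(\<integral>\<^sup>+x. pending x \<partial>measure_pmf (bind_pmf \<zeta> W)) \<le> r + (\<integral>\<^sup>+p. e p \<partial>measure_pmf t)"
    proof -
      have "(\<integral>\<^sup>+x. pending x \<partial>measure_pmf (bind_pmf \<zeta> W)) \<le> (\<integral>\<^sup>+y. snd (snd y) + e (fst y) \<partial>measure_pmf \<zeta>)"
        unfolding nn_integral_bind_pmf' by (rule nn_integral_pmf_mono) (rule W(4))
      also have "\<dots> = (\<integral>\<^sup>+y. snd (snd y) \<partial>measure_pmf \<zeta>) + (\<integral>\<^sup>+p. e p \<partial>measure_pmf t)"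
        unfolding et by (simp add: nn_integral_add)
      also have "\<dots> \<le> r + (\<integral>\<^sup>+p. e p \<partial>measure_pmf t)" by (intro add_right_mono \<zeta>(4))
      finally show ?thesis .
    qed
    moreover have "rel_pmf T (bind_pmf t M) (bind_pmf (bind_pmf \<zeta> W) target_of)"
      unfolding \<zeta>(2) bind_map_pmf bind_assoc_pmf by (rule T_bind) (rule W(5))
    ultimately show ?case by blast
  qed
next
  case J: (unroll_mix N P)
  have "\<forall>y. \<exists>W. y \<in> set_pmf N \<longrightarrow> (\<forall>x\<in>set_pmf W. lab x) \<and> WK Q (map_pmf state_of W) \<and>
    (\<integral>\<^sup>+x. potential x \<partial>measure_pmf W) \<le> c * r + snd y \<and> (\<integral>\<^sup>+x. pending x \<partial>measure_pmf W) \<le> r + snd y \<and> rel_pmf T (fst y) (bind_pmf W target_of)"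
    using J(2)[OF _ J(3)] by blast
  from choice[OF this] obtain W where W: "\<And>y x. y \<in> set_pmf N \<Longrightarrow> x \<in> set_pmf (W y) \<Longrightarrow> lab x"
      "\<And>y. y \<in> set_pmf N \<Longrightarrow> WK Q (map_pmf state_of (W y))"
      "\<And>y. y \<in> set_pmf N \<Longrightarrow> (\<integral>\<^sup>+x. potential x \<partial>measure_pmf (W y)) \<le> c * r + snd y"
      "\<And>y. y \<in> set_pmf N \<Longrightarrow> (\<integral>\<^sup>+x. pending x \<partial>measure_pmf (W y)) \<le> r + snd y"
      "\<And>y. y \<in> set_pmf N \<Longrightarrow> rel_pmf T (fst y) (bind_pmf (W y) target_of)" by blast
  have "\<forall>x\<in>set_pmf (bind_pmf N W). lab x" using W(1) by auto
  moreover have "WK Q (map_pmf state_of (bind_pmf N W))" unfolding map_bind_pmf by (rule WK_mix) (rule W(2))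
  moreover have "(\<integral>\<^sup>+x. potential x \<partial>measure_pmf (bind_pmf N W)) \<le> c * r + (\<integral>\<^sup>+y. snd y \<partial>measure_pmf N)"
  proof -
    have "(\<integral>\<^sup>+x. potential x \<partial>measure_pmf (bind_pmf N W)) \<le> (\<integral>\<^sup>+y. c * r + snd y \<partial>measure_pmf N)"
      unfolding nn_integral_bind_pmf' by (rule nn_integral_pmf_mono) (rule W(3))
    then show ?thesis by (simp add: nn_integral_add)
  qed
  moreover have "(\<integral>\<^sup>+x. pending x \<partial>measure_pmf (bind_pmf N W)) \<le> r + (\<integral>\<^sup>+y. snd y \<partial>measure_pmf N)"
  proof -
    have "(\<integral>\<^sup>+x. pending x \<partial>measure_pmf (bind_pmf N W)) \<le> (\<integral>\<^sup>+y. r + snd y \<partial>measure_pmf N)"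
      unfolding nn_integral_bind_pmf' by (rule nn_integral_pmf_mono) (rule W(4))
    then show ?thesis by (simp add: nn_integral_add)
  qed
  moreover have "rel_pmf T (bind_pmf N fst) (bind_pmf (bind_pmf N W) target_of)"
    unfolding bind_assoc_pmf by (rule T_bind) (rule W(5))
  ultimately show ?case by blast
qed

text \<open>Rounds of \<open>stage\<close> are iterated, each starting from the branches left open
  by the previous one; potential and open mass decay geometrically, which yields a single weak move
  in the limit.\<close>

lemma run:
  assumes "Rel P Q r" "X P m"
  shows "\<exists>U. (\<forall>x\<in>set_pmf U. Fin (fst x) (snd x)) \<and> WK Q (map_pmf fst U) \<and> rel_pmf T m (bind_pmf U snd)"
proof -
  obtain d where d: "c < d" "d < 1" using dense[OF c1] by blast
  \<comment> \<open>This tolerance is the one for which the bound \<open>d ^ n\<close> on the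
    potential reproduces itself: \<open>c * d ^ n + \<epsilon> n = d ^ Suc n\<close>.\<close>
  define \<epsilon> where "\<epsilon> n = (d - c) * d ^ n" for n
  have dc: "0 < d - c" using d by (simp add: diff_gr0_ennreal less_top[symmetric] top_unique)
  have d0: "0 < d ^ n" for n using le_less_trans[OF zero_le d(1)] by (induction n) (auto simp: ennreal_zero_less_mult_iff)
  have \<epsilon>0: "0 < \<epsilon> n" for n using dc d0 by (simp add: \<epsilon>_def ennreal_zero_less_mult_iff)
  define stg where "stg n l W \<longleftrightarrow> (\<forall>x\<in>set_pmf W. lab x) \<and> WK (fst (snd l)) (map_pmf state_of W) \<and>
     (\<integral>\<^sup>+x. potential x \<partial>measure_pmf W) \<le> c * fst (snd (snd l)) + \<epsilon> n \<and>
     (\<integral>\<^sup>+x. pending x \<partial>measure_pmf W) \<le> fst (snd (snd l)) + \<epsilon> n \<and> rel_pmf T (snd (snd (snd l))) (bind_pmf W target_of)" for n and l :: "('a, 'v) rlab" and W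
  have ex: "\<exists>W. stg n l W" if "lab (Inr l)" for n l
  proof -
    from that have l: "Rel (fst l) (fst (snd l)) (fst (snd (snd l)))" "X (fst l) (snd (snd (snd l)))" by (auto simp: lab_def)
    from unroll_ex[OF l(2) \<epsilon>0] obtain e where e: "e < \<epsilon> n" "unroll Z X (fst l) (snd (snd (snd l))) e" by blast
    from stage[OF e(2) l(1)] obtain W where W: "\<forall>x\<in>set_pmf W. lab x" "WK (fst (snd l)) (map_pmf state_of W)"
      "(\<integral>\<^sup>+x. potential x \<partial>measure_pmf W) \<le> c * fst (snd (snd l)) + e" "(\<integral>\<^sup>+x. pending x \<partial>measure_pmf W) \<le> fst (snd (snd l)) + e"
      "rel_pmf T (snd (snd (snd l))) (bind_pmf W target_of)" by blast
    have le: "b + e \<le> b + \<epsilon> n" for b using e(1) by (intro add_left_mono) simp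
    show ?thesis unfolding stg_def using W order_trans[OF W(3) le] order_trans[OF W(4) le] by blast
  qed
  define K where "K n l = (SOME W. stg n l W)" for n l
  have K: "stg n l (K n l)" if "lab (Inr l)" for n l unfolding K_def using someI_ex[OF ex[OF that]] .
  define l0 where "l0 = (P, Q, r, m)"
  define D where "D n = rec_nat (return_pmf (Inr l0)) (\<lambda>n D. bind_pmf D (case_sum (\<lambda>x. return_pmf (Inl x)) (K n))) n" for n
  have D0: "D 0 = return_pmf (Inr l0)" by (simp add: D_def)
  have DS: "D (Suc n) = bind_pmf (D n) (case_sum (\<lambda>x. return_pmf (Inl x)) (K n))" for n by (simp add: D_def)
  have labD: "lab x" if "x \<in> set_pmf (D n)" for x n
    using that
  proof (induction n arbitrary: x)
    case 0 then show ?case using assms by (simp add: D0 l0_def lab_def)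
  next
    case (Suc n)
    then obtain y where y: "y \<in> set_pmf (D n)" "x \<in> set_pmf (case_sum (\<lambda>x. return_pmf (Inl x)) (K n) y)" unfolding DS by auto
    show ?case
    proof (cases y)
      case (Inl a) then show ?thesis using y Suc.IH by auto
    next
      case (Inr l) then show ?thesis using y K[of l n] Suc.IH[OF y(1)] unfolding stg_def by auto
    qed
  qed
  have potS: "(\<integral>\<^sup>+x. potential x \<partial>measure_pmf (D (Suc n))) \<le> c * (\<integral>\<^sup>+x. potential x \<partial>measure_pmf (D n)) + \<epsilon> n"
    and lftS: "(\<integral>\<^sup>+x. pending x \<partial>measure_pmf (D (Suc n))) \<le> (\<integral>\<^sup>+x. potential x \<partial>measure_pmf (D n)) + \<epsilon> n" for n
  proof -
    have "(\<integral>\<^sup>+x. potential x \<partial>measure_pmf (D (Suc n))) \<le> (\<integral>\<^sup>+y. c * potential y + \<epsilon> n \<partial>measure_pmf (D n))"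
      unfolding DS nn_integral_bind_pmf'
    proof (rule nn_integral_pmf_mono)
      fix y assume "y \<in> set_pmf (D n)"
      then show "(\<integral>\<^sup>+x. potential x \<partial>measure_pmf (case_sum (\<lambda>x. return_pmf (Inl x)) (K n) y)) \<le> c * potential y + \<epsilon> n"
        using labD[of y n] K[of _ n] by (cases y) (auto simp: stg_def)
    qed
    then show "(\<integral>\<^sup>+x. potential x \<partial>measure_pmf (D (Suc n))) \<le> c * (\<integral>\<^sup>+x. potential x \<partial>measure_pmf (D n)) + \<epsilon> n"
      by (simp add: nn_integral_add nn_integral_cmult)
    have "(\<integral>\<^sup>+x. pending x \<partial>measure_pmf (D (Suc n))) \<le> (\<integral>\<^sup>+y. potential y + \<epsilon> n \<partial>measure_pmf (D n))"
      unfolding DS nn_integral_bind_pmf'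
    proof (rule nn_integral_pmf_mono)
      fix y assume "y \<in> set_pmf (D n)"
      then show "(\<integral>\<^sup>+x. pending x \<partial>measure_pmf (case_sum (\<lambda>x. return_pmf (Inl x)) (K n) y)) \<le> potential y + \<epsilon> n"
        using labD[of y n] K[of _ n] by (cases y) (auto simp: stg_def)
    qed
    then show "(\<integral>\<^sup>+x. pending x \<partial>measure_pmf (D (Suc n))) \<le> (\<integral>\<^sup>+x. potential x \<partial>measure_pmf (D n)) + \<epsilon> n"
      by (simp add: nn_integral_add)
  qed
  have cd: "c + (d - c) = d" using d by (simp add: add_diff_inverse_ennreal)
  have potn: "(\<integral>\<^sup>+x. potential x \<partial>measure_pmf (D n)) \<le> d ^ n" for n
  proof (induction n)
    case 0 then show ?case using Rel1[OF assms(1)] by (simp add: D0 l0_def)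
  next
    case (Suc n)
    have "(\<integral>\<^sup>+x. potential x \<partial>measure_pmf (D (Suc n))) \<le> c * d ^ n + (d - c) * d ^ n"
      using order_trans[OF potS add_right_mono[OF mult_left_mono[OF Suc]]] unfolding \<epsilon>_def by simp
    then show ?case unfolding distrib_right[symmetric] cd by simp
  qed
  have lftn: "nsum (\<lambda>l. ep (D n) (Inr l)) = (\<integral>\<^sup>+x. pending x \<partial>measure_pmf (D n))" for n
    unfolding nsum_ep_mult[symmetric] nsum_sum by simp
  have "(\<lambda>n. nsum (\<lambda>l. ep (D (Suc n)) (Inr l))) \<longlonglongrightarrow> 0"
  proof (rule tendsto_sandwich[OF _ _ tendsto_const])
    show "(\<lambda>n. 2 * d ^ n) \<longlonglongrightarrow> 0" by (rule ennreal_geometric_lim) (use d in auto)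
    have "nsum (\<lambda>l. ep (D (Suc n)) (Inr l)) \<le> 2 * d ^ n" for n
    proof -
      have "nsum (\<lambda>l. ep (D (Suc n)) (Inr l)) \<le> d ^ n + \<epsilon> n"
        unfolding lftn using order_trans[OF lftS add_right_mono[OF potn]] .
      also have "\<epsilon> n \<le> 1 * d ^ n" unfolding \<epsilon>_def using d by (intro mult_right_mono) (auto intro: order_trans[OF diff_le_self_ennreal])
      finally show ?thesis by (simp add: mult_2)
    qed
    then show "\<forall>\<^sub>F n in sequentially. nsum (\<lambda>l. ep (D (Suc n)) (Inr l)) \<le> 2 * d ^ n" by simp
  qed simp
  then have lim: "(\<lambda>n. nsum (\<lambda>l. ep (D n) (Inr l))) \<longlonglongrightarrow> 0" by (rule LIMSEQ_imp_Suc)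
  have "\<exists>U. WK (fst (snd l0)) (map_pmf fst U) \<and> (\<forall>n x. ep (D n) (Inl x) \<le> ep U x) \<and> (\<forall>x\<in>set_pmf U. \<exists>n. Inl x \<in> set_pmf (D n))"
  proof (rule WK_iterate[where K = K and st = "\<lambda>l. fst (snd l)", OF D0 DS _ lim])
    fix n l assume "Inr l \<in> set_pmf (D n)"
    from K[OF labD[OF this], of n] show "WK (fst (snd l)) (map_pmf (case_sum fst (\<lambda>l. fst (snd l))) (K n l))"
      unfolding stg_def state_of_def by blast
  qed
  then obtain U where U: "WK Q (map_pmf fst U)" "\<And>n x. ep (D n) (Inl x) \<le> ep U x" "\<And>x. x \<in> set_pmf U \<Longrightarrow> \<exists>n. Inl x \<in> set_pmf (D n)"
    unfolding l0_def by auto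
  have rel: "rel_pmf T m (bind_pmf (D n) target_of)" for n
  proof (induction n)
    case 0 show ?case by (simp add: D0 l0_def bind_return_pmf T_refl)
  next
    case (Suc n)
    have "rel_pmf T (bind_pmf (D n) target_of) (bind_pmf (D (Suc n)) target_of)" unfolding DS bind_assoc_pmf
    proof (rule T_bind)
      fix y assume "y \<in> set_pmf (D n)"
      then show "rel_pmf T (target_of y) (bind_pmf (case_sum (\<lambda>x. return_pmf (Inl x)) (K n) y) target_of)"
        using labD[of y n] K[of _ n] by (cases y) (auto simp: stg_def bind_return_pmf T_refl)
    qed
    with Suc show ?case by (rule T_trans)
  qed
  \<comment> \<open>Passage to the limit. On a set \<open>C\<close> to which every round gives the
    mass that \<open>m\<close> gives it, the finished part of round \<open>n\<close> lies below
    \<open>U\<close>, and the error is at most the open mass. Applied to an equivalence class and to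
    its complement, this yields equality.\<close>
  have wcong_half: "emeasure m C \<le> emeasure (bind_pmf U snd) C" if eq: "\<And>n. emeasure m C = emeasure (bind_pmf (D n) target_of) C" for C
  proof (rule ennreal_le_epsilon)
    fix \<delta> :: real assume "0 < \<delta>"
    then have "0 < ennreal \<delta>" by simp
    from order_tendstoD(2)[OF lim this] obtain n where n: "nsum (\<lambda>l. ep (D n) (Inr l)) < ennreal \<delta>" by (auto simp: eventually_sequentially)
    have "emeasure m C = nsum (\<lambda>x. ep (D n) x * emeasure (target_of x) C)" unfolding eq[of n] nsum_ep_mult
      by (simp add: emeasure_bind_pmf)
    also have "\<dots> = nsum (\<lambda>x. ep (D n) (Inl x) * emeasure (snd x) C) + nsum (\<lambda>l. ep (D n) (Inr l) * emeasure (target_of (Inr l)) C)"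
      unfolding nsum_sum by simp
    also have "\<dots> \<le> nsum (\<lambda>x. ep U x * emeasure (snd x) C) + nsum (\<lambda>l. ep (D n) (Inr l) * 1)"
      by (intro add_mono nsum_mono mult_right_mono mult_left_mono U(2)) (auto simp: measure_pmf.emeasure_le_1)
    also have "\<dots> \<le> emeasure (bind_pmf U snd) C + ennreal \<delta>"
      using n by (intro add_mono) (auto simp: nsum_ep_mult emeasure_bind_pmf)
    finally show "emeasure m C \<le> emeasure (bind_pmf U snd) C + ennreal \<delta>" .
  qed
  have "rel_pmf T m (bind_pmf U snd)" unfolding rel_pmf_iff_equivp[OF T]
  proof
    fix C assume C: "C \<in> UNIV // {(x, y). T x y}"
    have eq: "measure m C = measure (bind_pmf (D n) target_of) C" for n using rel[of n] C unfolding rel_pmf_iff_equivp[OF T] by blast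
    have le: "measure m B \<le> measure (bind_pmf U snd) B" if "\<And>n. measure m B = measure (bind_pmf (D n) target_of) B" for B
      using wcong_half[of B] that by (simp add: measure_pmf.emeasure_eq_measure)
    have "measure m (- C) = 1 - measure m C" for m :: "('a, 'v) nexp pmf"
      using measure_pmf.prob_compl[of C m] by (simp add: Compl_eq_Diff_UNIV)
    then have "measure m C \<le> measure (bind_pmf U snd) C" "1 - measure m C \<le> 1 - measure (bind_pmf U snd) C"
      using le[of C] le[of "- C"] eq by metis+
    then show "measure m C = measure (bind_pmf U snd) C" by simp
  qed
  moreover have "Fin (fst x) (snd x)" if "x \<in> set_pmf U" for x
    using U(3)[OF that] labD by (force simp: lab_def)
  ultimately show ?thesis using U(1) by blast
qed

end

section \<open>Free variables and simultaneous substitution\<close>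

lemma finite_fv: "finite (fv_n E)" "finite (fv_p P)"
  for E :: "('a, 'v) nexp" and P :: "('a, 'v) pexp"
  by (induction E and P) auto

lemma subst_cong:
  fixes E :: "('a, 'v) nexp" and P :: "('a, 'v) pexp"
  shows "(\<And>Z. Z \<in> fv_n E \<Longrightarrow> \<sigma> Z = \<sigma>' Z) \<Longrightarrow> subst_n \<sigma> E = subst_n \<sigma>' E"
    and "(\<And>Z. Z \<in> fv_p P \<Longrightarrow> \<sigma> Z = \<sigma>' Z) \<Longrightarrow> subst_p \<sigma> P = subst_p \<sigma>' P"
proof (induction E and P arbitrary: \<sigma> \<sigma>' and \<sigma> \<sigma>')
  case (NRec X E)
  have "(\<Union>Z\<in>fv_n E - {X}. fv_n (\<sigma> Z)) = (\<Union>Z\<in>fv_n E - {X}. fv_n (\<sigma>' Z))" using NRec.prems by auto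
  moreover have "subst_n (\<sigma>(X := NVar Y)) E = subst_n (\<sigma>'(X := NVar Y)) E" for Y by (rule NRec.IH) (use NRec.prems in auto)
  ultimately show ?case by (simp add: Let_def)
next
  case (NPre a P)
  have "subst_p \<sigma> P = subst_p \<sigma>' P" by (rule NPre.IH) (use NPre.prems in auto)
  then show ?case by simp
next
  case (NSum E F)
  have "subst_n \<sigma> E = subst_n \<sigma>' E" by (rule NSum.IH(1)) (use NSum.prems in auto)
  moreover have "subst_n \<sigma> F = subst_n \<sigma>' F" by (rule NSum.IH(2)) (use NSum.prems in auto)
  ultimately show ?case by simp
next
  case (PChoice P p Q)
  have "subst_p \<sigma> P = subst_p \<sigma>' P" by (rule PChoice.IH(1)) (use PChoice.prems in auto)
  moreover have "subst_p \<sigma> Q = subst_p \<sigma>' Q" by (rule PChoice.IH(2)) (use PChoice.prems in auto)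
  ultimately show ?case by simp
next
  case (PDirac E)
  have "subst_n \<sigma> E = subst_n \<sigma>' E" by (rule PDirac.IH) (use PDirac.prems in auto)
  then show ?case by simp
qed auto

lemma subst_NVar:
  fixes E :: "('a, 'v) nexp" and P :: "('a, 'v) pexp"
  shows "subst_n NVar E = E" "subst_p NVar P = P"
proof (induction E and P)
  case (NRec X E)
  have "fresh_var X (\<Union>Z\<in>fv_n E - {X}. fv_n (NVar Z :: ('a, 'v) nexp)) = X" by (auto simp: fresh_var_def)
  moreover have "NVar(X := NVar X) = (NVar :: 'v \<Rightarrow> ('a, 'v) nexp)" by auto
  ultimately show ?case using NRec.IH by (simp add: Let_def)
qed auto

lemma subst_closed: "closed_n E \<Longrightarrow> subst_n \<sigma> E = E"
  using subst_cong(1)[of E \<sigma> NVar] by (simp add: closed_n_def subst_NVar)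

section \<open>Instances of expressions and contexts\<close>

text \<open>Such substitutions introduce no variable other than the one replaced, so binders are
  never renamed and the substitution laws hold as equations. The class is stable under passing below
  a binder, which \<open>closing\<close> is not.\<close>

definition semiclosing :: "('v \<Rightarrow> ('a, 'v) nexp) \<Rightarrow> bool" where
  "semiclosing \<sigma> \<longleftrightarrow> (\<forall>Z. closed_n (\<sigma> Z) \<or> \<sigma> Z = NVar Z)"

definition closing :: "('v \<Rightarrow> ('a, 'v) nexp) \<Rightarrow> bool" where
  "closing \<sigma> \<longleftrightarrow> (\<forall>Z. closed_n (\<sigma> Z))"

lemma closing_semiclosing: "closing \<sigma> \<Longrightarrow> semiclosing \<sigma>" by (auto simp: closing_def semiclosing_def)
lemma closing_upd: "closing \<sigma> \<Longrightarrow> closed_n P \<Longrightarrow> closing (\<sigma>(X := P))" by (auto simp: closing_def)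
lemma semiclosing_upd: "semiclosing \<sigma> \<Longrightarrow> semiclosing (\<sigma>(X := NVar X))" by (auto simp: semiclosing_def)
lemma semiclosing_upd': "semiclosing \<sigma> \<Longrightarrow> closed_n P \<Longrightarrow> semiclosing (\<sigma>(X := P))" by (auto simp: semiclosing_def)
lemma semiclosing_NVar: "semiclosing NVar" by (auto simp: semiclosing_def)

lemma semiclosing_fv: "semiclosing \<sigma> \<Longrightarrow> fv_n (\<sigma> Z) \<subseteq> {Z}"
  by (metis closed_n_def empty_subsetI fv_n.simps(2) order_refl semiclosing_def)

lemma subst_rec_sc: assumes "semiclosing \<sigma>" shows "subst_n \<sigma> (NRec X E) = NRec X (subst_n (\<sigma>(X := NVar X)) E)"
proof -
  have "X \<notin> (\<Union>Z\<in>fv_n E - {X}. fv_n (\<sigma> Z))" using semiclosing_fv[OF assms] by auto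
  then show ?thesis by (simp add: fresh_var_def)
qed

lemma fv_subst_sc:
  fixes E :: "('a, 'v) nexp" and P :: "('a, 'v) pexp"
  shows "semiclosing \<sigma> \<Longrightarrow> fv_n (subst_n \<sigma> E) = (\<Union>Z\<in>fv_n E. fv_n (\<sigma> Z))"
    and "semiclosing \<sigma> \<Longrightarrow> fv_p (subst_p \<sigma> P) = (\<Union>Z\<in>fv_p P. fv_n (\<sigma> Z))"
proof (induction E and P arbitrary: \<sigma> and \<sigma>)
  case (NRec X E)
  have "(\<Union>Z\<in>fv_n E. fv_n ((\<sigma>(X := NVar X)) Z)) - {X} = (\<Union>Z\<in>fv_n E - {X}. fv_n (\<sigma> Z))"
    using semiclosing_fv[OF NRec.prems] by (force split: if_splits)
  then show ?case unfolding subst_rec_sc[OF NRec.prems] fv_n.simps NRec.IH[OF semiclosing_upd[OF NRec.prems]] .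
qed auto

lemma subst_subst_sc:
  fixes E :: "('a, 'v) nexp" and P :: "('a, 'v) pexp"
  shows "semiclosing \<sigma> \<Longrightarrow> semiclosing \<theta> \<Longrightarrow> subst_n \<theta> (subst_n \<sigma> E) = subst_n (\<lambda>Z. subst_n \<theta> (\<sigma> Z)) E"
    and "semiclosing \<sigma> \<Longrightarrow> semiclosing \<theta> \<Longrightarrow> subst_p \<theta> (subst_p \<sigma> P) = subst_p (\<lambda>Z. subst_n \<theta> (\<sigma> Z)) P"
proof (induction E and P arbitrary: \<sigma> \<theta> and \<sigma> \<theta>)
  case (NRec X E)
  have semiclosing: "semiclosing (\<lambda>Z. subst_n \<theta> (\<sigma> Z))"
    unfolding semiclosing_def
  proof
    fix Z show "closed_n (subst_n \<theta> (\<sigma> Z)) \<or> subst_n \<theta> (\<sigma> Z) = NVar Z"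
      using NRec.prems unfolding semiclosing_def by (metis subst_closed subst_n.simps(2))
  qed
  have "(\<lambda>Z. subst_n (\<theta>(X := NVar X)) ((\<sigma>(X := NVar X)) Z)) = (\<lambda>Z. subst_n \<theta> (\<sigma> Z))(X := NVar X)"
  proof
    fix Z
    from NRec.prems(1) have "closed_n (\<sigma> Z) \<or> \<sigma> Z = NVar Z" by (auto simp: semiclosing_def)
    then show "subst_n (\<theta>(X := NVar X)) ((\<sigma>(X := NVar X)) Z) = ((\<lambda>Z. subst_n \<theta> (\<sigma> Z))(X := NVar X)) Z"
      by (auto simp: subst_closed)
  qed
  then show ?case
    unfolding subst_rec_sc[OF NRec.prems(1)] subst_rec_sc[OF NRec.prems(2)] subst_rec_sc[OF semiclosing]
    using NRec.IH[OF semiclosing_upd semiclosing_upd, OF NRec.prems] by metis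
qed auto

lemma closed_subst: "closing \<sigma> \<Longrightarrow> closed_n (subst_n \<sigma> E)"
  using fv_subst_sc(1)[OF closing_semiclosing, of \<sigma> E] by (auto simp: closed_n_def closing_def)

lemma unfold_subst:
  assumes "closing \<sigma>" "closed_n P" shows "subst1 (subst_n (\<sigma>(X := NVar X)) E) X P = subst_n (\<sigma>(X := P)) E"
proof -
  have "subst1 (subst_n (\<sigma>(X := NVar X)) E) X P = subst_n (\<lambda>Z. subst_n (NVar(X := P)) ((\<sigma>(X := NVar X)) Z)) E"
    unfolding subst1_def
    by (rule subst_subst_sc(1)) (use assms in \<open>auto intro: semiclosing_upd semiclosing_upd' semiclosing_NVar closing_semiclosing\<close>)
  also have "(\<lambda>Z. subst_n (NVar(X := P)) ((\<sigma>(X := NVar X)) Z)) = \<sigma>(X := P)"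
    using assms by (auto simp: closing_def subst_closed)
  finally show ?thesis .
qed

lemma closed_unfold: "closed_n (NRec X E) \<Longrightarrow> closed_n (subst1 E X (NRec X E))"
  unfolding subst1_def closed_n_def by (subst fv_subst_sc) (auto simp: semiclosing_def closed_n_def)

lemma pdist_closed: "fv_p P = {} \<Longrightarrow> p \<in> set_pmf (pdist P) \<Longrightarrow> closed_n p"
  by (induction P rule: pexp.induct[of "\<lambda>_. True"]) (auto simp: closed_n_def split: if_splits)

lemma step_closed: "step E a \<mu> \<Longrightarrow> closed_n E \<Longrightarrow> \<mu> p \<noteq> 0 \<Longrightarrow> closed_n p"
proof (induction rule: step.induct)
  case (step_pre P \<mu> a)
  then show ?case using pdist_closed[of P p] by (auto simp: pstep_iff closed_n_def set_pmf_iff)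
next
  case (step_rec E X a \<mu>) then show ?case using closed_unfold[of X E] by simp
qed (auto simp: closed_n_def)

lemma stp_closed: "stp E a t \<Longrightarrow> closed_n E \<Longrightarrow> p \<in> set_pmf t \<Longrightarrow> closed_n p"
  unfolding stp_def using step_closed[of E a "pmf t" p] by (simp add: set_pmf_iff)

text \<open>The two-stage substitution makes instances stable under descending below a binder, where the bound
  variable is renamed first.\<close>
definition inst :: "('a, 'v) nexp \<Rightarrow> ('a, 'v) nexp \<Rightarrow> ('v \<Rightarrow> ('a, 'v) nexp) \<Rightarrow> bool" where
  "inst P G \<rho> \<longleftrightarrow> (\<exists>\<sigma> \<tau>. closing \<sigma> \<and> P = subst_n \<sigma> (subst_n \<tau> G) \<and> (\<forall>Z\<in>fv_n G. \<rho> Z = subst_n \<sigma> (\<tau> Z)))"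

definition instp :: "('a, 'v) pexp \<Rightarrow> ('a, 'v) pexp \<Rightarrow> ('v \<Rightarrow> ('a, 'v) nexp) \<Rightarrow> bool" where
  "instp P G \<rho> \<longleftrightarrow> (\<exists>\<sigma> \<tau>. closing \<sigma> \<and> P = subst_p \<sigma> (subst_p \<tau> G) \<and> (\<forall>Z\<in>fv_p G. \<rho> Z = subst_n \<sigma> (\<tau> Z)))"

lemma inst_closed: "inst P G \<rho> \<Longrightarrow> closed_n P"
  unfolding inst_def using closed_subst by blast

lemma inst_self: "closing \<sigma> \<Longrightarrow> inst (subst_n \<sigma> G) G \<sigma>"
  unfolding inst_def by (intro exI[of _ \<sigma>] exI[of _ NVar]) (auto simp: subst_NVar)

lemma inst_Nil: "inst P NNil \<rho> \<Longrightarrow> P = NNil"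
  unfolding inst_def by auto

lemma inst_Var: "inst P (NVar Z) \<rho> \<Longrightarrow> P = \<rho> Z"
  unfolding inst_def by auto

lemma inst_Pre: "inst P (NPre a g) \<rho> \<Longrightarrow> \<exists>p. P = NPre a p \<and> instp p g \<rho>"
  unfolding inst_def instp_def by auto

lemma inst_Sum: "inst P (NSum G H) \<rho> \<Longrightarrow> \<exists>P1 P2. P = NSum P1 P2 \<and> inst P1 G \<rho> \<and> inst P2 H \<rho>"
  unfolding inst_def by (simp, metis UnI1 UnI2)

lemma instp_Dirac: "instp p (PDirac G) \<rho> \<Longrightarrow> \<exists>P. p = PDirac P \<and> inst P G \<rho>"
  unfolding inst_def instp_def by auto

lemma instp_Choice: "instp p (PChoice g x h) \<rho> \<Longrightarrow> \<exists>p1 p2. p = PChoice p1 x p2 \<and> instp p1 g \<rho> \<and> instp p2 h \<rho>"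
  unfolding instp_def by (simp, metis UnI1 UnI2)

text \<open>Unfolding an instance of a recursion fills the hole of its bound variable with the
  instance itself. This keeps contexts closed under unfolding.\<close>

lemma inst_Rec:
  fixes P :: "('a, 'v::infinite) nexp"
  assumes "inst P (NRec Y G) \<rho>"
  shows "\<exists>Y' P'. P = NRec Y' P' \<and> inst (subst1 P' Y' P) G (\<rho>(Y := P))"
proof -
  obtain \<sigma> \<tau> where s: "closing \<sigma>" "P = subst_n \<sigma> (subst_n \<tau> (NRec Y G))" "\<forall>Z\<in>fv_n G - {Y}. \<rho> Z = subst_n \<sigma> (\<tau> Z)"
    using assms unfolding inst_def by auto
  define S where "S = (\<Union>Z\<in>fv_n G - {Y}. fv_n (\<tau> Z))"
  \<comment> \<open>An infinite variable type yields a variable outside the finite set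
    \<open>S\<close>. Freshness of \<open>V\<close> then leaves the fillers of the other variables
    untouched.\<close>
  have "finite S" unfolding S_def using finite_fv by auto
  then have "\<exists>V. V \<notin> S" using infinite_UNIV ex_new_if_finite by blast
  then have "(SOME V. V \<notin> S) \<notin> S" by (rule someI_ex)
  then have V: "fresh_var Y S \<notin> S" by (simp add: fresh_var_def)
  define V where "V = fresh_var Y S"
  define G1 where "G1 = subst_n (\<tau>(Y := NVar V)) G"
  define P' where "P' = subst_n (\<sigma>(V := NVar V)) G1"
  have t: "subst_n \<tau> (NRec Y G) = NRec V G1" by (simp add: V_def S_def G1_def Let_def)
  have P: "P = NRec V P'" unfolding s(2) t subst_rec_sc[OF closing_semiclosing[OF s(1)]] P'_def ..
  have cP: "closed_n P" using inst_closed[OF assms] .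
  have "subst1 P' V P = subst_n (\<sigma>(V := P)) (subst_n (\<tau>(Y := NVar V)) G)"
    unfolding P'_def unfold_subst[OF s(1) cP] G1_def ..
  moreover have "(\<rho>(Y := P)) Z = subst_n (\<sigma>(V := P)) ((\<tau>(Y := NVar V)) Z)" if "Z \<in> fv_n G" for Z
  proof (cases "Z = Y")
    case False
    then have "V \<notin> fv_n (\<tau> Z)" using V that unfolding V_def S_def by auto
    then have "subst_n (\<sigma>(V := P)) (\<tau> Z) = subst_n \<sigma> (\<tau> Z)" by (intro subst_cong) auto
    then show ?thesis using False s(3) that by simp
  qed simp
  ultimately have "inst (subst1 P' V P) G (\<rho>(Y := P))" unfolding inst_def using closing_upd[OF s(1) cP] by blast
  then show ?thesis using P by blast
qed

text \<open>The maximal probability of reaching, by internal moves only, an unguarded variable, weighted by \<open>w\<close>.\<close>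
primrec val_n :: "('v \<Rightarrow> ennreal) \<Rightarrow> ('a, 'v) nexp \<Rightarrow> ennreal" and val_p :: "('v \<Rightarrow> ennreal) \<Rightarrow> ('a, 'v) pexp \<Rightarrow> ennreal" where
  "val_n w NNil = 0"
| "val_n w (NVar X) = w X"
| "val_n w (NPre a P) = (if a = Tau then val_p w P else 0)"
| "val_n w (NRec X E) = lfp (\<lambda>d. val_n (w(X := d)) E)"
| "val_n w (NSum E F) = max (val_n w E) (val_n w F)"
| "val_p w (PDirac E) = val_n w E"
| "val_p w (PChoice P p Q) = ennreal (Rep_prob p) * val_p w P + ennreal (1 - Rep_prob p) * val_p w Q"

lemma val_mono:
  fixes E :: "('a, 'v) nexp" and P :: "('a, 'v) pexp"
  shows "(\<And>Z. w Z \<le> w' Z) \<Longrightarrow> val_n w E \<le> val_n w' E" "(\<And>Z. w Z \<le> w' Z) \<Longrightarrow> val_p w P \<le> val_p w' P"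
proof (induction E and P arbitrary: w w' and w w')
  case (NRec X E)
  show ?case unfolding val_n.simps by (rule lfp_mono) (use NRec in auto)
next
  case (NSum E F) then show ?case by (simp add: max.coboundedI1 max.coboundedI2)
next
  case (PChoice P p Q) then show ?case by (simp add: add_mono mult_left_mono)
qed auto

lemma val_rec_unfold: "val_n w (NRec X E) = val_n (w(X := val_n w (NRec X E))) E"
proof -
  have "mono (\<lambda>d. val_n (w(X := d)) E)" by (rule monoI, rule val_mono) auto
  from lfp_unfold[OF this] show ?thesis by simp
qed

lemma val_cong:
  fixes E :: "('a, 'v) nexp" and P :: "('a, 'v) pexp"
  shows "(\<And>Z. Z \<in> fv_n E \<Longrightarrow> w Z = w' Z) \<Longrightarrow> val_n w E = val_n w' E" "(\<And>Z. Z \<in> fv_p P \<Longrightarrow> w Z = w' Z) \<Longrightarrow> val_p w P = val_p w' P"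
proof (induction E and P arbitrary: w w' and w w')
  case (NRec X E)
  have "val_n (w(X := d)) E = val_n (w'(X := d)) E" for d by (rule NRec.IH) (use NRec.prems in auto)
  then show ?case by simp
next
  case (NSum E F)
  have "val_n w E = val_n w' E" by (rule NSum.IH) (use NSum.prems in auto)
  moreover have "val_n w F = val_n w' F" by (rule NSum.IH) (use NSum.prems in auto)
  ultimately show ?case by simp
next
  case (PChoice P p Q)
  have "val_p w P = val_p w' P" by (rule PChoice.IH) (use PChoice.prems in auto)
  moreover have "val_p w Q = val_p w' Q" by (rule PChoice.IH) (use PChoice.prems in auto)
  ultimately show ?case by simp
next
  case (NPre a P)
  have "val_p w P = val_p w' P" by (rule NPre.IH) (use NPre.prems in auto)
  then show ?case by simp
next
  case (PDirac E)
  have "val_n w E = val_n w' E" by (rule PDirac.IH) (use PDirac.prems in auto)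
  then show ?case by simp
qed auto

lemma prob_add: "ennreal (Rep_prob p) + ennreal (1 - Rep_prob p) = 1"
  using Rep_prob_bounds[of p] by (simp flip: ennreal_plus)

lemma val_le_1:
  fixes E :: "('a, 'v) nexp" and P :: "('a, 'v) pexp"
  shows "(\<And>Z. w Z \<le> 1) \<Longrightarrow> val_n w E \<le> 1" "(\<And>Z. w Z \<le> 1) \<Longrightarrow> val_p w P \<le> 1"
proof (induction E and P arbitrary: w and w)
  case (NRec X E)
  show ?case unfolding val_n.simps by (rule lfp_lowerbound) (use NRec in auto)
next
  case (PChoice P p Q)
  have "val_p w (PChoice P p Q) \<le> ennreal (Rep_prob p) * 1 + ennreal (1 - Rep_prob p) * 1"
    unfolding val_p.simps by (intro add_mono mult_left_mono PChoice) auto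
  then show ?case by (simp add: prob_add)
qed auto

text \<open>The fillers may be context pairs themselves. This is essential for recursion contexts,
  where unfolding puts the current pair into the hole of the bound variable. The last argument is
  the potential: 1 at a hole pair, 0 for identical states, and in between the value of the context
  with the potentials of the fillers as weights.\<close>

inductive Ctx :: "(('a, 'v) nexp \<Rightarrow> ('a, 'v) nexp \<Rightarrow> bool) \<Rightarrow> ('a, 'v) nexp \<Rightarrow> ('a, 'v) nexp \<Rightarrow> ennreal \<Rightarrow> bool" for B where
  Ctx_base: "B P Q \<Longrightarrow> closed_n P \<Longrightarrow> closed_n Q \<Longrightarrow> Ctx B P Q 1"
| Ctx_refl: "closed_n P \<Longrightarrow> Ctx B P P 0"
| Ctx_inst: "inst P G \<rho> \<Longrightarrow> inst Q G \<rho>' \<Longrightarrow> (\<And>Z. w Z \<le> 1) \<Longrightarrow> (\<And>Z. Z \<in> fv_n G \<Longrightarrow> Ctx B (\<rho> Z) (\<rho>' Z) (w Z)) \<Longrightarrow> Ctx B P Q (val_n w G)"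

lemma Ctx_closed: "Ctx B P Q r \<Longrightarrow> closed_n P \<and> closed_n Q"
  by (induction rule: Ctx.induct) (auto dest: inst_closed)

lemma Ctx_le_1: "Ctx B P Q r \<Longrightarrow> r \<le> 1"
  by (induction rule: Ctx.induct) (auto intro: val_le_1)

lemma Ctx_conv: "Ctx B P Q r \<Longrightarrow> Ctx (\<lambda>x y. B y x) Q P r"
  by (induction rule: Ctx.induct) (auto intro: Ctx.intros)

text \<open>The index counts the unfoldings of recursions in the derivation of the transition; it is
  the measure for inductions through holes.\<close>

inductive stepn :: "nat \<Rightarrow> ('a, 'v) nexp \<Rightarrow> 'a act \<Rightarrow> ('a, 'v) nexp pmf \<Rightarrow> bool" where
  stepn_pre: "stepn 0 (NPre a P) a (pdist P)"
| stepn_rec: "stepn n (subst1 E X (NRec X E)) a t \<Longrightarrow> stepn (Suc n) (NRec X E) a t"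
| stepn_suml: "stepn n E a t \<Longrightarrow> stepn n (NSum E F) a t"
| stepn_sumr: "stepn n E a t \<Longrightarrow> stepn n (NSum F E) a t"

lemma stp_stepn: "stp E a t \<longleftrightarrow> (\<exists>n. stepn n E a t)"
proof
  have "\<exists>n t. \<mu> = pmf t \<and> stepn n E a t" if "step E a \<mu>" for \<mu>
    using that by (induction rule: step.induct) (auto simp: pstep_iff intro: stepn.intros)
  then show "stp E a t \<Longrightarrow> \<exists>n. stepn n E a t" unfolding stp_def by (metis pmf_eqI)
  have "stepn n E a t \<Longrightarrow> step E a (pmf t)" for n
    by (induction rule: stepn.induct) (auto simp: pstep_iff intro: step.intros)
  then show "\<exists>n. stepn n E a t \<Longrightarrow> stp E a t" unfolding stp_def by blast
qed

lemma stp_sum: "stp (NSum E F) a t \<longleftrightarrow> stp E a t \<or> stp F a t"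
  unfolding stp_def by (auto intro: step_suml step_sumr elim: step.cases)
lemma stp_pre: "stp (NPre b P) a t \<longleftrightarrow> a = b \<and> t = pdist P"
  unfolding stp_def by (auto simp: pstep_iff intro!: step_pre pmf_eqI elim!: step.cases)
lemma stp_rec: "stp (NRec X E) a t \<longleftrightarrow> stp (subst1 E X (NRec X E)) a t"
  unfolding stp_def by (auto intro: step_rec elim: step.cases)
lemma stp_nil: "\<not> stp NNil a t"
  unfolding stp_def by (auto elim: step.cases)

text \<open>An instance of a bare variable is its filler, so variable contexts can be peeled off
  until the context has a top operator.\<close>

lemma Ctx_cases:
  assumes "Ctx B P Q r"
  shows "(B P Q \<and> r = 1) \<or> (P = Q \<and> r = 0) \<or>
    (\<exists>G \<rho> \<rho>' w. (\<forall>X. G \<noteq> NVar X) \<and> inst P G \<rho> \<and> inst Q G \<rho>' \<and> (\<forall>Z. w Z \<le> 1) \<and> (\<forall>Z\<in>fv_n G. Ctx B (\<rho> Z) (\<rho>' Z) (w Z)) \<and> r = val_n w G)"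
  using assms
proof (induction rule: Ctx.induct)
  case J: (Ctx_inst P G \<rho> Q \<rho>' w)
  show ?case
  proof (cases "\<exists>X. G = NVar X")
    case True
    then obtain X where G: "G = NVar X" by blast
    have e: "P = \<rho> X" "Q = \<rho>' X" using J(1,2) unfolding G by (auto dest: inst_Var)
    have "X \<in> fv_n G" using G by simp
    from J(5)[OF this] show ?thesis unfolding e G val_n.simps .
  next
    case False
    then show ?thesis using J(1-4) by (intro disjI2) metis
  qed
qed auto

text \<open>Both sides make the same random choices, which couples them by triples of two states and
  a potential.\<close>

lemma Ctx_pd:
  fixes g :: "('a, 'v) pexp"
  assumes "\<And>Z. Z \<in> fv_p g \<Longrightarrow> Ctx B (\<rho> Z) (\<rho>' Z) (w Z)" "\<And>Z. w Z \<le> 1" "instp p g \<rho>" "instp q g \<rho>'"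
  shows "\<exists>\<zeta>. (\<forall>y\<in>set_pmf \<zeta>. Ctx B (fst y) (fst (snd y)) (snd (snd y))) \<and> map_pmf fst \<zeta> = pdist p \<and>
     map_pmf (\<lambda>y. fst (snd y)) \<zeta> = pdist q \<and> (\<integral>\<^sup>+y. snd (snd y) \<partial>measure_pmf \<zeta>) = val_p w g"
  using assms(1,3,4)
proof (induction g arbitrary: p q rule: pexp.induct[of "\<lambda>_. True"])
  case (PDirac G)
  then obtain P Q where "p = PDirac P" "q = PDirac Q" "inst P G \<rho>" "inst Q G \<rho>'" by (meson instp_Dirac)
  moreover then have "Ctx B P Q (val_n w G)" using PDirac.prems(1) assms(2) by (auto intro: Ctx_inst)
  ultimately show ?case by (intro exI[of _ "return_pmf (P, Q, val_n w G)"]) auto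
next
  case (PChoice g1 x g2)
  obtain p1 p2 q1 q2 where pq: "p = PChoice p1 x p2" "q = PChoice q1 x q2" "instp p1 g1 \<rho>" "instp p2 g2 \<rho>" "instp q1 g1 \<rho>'" "instp q2 g2 \<rho>'"
    using PChoice.prems by (meson instp_Choice)
  obtain \<zeta>1 where \<zeta>1: "\<forall>y\<in>set_pmf \<zeta>1. Ctx B (fst y) (fst (snd y)) (snd (snd y))" "map_pmf fst \<zeta>1 = pdist p1"
     "map_pmf (\<lambda>y. fst (snd y)) \<zeta>1 = pdist q1" "(\<integral>\<^sup>+y. snd (snd y) \<partial>measure_pmf \<zeta>1) = val_p w g1"
    using PChoice.IH(1)[OF _ pq(3,5)] PChoice.prems(1) by auto
  obtain \<zeta>2 where \<zeta>2: "\<forall>y\<in>set_pmf \<zeta>2. Ctx B (fst y) (fst (snd y)) (snd (snd y))" "map_pmf fst \<zeta>2 = pdist p2"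
     "map_pmf (\<lambda>y. fst (snd y)) \<zeta>2 = pdist q2" "(\<integral>\<^sup>+y. snd (snd y) \<partial>measure_pmf \<zeta>2) = val_p w g2"
    using PChoice.IH(2)[OF _ pq(4,6)] PChoice.prems(1) by auto
  have x: "0 \<le> Rep_prob x" "Rep_prob x \<le> 1" using Rep_prob_bounds[of x] by auto
  let ?\<zeta> = "bind_pmf (bernoulli_pmf (Rep_prob x)) (\<lambda>b. if b then \<zeta>1 else \<zeta>2)"
  have "map_pmf f ?\<zeta> = bind_pmf (bernoulli_pmf (Rep_prob x)) (\<lambda>b. if b then map_pmf f \<zeta>1 else map_pmf f \<zeta>2)" for f :: "_ \<Rightarrow> ('a, 'v) nexp"
    unfolding map_bind_pmf by (intro bind_pmf_cong) auto
  then have "map_pmf fst ?\<zeta> = pdist p" "map_pmf (\<lambda>y. fst (snd y)) ?\<zeta> = pdist q" by (simp_all only: pq(1,2) pdist.simps \<zeta>1(2,3) \<zeta>2(2,3))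
  moreover have "(\<integral>\<^sup>+y. snd (snd y) \<partial>measure_pmf ?\<zeta>) = val_p w (PChoice g1 x g2)"
    using x by (simp add: \<zeta>1(4) \<zeta>2(4) mult.commute)
  moreover have "\<forall>y\<in>set_pmf ?\<zeta>. Ctx B (fst y) (fst (snd y)) (snd (snd y))" using \<zeta>1(1) \<zeta>2(1) by (auto split: if_splits)
  ultimately show ?case by blast
qed auto

text \<open>Either the context generates the transition, and the other side copies it without
  raising the expected potential on internal steps; or a hole pair at the top generates it, with no
  more unfoldings, and then the potential is already 1 and \<open>Q\<close> can do whatever the
  partner in the hole can do.\<close>

lemma Ctx_step:
  fixes P :: "('a, 'v::infinite) nexp"
  assumes "stepn n P a t" "Ctx B P Q r"
  shows "(\<exists>\<zeta>. (\<forall>y\<in>set_pmf \<zeta>. Ctx B (fst y) (fst (snd y)) (snd (snd y))) \<and> map_pmf fst \<zeta> = t \<and>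
         stp Q a (map_pmf (\<lambda>y. fst (snd y)) \<zeta>) \<and> (a = Tau \<longrightarrow> (\<integral>\<^sup>+y. snd (snd y) \<partial>measure_pmf \<zeta>) \<le> r))
    \<or> (\<exists>A A' k. B A A' \<and> k \<le> n \<and> stepn k A a t \<and> 1 \<le> r \<and> (\<forall>b u. stp A' b u \<longrightarrow> stp Q b u))"
  using assms
proof (induction arbitrary: Q r rule: stepn.induct)
  case (stepn_pre a p)
  then have cP: "closed_n (NPre a p)" using Ctx_closed by blast
  from Ctx_cases[OF stepn_pre] consider "B (NPre a p) Q \<and> r = 1" | "Q = NPre a p" "r = 0"
    | G \<rho> \<rho>' w where "inst (NPre a p) G \<rho>" "inst Q G \<rho>'" "\<forall>Z. w Z \<le> 1" "\<forall>Z\<in>fv_n G. Ctx B (\<rho> Z) (\<rho>' Z) (w Z)" "r = val_n w G" "\<forall>X. G \<noteq> NVar X" by blast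
  then show ?case
  proof cases
    case 1 then show ?thesis by (intro disjI2) (force intro: stepn.stepn_pre)
  next
    case 2
    have "closed_n x" if "x \<in> set_pmf (pdist p)" for x using cP that pdist_closed by (auto simp: closed_n_def)
    then show ?thesis using 2 by (intro disjI1 exI[of _ "map_pmf (\<lambda>x. (x, x, 0)) (pdist p)"])
      (auto simp: map_pmf_comp stp_pre intro: Ctx_refl)
  next
    case 3
    then obtain g where G: "G = NPre a g" by (cases G) (auto dest: inst_Nil inst_Pre inst_Sum inst_Rec)
    then obtain q where q: "Q = NPre a q" "instp q g \<rho>'" using 3(2) inst_Pre by blast
    have p: "instp p g \<rho>" using inst_Pre 3(1) G by blast
    from Ctx_pd[of g B \<rho> \<rho>' w, OF _ _ p q(2)] 3 G obtain \<zeta> where \<zeta>: "\<forall>y\<in>set_pmf \<zeta>. Ctx B (fst y) (fst (snd y)) (snd (snd y))"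
      "map_pmf fst \<zeta> = pdist p" "map_pmf (\<lambda>y. fst (snd y)) \<zeta> = pdist q" "(\<integral>\<^sup>+y. snd (snd y) \<partial>measure_pmf \<zeta>) = val_p w g" by auto
    then show ?thesis using 3(5) G q(1) by (intro disjI1 exI[of _ \<zeta>]) (auto simp: stp_pre)
  qed
next
  case J: (stepn_rec n E X a t)
  from Ctx_cases[OF J(3)] consider "B (NRec X E) Q \<and> r = 1" | "Q = NRec X E" "r = 0"
    | G \<rho> \<rho>' w where "inst (NRec X E) G \<rho>" "inst Q G \<rho>'" "\<forall>Z. w Z \<le> 1" "\<forall>Z\<in>fv_n G. Ctx B (\<rho> Z) (\<rho>' Z) (w Z)" "r = val_n w G" "\<forall>X. G \<noteq> NVar X" by blast
  then show ?case
  proof cases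
    case 1 then show ?thesis using J(1) by (intro disjI2) (force intro: stepn.stepn_rec)
  next
    case 2
    have s: "stp (NRec X E) a t" using stp_stepn stepn.stepn_rec[OF J(1)] by blast
    have "closed_n x" if "x \<in> set_pmf t" for x using stp_closed[OF s _ that] Ctx_closed[OF J(3)] by blast
    then show ?thesis using 2 s by (intro disjI1 exI[of _ "map_pmf (\<lambda>x. (x, x, 0)) t"])
      (auto simp: map_pmf_comp intro: Ctx_refl)
  next
    case 3
    then obtain Y G' where G: "G = NRec Y G'" by (cases G) (auto dest: inst_Nil inst_Pre inst_Sum)
    obtain Y' P' where "NRec X E = NRec Y' P'" "inst (subst1 P' Y' (NRec X E)) G' (\<rho>(Y := NRec X E))"
      using inst_Rec[OF 3(1)[unfolded G]] by blast
    then have i1: "inst (subst1 E X (NRec X E)) G' (\<rho>(Y := NRec X E))" by simp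
    obtain V Q' where Q: "Q = NRec V Q'" "inst (subst1 Q' V Q) G' (\<rho>'(Y := Q))" using inst_Rec[OF 3(2)[unfolded G]] by blast
    \<comment> \<open>The potential of a recursion is a fixed point of its body, so unfolding with
      the pair itself as filler keeps it.\<close>
    have rr: "r = val_n (w(Y := r)) G'" using val_rec_unfold[of w Y G'] 3(5) G by simp
    have "Ctx B (subst1 E X (NRec X E)) (subst1 Q' V Q) (val_n (w(Y := r)) G')"
      using 3 G Ctx_le_1[OF J(3)] J(3) by (intro Ctx_inst[OF i1 Q(2)]) auto
    then have "Ctx B (subst1 E X (NRec X E)) (subst1 Q' V Q) r" using rr by simp
    from J(2)[OF this] show ?thesis
    proof (elim disjE exE conjE)
      fix A A' k assume "B A A'" "k \<le> n" "stepn k A a t" "1 \<le> r" "\<forall>b u. stp A' b u \<longrightarrow> stp (subst1 Q' V Q) b u"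
      then show ?thesis using Q(1) stp_rec[of V Q'] by (intro disjI2 exI[of _ A] exI[of _ A'] exI[of _ k]) auto
    next
      fix \<zeta> assume "\<forall>y\<in>set_pmf \<zeta>. Ctx B (fst y) (fst (snd y)) (snd (snd y))" "map_pmf fst \<zeta> = t"
        "stp (subst1 Q' V Q) a (map_pmf (\<lambda>y. fst (snd y)) \<zeta>)" "a = Tau \<longrightarrow> (\<integral>\<^sup>+y. snd (snd y) \<partial>measure_pmf \<zeta>) \<le> r"
      then show ?thesis using Q(1) stp_rec[of V Q' a] by (intro disjI1 exI[of _ \<zeta>]) auto
    qed
  qed
next
  case J: (stepn_suml n E a t F)
  from Ctx_cases[OF J(3)] consider "B (NSum E F) Q \<and> r = 1" | "Q = NSum E F" "r = 0"
    | G \<rho> \<rho>' w where "inst (NSum E F) G \<rho>" "inst Q G \<rho>'" "\<forall>Z. w Z \<le> 1" "\<forall>Z\<in>fv_n G. Ctx B (\<rho> Z) (\<rho>' Z) (w Z)" "r = val_n w G" "\<forall>X. G \<noteq> NVar X" by blast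
  then show ?case
  proof cases
    case 1 then show ?thesis using J(1) by (intro disjI2) (force intro: stepn.stepn_suml)
  next
    case 2
    have s: "stp (NSum E F) a t" using stp_stepn stepn.stepn_suml[OF J(1)] by blast
    have "closed_n x" if "x \<in> set_pmf t" for x using stp_closed[OF s _ that] Ctx_closed[OF J(3)] by blast
    then show ?thesis using 2 s by (intro disjI1 exI[of _ "map_pmf (\<lambda>x. (x, x, 0)) t"])
      (auto simp: map_pmf_comp intro: Ctx_refl)
  next
    case 3
    then obtain G1 G2 where G: "G = NSum G1 G2" by (cases G) (auto dest: inst_Nil inst_Pre inst_Rec)
    have i1: "inst E G1 \<rho>" using inst_Sum 3(1) G by blast
    obtain Q1 Q2 where Q: "Q = NSum Q1 Q2" "inst Q1 G1 \<rho>'" using inst_Sum 3(2) G by blast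
    have "Ctx B E Q1 (val_n w G1)" using 3 G by (intro Ctx_inst[OF i1 Q(2)]) auto
    from J(2)[OF this] show ?thesis
    proof (elim disjE exE conjE)
      fix A A' k assume a: "B A A'" "k \<le> n" "stepn k A a t" "1 \<le> val_n w G1" "\<forall>b u. stp A' b u \<longrightarrow> stp Q1 b u"
      then have "1 \<le> r" using 3(5) G by (simp add: max.coboundedI1)
      then show ?thesis using Q(1) a by (intro disjI2 exI[of _ A] exI[of _ A'] exI[of _ k]) (auto simp: stp_sum)
    next
      fix \<zeta> assume "\<forall>y\<in>set_pmf \<zeta>. Ctx B (fst y) (fst (snd y)) (snd (snd y))" "map_pmf fst \<zeta> = t"
        "stp Q1 a (map_pmf (\<lambda>y. fst (snd y)) \<zeta>)" "a = Tau \<longrightarrow> (\<integral>\<^sup>+y. snd (snd y) \<partial>measure_pmf \<zeta>) \<le> val_n w G1"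
      then show ?thesis using Q(1) 3(5) G by (intro disjI1 exI[of _ \<zeta>]) (auto simp: stp_sum max.coboundedI1)
    qed
  qed
next
  case J: (stepn_sumr n E a t F)
  from Ctx_cases[OF J(3)] consider "B (NSum F E) Q \<and> r = 1" | "Q = NSum F E" "r = 0"
    | G \<rho> \<rho>' w where "inst (NSum F E) G \<rho>" "inst Q G \<rho>'" "\<forall>Z. w Z \<le> 1" "\<forall>Z\<in>fv_n G. Ctx B (\<rho> Z) (\<rho>' Z) (w Z)" "r = val_n w G" "\<forall>X. G \<noteq> NVar X" by blast
  then show ?case
  proof cases
    case 1 then show ?thesis using J(1) by (intro disjI2) (force intro: stepn.stepn_sumr)
  next
    case 2
    have s: "stp (NSum F E) a t" using stp_stepn stepn.stepn_sumr[OF J(1)] by blast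
    have "closed_n x" if "x \<in> set_pmf t" for x using stp_closed[OF s _ that] Ctx_closed[OF J(3)] by blast
    then show ?thesis using 2 s by (intro disjI1 exI[of _ "map_pmf (\<lambda>x. (x, x, 0)) t"])
      (auto simp: map_pmf_comp intro: Ctx_refl)
  next
    case 3
    then obtain G1 G2 where G: "G = NSum G1 G2" by (cases G) (auto dest: inst_Nil inst_Pre inst_Rec)
    have i1: "inst E G2 \<rho>" using inst_Sum 3(1) G by blast
    obtain Q1 Q2 where Q: "Q = NSum Q1 Q2" "inst Q2 G2 \<rho>'" using inst_Sum 3(2) G by blast
    have "Ctx B E Q2 (val_n w G2)" using 3 G by (intro Ctx_inst[OF i1 Q(2)]) auto
    from J(2)[OF this] show ?thesis
    proof (elim disjE exE conjE)
      fix A A' k assume a: "B A A'" "k \<le> n" "stepn k A a t" "1 \<le> val_n w G2" "\<forall>b u. stp A' b u \<longrightarrow> stp Q2 b u"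
      then have "1 \<le> r" using 3(5) G by (simp add: max.coboundedI2)
      then show ?thesis using Q(1) a by (intro disjI2 exI[of _ A] exI[of _ A'] exI[of _ k]) (auto simp: stp_sum)
    next
      fix \<zeta> assume "\<forall>y\<in>set_pmf \<zeta>. Ctx B (fst y) (fst (snd y)) (snd (snd y))" "map_pmf fst \<zeta> = t"
        "stp Q2 a (map_pmf (\<lambda>y. fst (snd y)) \<zeta>)" "a = Tau \<longrightarrow> (\<integral>\<^sup>+y. snd (snd y) \<partial>measure_pmf \<zeta>) \<le> val_n w G2"
      then show ?thesis using Q(1) 3(5) G by (intro disjI1 exI[of _ \<zeta>]) (auto simp: stp_sum max.coboundedI2)
    qed
  qed
qed

lemma pmf_disintegrate:
  "\<exists>h. (\<forall>q\<in>set_pmf (map_pmf f \<zeta>). set_pmf (h q) \<subseteq> {y \<in> set_pmf \<zeta>. f y = q}) \<and> \<zeta> = bind_pmf (map_pmf f \<zeta>) h"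
proof (intro exI conjI ballI)
  let ?h = "\<lambda>q. cond_pmf \<zeta> {y. f y = q}"
  have ne: "set_pmf \<zeta> \<inter> {y. f y = q} \<noteq> {}" if "q \<in> set_pmf (map_pmf f \<zeta>)" for q using that by auto
  show "set_pmf (?h q) \<subseteq> {y \<in> set_pmf \<zeta>. f y = q}" if "q \<in> set_pmf (map_pmf f \<zeta>)" for q
    using set_cond_pmf[OF ne[OF that]] by auto
  show "\<zeta> = bind_pmf (map_pmf f \<zeta>) ?h"
  proof (rule pmf_eqI_ep)
    fix y
    have z: "ep (map_pmf f \<zeta>) q * ep (?h q) y = 0" if "q \<noteq> f y" for q
    proof (cases "q \<in> set_pmf (map_pmf f \<zeta>)")
      case True then show ?thesis using pmf_cond[OF ne[OF True], of y] that by simp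
    next
      case False
      then have "pmf (map_pmf f \<zeta>) q = 0" by (simp only: set_pmf_iff not_not)
      then show ?thesis by simp
    qed
    have "ep (bind_pmf (map_pmf f \<zeta>) ?h) y = ep (map_pmf f \<zeta>) (f y) * ep (?h (f y)) y"
      unfolding ep_bind by (rule nsum_single) (rule z)
    also have "\<dots> = ep \<zeta> y"
    proof (cases "f y \<in> set_pmf (map_pmf f \<zeta>)")
      case True
      have "pmf (map_pmf f \<zeta>) (f y) = measure \<zeta> {x. f x = f y}" by (simp add: pmf_map vimage_def)
      moreover have "pmf (map_pmf f \<zeta>) (f y) > 0" using True by (rule pmf_positive)
      ultimately show ?thesis using pmf_cond[OF ne[OF True], of y] by (simp flip: ennreal_mult)
    next
      case False
      then have "y \<notin> set_pmf \<zeta>" by auto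
      then have "pmf \<zeta> y = 0" by (simp only: set_pmf_iff not_not)
      moreover have "pmf (map_pmf f \<zeta>) (f y) = 0" using False by (simp only: set_pmf_iff not_not)
      ultimately show ?thesis by simp
    qed
    finally show "ep \<zeta> y = ep (bind_pmf (map_pmf f \<zeta>) ?h) y" by simp
  qed
qed

lemma WTH_mix: "(\<And>x. x \<in> set_pmf N \<Longrightarrow> WTH a s (f x)) \<Longrightarrow> WTH a s (bind_pmf N f)"
  by (auto simp: WTH_def intro: WT_mix WK_mix)

text \<open>Conditioning on the state averages the continuations of all labels with that state;
  closure of \<open>K\<close> under mixtures keeps the average a legitimate continuation.\<close>

lemma label_bind:
  assumes "\<And>y. y \<in> set_pmf \<zeta> \<Longrightarrow> K (f y) (k y)"
    and mix: "\<And>s (N :: 'y pmf) g. (\<And>x. x \<in> set_pmf N \<Longrightarrow> K s (g x)) \<Longrightarrow> K s (bind_pmf N g)"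
  shows "\<exists>h. (\<forall>q\<in>set_pmf (map_pmf f \<zeta>). K q (h q)) \<and> bind_pmf \<zeta> (k :: 'y \<Rightarrow> _) = bind_pmf (map_pmf f \<zeta>) h"
proof -
  obtain d where d: "\<And>q. q \<in> set_pmf (map_pmf f \<zeta>) \<Longrightarrow> set_pmf (d q) \<subseteq> {y \<in> set_pmf \<zeta>. f y = q}" "\<zeta> = bind_pmf (map_pmf f \<zeta>) d"
    using pmf_disintegrate[of f \<zeta>] by blast
  have "K q (bind_pmf (d q) k)" if "q \<in> set_pmf (map_pmf f \<zeta>)" for q
  proof (rule mix)
    fix y assume "y \<in> set_pmf (d q)"
    then have "y \<in> set_pmf \<zeta>" "f y = q" using d(1)[OF that] by auto
    then show "K q (k y)" using assms(1) by blast
  qed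
  moreover have "bind_pmf \<zeta> k = bind_pmf (map_pmf f \<zeta>) (\<lambda>q. bind_pmf (d q) k)"
    by (subst d(2)) (simp only: bind_assoc_pmf)
  ultimately show ?thesis by (intro exI[of _ "\<lambda>q. bind_pmf (d q) k"] conjI ballI)
qed

lemma WK_WTH_label:
  assumes "WK s (map_pmf f \<zeta>)" "\<And>y. y \<in> set_pmf \<zeta> \<Longrightarrow> WTH a (f y) (k y)" shows "WTH a s (bind_pmf \<zeta> k)"
proof -
  have "\<exists>h. (\<forall>q\<in>set_pmf (map_pmf f \<zeta>). WTH a q (h q)) \<and> bind_pmf \<zeta> k = bind_pmf (map_pmf f \<zeta>) h"
    by (rule label_bind[of \<zeta> "WTH a" f k]) (erule assms(2), rule WTH_mix, assumption)
  then obtain h where h: "\<forall>q\<in>set_pmf (map_pmf f \<zeta>). WTH a q (h q)" "bind_pmf \<zeta> k = bind_pmf (map_pmf f \<zeta>) h" by blast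
  show ?thesis unfolding h(2) by (rule WK_WTH[OF assms(1)]) (use h(1) in blast)
qed

lemma WT_WK_label:
  assumes "WT a s (map_pmf f \<zeta>)" "\<And>y. y \<in> set_pmf \<zeta> \<Longrightarrow> WK (f y) (k y)" shows "WT a s (bind_pmf \<zeta> k)"
proof -
  have "\<exists>h. (\<forall>q\<in>set_pmf (map_pmf f \<zeta>). WK q (h q)) \<and> bind_pmf \<zeta> k = bind_pmf (map_pmf f \<zeta>) h"
    by (rule label_bind[of \<zeta> WK f k]) (erule assms(2), rule WK_mix, assumption)
  then obtain h where h: "\<forall>q\<in>set_pmf (map_pmf f \<zeta>). WK q (h q)" "bind_pmf \<zeta> k = bind_pmf (map_pmf f \<zeta>) h" by blast
  show ?thesis unfolding h(2) by (rule WT_WK[OF assms(1)]) (use h(1) in blast)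
qed

lemma WT_Tau_WTH_label:
  assumes "WT Tau s (map_pmf f \<zeta>)" "\<And>y. y \<in> set_pmf \<zeta> \<Longrightarrow> WTH a (f y) (k y)" shows "WT a s (bind_pmf \<zeta> k)"
proof -
  have "\<exists>h. (\<forall>q\<in>set_pmf (map_pmf f \<zeta>). WTH a q (h q)) \<and> bind_pmf \<zeta> k = bind_pmf (map_pmf f \<zeta>) h"
    by (rule label_bind[of \<zeta> "WTH a" f k]) (erule assms(2), rule WTH_mix, assumption)
  then obtain h where h: "\<forall>q\<in>set_pmf (map_pmf f \<zeta>). WTH a q (h q)" "bind_pmf \<zeta> k = bind_pmf (map_pmf f \<zeta>) h" by blast
  show ?thesis unfolding h(2) by (rule WT_Tau_WTH[OF assms(1)]) (use h(1) in blast)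
qed

section \<open>Weak bisimilarity and congruence for recursion\<close>

text \<open>Where the unrolling of a weak move ends. For \<open>Tau\<close> this is the empty move.
  For a visible action it is the visible step together with its internal remainder, which is matched
  separately by the result for internal moves.\<close>

definition stop_move :: "'a act \<Rightarrow> ('a, 'v) nexp \<Rightarrow> ('a, 'v) nexp pmf \<Rightarrow> bool" where
  "stop_move a P m \<longleftrightarrow> (if a = Tau then m = return_pmf P else \<exists>t k. stp P a t \<and> (\<forall>p\<in>set_pmf t. WK p (k p)) \<and> m = bind_pmf t k)"

lemma stop_move_WTH: "stop_move a P m \<Longrightarrow> WTH a P m"
  by (auto simp: stop_move_def WTH_def WK_return intro: WT_WK[OF WT_step] split: if_splits)

lemma unroll_WTH: "unroll (stop_move a) (WTH a) P m e \<Longrightarrow> WTH a P m"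
proof (induction rule: unroll.induct)
  case (unroll_step P t M e) show ?case by (rule WK_WTH[OF WK_step[OF unroll_step(1)]]) (rule unroll_step(3))
next
  case (unroll_mix N P) show ?case by (rule WTH_mix) (rule unroll_mix(2))
qed (auto intro: stop_move_WTH)

text \<open>Only the internal prefix of a visible weak move is unrolled; each of its stopping points
  then performs the visible step.\<close>

lemma unroll_visible:
  assumes "unroll (\<lambda>P m. m = return_pmf P) WK P \<rho> e"
    and "\<And>q. q \<in> set_pmf \<rho> \<Longrightarrow> \<exists>N. (\<forall>y\<in>set_pmf N. stop_move a q y) \<and> g q = bind_pmf N (\<lambda>x. x)"
  shows "unroll (stop_move a) (WTH a) P (bind_pmf \<rho> g) e"
  using assms
proof (induction rule: unroll.induct)
  case (unroll_stop P m)
  then obtain N where N: "\<forall>y\<in>set_pmf N. stop_move a P y" "g P = bind_pmf N (\<lambda>x. x)" by auto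
  have "unroll (stop_move a) (WTH a) P (bind_pmf N (\<lambda>x. x)) (\<integral>\<^sup>+x. 0 \<partial>measure_pmf N)"
    by (rule unroll_bind) (use N(1) in \<open>auto intro: unroll.unroll_stop\<close>)
  then show ?case using unroll_stop N(2) by (simp add: bind_return_pmf)
next
  case (unroll_left P m)
  have "WTH a P (bind_pmf m g)"
  proof (rule WK_WTH[OF unroll_left(1)])
    fix q assume "q \<in> set_pmf m"
    then obtain N where N: "\<forall>y\<in>set_pmf N. stop_move a q y" "g q = bind_pmf N (\<lambda>x. x)" using unroll_left(2) by blast
    show "WTH a q (g q)" unfolding N(2) by (rule WTH_mix) (use N(1) stop_move_WTH in blast)
  qed
  then show ?case by (rule unroll.unroll_left)
next
  case (unroll_step P t M e)
  show ?case unfolding bind_assoc_pmf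
  proof (rule unroll.unroll_step[OF unroll_step(1)])
    fix p assume p: "p \<in> set_pmf t"
    show "unroll (stop_move a) (WTH a) p (bind_pmf (M p) g) (e p)"
      by (rule unroll_step(3)[OF p], rule unroll_step(4)) (use p in auto)
  qed
next
  case (unroll_mix N P)
  show ?case unfolding bind_assoc_pmf
  proof (rule unroll_bind)
    fix y assume y: "y \<in> set_pmf N"
    show "unroll (stop_move a) (WTH a) P (bind_pmf (fst y) g) (snd y)"
      by (rule unroll_mix(2)[OF y], rule unroll_mix(3)) (use y in auto)
  qed
qed

lemma WTH_app:
  assumes "WTH a P m" "0 < \<epsilon>" shows "\<exists>e<\<epsilon>. unroll (stop_move a) (WTH a) P m e"
proof (cases "a = Tau")
  case True
  have z: "stop_move Tau = (\<lambda>P m. m = return_pmf P)" "WTH Tau = WK" by (auto simp: stop_move_def WTH_def fun_eq_iff)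
  show ?thesis unfolding True z by (rule WK_app) (use assms True in \<open>auto simp: WTH_def\<close>)
next
  case False
  then have "WT a P m" using assms(1) by (simp add: WTH_def)
  then obtain \<rho> \<eta> where w: "WK P \<rho>" "flow (Bst a) (ep \<rho>) (ep \<eta>)" "flow_star (ep \<eta>) (ep m)" unfolding WT_iff by blast
  obtain k1 where k: "\<forall>s\<in>set_pmf \<rho>. combined_stp a s (k1 s)" "\<eta> = bind_pmf \<rho> k1" using flow_pmfD[OF w(2)] by blast
  obtain k2 where h: "\<forall>s\<in>set_pmf \<eta>. WK s (k2 s)" "m = bind_pmf \<eta> k2" using flow_star_pmfD[OF w(3)] by blast
  obtain e where e: "e < \<epsilon>" "unroll (\<lambda>P m. m = return_pmf P) WK P \<rho> e" using WK_app[OF w(1) assms(2)] by blast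
  have "unroll (stop_move a) (WTH a) P (bind_pmf \<rho> (\<lambda>q. bind_pmf (k1 q) k2)) e"
  proof (rule unroll_visible[OF e(2)])
    fix q assume q: "q \<in> set_pmf \<rho>"
    then obtain N where N: "\<forall>t\<in>set_pmf N. stp q a t" "k1 q = bind_pmf N (\<lambda>t. t)" using k(1) unfolding combined_stp_def by blast
    have "stop_move a q (bind_pmf t k2)" if "t \<in> set_pmf N" for t
      using False N that h(1) q unfolding k(2) stop_move_def by (auto intro!: exI[of _ t] exI[of _ k2])
    then show "\<exists>N. (\<forall>y\<in>set_pmf N. stop_move a q y) \<and> bind_pmf (k1 q) k2 = bind_pmf N (\<lambda>x. x)"
      unfolding N(2) by (intro exI[of _ "map_pmf (\<lambda>t. bind_pmf t k2) N"]) (auto simp: bind_assoc_pmf bind_map_pmf)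
  qed
  then show ?thesis using e(1) unfolding h(2) k(2) bind_assoc_pmf by blast
qed

definition wsim :: "(('a, 'v) nexp \<Rightarrow> ('a, 'v) nexp \<Rightarrow> bool) \<Rightarrow> bool" where
  "wsim R \<longleftrightarrow> (\<forall>E F a t. R E F \<longrightarrow> stp E a t \<longrightarrow> (\<exists>n. WTH a F n \<and> rel_pmf R t n))"

lemma rel_pmf_couple: "rel_pmf R t n \<Longrightarrow> \<exists>pq. (\<forall>y\<in>set_pmf pq. R (fst y) (snd y)) \<and> t = map_pmf fst pq \<and> n = map_pmf snd pq"
  by (force elim: rel_pmf.cases)

text \<open>The engine with potential constantly 0, so that no jump ever occurs, and with equality
  as tolerance.\<close>

lemma wsim_run:
  assumes s: "wsim R" and F: "\<And>P Q m. R P Q \<Longrightarrow> stop_move a P m \<Longrightarrow> Fin Q m" and R: "R P Q" "WTH a P m"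
  shows "\<exists>U. (\<forall>x\<in>set_pmf U. Fin (fst x) (snd x)) \<and> WK Q (map_pmf fst U) \<and> m = bind_pmf U snd"
proof -
  interpret sim_engine "WTH a" "stop_move a" "\<lambda>P Q r. R P Q \<and> r = 0" Fin "(=)" 0
    "case_sum (\<lambda>x. Fin (fst x) (snd x)) (\<lambda>l. (R (fst l) (fst (snd l)) \<and> fst (snd (snd l)) = 0) \<and> WTH a (fst l) (snd (snd (snd l))))"
    "\<lambda>Q m. \<exists>W. (\<forall>x\<in>set_pmf W. case_sum (\<lambda>x. Fin (fst x) (snd x)) (\<lambda>l. (R (fst l) (fst (snd l)) \<and> fst (snd (snd l)) = 0) \<and> WTH a (fst l) (snd (snd (snd l)))) x) \<and>
        WK Q (map_pmf state_of W) \<and> (\<integral>\<^sup>+x. potential x \<partial>measure_pmf W) \<le> 0 \<and> rel_pmf (=) m (bind_pmf W target_of)"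
  proof (unfold_locales, goal_cases)
    \<comment> \<open>Goals 6 and 7 are the assumptions \<open>H1\<close> and
      \<open>H2\<close>.\<close>
    case (6 P Q r t)
    then obtain n where "WK Q n" "rel_pmf R t n" using s unfolding wsim_def WTH_def by metis
    then obtain pq where pq: "\<forall>y\<in>set_pmf pq. R (fst y) (snd y)" "t = map_pmf fst pq" "WK Q (map_pmf snd pq)" using rel_pmf_couple by metis
    show ?case
      by (intro disjI1 exI[of _ "map_pmf (\<lambda>y. (fst y, snd y, 0)) pq"]) (use pq in \<open>auto simp: map_pmf_comp\<close>)
  next
    case (7 P Q r m) then show ?case using F by blast
  qed (auto simp: identity_equivp unroll_WTH intro: WTH_app)
  from run[of P Q 0 m] R show ?thesis by (simp add: pmf.rel_eq)
qed

lemma rel_pmf_bind_set: "(\<And>x. x \<in> set_pmf M \<Longrightarrow> rel_pmf R (f x) (g x)) \<Longrightarrow> rel_pmf R (bind_pmf M f) (bind_pmf M g)"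
  by (rule rel_pmf_bindI[of "\<lambda>x y. x = y \<and> x \<in> set_pmf M"]) (auto intro: rel_pmf_reflI)

text \<open>Matching single steps suffices for matching weak moves. As these may be infinite, the
  engine replaces the usual induction on length.\<close>

lemma wsim_WK:
  assumes "wsim R" "R P Q" "WK P m" shows "\<exists>n. WK Q n \<and> rel_pmf R m n"
proof -
  have "\<exists>U. (\<forall>x\<in>set_pmf U. \<exists>p. R p (fst x) \<and> snd x = return_pmf p) \<and> WK Q (map_pmf fst U) \<and> m = bind_pmf U snd"
    by (rule wsim_run[where a = Tau and Fin = "\<lambda>q m. \<exists>p. R p q \<and> m = return_pmf p", OF assms(1) _ assms(2)])
       (use assms(3) in \<open>auto simp: stop_move_def WTH_def\<close>)
  then obtain U where U: "\<forall>x\<in>set_pmf U. \<exists>p. R p (fst x) \<and> snd x = return_pmf p" "WK Q (map_pmf fst U)" "m = bind_pmf U snd" by blast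
  have "rel_pmf R m (map_pmf fst U)" unfolding U(3) map_pmf_def
    by (rule rel_pmf_bind_set) (use U(1) in force)
  then show ?thesis using U(2) by blast
qed

lemma choose_rel:
  assumes "\<forall>y\<in>set_pmf pq. \<exists>n. A y n \<and> rel_pmf R (k y) n"
  shows "\<exists>h. (\<forall>y\<in>set_pmf pq. A y (h y)) \<and> rel_pmf R (bind_pmf pq k) (bind_pmf pq h)"
proof -
  from bchoice[OF assms] obtain h where h: "\<forall>y\<in>set_pmf pq. A y (h y) \<and> rel_pmf R (k y) (h y)" by blast
  then have "rel_pmf R (bind_pmf pq k) (bind_pmf pq h)" by (intro rel_pmf_bind_set) blast
  then show ?thesis using h by blast
qed

text \<open>Three phases for a visible action: the internal prefix by the engine, the visible step
  by the simulation property, the internal remainder by \<open>wsim_WK\<close>.\<close>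

lemma wsim_WTH:
  assumes "wsim R" "R P Q" "WTH a P m" shows "\<exists>n. WTH a Q n \<and> rel_pmf R m n"
proof (cases "a = Tau")
  case True then show ?thesis using wsim_WK assms by (auto simp: WTH_def)
next
  case False
  have "\<exists>U. (\<forall>x\<in>set_pmf U. \<exists>n. WTH a (fst x) n \<and> rel_pmf R (snd x) n) \<and> WK Q (map_pmf fst U) \<and> m = bind_pmf U snd"
  proof (rule wsim_run[where Fin = "\<lambda>q m. \<exists>n. WTH a q n \<and> rel_pmf R m n", OF assms(1) _ assms(2,3)])
    fix P Q m assume r: "R P Q" and "stop_move a P m"
    then obtain t k where t: "stp P a t" "\<forall>p\<in>set_pmf t. WK p (k p)" "m = bind_pmf t k" using False by (auto simp: stop_move_def)
    then obtain n where "WT a Q n" "rel_pmf R t n" using assms(1) r False unfolding wsim_def WTH_def by metis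
    then obtain pq where pq: "\<forall>y\<in>set_pmf pq. R (fst y) (snd y)" "t = map_pmf fst pq" "WT a Q (map_pmf snd pq)" using rel_pmf_couple by metis
    have "\<forall>y\<in>set_pmf pq. \<exists>n. WK (snd y) n \<and> rel_pmf R (k (fst y)) n"
    proof
      fix y assume "y \<in> set_pmf pq"
      then show "\<exists>n. WK (snd y) n \<and> rel_pmf R (k (fst y)) n"
        using wsim_WK[OF assms(1), of "fst y" "snd y" "k (fst y)"] pq(1,2) t(2) by simp
    qed
    from choose_rel[OF this] obtain h where h: "\<forall>y\<in>set_pmf pq. WK (snd y) (h y)" "rel_pmf R (bind_pmf pq (\<lambda>y. k (fst y))) (bind_pmf pq h)" by blast
    have "WT a Q (bind_pmf pq h)" by (rule WT_WK_label[OF pq(3)]) (use h(1) in blast)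
    then show "\<exists>n. WTH a Q n \<and> rel_pmf R m n" using h(2) unfolding t(3) pq(2) bind_map_pmf using WT_WTH by blast
  qed
  then obtain U where U: "\<forall>x\<in>set_pmf U. \<exists>n. WTH a (fst x) n \<and> rel_pmf R (snd x) n" "WK Q (map_pmf fst U)" "m = bind_pmf U snd" by blast
  from choose_rel[OF U(1)] obtain h where h: "\<forall>y\<in>set_pmf U. WTH a (fst y) (h y)" "rel_pmf R (bind_pmf U snd) (bind_pmf U h)" by blast
  have "WTH a Q (bind_pmf U h)" by (rule WK_WTH_label[OF U(2)]) (use h(1) in blast)
  then show ?thesis using h(2) unfolding U(3) by blast
qed

lemma rel_trans: "rel_pmf R m n \<Longrightarrow> rel_pmf S n k \<Longrightarrow> (\<And>x y z. R x y \<Longrightarrow> S y z \<Longrightarrow> T x z) \<Longrightarrow> rel_pmf T m k"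
proof -
  assume "rel_pmf R m n" "rel_pmf S n k" and i: "\<And>x y z. R x y \<Longrightarrow> S y z \<Longrightarrow> T x z"
  then have "rel_pmf (R OO S) m k" by (metis pmf.rel_compp relcomppI)
  then show ?thesis by (rule pmf.rel_mono_strong) (use i in auto)
qed

lemma rel_sym: "rel_pmf R m n \<Longrightarrow> (\<And>x y. R x y \<Longrightarrow> S y x) \<Longrightarrow> rel_pmf S n m"
proof -
  assume "rel_pmf R m n" and i: "\<And>x y. R x y \<Longrightarrow> S y x"
  then have "rel_pmf (conversep R) n m" by (simp add: pmf.rel_conversep)
  then show ?thesis by (rule pmf.rel_mono_strong) (use i in auto)
qed

text \<open>Lifted relations preserve mass, so an answer to a full distribution is full, and the
  clauses about subdistributions speak about pmfs only.\<close>

lemma weak_bisim_iff: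
  "weak_bisim R \<longleftrightarrow> (\<forall>E F. R E F \<longrightarrow> closed_n E \<and> closed_n F) \<and> wsim R \<and> wsim (\<lambda>x y. R y x)"
proof -
  have flow_conv: "rel_pmf (\<lambda>x y. R y x) m n \<longleftrightarrow> rel_pmf R n m" for m n :: "('a, 'b) nexp pmf"
    by (auto intro: rel_sym[of "\<lambda>x y. R y x" m n R] rel_sym[of R n m "\<lambda>x y. R y x"])
  have 1: "(\<forall>\<mu>. step E a \<mu> \<longrightarrow> (\<exists>\<nu>. wtrans_hat (dirac F) a \<nu> \<and> lift R \<mu> \<nu>)) \<longleftrightarrow> (\<forall>t. stp E a t \<longrightarrow> (\<exists>n. WTH a F n \<and> rel_pmf R t n))" for E F :: "('a, 'b) nexp" and a
  proof
    assume A: "\<forall>\<mu>. step E a \<mu> \<longrightarrow> (\<exists>\<nu>. wtrans_hat (dirac F) a \<nu> \<and> lift R \<mu> \<nu>)"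
    show "\<forall>t. stp E a t \<longrightarrow> (\<exists>n. WTH a F n \<and> rel_pmf R t n)"
      using A lift_pmf_right lift_rel_pmf unfolding stp_def WTH_wtrans_hat by metis
  next
    assume A: "\<forall>t. stp E a t \<longrightarrow> (\<exists>n. WTH a F n \<and> rel_pmf R t n)"
    show "\<forall>\<mu>. step E a \<mu> \<longrightarrow> (\<exists>\<nu>. wtrans_hat (dirac F) a \<nu> \<and> lift R \<mu> \<nu>)"
      using A step_pmf lift_rel_pmf unfolding stp_def WTH_wtrans_hat by metis
  qed
  have 2: "(\<forall>\<nu>. step F a \<nu> \<longrightarrow> (\<exists>\<mu>. wtrans_hat (dirac E) a \<mu> \<and> lift R \<mu> \<nu>)) \<longleftrightarrow> (\<forall>t. stp F a t \<longrightarrow> (\<exists>n. WTH a E n \<and> rel_pmf R n t))" for E F :: "('a, 'b) nexp" and a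
  proof
    assume A: "\<forall>\<mu>. step F a \<mu> \<longrightarrow> (\<exists>\<nu>. wtrans_hat (dirac E) a \<nu> \<and> lift R \<nu> \<mu>)"
    show "\<forall>t. stp F a t \<longrightarrow> (\<exists>n. WTH a E n \<and> rel_pmf R n t)"
      using A lift_pmf_left lift_rel_pmf unfolding stp_def WTH_wtrans_hat by metis
  next
    assume A: "\<forall>t. stp F a t \<longrightarrow> (\<exists>n. WTH a E n \<and> rel_pmf R n t)"
    show "\<forall>\<mu>. step F a \<mu> \<longrightarrow> (\<exists>\<nu>. wtrans_hat (dirac E) a \<nu> \<and> lift R \<nu> \<mu>)"
      using A step_pmf lift_rel_pmf unfolding stp_def WTH_wtrans_hat by metis
  qed
  show ?thesis unfolding weak_bisim_def wsim_def flow_conv 1 2 by blast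
qed

lemma wsim_mono: "wsim R \<Longrightarrow> R E F \<Longrightarrow> stp E a t \<Longrightarrow> (\<And>x y. R x y \<Longrightarrow> S x y) \<Longrightarrow> \<exists>n. WTH a F n \<and> rel_pmf S t n"
  unfolding wsim_def by (metis pmf.rel_mono_strong)

lemma wbisim_sym: "wbisim E F \<Longrightarrow> wbisim F E"
  unfolding wbisim_def weak_bisim_iff
  by (elim exE conjE, rule_tac x = "\<lambda>x y. R y x" in exI) auto

lemma wbisim_closed: "wbisim E F \<Longrightarrow> closed_n E \<and> closed_n F"
  unfolding wbisim_def weak_bisim_iff by blast

lemma wbisimI: "weak_bisim R \<Longrightarrow> R E F \<Longrightarrow> wbisim E F"
  unfolding wbisim_def by blast

lemma wsim_wbisim: "wsim wbisim"
  unfolding wsim_def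
proof (intro allI impI)
  fix E F :: "('a, 'b) nexp" and a t assume "wbisim E F" and s: "stp E a t"
  then obtain R where R: "weak_bisim R" "R E F" unfolding wbisim_def by blast
  then have "wsim R" by (simp add: weak_bisim_iff)
  from wsim_mono[OF this R(2) s] wbisimI[OF R(1)] show "\<exists>n. WTH a F n \<and> rel_pmf wbisim t n" by blast
qed

lemma wbisim_WTH: "wbisim P Q \<Longrightarrow> WTH a P m \<Longrightarrow> \<exists>n. WTH a Q n \<and> rel_pmf wbisim m n"
  by (rule wsim_WTH[OF wsim_wbisim])

lemma wbisim_WK: "wbisim P Q \<Longrightarrow> WK P m \<Longrightarrow> \<exists>n. WK Q n \<and> rel_pmf wbisim m n"
  by (rule wsim_WK[OF wsim_wbisim])

lemma wbisim_refl: assumes "closed_n E" shows "wbisim E E"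
proof (rule wbisimI[of "\<lambda>x y. x = y \<and> closed_n x"])
  have "\<exists>n. WTH a y n \<and> rel_pmf (\<lambda>x y. x = y \<and> closed_n x) t n" if "closed_n y" "stp y a t" for a t and y :: "('a, 'b) nexp"
    using that stp_closed[OF that(2,1)] by (intro exI[of _ t]) (auto intro!: WT_WTH WT_step rel_pmf_reflI)
  moreover from this have "\<exists>n. WTH a y n \<and> rel_pmf (\<lambda>y x. x = y \<and> closed_n x) t n" if "closed_n y" "stp y a t" for a t and y :: "('a, 'b) nexp"
    using that stp_closed[OF that(2,1)] by (intro exI[of _ t]) (auto intro!: WT_WTH WT_step rel_pmf_reflI)
  ultimately show "weak_bisim (\<lambda>x y. x = y \<and> closed_n (x :: ('a, 'b) nexp))" unfolding weak_bisim_iff wsim_def by auto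
qed (use assms in auto)

lemma wsim_comp: "wsim R \<Longrightarrow> wsim S \<Longrightarrow> wsim (R OO S)"
  unfolding wsim_def[of "R OO S"]
proof (intro allI impI)
  fix E F a t assume R: "wsim R" and S: "wsim S" and "(R OO S) E F" and s: "stp E a t"
  then obtain G where G: "R E G" "S G F" by blast
  obtain n where n: "WTH a G n" "rel_pmf R t n" using R G(1) s unfolding wsim_def by blast
  obtain k where k: "WTH a F k" "rel_pmf S n k" using wsim_WTH[OF S G(2) n(1)] by blast
  have "rel_pmf (R OO S) t k" by (rule rel_trans[OF n(2) k(2)]) blast
  then show "\<exists>n. WTH a F n \<and> rel_pmf (R OO S) t n" using k(1) by blast
qed

lemma wbisim_trans: assumes "wbisim E F" "wbisim F G" shows "wbisim E G"
proof (rule wbisimI[of "wbisim OO wbisim"])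
  have e: "(\<lambda>x y. (wbisim OO wbisim) y x) = (wbisim OO wbisim :: ('a, 'b) nexp \<Rightarrow> _)" using wbisim_sym by (auto simp: fun_eq_iff)
  show "weak_bisim (wbisim OO wbisim :: ('a, 'b) nexp \<Rightarrow> _)" unfolding weak_bisim_iff e
    using wsim_comp[OF wsim_wbisim wsim_wbisim] wbisim_closed by blast
qed (use assms in auto)

lemma rel_wbisim_trans: "rel_pmf wbisim m n \<Longrightarrow> rel_pmf wbisim n k \<Longrightarrow> rel_pmf wbisim m k"
  by (rule rel_trans[of wbisim m n wbisim k]) (auto intro: wbisim_trans)

lemma rel_wbisim_sym: "rel_pmf wbisim m n \<Longrightarrow> rel_pmf wbisim n m"
  by (rule rel_sym[of wbisim m n]) (auto intro: wbisim_sym)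

lemma rel_wbisim_refl: "(\<And>p. p \<in> set_pmf m \<Longrightarrow> closed_n p) \<Longrightarrow> rel_pmf wbisim m m"
  by (rule rel_pmf_reflI) (auto intro: wbisim_refl)

definition wcong_half :: "('a, 'v) nexp \<Rightarrow> ('a, 'v) nexp \<Rightarrow> bool" where
  "wcong_half E F \<longleftrightarrow> (\<forall>a t. stp E a t \<longrightarrow> (\<exists>n. WT a F n \<and> rel_pmf wbisim t n))"

lemma wcong_closed_iff: "wcong_closed E F \<longleftrightarrow> wcong_half E F \<and> wcong_half F E"
proof -
  have 1: "(\<forall>a \<mu>. step E a \<mu> \<longrightarrow> (\<exists>\<nu>. wtrans (dirac F) a \<nu> \<and> lift wbisim \<mu> \<nu>)) \<longleftrightarrow> wcong_half E F"
  proof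
    assume A: "\<forall>a \<mu>. step E a \<mu> \<longrightarrow> (\<exists>\<nu>. wtrans (dirac F) a \<nu> \<and> lift wbisim \<mu> \<nu>)"
    show "wcong_half E F" using A lift_pmf_right lift_rel_pmf unfolding wcong_half_def stp_def WT_def by metis
  next
    assume A: "wcong_half E F"
    show "\<forall>a \<mu>. step E a \<mu> \<longrightarrow> (\<exists>\<nu>. wtrans (dirac F) a \<nu> \<and> lift wbisim \<mu> \<nu>)"
      using A step_pmf lift_rel_pmf unfolding wcong_half_def stp_def WT_def by metis
  qed
  have 2: "(\<forall>a \<nu>. step F a \<nu> \<longrightarrow> (\<exists>\<mu>. wtrans (dirac E) a \<mu> \<and> lift wbisim \<mu> \<nu>)) \<longleftrightarrow> wcong_half F E"
  proof
    assume A: "\<forall>a \<mu>. step F a \<mu> \<longrightarrow> (\<exists>\<nu>. wtrans (dirac E) a \<nu> \<and> lift wbisim \<nu> \<mu>)"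
    show "wcong_half F E" using A lift_pmf_left lift_rel_pmf rel_wbisim_sym unfolding wcong_half_def stp_def WT_def by metis
  next
    assume A: "wcong_half F E"
    show "\<forall>a \<mu>. step F a \<mu> \<longrightarrow> (\<exists>\<nu>. wtrans (dirac E) a \<nu> \<and> lift wbisim \<nu> \<mu>)"
      using A step_pmf lift_rel_pmf rel_wbisim_sym unfolding wcong_half_def stp_def WT_def by metis
  qed
  show ?thesis unfolding wcong_closed_def 1 2 ..
qed

text \<open>Each item starts with one strong step, which the congruence answers by a nonempty move;
  bisimilarity takes care of the continuation. This is what makes the congruence transitive.\<close>

lemma wcong_half_WT:
  assumes "wcong_half E F" "WT a E m" shows "\<exists>n. WT a F n \<and> rel_pmf wbisim m n"
proof -
  obtain M where M: "\<forall>x\<in>set_pmf M. item a E x" "m = bind_pmf M (\<lambda>x. x)" using WT_items[OF assms(2)] by blast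
  have "\<exists>n. WT a F n \<and> rel_pmf wbisim x n" if "item a E x" for x
  proof -
    from that obtain t k where x: "x = bind_pmf t k" and
      tk: "stp E Tau t \<and> (\<forall>p\<in>set_pmf t. WTH a p (k p)) \<or> stp E a t \<and> (\<forall>p\<in>set_pmf t. WK p (k p))" unfolding item_def by blast
    from tk show ?thesis
    proof
      assume A: "stp E Tau t \<and> (\<forall>p\<in>set_pmf t. WTH a p (k p))"
      then obtain n where "WT Tau F n" "rel_pmf wbisim t n" using assms(1) unfolding wcong_half_def by blast
      then obtain pq where pq: "\<forall>y\<in>set_pmf pq. wbisim (fst y) (snd y)" "t = map_pmf fst pq" "WT Tau F (map_pmf snd pq)" using rel_pmf_couple by metis
      have "\<forall>y\<in>set_pmf pq. \<exists>n. WTH a (snd y) n \<and> rel_pmf wbisim (k (fst y)) n"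
      proof
        fix y assume "y \<in> set_pmf pq"
        then show "\<exists>n. WTH a (snd y) n \<and> rel_pmf wbisim (k (fst y)) n"
          using wbisim_WTH[of "fst y" "snd y" a "k (fst y)"] pq(1,2) A by simp
      qed
      from choose_rel[OF this] obtain h where h: "\<forall>y\<in>set_pmf pq. WTH a (snd y) (h y)" "rel_pmf wbisim (bind_pmf pq (\<lambda>y. k (fst y))) (bind_pmf pq h)" by blast
      have "WT a F (bind_pmf pq h)" by (rule WT_Tau_WTH_label[OF pq(3)]) (use h(1) in blast)
      then show ?thesis using h(2) unfolding x pq(2) bind_map_pmf by blast
    next
      assume A: "stp E a t \<and> (\<forall>p\<in>set_pmf t. WK p (k p))"
      then obtain n where "WT a F n" "rel_pmf wbisim t n" using assms(1) unfolding wcong_half_def by blast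
      then obtain pq where pq: "\<forall>y\<in>set_pmf pq. wbisim (fst y) (snd y)" "t = map_pmf fst pq" "WT a F (map_pmf snd pq)" using rel_pmf_couple by metis
      have "\<forall>y\<in>set_pmf pq. \<exists>n. WK (snd y) n \<and> rel_pmf wbisim (k (fst y)) n"
      proof
        fix y assume "y \<in> set_pmf pq"
        then show "\<exists>n. WK (snd y) n \<and> rel_pmf wbisim (k (fst y)) n"
          using wbisim_WK[of "fst y" "snd y" "k (fst y)"] pq(1,2) A by simp
      qed
      from choose_rel[OF this] obtain h where h: "\<forall>y\<in>set_pmf pq. WK (snd y) (h y)" "rel_pmf wbisim (bind_pmf pq (\<lambda>y. k (fst y))) (bind_pmf pq h)" by blast
      have "WT a F (bind_pmf pq h)" by (rule WT_WK_label[OF pq(3)]) (use h(1) in blast)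
      then show ?thesis using h(2) unfolding x pq(2) bind_map_pmf by blast
    qed
  qed
  then have "\<forall>x\<in>set_pmf M. \<exists>n. WT a F n \<and> rel_pmf wbisim x n" using M(1) by blast
  from choose_rel[OF this] obtain h where h: "\<forall>x\<in>set_pmf M. WT a F (h x)" "rel_pmf wbisim (bind_pmf M (\<lambda>x. x)) (bind_pmf M h)" by blast
  have "WT a F (bind_pmf M h)" by (rule WT_mix) (use h(1) in blast)
  then show ?thesis using h(2) M(2) by blast
qed

lemma wcong_half_trans: "wcong_half E F \<Longrightarrow> wcong_half F G \<Longrightarrow> wcong_half E G"
  unfolding wcong_half_def[of E] using wcong_half_WT rel_wbisim_trans unfolding wcong_half_def[of E] by metis

lemma wcong_closed_trans: "wcong_closed E F \<Longrightarrow> wcong_closed F G \<Longrightarrow> wcong_closed E G"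
  unfolding wcong_closed_iff using wcong_half_trans by blast

lemma wcong_closed_sym: "wcong_closed E F \<Longrightarrow> wcong_closed F E"
  unfolding wcong_closed_iff by blast

lemma wcong_half_stp:
  assumes "closed_n E" "\<And>a t. stp E a t \<Longrightarrow> WT a F t" shows "wcong_half E F"
  unfolding wcong_half_def using assms stp_closed rel_wbisim_refl by blast

lemma wcong_closed_stp:
  assumes "closed_n E" "closed_n F" "\<And>a t. stp E a t \<longleftrightarrow> stp F a t" shows "wcong_closed E F"
  unfolding wcong_closed_iff using assms WT_step by (blast intro: wcong_half_stp)

lemma wcong_closed_wbisim:
  assumes "wcong_closed E F" "closed_n E" "closed_n F" shows "wbisim E F"
proof (rule wbisimI[of "\<lambda>x y. wbisim x y \<or> (x = E \<and> y = F)"])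
  have w: "wsim (\<lambda>x y. wbisim x y \<or> (x = E \<and> y = F))" if "wcong_half E F" for E F :: "('a, 'b) nexp"
    unfolding wsim_def
  proof (intro allI impI)
    fix G H a t assume "wbisim G H \<or> (G = E \<and> H = F)" "stp G a t"
    then have "\<exists>n. WTH a H n \<and> rel_pmf wbisim t n" using that wsim_wbisim WT_WTH unfolding wcong_half_def wsim_def by blast
    then show "\<exists>n. WTH a H n \<and> rel_pmf (\<lambda>x y. wbisim x y \<or> (x = E \<and> y = F)) t n" by (metis (mono_tags, lifting) pmf.rel_mono_strong)
  qed
  have e: "(\<lambda>x y. wbisim y x \<or> (y = E \<and> x = F)) = (\<lambda>x y. wbisim x y \<or> (x = F \<and> y = E))" using wbisim_sym by (auto simp: fun_eq_iff)
  show "weak_bisim (\<lambda>x y. wbisim x y \<or> (x = E \<and> y = F))" unfolding weak_bisim_iff e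
    using w assms wbisim_closed unfolding wcong_closed_iff by blast
qed simp

text \<open>Bisimulation up to bisimilarity, with \<open>wbisim\<close> allowed only on the
  answering side. The bisimulation behind it is \<open>wbisim OO R OO wbisim\<close>, a composition
  of simulations in both directions.\<close>

lemma wbisim_upto:
  assumes closing: "\<And>P Q. R P Q \<Longrightarrow> closed_n P \<and> closed_n Q"
    and fwd: "\<And>P Q a t. R P Q \<Longrightarrow> stp P a t \<Longrightarrow> \<exists>n. WTH a Q n \<and> rel_pmf (R OO wbisim) t n"
    and bwd: "\<And>P Q a t. R P Q \<Longrightarrow> stp Q a t \<Longrightarrow> \<exists>n. WTH a P n \<and> rel_pmf (conversep R OO wbisim) t n"
  shows "R P Q \<Longrightarrow> wbisim P Q"
proof -
  have *: "wsim (S OO wbisim)" if S: "\<And>P Q a t. S P Q \<Longrightarrow> stp P a t \<Longrightarrow> \<exists>n. WTH a Q n \<and> rel_pmf (S OO wbisim) t n"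
    for S :: "('a, 'b) nexp \<Rightarrow> _"
    unfolding wsim_def
  proof (intro allI impI)
    fix E F a t assume "(S OO wbisim) E F" and s: "stp E a t"
    then obtain G where G: "S E G" "wbisim G F" by blast
    obtain n where n: "WTH a G n" "rel_pmf (S OO wbisim) t n" using S[OF G(1) s] by blast
    obtain k where k: "WTH a F k" "rel_pmf wbisim n k" using wbisim_WTH[OF G(2) n(1)] by blast
    have "rel_pmf (S OO wbisim) t k" by (rule rel_trans[OF n(2) k(2)]) (blast intro: wbisim_trans)
    then show "\<exists>n. WTH a F n \<and> rel_pmf (S OO wbisim) t n" using k(1) by blast
  qed
  have f: "wsim (wbisim OO (R OO wbisim))" by (intro wsim_comp wsim_wbisim * fwd)
  have b: "wsim (wbisim OO (conversep R OO wbisim))" by (intro wsim_comp wsim_wbisim * bwd) auto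
  have e: "(\<lambda>x y. (wbisim OO (R OO wbisim)) y x) = wbisim OO (conversep R OO wbisim)"
    using wbisim_sym by (intro ext iffI) blast+
  have "weak_bisim (wbisim OO (R OO wbisim))" unfolding weak_bisim_iff e using f b wbisim_closed by blast
  moreover assume "R P Q"
  then have "(wbisim OO (R OO wbisim)) P Q" using wbisim_refl closing by blast
  ultimately show "wbisim P Q" by (rule wbisimI)
qed

section \<open>Comparing recursions through their solutions\<close>

definition Cx :: "(('a, 'v) nexp \<Rightarrow> ('a, 'v) nexp \<Rightarrow> bool) \<Rightarrow> ('a, 'v) nexp \<Rightarrow> ('a, 'v) nexp \<Rightarrow> bool" where
  "Cx B P Q \<longleftrightarrow> (\<exists>r. Ctx B P Q r)"

lemma Cx_closed: "Cx B P Q \<Longrightarrow> closed_n P \<and> closed_n Q"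
  unfolding Cx_def using Ctx_closed by blast

lemma Cx_conv: "Cx B P Q \<Longrightarrow> Cx (\<lambda>x y. B y x) Q P"
  unfolding Cx_def using Ctx_conv by blast

lemma Ctx_rel:
  assumes "\<forall>y\<in>set_pmf \<zeta>. Ctx B (fst y) (fst (snd y)) (snd (snd y))"
  shows "rel_pmf (Cx B) (map_pmf fst \<zeta>) (map_pmf (\<lambda>y. fst (snd y)) \<zeta>)"
  unfolding map_pmf_def
proof (rule rel_pmf_bind_set)
  fix y assume "y \<in> set_pmf \<zeta>"
  then have "Cx B (fst y) (fst (snd y))" using assms unfolding Cx_def by blast
  then show "rel_pmf (Cx B) (return_pmf (fst y)) (return_pmf (fst (snd y)))" by simp
qed

lemma Cx_rel_mono: "rel_pmf (Cx B) m n \<Longrightarrow> rel_pmf (Cx B OO wbisim) m n"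
proof (erule pmf.rel_mono_strong)
  fix x y assume "Cx B x y"
  then show "(Cx B OO wbisim) x y" using Cx_closed wbisim_refl by blast
qed

lemma WT_mono_stp:
  assumes "\<And>b u. stp A b u \<Longrightarrow> stp Q b u" "WT a A m" shows "WT a Q m"
proof -
  obtain M where M: "\<forall>x\<in>set_pmf M. item a A x" "m = bind_pmf M (\<lambda>x. x)" using WT_items[OF assms(2)] by blast
  have "item a A x \<Longrightarrow> item a Q x" for x unfolding item_def using assms(1) by blast
  then show ?thesis unfolding M(2) by (intro WT_mix item_WT) (use M(1) in blast)
qed

lemma Ctx_sub1:
  assumes "B P Q" "closed_n P" "closed_n Q" "fv_n E \<subseteq> {X}"
  shows "Ctx B (subst1 E X P) (subst1 E X Q) (val_n (\<lambda>_. 1) E)"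
proof (rule Ctx_inst)
  have "subst1 E X R = subst_n (\<lambda>_. R) E" for R
    unfolding subst1_def by (rule subst_cong) (use assms(4) in auto)
  moreover have "closing (\<lambda>_. R)" if "closed_n R" for R :: "('a, 'b) nexp" using that by (simp add: closing_def)
  ultimately show "inst (subst1 E X P) E (\<lambda>_. P)" "inst (subst1 E X Q) E (\<lambda>_. Q)" using assms(2,3) inst_self by metis+
qed (use assms in \<open>auto intro: Ctx_base\<close>)

text \<open>Induction on the number of unfoldings. If a hole generates the transition, the recursion
  there makes it, hence its body does with one unfolding less. The induction hypothesis moves it to
  the body applied to \<open>A\<close>, then \<open>sol\<close> moves it to \<open>A\<close>, and so
  to \<open>Q\<close>.\<close>

lemma rec_solution_simulates:
  fixes E :: "('a, 'v::infinite) nexp"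
  assumes cH: "closed_n (NRec X E)" and cA: "closed_n A" and sol: "wcong_closed A (subst1 E X A)"
  defines "B \<equiv> (\<lambda>x y. x = NRec X E \<and> y = A)"
  shows "stepn n P a t \<Longrightarrow> Ctx B P Q r \<Longrightarrow> \<exists>m. WT a Q m \<and> rel_pmf (Cx B OO wbisim) t m"
proof (induction n arbitrary: P Q r t rule: less_induct)
  case (less n)
  have fv: "fv_n E \<subseteq> {X}" using cH by (auto simp: closed_n_def)
  from Ctx_step[OF less.prems] show ?case
  proof (elim disjE exE conjE)
    fix \<zeta> assume "\<forall>y\<in>set_pmf \<zeta>. Ctx B (fst y) (fst (snd y)) (snd (snd y))" "map_pmf fst \<zeta> = t"
      "stp Q a (map_pmf (\<lambda>y. fst (snd y)) \<zeta>)"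
    then show ?thesis using Ctx_rel[of \<zeta> B] Cx_rel_mono WT_step by blast
  next
    fix H A' k assume a: "B H A'" "k \<le> n" "stepn k H a t" "\<forall>b u. stp A' b u \<longrightarrow> stp Q b u"
    then have e: "H = NRec X E" "A' = A" by (auto simp: B_def)
    from a(3)[unfolded e] obtain k' where k: "k = Suc k'" "stepn k' (subst1 E X (NRec X E)) a t"
      by (cases rule: stepn.cases) auto
    have "Ctx B (subst1 E X (NRec X E)) (subst1 E X A) (val_n (\<lambda>_. 1) E)"
      by (rule Ctx_sub1) (use cH cA fv in \<open>auto simp: B_def\<close>)
    moreover have "k' < n" using k a(2) by simp
    ultimately obtain m where m: "WT a (subst1 E X A) m" "rel_pmf (Cx B OO wbisim) t m" using less.IH k(2) by blast
    from wcong_half_WT[OF _ m(1), of A] sol obtain m' where m': "WT a A m'" "rel_pmf wbisim m m'" unfolding wcong_closed_iff by blast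
    have "WT a Q m'" by (rule WT_mono_stp[OF _ m'(1)]) (use a(4) e in blast)
    moreover have "rel_pmf (Cx B OO wbisim) t m'" by (rule rel_trans[OF m(2) m'(2)]) (blast intro: wbisim_trans)
    ultimately show ?thesis by blast
  qed
qed

text \<open>Each recursion is a solution of the other's equation, so the unfolding induction applies
  in both directions; the two context relations are converses of each other.\<close>

lemma rec_mutual_solutions:
  fixes E :: "('a, 'v::infinite) nexp"
  assumes c: "closed_n (NRec X E)" "closed_n (NRec Y F)"
    and s: "wcong_closed (NRec Y F) (subst1 E X (NRec Y F))" "wcong_closed (NRec X E) (subst1 F Y (NRec X E))"
  shows "wcong_closed (NRec X E) (NRec Y F)"
proof -
  let ?B = "\<lambda>x y. x = NRec X E \<and> y = NRec Y F" and ?B' = "\<lambda>x y. x = NRec Y F \<and> y = NRec X E"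
  have flow_conv: "conversep (Cx ?B) = Cx ?B'"
    using Cx_conv[of ?B] Cx_conv[of ?B'] by (intro ext iffI) (auto simp: conj_commute)
  have f: "\<exists>n. WT a Q n \<and> rel_pmf (Cx ?B OO wbisim) t n" if "Cx ?B P Q" "stp P a t" for P Q a t
    using rec_solution_simulates[OF c(1) c(2) s(1)] that unfolding stp_stepn Cx_def by blast
  have b: "\<exists>n. WT a P n \<and> rel_pmf (Cx ?B' OO wbisim) t n" if "Cx ?B' Q P" "stp Q a t" for P Q a t
    using rec_solution_simulates[OF c(2) c(1) s(2)] that unfolding stp_stepn Cx_def by blast
  have w: "wbisim P Q" if "Cx ?B P Q" for P Q
  proof (rule wbisim_upto[of "Cx ?B", OF _ _ _ that])
    show "\<exists>n. WTH a Q n \<and> rel_pmf (Cx ?B OO wbisim) t n" if "Cx ?B P Q" "stp P a t" for P Q a t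
      using f[OF that] WT_WTH by blast
    show "\<exists>n. WTH a P n \<and> rel_pmf (conversep (Cx ?B) OO wbisim) t n" if "Cx ?B P Q" "stp Q a t" for P Q a t
    proof -
      have "Cx ?B' Q P" using that(1) unfolding flow_conv[symmetric] by simp
      from b[OF this that(2)] show ?thesis unfolding flow_conv using WT_WTH by blast
    qed
  qed (rule Cx_closed)
  have "Ctx ?B (NRec X E) (NRec Y F) 1" by (rule Ctx_base) (use c in auto)
  then have c1: "Cx ?B (NRec X E) (NRec Y F)" unfolding Cx_def by blast
  then have c2: "Cx ?B' (NRec Y F) (NRec X E)" unfolding flow_conv[symmetric] by simp
  have "wcong_half (NRec X E) (NRec Y F)" unfolding wcong_half_def
  proof (intro allI impI)
    fix a t assume "stp (NRec X E) a t"
    from f[OF c1 this] obtain n where n: "WT a (NRec Y F) n" "rel_pmf (Cx ?B OO wbisim) t n" by blast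
    have "rel_pmf wbisim t n" using n(2) by (rule pmf.rel_mono_strong) (blast intro: w wbisim_trans)
    then show "\<exists>n. WT a (NRec Y F) n \<and> rel_pmf wbisim t n" using n(1) by blast
  qed
  moreover have "wcong_half (NRec Y F) (NRec X E)" unfolding wcong_half_def
  proof (intro allI impI)
    fix a t assume "stp (NRec Y F) a t"
    from b[OF c2 this] obtain n where n: "WT a (NRec X E) n" "rel_pmf (Cx ?B' OO wbisim) t n" by blast
    have "rel_pmf wbisim t n" using n(2)
    proof (rule pmf.rel_mono_strong)
      fix z y assume "(Cx ?B' OO wbisim) z y"
      then obtain x where x: "Cx ?B' z x" "wbisim x y" by blast
      from x(1) have "Cx ?B x z" unfolding flow_conv[symmetric] by simp
      then show "wbisim z y" using w wbisim_sym x(2) wbisim_trans by blast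
    qed
    then show "\<exists>n. WT a (NRec X E) n \<and> rel_pmf wbisim t n" using n(1) by blast
  qed
  ultimately show ?thesis unfolding wcong_closed_iff ..
qed

text \<open>A potential below 1 excludes that a hole makes the first step. The first step is
  therefore copied as a strong step, which gives congruence rather than mere bisimilarity.\<close>

lemma Ctx_strong_half:
  fixes P :: "('a, 'v::infinite) nexp"
  assumes "Ctx B P Q r" "r < 1 \<or> (\<forall>x y. \<not> B x y)" "\<And>x y. Cx B x y \<Longrightarrow> wbisim x y" shows "wcong_half P Q"
  unfolding wcong_half_def
proof (intro allI impI)
  fix a t assume "stp P a t"
  then obtain n where n: "stepn n P a t" unfolding stp_stepn by blast
  from Ctx_step[OF n assms(1)] assms(2) obtain \<zeta> where \<zeta>: "\<forall>y\<in>set_pmf \<zeta>. Ctx B (fst y) (fst (snd y)) (snd (snd y))" "map_pmf fst \<zeta> = t"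
    "stp Q a (map_pmf (\<lambda>y. fst (snd y)) \<zeta>)" by (auto simp: not_le[symmetric])
  have "rel_pmf wbisim t (map_pmf (\<lambda>y. fst (snd y)) \<zeta>)"
    unfolding \<zeta>(2)[symmetric] using Ctx_rel[OF \<zeta>(1)] by (rule pmf.rel_mono_strong) (rule assms(3))
  then show "\<exists>n. WT a Q n \<and> rel_pmf wbisim t n" using WT_step[OF \<zeta>(3)] by blast
qed

text \<open>Without hole pairs, contexts only identify instances of the same expression, so this covers
  renaming of bound variables.\<close>
lemma inst_wcong:
  fixes P :: "('a, 'v::infinite) nexp"
  assumes "inst P G \<rho>" "inst Q G \<rho>'" "\<And>Z. Z \<in> fv_n G \<Longrightarrow> \<rho> Z = \<rho>' Z" "\<And>Z. Z \<in> fv_n G \<Longrightarrow> closed_n (\<rho> Z)"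
  shows "wcong_closed P Q"
proof -
  let ?B = "\<lambda>x y :: ('a, 'v) nexp. False"
  have m: "\<exists>n. WTH a Q n \<and> rel_pmf (Cx ?B) t n" if "Cx ?B P Q" "stp P a t" for P Q :: "('a, 'v) nexp" and a t
  proof -
    from that obtain n r where n: "stepn n P a t" "Ctx ?B P Q r" unfolding stp_stepn Cx_def by blast
    from Ctx_step[OF n] obtain \<zeta> where \<zeta>: "\<forall>y\<in>set_pmf \<zeta>. Ctx ?B (fst y) (fst (snd y)) (snd (snd y))" "map_pmf fst \<zeta> = t"
      "stp Q a (map_pmf (\<lambda>y. fst (snd y)) \<zeta>)" by blast
    then show ?thesis using Ctx_rel[OF \<zeta>(1)] WT_WTH[OF WT_step[OF \<zeta>(3)]] by blast
  qed
  have s: "Cx ?B y x" if "Cx ?B x y" for x y :: "('a, 'v) nexp" using Cx_conv[OF that] by simp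
  have w: "wbisim x y" if "Cx ?B x y" for x y
  proof (rule wbisim_upto[of "Cx ?B", OF _ _ _ that])
    show "\<exists>n. WTH a Q n \<and> rel_pmf (Cx ?B OO wbisim) t n" if "Cx ?B P Q" "stp P a t" for P Q a t
      using m[OF that] Cx_rel_mono by blast
    show "\<exists>n. WTH a P n \<and> rel_pmf (conversep (Cx ?B) OO wbisim) t n" if "Cx ?B P Q" "stp Q a t" for P Q a t
    proof -
      have e: "conversep (Cx ?B) = Cx ?B" using s by (intro ext) auto
      show ?thesis unfolding e using m[OF s[OF that(1)] that(2)] Cx_rel_mono by blast
    qed
  qed (rule Cx_closed)
  have c: "Ctx ?B P Q (val_n (\<lambda>_. 0) G)"
    by (rule Ctx_inst[OF assms(1,2)]) (use assms(3,4) in \<open>auto intro: Ctx_refl\<close>)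
  have "wcong_half P Q" by (rule Ctx_strong_half[OF c]) (use w in auto)
  moreover have "wcong_half Q P" by (rule Ctx_strong_half[OF Ctx_conv[OF c]]) (use w in auto)
  ultimately show ?thesis unfolding wcong_closed_iff ..
qed

text \<open>For a recursion, the scaled value is a prefixed point of the scaled equation, so the
  least fixed point lies below it.\<close>

lemma val_scale:
  fixes E :: "('a, 'v) nexp" and P :: "('a, 'v) pexp"
  shows "val_n (\<lambda>Z. k * w Z) E \<le> k * val_n w E" "val_p (\<lambda>Z. k * w Z) P \<le> k * val_p w P"
proof (induction E and P arbitrary: w and w)
  case (NRec X E)
  let ?d = "val_n w (NRec X E)"
  have eq: "(\<lambda>Z. k * w Z)(X := k * ?d) = (\<lambda>Z. k * (w(X := ?d)) Z)" by auto
  have "val_n ((\<lambda>Z. k * w Z)(X := k * ?d)) E \<le> k * val_n (w(X := ?d)) E" unfolding eq by (rule NRec.IH)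
  also have "\<dots> = k * ?d" by (subst val_rec_unfold[symmetric]) simp
  finally show ?case by (subst val_n.simps) (rule lfp_lowerbound)
next
  case (NSum E F)
  have "k * val_n w E \<le> k * max (val_n w E) (val_n w F)" "k * val_n w F \<le> k * max (val_n w E) (val_n w F)"
    by (auto intro: mult_left_mono)
  then show ?case using NSum[of w] by (auto intro: order_trans)
next
  case (PChoice P p Q)
  have "val_p (\<lambda>Z. k * w Z) (PChoice P p Q) \<le> ennreal (Rep_prob p) * (k * val_p w P) + ennreal (1 - Rep_prob p) * (k * val_p w Q)"
    unfolding val_p.simps by (intro add_mono mult_left_mono PChoice) auto
  then show ?case by (simp add: distrib_left ac_simps)
qed auto

section \<open>Guardedness and unique solutions\<close>

text \<open>With \<open>c > 1\<close>, a value at most 1 under these weights expresses that reaching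
  \<open>V\<close> is always accompanied by a loss of mass, while \<open>U\<close> may be reached
  without loss. \<open>U\<close> takes precedence over \<open>V\<close>.\<close>

definition wt :: "real \<Rightarrow> 'v set \<Rightarrow> 'v set \<Rightarrow> 'v \<Rightarrow> ennreal" where
  "wt c V U Z = (if Z \<in> U then 1 else if Z \<in> V then ennreal c else 0)"

lemma wt_mono: "c \<le> d \<Longrightarrow> wt c V U Z \<le> wt d V U Z"
  by (auto simp: wt_def intro: ennreal_leI)

lemma val_wt_min:
  assumes "val_n (wt c V U) E \<le> 1" shows "val_n (wt (min c d) V U) E \<le> 1" "val_n (wt (min d c) V U) E \<le> 1"
  by (rule order_trans[OF val_mono(1)[OF wt_mono] assms], simp)+

lemma val_wt_min_p:
  assumes "val_p (wt c V U) P \<le> 1" shows "val_p (wt (min c d) V U) P \<le> 1" "val_p (wt (min d c) V U) P \<le> 1"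
  by (rule order_trans[OF val_mono(2)[OF wt_mono] assms], simp)+

lemma val_wt_le: assumes "1 \<le> c" shows "val_p (wt c V U) P \<le> ennreal c"
proof -
  have "val_p (wt c V U) P \<le> val_p (\<lambda>Z. ennreal c * 1) P"
    by (rule val_mono) (use assms in \<open>auto simp: wt_def\<close>)
  also have "\<dots> \<le> ennreal c * val_p (\<lambda>_. 1) P" by (rule val_scale)
  also have "\<dots> \<le> ennreal c * 1" by (intro mult_left_mono val_le_1) auto
  finally show ?thesis by simp
qed

text \<open>Since \<open>1 \<le> c\<close>, the weights \<open>wt c V U\<close> lie below
  \<open>c / c1\<close> times the weights that give \<open>c1\<close> to all of
  \<open>V \<union> U\<close>.\<close>

lemma val_wt_shrink:
  assumes c1: "1 < c1" and v: "val_p (wt c1 (V \<union> U) {}) P \<le> 1" and c: "1 \<le> c"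
  shows "val_p (wt c V U) P \<le> ennreal (c / c1)"
proof -
  have "ennreal (c / c1) * ennreal c1 = ennreal c" using c1 c by (simp flip: ennreal_mult)
  then have "wt c V U Z \<le> ennreal (c / c1) * wt c1 (V \<union> U) {} Z" for Z using c by (auto simp: wt_def)
  then have "val_p (wt c V U) P \<le> val_p (\<lambda>Z. ennreal (c / c1) * wt c1 (V \<union> U) {} Z) P" by (rule val_mono)
  also have "\<dots> \<le> ennreal (c / c1) * val_p (wt c1 (V \<union> U) {}) P" by (rule val_scale)
  also have "\<dots> \<le> ennreal (c / c1) * 1" by (intro mult_left_mono v) simp
  finally show ?thesis by simp
qed

text \<open>The constant \<open>c\<close> solves \<open>p * (c / c1) + (1 - p) * c = 1\<close>. It
  exceeds 1 because the lossy branch, of probability \<open>p\<close>, makes the denominator smaller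
  than 1.\<close>

lemma convex_bound:
  fixes x :: prob
  assumes "p = Rep_prob x \<or> p = 1 - Rep_prob x" "1 < c1" "A \<le> ennreal (c / c1)" "B \<le> ennreal c" "c = 1 / (p / c1 + (1 - p))"
  shows "ennreal p * A + ennreal (1 - p) * B \<le> 1" "1 < c"
proof -
  have p: "0 < p" "p < 1" using assms(1) Rep_prob_bounds[of x] by auto
  have "0 < p / c1" "p / c1 < p" using p assms(2) by (auto simp: divide_less_eq)
  then have d: "0 < p / c1 + (1 - p)" "p / c1 + (1 - p) < 1" using p by linarith+
  show c: "1 < c" unfolding assms(5) using d by simp
  have "ennreal p * A + ennreal (1 - p) * B \<le> ennreal p * ennreal (c / c1) + ennreal (1 - p) * ennreal c"
    by (intro add_mono mult_left_mono assms) auto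
  also have "\<dots> = ennreal (p * (c / c1) + (1 - p) * c)" using p c assms(2) by (simp flip: ennreal_mult ennreal_plus)
  also have "p * (c / c1) + (1 - p) * c = c * (p / c1 + (1 - p))" by (simp add: algebra_simps)
  also have "\<dots> = 1" unfolding assms(5) using d by simp
  finally show "ennreal p * A + ennreal (1 - p) * B \<le> 1" by simp
qed

text \<open>A quantitative form of guardedness, stated for two sets of variables so that it passes
  through binders and choices. At a choice where both branches have an unguarded set inside
  \<open>V \<union> U\<close>, the two sets join and each branch inherits the hypothesis. Otherwise
  one branch has no such set at all, hence loses mass, and its loss pays for the excess weight of
  the other branch.\<close>

lemma guarded_weights:
  fixes E :: "('a, 'v) nexp" and P :: "('a, 'v) pexp"
  shows "(\<forall>W. ung_n E W \<longrightarrow> W \<subseteq> V \<union> U \<longrightarrow> W \<subseteq> U) \<Longrightarrow> \<exists>c>1. val_n (wt c V U) E \<le> 1"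
    and "(\<forall>W. ung_p P W \<longrightarrow> W \<subseteq> V \<union> U \<longrightarrow> W \<subseteq> U) \<Longrightarrow> \<exists>c>1. val_p (wt c V U) P \<le> 1"
proof (induction E and P arbitrary: V U and V U)
  case NNil then show ?case by (intro exI[of _ 2]) simp
next
  case (NVar X)
  have "X \<notin> V \<union> U \<or> X \<in> U" using NVar[rule_format, OF ung_var] by blast
  then show ?case by (intro exI[of _ 2]) (auto simp: wt_def)
next
  case (NPre a P)
  show ?case
  proof (cases "a = Tau")
    case True
    have "\<exists>c>1. val_p (wt c V U) P \<le> 1" using NPre.prems ung_tau unfolding True by (intro NPre.IH) blast
    then show ?thesis using True by simp
  next
    case False
    then have "val_n (wt 2 V U) (NPre a P) \<le> 1" by simp
    then show ?thesis by (intro exI[of _ 2]) simp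
  qed
next
  case (NRec Y E)
  \<comment> \<open>The bound variable joins \<open>U\<close>, as returning to the recursion loses
    nothing. This also absorbs the set \<open>{Y}\<close>, which the rule for recursions
    excludes.\<close>
  have "\<exists>c>1. val_n (wt c (V - {Y}) (insert Y U)) E \<le> 1"
  proof (rule NRec.IH, intro allI impI)
    fix W assume W: "ung_n E W" "W \<subseteq> V - {Y} \<union> insert Y U"
    show "W \<subseteq> insert Y U"
    proof (cases "W = {Y}")
      case False
      have "ung_n (NRec Y E) (W - {Y})" by (rule ung_rec[OF W(1) False])
      moreover have "W - {Y} \<subseteq> V \<union> U" using W(2) by blast
      ultimately have "W - {Y} \<subseteq> U" using NRec.prems by simp
      then show ?thesis by blast
    qed simp
  qed
  then obtain c where c: "c > 1" "val_n (wt c (V - {Y}) (insert Y U)) E \<le> 1" by blast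
  have "(wt c V U)(Y := 1) = wt c (V - {Y}) (insert Y U)" by (auto simp: wt_def)
  \<comment> \<open>With weight 1 at \<open>Y\<close> the body has value at most 1, so 1 is a
    prefixed point.\<close>
  then have "val_n (wt c V U) (NRec Y E) \<le> 1" unfolding val_n.simps using c(2) by (intro lfp_lowerbound) simp
  then show ?case using c(1) by blast
next
  case (NSum E F)
  obtain c1 where c1: "c1 > 1" "val_n (wt c1 V U) E \<le> 1" using NSum.IH(1)[of V U] NSum.prems by (metis ung_suml)
  obtain c2 where c2: "c2 > 1" "val_n (wt c2 V U) F \<le> 1" using NSum.IH(2)[of V U] NSum.prems by (metis ung_sumr)
  show ?case using c1(1) c2(1) val_wt_min(1)[OF c1(2), of c2] val_wt_min(2)[OF c2(2), of c1]
    by (intro exI[of _ "min c1 c2"]) simp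
next
  case (PDirac E)
  have "\<exists>c>1. val_n (wt c V U) E \<le> 1" using PDirac.prems ung_dirac by (intro PDirac.IH) blast
  then show ?case by simp
next
  case (PChoice P x Q)
  consider W1 W2 where "ung_p P W1" "W1 \<subseteq> V \<union> U" "ung_p Q W2" "W2 \<subseteq> V \<union> U"
    | "\<forall>W. ung_p P W \<longrightarrow> \<not> W \<subseteq> V \<union> U" | "\<forall>W. ung_p Q W \<longrightarrow> \<not> W \<subseteq> V \<union> U" by blast
  then show ?case
  proof cases
    case 1
    have "\<forall>W. ung_p P W \<longrightarrow> W \<subseteq> V \<union> U \<longrightarrow> W \<subseteq> U"
    proof (intro allI impI)
      fix W assume W: "ung_p P W" "W \<subseteq> V \<union> U"
      have "W \<union> W2 \<subseteq> U" by (rule PChoice.prems[rule_format, OF ung_choice[OF W(1) 1(3)]]) (use W(2) 1(4) in blast)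
      then show "W \<subseteq> U" by blast
    qed
    then obtain c1 where c1: "c1 > 1" "val_p (wt c1 V U) P \<le> 1" using PChoice.IH(1) by blast
    have "\<forall>W. ung_p Q W \<longrightarrow> W \<subseteq> V \<union> U \<longrightarrow> W \<subseteq> U"
    proof (intro allI impI)
      fix W assume W: "ung_p Q W" "W \<subseteq> V \<union> U"
      have "W1 \<union> W \<subseteq> U" by (rule PChoice.prems[rule_format, OF ung_choice[OF 1(1) W(1)]]) (use W(2) 1(2) in blast)
      then show "W \<subseteq> U" by blast
    qed
    then obtain c2 where c2: "c2 > 1" "val_p (wt c2 V U) Q \<le> 1" using PChoice.IH(2) by blast
    have "val_p (wt (min c1 c2) V U) (PChoice P x Q) \<le> ennreal (Rep_prob x) * 1 + ennreal (1 - Rep_prob x) * 1"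
      unfolding val_p.simps by (intro add_mono mult_left_mono val_wt_min_p c1 c2) auto
    then show ?thesis using c1(1) c2(1) by (intro exI[of _ "min c1 c2"]) (simp add: prob_add)
  next
    case 2
    then obtain c1 where c1: "c1 > 1" "val_p (wt c1 (V \<union> U) {}) P \<le> 1" using PChoice.IH(1)[of "V \<union> U" "{}"] by auto
    define c where "c = 1 / (Rep_prob x / c1 + (1 - Rep_prob x))"
    have c1c: "1 < c" using convex_bound(2)[of "Rep_prob x" x c1 0 c 0] c1 by (auto simp: c_def)
    have c1': "1 \<le> c" using c1c by simp
    have "val_p (wt c V U) (PChoice P x Q) \<le> 1" unfolding val_p.simps
      by (rule convex_bound(1)[OF disjI1[OF refl] c1(1) val_wt_shrink[OF c1 c1'] val_wt_le[OF c1'] c_def])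
    then show ?thesis using c1c by blast
  next
    case 3
    then obtain c1 where c1: "c1 > 1" "val_p (wt c1 (V \<union> U) {}) Q \<le> 1" using PChoice.IH(2)[of "V \<union> U" "{}"] by auto
    define p where "p = 1 - Rep_prob x"
    define c where "c = 1 / (p / c1 + (1 - p))"
    have c1c: "1 < c" using convex_bound(2)[of p x c1 0 c 0] c1 by (auto simp: c_def p_def)
    have c1': "1 \<le> c" using c1c by simp
    have "ennreal p * val_p (wt c V U) Q + ennreal (1 - p) * val_p (wt c V U) P \<le> 1"
      by (rule convex_bound(1)[OF disjI2[OF p_def] c1(1) val_wt_shrink[OF c1 c1'] val_wt_le[OF c1'] c_def])
    then show ?thesis using c1c by (intro exI[of _ c]) (simp add: p_def add.commute)
  qed
qed

text \<open>With \<open>V = {X}\<close> and \<open>U\<close> empty, guardedness gives value at most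
  1 under some weight \<open>c > 1\<close> at \<open>X\<close>; rescaling to weight 1 gives at most
  \<open>1 / c\<close>.\<close>

lemma guarded_val:
  fixes E :: "('a, 'v) nexp"
  assumes "\<not> unguarded X E" shows "val_n (\<lambda>Z. if Z = X then 1 else 0) E < 1"
proof -
  have "W \<subseteq> {}" if "ung_n E W" "W \<subseteq> {X} \<union> {}" for W
    using that assms unfolding unguarded_def by (cases "W = {}") (auto simp: subset_singleton_iff)
  then obtain c where c: "c > 1" "val_n (wt c {X} {}) E \<le> 1" using guarded_weights(1)[of E "{X}" "{}"] by blast
  have "(if Z = X then 1 else 0) \<le> ennreal (1 / c) * wt c {X} {} Z" for Z
    using c(1) by (auto simp: wt_def simp flip: ennreal_mult)
  then have "val_n (\<lambda>Z. if Z = X then 1 else 0) E \<le> val_n (\<lambda>Z. ennreal (1 / c) * wt c {X} {} Z) E" by (rule val_mono)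
  also have "\<dots> \<le> ennreal (1 / c) * val_n (wt c {X} {}) E" by (rule val_scale)
  also have "\<dots> \<le> ennreal (1 / c) * 1" by (intro mult_left_mono c(2)) simp
  also have "\<dots> < 1" using c(1) by (simp add: ennreal_less_one_iff)
  finally show ?thesis .
qed

text \<open>The engine asks for an equivalence on all expressions, but \<open>wbisim\<close> is
  reflexive on closed ones only.\<close>

definition Tw :: "('a, 'v) nexp \<Rightarrow> ('a, 'v) nexp \<Rightarrow> bool" where
  "Tw x y \<longleftrightarrow> x = y \<or> wbisim x y"

lemma Tw_sym: "Tw x y \<Longrightarrow> Tw y x"
  unfolding Tw_def using wbisim_sym by blast
lemma Tw_trans: "Tw x y \<Longrightarrow> Tw y z \<Longrightarrow> Tw x z"
  unfolding Tw_def using wbisim_trans by blast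
lemma Tw_equivp: "equivp Tw"
  by (intro equivpI reflpI sympI transpI) (auto simp: Tw_def intro: wbisim_sym wbisim_trans)

lemma rel_Tw: "rel_pmf wbisim m n \<Longrightarrow> rel_pmf Tw m n"
  by (erule pmf.rel_mono_strong) (simp add: Tw_def)

lemma Tw_WTH: assumes "Tw P Q" "WTH a P m" shows "\<exists>n. WTH a Q n \<and> rel_pmf Tw m n"
  using assms(1) unfolding Tw_def[of P Q]
proof
  assume "P = Q"
  then show ?thesis using assms(2) rel_pmf_reflI[of m Tw] by (auto simp: Tw_def)
next
  assume "wbisim P Q"
  then show ?thesis using wbisim_WTH[OF _ assms(2)] rel_Tw by blast
qed

text \<open>The pairs in \<open>B\<close> are oriented so that the solution \<open>A\<close>
  challenges and the recursion answers. The constant \<open>c\<close> is the potential of the pair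
  of bodies, that is, a bound on the chance that a body reaches a hole again by internal
  moves.\<close>

locale guarded_equation =
  fixes A :: "('a, 'v::infinite) nexp" and X E c B
  defines "B \<equiv> \<lambda>x y. x = A \<and> y = NRec X E"
  assumes cA: "closed_n A" and cH: "closed_n (NRec X E)" and sol: "wcong_closed A (subst1 E X A)"
    and ctx: "Ctx B (subst1 E X A) (subst1 E X (NRec X E)) c" and c1: "c < 1"
begin

definition post :: "'a act \<Rightarrow> ('a, 'v) nexp \<Rightarrow> ('a, 'v) nexp pmf \<Rightarrow> bool" where
  "post a q m \<longleftrightarrow> (\<exists>n. WTH a q n \<and> rel_pmf (Tw OO Cx B) m n)"

lemma post_step:
  assumes pre: "\<And>P Q m. Cx B P Q \<Longrightarrow> WK P m \<Longrightarrow> post Tau Q m"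
    and \<zeta>: "\<forall>y\<in>set_pmf \<zeta>. Ctx B (fst y) (fst (snd y)) (snd (snd y))" "stp Q a (map_pmf (\<lambda>y. fst (snd y)) \<zeta>)"
    and k: "\<forall>p\<in>set_pmf (map_pmf fst \<zeta>). WK p (k p)"
  shows "post a Q (bind_pmf (map_pmf fst \<zeta>) k)"
proof -
  have "\<forall>y\<in>set_pmf \<zeta>. \<exists>n. WK (fst (snd y)) n \<and> rel_pmf (Tw OO Cx B) (k (fst y)) n"
  proof
    fix y assume y: "y \<in> set_pmf \<zeta>"
    then have "Cx B (fst y) (fst (snd y))" "WK (fst y) (k (fst y))" using \<zeta>(1) k by (auto simp: Cx_def)
    from pre[OF this] show "\<exists>n. WK (fst (snd y)) n \<and> rel_pmf (Tw OO Cx B) (k (fst y)) n" by (simp add: post_def WTH_def)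
  qed
  from choose_rel[OF this] obtain h where h: "\<forall>y\<in>set_pmf \<zeta>. WK (fst (snd y)) (h y)"
    "rel_pmf (Tw OO Cx B) (bind_pmf \<zeta> (\<lambda>y. k (fst y))) (bind_pmf \<zeta> h)" by blast
  have "WT a Q (bind_pmf \<zeta> h)" by (rule WT_WK_label[OF WT_step[OF \<zeta>(2)]]) (use h(1) in blast)
  then show ?thesis unfolding post_def bind_map_pmf using h(2) WT_WTH by blast
qed

text \<open>\<open>lb\<close> and \<open>jmp\<close> spell out \<open>lab\<close> and
  \<open>Jump\<close> of the engine for this instance, so that jumps can be justified before the
  interpretation.\<close>

definition lb :: "'a act \<Rightarrow> ('a, 'v) olab + ('a, 'v) rlab \<Rightarrow> bool" where
  "lb a = case_sum (\<lambda>x. post a (fst x) (snd x)) (\<lambda>l. Ctx B (fst l) (fst (snd l)) (fst (snd (snd l))) \<and> WTH a (fst l) (snd (snd (snd l))))"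

definition jmp :: "'a act \<Rightarrow> ('a, 'v) nexp \<Rightarrow> ('a, 'v) nexp pmf \<Rightarrow> bool" where
  "jmp a Q m \<longleftrightarrow> (\<exists>W. (\<forall>x\<in>set_pmf W. lb a x) \<and> WK Q (map_pmf state_of W) \<and> (\<integral>\<^sup>+x. potential x \<partial>measure_pmf W) \<le> c \<and> rel_pmf Tw m (bind_pmf W target_of))"

text \<open>The move of \<open>A\<close> is first transferred by \<open>sol\<close> to the body
  applied to \<open>A\<close>. Because \<open>c < 1\<close>, the first steps there come from the
  context and are copied by the body applied to the recursion, hence by \<open>Q\<close>. After an
  internal first step the pairs reached have expected potential at most \<open>c\<close> and stay
  open; after a visible one the internal remainder is answered by \<open>pre\<close>.\<close>

lemma jump:
  assumes pre: "\<And>P Q m. a \<noteq> Tau \<Longrightarrow> Cx B P Q \<Longrightarrow> WK P m \<Longrightarrow> post Tau Q m"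
    and item: "item a A m" and Q: "\<And>b u. stp (NRec X E) b u \<Longrightarrow> stp Q b u"
  shows "jmp a Q m"
proof -
  from wcong_half_WT[OF _ item_WT[OF item], of "subst1 E X A"] sol obtain m2 where m2: "WT a (subst1 E X A) m2" "rel_pmf wbisim m m2"
    unfolding wcong_closed_iff by blast
  obtain M where M: "\<forall>x\<in>set_pmf M. item a (subst1 E X A) x" "m2 = bind_pmf M (\<lambda>x. x)" using WT_items[OF m2(1)] by blast
  have match: "\<exists>\<zeta>. (\<forall>y\<in>set_pmf \<zeta>. Ctx B (fst y) (fst (snd y)) (snd (snd y))) \<and> map_pmf fst \<zeta> = t \<and>
         stp Q b (map_pmf (\<lambda>y. fst (snd y)) \<zeta>) \<and> (b = Tau \<longrightarrow> (\<integral>\<^sup>+y. snd (snd y) \<partial>measure_pmf \<zeta>) \<le> c)"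
    if "stp (subst1 E X A) b t" for b t
  proof -
    from that obtain n where n: "stepn n (subst1 E X A) b t" unfolding stp_stepn by blast
    from Ctx_step[OF n ctx] c1 show ?thesis using Q stp_rec by (metis not_le)
  qed
  have "\<exists>W. (\<forall>y\<in>set_pmf W. lb a y) \<and> WK Q (map_pmf state_of W) \<and> (\<integral>\<^sup>+y. potential y \<partial>measure_pmf W) \<le> c \<and> bind_pmf W target_of = x"
    if "item a (subst1 E X A) x" for x
  proof -
    from that obtain t k where x: "x = bind_pmf t k" and
      tk: "(stp (subst1 E X A) Tau t \<and> (\<forall>p\<in>set_pmf t. WTH a p (k p))) \<or> (stp (subst1 E X A) a t \<and> (\<forall>p\<in>set_pmf t. WK p (k p)))" unfolding item_def by blast
    then consider "stp (subst1 E X A) Tau t" "\<forall>p\<in>set_pmf t. WTH a p (k p)" | "a \<noteq> Tau" "stp (subst1 E X A) a t" "\<forall>p\<in>set_pmf t. WK p (k p)"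
      by (cases "a = Tau") (auto simp: WTH_def)
    then show ?thesis
    proof cases
      case 1
      from match[OF 1(1)] obtain \<zeta> where \<zeta>: "\<forall>y\<in>set_pmf \<zeta>. Ctx B (fst y) (fst (snd y)) (snd (snd y))" "map_pmf fst \<zeta> = t"
        "stp Q Tau (map_pmf (\<lambda>y. fst (snd y)) \<zeta>)" "(\<integral>\<^sup>+y. snd (snd y) \<partial>measure_pmf \<zeta>) \<le> c" by blast
      let ?W = "map_pmf (\<lambda>y. Inr (fst y, fst (snd y), snd (snd y), k (fst y))) \<zeta>"
      have "\<forall>y\<in>set_pmf ?W. lb a y" using \<zeta>(1) 1(2) unfolding \<zeta>(2)[symmetric] by (auto simp: lb_def)
      moreover have "WK Q (map_pmf state_of ?W)" using WK_step[OF \<zeta>(3)] by (simp add: map_pmf_comp)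
      moreover have "(\<integral>\<^sup>+y. potential y \<partial>measure_pmf ?W) \<le> c" using \<zeta>(4) by simp
      moreover have "bind_pmf ?W target_of = x" unfolding x \<zeta>(2)[symmetric] by (simp add: bind_map_pmf)
      ultimately show ?thesis by blast
    next
      case 2
      from match[OF 2(2)] obtain \<zeta> where \<zeta>: "\<forall>y\<in>set_pmf \<zeta>. Ctx B (fst y) (fst (snd y)) (snd (snd y))" "map_pmf fst \<zeta> = t"
        "stp Q a (map_pmf (\<lambda>y. fst (snd y)) \<zeta>)" by blast
      have "post a Q x" unfolding x \<zeta>(2)[symmetric]
        by (rule post_step[OF _ \<zeta>(1,3)]) (erule (1) pre[OF 2(1)], subst \<zeta>(2), rule 2(3))
      then show ?thesis by (intro exI[of _ "return_pmf (Inl (Q, x))"]) (auto simp: lb_def WK_return bind_return_pmf)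
    qed
  qed
  then have "\<forall>x\<in>set_pmf M. \<exists>W. (\<forall>y\<in>set_pmf W. lb a y) \<and> WK Q (map_pmf state_of W) \<and> (\<integral>\<^sup>+y. potential y \<partial>measure_pmf W) \<le> c \<and> bind_pmf W target_of = x"
    using M(1) by blast
  from bchoice[OF this] obtain W where W: "\<forall>x\<in>set_pmf M. (\<forall>y\<in>set_pmf (W x). lb a y) \<and> WK Q (map_pmf state_of (W x)) \<and>
     (\<integral>\<^sup>+y. potential y \<partial>measure_pmf (W x)) \<le> c \<and> bind_pmf (W x) target_of = x" by blast
  have "\<forall>y\<in>set_pmf (bind_pmf M W). lb a y" using W by auto
  moreover have "WK Q (map_pmf state_of (bind_pmf M W))" unfolding map_bind_pmf by (rule WK_mix) (use W in blast)
  moreover have "(\<integral>\<^sup>+y. potential y \<partial>measure_pmf (bind_pmf M W)) \<le> c"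
  proof -
    have "(\<integral>\<^sup>+y. potential y \<partial>measure_pmf (bind_pmf M W)) \<le> (\<integral>\<^sup>+x. c \<partial>measure_pmf M)"
      unfolding nn_integral_bind_pmf' by (rule nn_integral_pmf_mono) (use W in blast)
    then show ?thesis by simp
  qed
  moreover have "rel_pmf Tw m (bind_pmf (bind_pmf M W) target_of)"
  proof -
    have "bind_pmf (bind_pmf M W) target_of = m2" unfolding bind_assoc_pmf M(2) by (rule bind_pmf_cong[OF refl]) (use W in blast)
    then show ?thesis using rel_Tw[OF m2(2)] by simp
  qed
  ultimately show ?thesis unfolding jmp_def by blast
qed

text \<open>Used first for \<open>Tau\<close>, where \<open>pre\<close> is vacuous, and then for
  visible actions, where the internal result provides \<open>pre\<close>.\<close>

lemma simulate_mode:
  assumes pre: "\<And>P Q m. a \<noteq> Tau \<Longrightarrow> Cx B P Q \<Longrightarrow> WK P m \<Longrightarrow> post Tau Q m"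
    and R: "Ctx B P Q r" "WTH a P m"
  shows "post a Q m"
proof -
  have BD: "Aa = A \<and> A' = NRec X E" if "B Aa A'" for Aa A' using that by (simp add: B_def)
  interpret sim_engine "WTH a" "stop_move a" "Ctx B" "post a" Tw c
    "case_sum (\<lambda>x. post a (fst x) (snd x)) (\<lambda>l. Ctx B (fst l) (fst (snd l)) (fst (snd (snd l))) \<and> WTH a (fst l) (snd (snd (snd l))))"
    "\<lambda>Q m. \<exists>W. (\<forall>x\<in>set_pmf W. case_sum (\<lambda>x. post a (fst x) (snd x)) (\<lambda>l. Ctx B (fst l) (fst (snd l)) (fst (snd (snd l))) \<and> WTH a (fst l) (snd (snd (snd l)))) x) \<and>
        WK Q (map_pmf state_of W) \<and> (\<integral>\<^sup>+x. potential x \<partial>measure_pmf W) \<le> c \<and> rel_pmf Tw m (bind_pmf W target_of)"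
  proof (unfold_locales, goal_cases)
    \<comment> \<open>Goals 6 and 7 are \<open>H1\<close> and \<open>H2\<close>: steps generated by
      the context keep the potential, and steps generated by a hole lead to a jump.\<close>
    case (6 P Q r t)
    then obtain n where n: "stepn n P Tau t" unfolding stp_stepn by blast
    from Ctx_step[OF n 6(1)] show ?case
    proof (elim disjE exE conjE)
      fix \<zeta> assume "\<forall>y\<in>set_pmf \<zeta>. Ctx B (fst y) (fst (snd y)) (snd (snd y))" "map_pmf fst \<zeta> = t"
        "stp Q Tau (map_pmf (\<lambda>y. fst (snd y)) \<zeta>)" "Tau = Tau \<longrightarrow> (\<integral>\<^sup>+y. snd (snd y) \<partial>measure_pmf \<zeta>) \<le> r"
      then show ?thesis by (intro disjI1 exI[of _ \<zeta>]) (auto intro: WK_step)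
    next
      fix Aa A' k assume a: "B Aa A'" "stepn k Aa Tau t" "1 \<le> r" "\<forall>b u. stp A' b u \<longrightarrow> stp Q b u"
      have "jmp a Q (bind_pmf t M)" if "\<forall>p\<in>set_pmf t. WTH a p (M p)" for M
      proof (rule jump)
        show "post Tau q n" if "a \<noteq> Tau" "Cx B p q" "WK p n" for p q n by (rule pre[OF that])
        have "stp A Tau t" using a(2) BD[OF a(1)] unfolding stp_stepn by blast
        then show "item a A (bind_pmf t M)" unfolding item_def using that by (intro exI[of _ t] exI[of _ M]) simp
      qed (use a(4) BD[OF a(1)] in auto)
      then show ?thesis using a(3) unfolding jmp_def lb_def by (intro disjI2 conjI allI impI)
    qed
  next
    case (7 P Q r m)
    show ?case
    proof (cases "a = Tau")
      case True
      have "Cx B P Q" using 7 unfolding Cx_def by blast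
      then have "rel_pmf (Tw OO Cx B) (return_pmf P) (return_pmf Q)" by (auto simp: Tw_def)
      moreover have "m = return_pmf P" using 7 True by (simp add: stop_move_def)
      moreover have "WTH a Q (return_pmf Q)" using True by (simp add: WTH_def WK_return)
      ultimately have "post a Q m" unfolding post_def by blast
      then show ?thesis ..
    next
      case False
      then obtain t k where t: "stp P a t" "\<forall>p\<in>set_pmf t. WK p (k p)" "m = bind_pmf t k" using 7 by (auto simp: stop_move_def)
      then obtain n where n: "stepn n P a t" unfolding stp_stepn by blast
      from Ctx_step[OF n 7(1)] show ?thesis
      proof (elim disjE exE conjE)
        fix \<zeta> assume \<zeta>: "\<forall>y\<in>set_pmf \<zeta>. Ctx B (fst y) (fst (snd y)) (snd (snd y))" "map_pmf fst \<zeta> = t"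
          "stp Q a (map_pmf (\<lambda>y. fst (snd y)) \<zeta>)"
        have "post a Q m" unfolding t(3) \<zeta>(2)[symmetric]
          by (rule post_step[OF _ \<zeta>(1,3)]) (erule (1) pre[OF False], subst \<zeta>(2), rule t(2))
        then show ?thesis ..
      next
        fix Aa A' k' assume a: "B Aa A'" "stepn k' Aa a t" "1 \<le> r" "\<forall>b u. stp A' b u \<longrightarrow> stp Q b u"
        have "jmp a Q m"
        proof (rule jump)
        show "post Tau q n" if "a \<noteq> Tau" "Cx B p q" "WK p n" for p q n by (rule pre[OF that])
          have "stp A a t" using a(2) BD[OF a(1)] unfolding stp_stepn by blast
          then show "item a A m" unfolding item_def t(3) using t(2) by (intro exI[of _ t] exI[of _ k]) simp
        qed (use a(4) BD[OF a(1)] in auto)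
        then show ?thesis using a(3) unfolding jmp_def lb_def by (intro disjI2 conjI)
      qed
    qed
  qed (use c1 Tw_equivp WTH_app unroll_WTH Ctx_le_1 in auto)
  from run[OF R] obtain U where U: "\<forall>x\<in>set_pmf U. post a (fst x) (snd x)" "WK Q (map_pmf fst U)" "rel_pmf Tw m (bind_pmf U snd)" by blast
  from choose_rel[OF U(1)[unfolded post_def]] obtain h where h: "\<forall>y\<in>set_pmf U. WTH a (fst y) (h y)"
    "rel_pmf (Tw OO Cx B) (bind_pmf U snd) (bind_pmf U h)" by blast
  have "WTH a Q (bind_pmf U h)" by (rule WK_WTH_label[OF U(2)]) (use h(1) in blast)
  moreover have "rel_pmf (Tw OO Cx B) m (bind_pmf U h)" by (rule rel_trans[OF U(3) h(2)]) (blast intro: Tw_trans)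
  ultimately show ?thesis unfolding post_def by blast
qed

lemma simulate: assumes "Cx B P Q" "WTH a P m" shows "post a Q m"
proof -
  have "post Tau Q m" if "Cx B P Q" "WK P m" for P Q m
    using that simulate_mode[of Tau P Q] unfolding Cx_def WTH_def by auto
  then show ?thesis using assms simulate_mode[of a P Q] unfolding Cx_def by blast
qed

text \<open>The forward half of the bisimulation comes from the engine, the backward half from the
  unfolding induction \<open>rec_solution_simulates\<close>.\<close>

lemma Cx_wbisim: assumes "Cx B P Q" shows "wbisim P Q"
proof (rule wbisimI[of "Tw OO Cx B"])
  let ?B = "\<lambda>x y. x = NRec X E \<and> y = A"
  have flow_conv: "conversep (Cx B) = Cx ?B"
    using Cx_conv[of B] Cx_conv[of ?B] unfolding B_def by (intro ext iffI) (auto simp: conj_commute)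
  have f: "wsim (Tw OO Cx B)" unfolding wsim_def
  proof (intro allI impI)
    fix P Q a t assume "(Tw OO Cx B) P Q" and s: "stp P a t"
    then obtain P1 where P1: "Tw P P1" "Cx B P1 Q" by blast
    obtain n1 where n1: "WTH a P1 n1" "rel_pmf Tw t n1" using Tw_WTH[OF P1(1) WT_WTH[OF WT_step[OF s]]] by blast
    obtain n where n: "WTH a Q n" "rel_pmf (Tw OO Cx B) n1 n" using simulate[OF P1(2) n1(1)] unfolding post_def by blast
    have "rel_pmf (Tw OO Cx B) t n" by (rule rel_trans[OF n1(2) n(2)]) (blast intro: Tw_trans)
    then show "\<exists>n. WTH a Q n \<and> rel_pmf (Tw OO Cx B) t n" using n(1) by blast
  qed
  have b: "wsim (\<lambda>x y. (Tw OO Cx B) y x)" unfolding wsim_def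
  proof (intro allI impI)
    fix Q P a t assume "(Tw OO Cx B) P Q" and s: "stp Q a t"
    then obtain P1 where P1: "Tw P P1" "Cx B P1 Q" by blast
    have "Cx ?B Q P1" using P1(2) unfolding flow_conv[symmetric] by simp
    then obtain r n where r: "Ctx ?B Q P1 r" "stepn n Q a t" using s unfolding Cx_def stp_stepn by blast
    from rec_solution_simulates[OF cH cA sol r(2,1)] obtain n1 where n1: "WT a P1 n1" "rel_pmf (Cx ?B OO wbisim) t n1" by blast
    obtain n where n: "WTH a P n" "rel_pmf Tw n1 n" using Tw_WTH[OF Tw_sym[OF P1(1)] WT_WTH[OF n1(1)]] by blast
    have "rel_pmf (\<lambda>x y. (Tw OO Cx B) y x) t n"
    proof (rule rel_trans[OF n1(2) n(2)])
      fix x y z assume "(Cx ?B OO wbisim) x y" "Tw y z"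
      then obtain w where w: "Cx ?B x w" "wbisim w y" by blast
      then have "Cx B w x" unfolding flow_conv[symmetric] by simp
      moreover have "Tw z w" using w(2) \<open>Tw y z\<close> Tw_sym Tw_trans unfolding Tw_def by blast
      ultimately show "(Tw OO Cx B) z x" by blast
    qed
    then show "\<exists>n. WTH a P n \<and> rel_pmf (\<lambda>x y. (Tw OO Cx B) y x) t n" using n(1) by blast
  qed
  show "weak_bisim (Tw OO Cx B)" unfolding weak_bisim_iff
    using f b wbisim_closed Cx_closed unfolding Tw_def by blast
  show "(Tw OO Cx B) P Q" using assms unfolding Tw_def by blast
qed

text \<open>The chain runs from \<open>A\<close> to the body at \<open>A\<close>, to the body at the
  recursion, to the recursion. Its middle link holds because the potential \<open>c\<close> of the
  two bodies is below 1.\<close>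

lemma unique: "wcong_closed A (NRec X E)"
proof -
  have "wcong_half (subst1 E X A) (subst1 E X (NRec X E))" by (rule Ctx_strong_half[OF ctx]) (use c1 Cx_wbisim in auto)
  moreover have "wcong_half (subst1 E X (NRec X E)) (subst1 E X A)"
  proof (rule Ctx_strong_half[OF Ctx_conv[OF ctx]])
    fix x y assume "Cx (\<lambda>x y. B y x) x y"
    from Cx_conv[OF this] have "Cx B y x" by simp
    then show "wbisim x y" using Cx_wbisim wbisim_sym by blast
  qed (use c1 in auto)
  moreover have "wcong_closed (subst1 E X (NRec X E)) (NRec X E)"
    by (rule wcong_closed_stp) (rule closed_unfold[OF cH], rule cH, rule stp_rec[symmetric])
  ultimately show ?thesis using sol wcong_closed_trans unfolding wcong_closed_iff by blast
qed

end

lemma wbisim_pairI: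
  assumes c: "closed_n P" "closed_n Q"
    and f: "\<And>a t. stp P a t \<Longrightarrow> \<exists>n. WTH a Q n \<and> rel_pmf (\<lambda>x y. wbisim x y \<or> (x = P \<and> y = Q)) t n"
    and b: "\<And>a t. stp Q a t \<Longrightarrow> \<exists>n. WTH a P n \<and> rel_pmf (\<lambda>x y. wbisim x y \<or> (x = Q \<and> y = P)) t n"
  shows "wbisim P Q"
proof (rule wbisimI[of "\<lambda>x y. wbisim x y \<or> (x = P \<and> y = Q)"])
  have w: "wsim (\<lambda>x y. wbisim x y \<or> (x = P \<and> y = Q))"
    if f: "\<And>a t. stp P a t \<Longrightarrow> \<exists>n. WTH a Q n \<and> rel_pmf (\<lambda>x y. wbisim x y \<or> (x = P \<and> y = Q)) t n" for P Q :: "('a, 'b) nexp"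
    unfolding wsim_def
  proof (intro allI impI)
    fix G H a t assume GH: "wbisim G H \<or> (G = P \<and> H = Q)" and s: "stp G a t"
    from GH show "\<exists>n. WTH a H n \<and> rel_pmf (\<lambda>x y. wbisim x y \<or> (x = P \<and> y = Q)) t n"
    proof
      assume "wbisim G H"
      then obtain n where n: "WTH a H n" "rel_pmf wbisim t n" using wsim_wbisim s unfolding wsim_def by blast
      have "rel_pmf (\<lambda>x y. wbisim x y \<or> (x = P \<and> y = Q)) t n" using n(2) by (rule pmf.rel_mono_strong) simp
      then show ?thesis using n(1) by blast
    qed (use f s in simp)
  qed
  have e: "(\<lambda>x y. wbisim y x \<or> (y = P \<and> x = Q)) = (\<lambda>x y. wbisim x y \<or> (x = Q \<and> y = P))" using wbisim_sym by (auto simp: fun_eq_iff)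
  show "weak_bisim (\<lambda>x y. wbisim x y \<or> (x = P \<and> y = Q))" unfolding weak_bisim_iff e
    using w[OF f] w[OF b] c wbisim_closed by blast
qed simp

lemma rel_pair_refl: "stp P a t \<Longrightarrow> closed_n P \<Longrightarrow> rel_pmf (\<lambda>x y. wbisim x y \<or> R x y) t t"
  by (rule rel_pmf_reflI) (auto intro: wbisim_refl stp_closed)

lemma rel_stp_refl: "stp P a t \<Longrightarrow> closed_n P \<Longrightarrow> rel_pmf wbisim t t"
  by (rule rel_pmf_reflI) (auto intro: wbisim_refl stp_closed)

lemma item_tau: "stp P Tau s \<Longrightarrow> (\<And>p. p \<in> set_pmf s \<Longrightarrow> stp p a t) \<Longrightarrow> WT a P t"
  using item_WT[of a P t] unfolding item_def
  by (metis WT_WTH WT_step bind_pmf_const)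

lemma closed_pd_subst: "closing \<sigma> \<Longrightarrow> p \<in> set_pmf (pdist (subst_p \<sigma> P)) \<Longrightarrow> closed_n p"
  by (erule pdist_closed[rotated]) (auto simp: fv_subst_sc(2)[OF closing_semiclosing] closing_def closed_n_def)

lemma wcong_def': "wcong E F \<longleftrightarrow> (\<forall>\<sigma>. closing \<sigma> \<longrightarrow> wcong_closed (subst_n \<sigma> E) (subst_n \<sigma> F))"
  by (simp add: wcong_def closing_def)

section \<open>Soundness of the axioms\<close>

text \<open>Lifted bisimilarity is enough here: probabilistic expressions occur only below a prefix,
  which already supplies a first step.\<close>

definition pcong :: "('a, 'v) pexp \<Rightarrow> ('a, 'v) pexp \<Rightarrow> bool" where
  "pcong P Q \<longleftrightarrow> (\<forall>\<sigma>. closing \<sigma> \<longrightarrow> rel_pmf wbisim (pdist (subst_p \<sigma> P)) (pdist (subst_p \<sigma> Q)))"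

lemma pcong_refl: "(\<And>\<sigma>. closing \<sigma> \<Longrightarrow> pdist (subst_p \<sigma> P) = pdist (subst_p \<sigma> Q)) \<Longrightarrow> pcong P Q"
  unfolding pcong_def using rel_wbisim_refl closed_pd_subst by metis

lemma wcong_stp: "(\<And>\<sigma> a t. closing \<sigma> \<Longrightarrow> stp (subst_n \<sigma> E) a t \<longleftrightarrow> stp (subst_n \<sigma> F) a t) \<Longrightarrow> wcong E F"
  unfolding wcong_def' using wcong_closed_stp closed_subst by blast

lemma wcong_pre: "pcong (P :: ('b, 'c) pexp) Q \<Longrightarrow> wcong (NPre a P) (NPre a Q)"
proof -
  assume pq: "pcong P Q"
  have h: "wcong_half (NPre a p) (NPre a q)" if "rel_pmf wbisim (pdist p) (pdist q)" for p q :: "('b, 'c) pexp" and a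
    unfolding wcong_half_def
  proof (intro allI impI)
    fix b t assume "stp (NPre a p) b t"
    then have "b = a" "t = pdist p" by (auto simp: stp_pre)
    moreover have "WT a (NPre a q) (pdist q)" by (rule WT_step) (simp add: stp_pre)
    ultimately show "\<exists>n. WT b (NPre a q) n \<and> rel_pmf wbisim t n" using that by blast
  qed
  show ?thesis unfolding wcong_def' wcong_closed_iff subst_n.simps
    using pq h rel_wbisim_sym unfolding pcong_def by blast
qed

lemma wcong_half_sum: assumes "wcong_half E E'" "wcong_half F F'" shows "wcong_half (NSum E F) (NSum E' F')"
  unfolding wcong_half_def
proof (intro allI impI)
  fix a t assume "stp (NSum E F) a t"
  then have "stp E a t \<or> stp F a t" by (simp add: stp_sum)
  then show "\<exists>n. WT a (NSum E' F') n \<and> rel_pmf wbisim t n"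
  proof
    assume "stp E a t"
    then obtain n where n: "WT a E' n" "rel_pmf wbisim t n" using assms unfolding wcong_half_def by blast
    have "WT a (NSum E' F') n" by (rule WT_mono_stp[OF _ n(1)]) (simp add: stp_sum)
    then show ?thesis using n(2) by blast
  next
    assume "stp F a t"
    then obtain n where n: "WT a F' n" "rel_pmf wbisim t n" using assms unfolding wcong_half_def by blast
    have "WT a (NSum E' F') n" by (rule WT_mono_stp[OF _ n(1)]) (simp add: stp_sum)
    then show ?thesis using n(2) by blast
  qed
qed

lemma wcong_sum: "wcong E E' \<Longrightarrow> wcong F F' \<Longrightarrow> wcong (NSum E F) (NSum E' F')"
  unfolding wcong_def' wcong_closed_iff subst_n.simps using wcong_half_sum by blast

lemma pcong_dirac: "wcong E F \<Longrightarrow> pcong (PDirac E) (PDirac F)"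
  unfolding wcong_def' pcong_def subst_p.simps pdist.simps using wcong_closed_wbisim closed_subst by (metis rel_return_pmf)

lemma pcong_choice: assumes "pcong P P'" "pcong Q Q'" shows "pcong (PChoice P p Q) (PChoice P' p Q')"
  unfolding pcong_def
proof (intro allI impI)
  fix \<sigma> :: "'b \<Rightarrow> ('a, 'b) nexp" assume "closing \<sigma>"
  then show "rel_pmf wbisim (pdist (subst_p \<sigma> (PChoice P p Q))) (pdist (subst_p \<sigma> (PChoice P' p Q')))"
    unfolding subst_p.simps pdist.simps by (intro rel_pmf_bind_set) (use assms in \<open>auto simp: pcong_def\<close>)
qed

lemma wcong_trans: "wcong E F \<Longrightarrow> wcong F G \<Longrightarrow> wcong E G"
  unfolding wcong_def' using wcong_closed_trans by blast

text \<open>If the bodies agree on every closed argument, then a recursion, being a solution of its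
  own equation, also solves the other one.\<close>

lemma rec_body_cong:
  fixes E :: "('a, 'v::infinite) nexp"
  assumes c: "closed_n (NRec X E)" "closed_n (NRec Y F)"
    and b: "\<And>Z. closed_n Z \<Longrightarrow> wcong_closed (subst1 E X Z) (subst1 F Y Z)"
  shows "wcong_closed (NRec X E) (NRec Y F)"
proof (rule rec_mutual_solutions[OF c])
  have u: "wcong_closed (NRec V G) (subst1 G V (NRec V G))" if "closed_n (NRec V G)" for V and G :: "('a, 'v) nexp"
    by (rule wcong_closed_stp) (rule that, rule closed_unfold[OF that], rule stp_rec)
  show "wcong_closed (NRec Y F) (subst1 E X (NRec Y F))"
    using u[OF c(2)] b[OF c(2)] wcong_closed_trans wcong_closed_sym by blast
  show "wcong_closed (NRec X E) (subst1 F Y (NRec X E))"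
    using u[OF c(1)] b[OF c(1)] wcong_closed_trans by blast
qed

lemma closed_rec_subst: "closing \<sigma> \<Longrightarrow> closed_n (NRec X (subst_n (\<sigma>(X := NVar X)) E))"
  using closed_subst[of \<sigma> "NRec X E"] subst_rec_sc[OF closing_semiclosing, of \<sigma> X E] by simp

lemma wcong_rec:
  fixes E :: "('a, 'v::infinite) nexp"
  assumes "wcong E F" shows "wcong (NRec X E) (NRec X F)"
  unfolding wcong_def'
proof (intro allI impI)
  fix \<sigma> :: "'v \<Rightarrow> ('a, 'v) nexp" assume closing: "closing \<sigma>"
  show "wcong_closed (subst_n \<sigma> (NRec X E)) (subst_n \<sigma> (NRec X F))"
    unfolding subst_rec_sc[OF closing_semiclosing[OF closing]]
  proof (rule rec_body_cong[OF closed_rec_subst[OF closing] closed_rec_subst[OF closing]])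
    fix Z :: "('a, 'v) nexp" assume "closed_n Z"
    then show "wcong_closed (subst1 (subst_n (\<sigma>(X := NVar X)) E) X Z) (subst1 (subst_n (\<sigma>(X := NVar X)) F) X Z)"
      unfolding unfold_subst[OF closing \<open>closed_n Z\<close>] using assms closing_upd[OF closing] unfolding wcong_def' by blast
  qed
qed

text \<open>The two sides can differ in the bound names picked by \<open>fresh_var\<close>, so
  congruence takes the place of equality.\<close>

lemma subst_subst1_wcong:
  fixes E :: "('a, 'v::infinite) nexp"
  assumes "closing \<sigma>" shows "wcong_closed (subst_n \<sigma> (subst1 E X F)) (subst_n (\<sigma>(X := subst_n \<sigma> F)) E)"
proof (rule inst_wcong)
  show "inst (subst_n \<sigma> (subst1 E X F)) E (\<lambda>Z. subst_n \<sigma> ((NVar(X := F)) Z))"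
    unfolding inst_def subst1_def using assms by (intro exI[of _ \<sigma>] exI[of _ "NVar(X := F)"]) simp
  show "inst (subst_n (\<sigma>(X := subst_n \<sigma> F)) E) E (\<sigma>(X := subst_n \<sigma> F))"
    by (rule inst_self, rule closing_upd[OF assms], rule closed_subst[OF assms])
next
  fix Z show "closed_n (subst_n \<sigma> ((NVar(X := F)) Z))" by (rule closed_subst[OF assms])
qed simp

lemma wcong_alpha:
  fixes E :: "('a, 'v::infinite) nexp"
  assumes "Y \<notin> fv_n (NRec X E)" shows "wcong (NRec X E) (NRec Y (subst1 E X (NVar Y)))"
  unfolding wcong_def'
proof (intro allI impI)
  fix \<sigma> :: "'v \<Rightarrow> ('a, 'v) nexp" assume closing: "closing \<sigma>"
  show "wcong_closed (subst_n \<sigma> (NRec X E)) (subst_n \<sigma> (NRec Y (subst1 E X (NVar Y))))"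
    unfolding subst_rec_sc[OF closing_semiclosing[OF closing]]
  proof (rule rec_body_cong[OF closed_rec_subst[OF closing] closed_rec_subst[OF closing]])
    fix Z :: "('a, 'v) nexp" assume Z: "closed_n Z"
    have "subst_n ((\<sigma>(Y := Z))(X := Z)) E = subst_n (\<sigma>(X := Z)) E"
      by (rule subst_cong) (use assms in auto)
    then show "wcong_closed (subst1 (subst_n (\<sigma>(X := NVar X)) E) X Z) (subst1 (subst_n (\<sigma>(Y := NVar Y)) (subst1 E X (NVar Y))) Y Z)"
      unfolding unfold_subst[OF closing Z] using wcong_closed_sym[OF subst_subst1_wcong[OF closing_upd[OF closing Z], of Y E X "NVar Y"]] by simp
  qed
qed

lemma wcong_unfold:
  fixes E :: "('a, 'v::infinite) nexp" shows "wcong (NRec X E) (subst1 E X (NRec X E))"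
  unfolding wcong_def'
proof (intro allI impI)
  fix \<sigma> :: "'v \<Rightarrow> ('a, 'v) nexp" assume closing: "closing \<sigma>"
  let ?H = "subst_n \<sigma> (NRec X E)"
  have H: "?H = NRec X (subst_n (\<sigma>(X := NVar X)) E)" by (rule subst_rec_sc[OF closing_semiclosing[OF closing]])
  have "wcong_closed ?H (subst_n (\<sigma>(X := ?H)) E)"
    unfolding unfold_subst[OF closing closed_subst[OF closing, of "NRec X E"], symmetric]
    unfolding H
  proof (rule wcong_closed_stp)
    show "closed_n (NRec X (subst_n (\<sigma>(X := NVar X)) E))" by (rule closed_rec_subst[OF closing])
    then show "closed_n (subst1 (subst_n (\<sigma>(X := NVar X)) E) X (NRec X (subst_n (\<sigma>(X := NVar X)) E)))" by (rule closed_unfold)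
  qed (rule stp_rec)
  then show "wcong_closed ?H (subst_n \<sigma> (subst1 E X (NRec X E)))"
    using subst_subst1_wcong[OF closing, of E X "NRec X E"] wcong_closed_trans wcong_closed_sym by blast
qed

lemma wcong_unique:
  fixes E :: "('a, 'v::infinite) nexp"
  assumes F: "wcong F (subst1 E X F)" and g: "\<not> unguarded X E" shows "wcong F (NRec X E)"
  unfolding wcong_def'
proof (intro allI impI)
  fix \<sigma> :: "'v \<Rightarrow> ('a, 'v) nexp" assume closing: "closing \<sigma>"
  define A where "A = subst_n \<sigma> F"
  define E0 where "E0 = subst_n (\<sigma>(X := NVar X)) E"
  define H where "H = NRec X E0"
  have cA: "closed_n A" unfolding A_def by (rule closed_subst[OF closing])
  have cH: "closed_n H" unfolding H_def E0_def by (rule closed_rec_subst[OF closing])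
  have u: "subst1 E0 X Z = subst_n (\<sigma>(X := Z)) E" if "closed_n Z" for Z unfolding E0_def by (rule unfold_subst[OF closing that])
  \<comment> \<open>Only the hole \<open>X\<close> is filled differently on the two sides; all other
    fillers coincide and get potential 0.\<close>
  let ?w = "\<lambda>Z. if Z = X then 1 else 0"
  interpret guarded_equation A X E0 "val_n ?w E" "\<lambda>x y. x = A \<and> y = NRec X E0"
  proof (unfold_locales, goal_cases)
    \<comment> \<open>Goals 3 and 4 are the assumptions \<open>sol\<close> and
      \<open>ctx\<close>.\<close>
    case 3
    have "wcong_closed A (subst_n \<sigma> (subst1 E X F))" using F closing unfolding wcong_def' A_def by blast
    moreover have "wcong_closed (subst_n \<sigma> (subst1 E X F)) (subst1 E0 X A)"
      unfolding u[OF cA] unfolding A_def by (rule subst_subst1_wcong[OF closing])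
    ultimately show ?case by (rule wcong_closed_trans)
  next
    case 4
    show ?case unfolding u[OF cA] u[OF cH, unfolded H_def]
    proof (rule Ctx_inst)
      show "inst (subst_n (\<sigma>(X := A)) E) E (\<sigma>(X := A))" by (rule inst_self[OF closing_upd[OF closing cA]])
      show "inst (subst_n (\<sigma>(X := NRec X E0)) E) E (\<sigma>(X := NRec X E0))" by (rule inst_self[OF closing_upd[OF closing cH[unfolded H_def]]])
      fix Z show "Ctx (\<lambda>x y. x = A \<and> y = NRec X E0) ((\<sigma>(X := A)) Z) ((\<sigma>(X := NRec X E0)) Z) (?w Z)"
        using cA cH closing by (auto simp: H_def closing_def intro: Ctx_base Ctx_refl)
    qed simp
  qed (use cA cH guarded_val[OF g] in \<open>auto simp: H_def\<close>)
  show "wcong_closed (subst_n \<sigma> F) (subst_n \<sigma> (NRec X E))"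
    using unique unfolding A_def E0_def subst_rec_sc[OF closing_semiclosing[OF closing]] .
qed

section \<open>Axioms for probabilistic choice, internal actions and convexity\<close>

lemma Rep_Abs: "0 < p \<Longrightarrow> p < 1 \<Longrightarrow> Rep_prob (Abs_prob p) = p"
  by (rule Abs_prob_inverse) simp

lemma pcong_P1: "pcong (PChoice P p Q) (PChoice Q (Abs_prob (1 - Rep_prob p)) P)"
  by (rule pcong_refl, rule pmf_eqI)
     (use Rep_prob_bounds[of p] in \<open>simp add: pmf_pd_choice Rep_Abs del: pdist.simps\<close>)

lemma pcong_P2:
  assumes "0 < p" "0 < q" "p + q < 1"
  shows "pcong (PChoice P (Abs_prob p) (PChoice Q (Abs_prob (q / (1 - p))) R))
           (PChoice (PChoice P (Abs_prob (p / (p + q))) Q) (Abs_prob (p + q)) R)"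
proof (rule pcong_refl, rule pmf_eqI)
  fix \<sigma> :: "'b \<Rightarrow> ('a, 'b) nexp" and u
  have 1: "Rep_prob (Abs_prob p) = p" "Rep_prob (Abs_prob (q / (1 - p))) = q / (1 - p)"
     "Rep_prob (Abs_prob (p / (p + q))) = p / (p + q)" "Rep_prob (Abs_prob (p + q)) = p + q"
    using assms by (intro Rep_Abs; simp add: field_simps)+
  have e: "(1 - p) * (q / (1 - p)) = q" "(1 - p) * (1 - q / (1 - p)) = 1 - p - q" "(p + q) * (p / (p + q)) = p"
    "(p + q) * (1 - p / (p + q)) = q" using assms by (auto simp: right_diff_distrib)
  have a: "p * x + (1 - p) * (q / (1 - p) * y + (1 - q / (1 - p)) * z) = p * x + ((1 - p) * (q / (1 - p))) * y + ((1 - p) * (1 - q / (1 - p))) * z" for x y z :: real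
    by (simp only: distrib_left mult.assoc add.assoc)
  have b: "(p + q) * (p / (p + q) * x + (1 - p / (p + q)) * y) + (1 - (p + q)) * z = ((p + q) * (p / (p + q))) * x + ((p + q) * (1 - p / (p + q))) * y + (1 - (p + q)) * z" for x y z :: real
    by (simp only: distrib_left mult.assoc add.assoc)
  show "pmf (pdist (subst_p \<sigma> (PChoice P (Abs_prob p) (PChoice Q (Abs_prob (q / (1 - p))) R)))) u =
      pmf (pdist (subst_p \<sigma> (PChoice (PChoice P (Abs_prob (p / (p + q))) Q) (Abs_prob (p + q)) R))) u"
    unfolding subst_p.simps pmf_pd_choice 1 a b unfolding e by (simp add: algebra_simps)
qed

lemma pcong_P3: "pcong (PChoice P p P) P"
  by (rule pcong_refl) simp

lemma tau_wbisim: assumes "closed_n E" shows "wbisim (npref Tau E) E"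
proof (rule wbisim_pairI)
  show "closed_n (npref Tau E)" using assms by (simp add: closed_n_def)
  show "\<exists>n. WTH a E n \<and> rel_pmf (\<lambda>x y. wbisim x y \<or> (x = npref Tau E \<and> y = E)) t n" if "stp (npref Tau E) a t" for a t
    using that wbisim_refl[OF assms] by (intro exI[of _ "return_pmf E"]) (simp add: stp_pre WTH_def WK_return)
  show "\<exists>n. WTH a (npref Tau E) n \<and> rel_pmf (\<lambda>x y. wbisim x y \<or> (x = E \<and> y = npref Tau E)) t n" if "stp E a t" for a t
  proof -
    have "WT a (npref Tau E) t" by (rule item_tau[of _ "return_pmf E"]) (use that in \<open>auto simp: stp_pre\<close>)
    then show ?thesis using rel_pair_refl[OF that assms] by (intro exI[of _ t] conjI WT_WTH)
  qed
qed (rule assms)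

lemma wcong_T1: "wcong (NPre a (PChoice (PDirac (npref Tau E)) p P)) (NPre a (PChoice (PDirac E) p P))"
proof (rule wcong_pre, unfold pcong_def, intro allI impI)
  fix \<sigma> :: "'b \<Rightarrow> ('a, 'b) nexp" assume closing: "closing \<sigma>"
  show "rel_pmf wbisim (pdist (subst_p \<sigma> (PChoice (PDirac (npref Tau E)) p P))) (pdist (subst_p \<sigma> (PChoice (PDirac E) p P)))"
    unfolding subst_p.simps pdist.simps
  proof (rule rel_pmf_bind_set)
    fix b
    have "rel_pmf wbisim (pdist (subst_p \<sigma> P)) (pdist (subst_p \<sigma> P))" by (rule rel_wbisim_refl, rule closed_pd_subst[OF closing])
    then show "rel_pmf wbisim (if b then return_pmf (subst_n \<sigma> (npref Tau E)) else pdist (subst_p \<sigma> P))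
       (if b then return_pmf (subst_n \<sigma> E) else pdist (subst_p \<sigma> P))"
      using tau_wbisim[OF closed_subst[OF closing, of E]] by simp
  qed
qed

lemma bigoplus_pmf:
  "(\<forall>x\<in>set xs. 0 < fst x) \<Longrightarrow> sum_list (map fst xs) = 1 \<Longrightarrow> xs \<noteq> [] \<Longrightarrow>
    pmf (pdist (bigoplus xs)) u = (\<Sum>x\<leftarrow>xs. fst x * pmf (pdist (snd x)) u)"
proof (induction xs rule: bigoplus.induct)
  case (3 p P y ys)
  let ?r = "map (\<lambda>(q, Q). (q / (1 - p), Q)) (y # ys)"
  have p: "0 < p" using 3(2) by simp
  have "0 < fst y" using 3(2) by simp
  moreover have "0 \<le> sum_list (map fst ys)" by (rule sum_list_nonneg) (use 3(2) in force)
  moreover have s: "sum_list (map fst (y # ys)) = 1 - p" using 3(3) by simp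
  \<comment> \<open>A second entry of positive weight exists, so \<open>p < 1\<close> and
    \<open>Abs_prob p\<close> is meaningful.\<close>
  ultimately have p1: "p < 1" by simp
  have fs: "map fst ?r = map (\<lambda>x. fst x * (1 / (1 - p))) (y # ys)" by (auto simp: case_prod_beta)
  have "sum_list (map fst ?r) = sum_list (map fst (y # ys)) * (1 / (1 - p))" unfolding fs sum_list_mult_const by simp
  then have "sum_list (map fst ?r) = 1" using s p1 by simp
  moreover have "\<forall>x\<in>set ?r. 0 < fst x" using 3(2) p1 by (auto simp: case_prod_beta)
  ultimately have IH: "pmf (pdist (bigoplus ?r)) u = (\<Sum>x\<leftarrow>?r. fst x * pmf (pdist (snd x)) u)" using 3(1) by blast
  have "(\<Sum>x\<leftarrow>?r. fst x * pmf (pdist (snd x)) u) = (\<Sum>x\<leftarrow>y # ys. (1 / (1 - p)) * (fst x * pmf (pdist (snd x)) u))"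
    by (simp add: case_prod_beta comp_def)
  also have "\<dots> = (1 / (1 - p)) * (\<Sum>x\<leftarrow>y # ys. fst x * pmf (pdist (snd x)) u)" by (rule sum_list_const_mult)
  finally have "(1 - p) * pmf (pdist (bigoplus ?r)) u = (\<Sum>x\<leftarrow>y # ys. fst x * pmf (pdist (snd x)) u)" unfolding IH using p1 by simp
  then show ?case unfolding bigoplus.simps pmf_pd_choice Rep_Abs[OF p p1] by simp
qed auto

text \<open>The weights are kept as a distribution on list indices, so that several sums over the same index
  set share it.\<close>
lemma bigoplus_index:
  assumes "valid_weights xs"
  shows "\<exists>W. set_pmf W = {..<length xs} \<and> (\<forall>f :: _ \<Rightarrow> ('a, 'v) pexp. pdist (bigoplus (map (\<lambda>x. (fst x, f x)) xs)) = bind_pmf W (\<lambda>i. pdist (f (xs ! i))))"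
proof -
  have v: "xs \<noteq> []" "\<And>i. i < length xs \<Longrightarrow> 0 < fst (xs ! i)" "sum_list (map fst xs) = 1" using assms by (auto simp: valid_weights_def)
  let ?w = "\<lambda>i. if i < length xs then ennreal (fst (xs ! i)) else 0"
  have "nsum ?w = (\<Sum>i<length xs. ?w i)" by (rule nn_integral_count_space') auto
  also have "\<dots> = (\<Sum>i<length xs. ennreal (fst (xs ! i)))" by (rule sum.cong) auto
  also have "\<dots> = ennreal (\<Sum>i<length xs. fst (xs ! i))" by (rule sum_ennreal) (use v(2) in \<open>auto dest: order.strict_implies_order\<close>)
  also have "(\<Sum>i<length xs. fst (xs ! i)) = 1" using v(3) by (simp add: sum_list_sum_nth atLeast0LessThan)
  finally obtain W where W: "\<And>i. ep W i = ?w i" using pmf_of_weights[of ?w] by auto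
  have "i \<in> set_pmf W \<longleftrightarrow> i < length xs" for i using W[of i] v(2)[of i] unfolding ep_nz[symmetric] by (auto simp: ennreal_eq_0_iff)
  then have sW: "set_pmf W = {..<length xs}" by auto
  have pW: "pmf W i = fst (xs ! i)" if "i < length xs" for i using W[of i] that v(2)[OF that] by (metis ennreal_inj less_imp_le pmf_nonneg)
  have "pdist (bigoplus (map (\<lambda>x. (fst x, f x)) xs)) = bind_pmf W (\<lambda>i. pdist (f (xs ! i)))" for f :: "_ \<Rightarrow> ('a, 'v) pexp"
  proof (rule pmf_eqI)
    fix u
    have "pmf (bind_pmf W (\<lambda>i. pdist (f (xs ! i)))) u = (\<Sum>i<length xs. fst (xs ! i) * pmf (pdist (f (xs ! i))) u)"
      unfolding pmf_bind by (subst integral_measure_pmf[of "{..<length xs}"]) (auto simp: sW pW intro!: sum.cong)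
    also have "\<dots> = (\<Sum>x\<leftarrow>map (\<lambda>x. (fst x, f x)) xs. fst x * pmf (pdist (snd x)) u)"
      by (simp add: sum_list_sum_nth atLeast0LessThan comp_def)
    also have "\<dots> = pmf (pdist (bigoplus (map (\<lambda>x. (fst x, f x)) xs))) u"
      by (rule bigoplus_pmf[symmetric]) (use assms in \<open>auto simp: valid_weights_def comp_def\<close>)
    finally show "pmf (pdist (bigoplus (map (\<lambda>x. (fst x, f x)) xs))) u = pmf (bind_pmf W (\<lambda>i. pdist (f (xs ! i)))) u" by simp
  qed
  then show ?thesis using sW by blast
qed

lemma subst_bigoplus: "subst_p \<sigma> (bigoplus ys) = bigoplus (map (\<lambda>(p, P). (p, subst_p \<sigma> P)) ys)"
  by (induction ys rule: bigoplus.induct) (simp_all add: case_prod_beta comp_def)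

lemma pdist_subst_bigoplus:
  assumes "valid_weights xs"
  shows "\<exists>W. set_pmf W = {..<length xs} \<and>
     (\<forall>\<sigma> (f :: _ \<Rightarrow> ('a, 'v) pexp). pdist (subst_p \<sigma> (bigoplus (map (\<lambda>x. (fst x, f x)) xs))) = bind_pmf W (\<lambda>i. pdist (subst_p \<sigma> (f (xs ! i)))))"
proof -
  obtain W where W: "set_pmf W = {..<length xs}" "\<And>f :: _ \<Rightarrow> ('a, 'v) pexp. pdist (bigoplus (map (\<lambda>x. (fst x, f x)) xs)) = bind_pmf W (\<lambda>i. pdist (f (xs ! i)))"
    using bigoplus_index[OF assms] by blast
  have "pdist (subst_p \<sigma> (bigoplus (map (\<lambda>x. (fst x, f x)) xs))) = bind_pmf W (\<lambda>i. pdist (subst_p \<sigma> (f (xs ! i))))" for \<sigma> and f :: "_ \<Rightarrow> ('a, 'v) pexp"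
    unfolding subst_bigoplus using W(2)[of "\<lambda>x. subst_p \<sigma> (f x)"] by (simp add: comp_def)
  then show ?thesis using W(1) by blast
qed

lemma wcong_T2:
  assumes "valid_weights xs"
  shows "wcong (NSum (NPre Tau (bigoplus (map (\<lambda>(p, E). (p, PDirac (NSum E F))) xs))) F)
           (NPre Tau (bigoplus (map (\<lambda>(p, E). (p, PDirac (NSum E F))) xs)))"
  unfolding wcong_def'
proof (intro allI impI)
  fix \<sigma> :: "'b \<Rightarrow> ('a, 'b) nexp" assume closing: "closing \<sigma>"
  let ?B = "bigoplus (map (\<lambda>(p, E). (p, PDirac (NSum E F))) xs)"
  obtain W where W: "\<And>\<sigma> (f :: real \<times> ('a, 'b) nexp \<Rightarrow> ('a, 'b) pexp). pdist (subst_p \<sigma> (bigoplus (map (\<lambda>x. (fst x, f x)) xs))) =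
     bind_pmf W (\<lambda>i. pdist (subst_p \<sigma> (f (xs ! i))))" using pdist_subst_bigoplus[OF assms] by blast
  have B: "pdist (subst_p \<sigma> ?B) = bind_pmf W (\<lambda>i. return_pmf (NSum (subst_n \<sigma> (snd (xs ! i))) (subst_n \<sigma> F)))"
    using W[of \<sigma> "\<lambda>x. PDirac (NSum (snd x) F)"] by (simp add: case_prod_beta')
  have c: "closed_n (subst_n \<sigma> G)" for G :: "('a, 'b) nexp" by (rule closed_subst[OF closing])
  have "wcong_half (subst_n \<sigma> (NSum (NPre Tau ?B) F)) (subst_n \<sigma> (NPre Tau ?B))"
  proof (rule wcong_half_stp[OF c])
    fix a t assume "stp (subst_n \<sigma> (NSum (NPre Tau ?B) F)) a t"
    then have "stp (NPre Tau (subst_p \<sigma> ?B)) a t \<or> stp (subst_n \<sigma> F) a t" by (simp add: stp_sum)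
    then show "WT a (subst_n \<sigma> (NPre Tau ?B)) t"
    proof
      assume "stp (subst_n \<sigma> F) a t"
      then show ?thesis by (intro item_tau[of _ "pdist (subst_p \<sigma> ?B)"]) (auto simp: stp_pre B stp_sum)
    qed (simp add: WT_step)
  qed
  moreover have "wcong_half (subst_n \<sigma> (NPre Tau ?B)) (subst_n \<sigma> (NSum (NPre Tau ?B) F))"
    by (rule wcong_half_stp[OF c]) (simp add: WT_step stp_sum)
  ultimately show "wcong_closed (subst_n \<sigma> (NSum (NPre Tau ?B) F)) (subst_n \<sigma> (NPre Tau ?B))" unfolding wcong_closed_iff ..
qed

text \<open>The pattern of T3 and T4: the extra summand offers a transition that the rest already
  has as a weak one.\<close>

lemma wcong_absorb:
  fixes E :: "('a, 'b) nexp"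
  assumes "\<And>\<sigma>. closing \<sigma> \<Longrightarrow> WT a (subst_n \<sigma> E) (pdist (subst_p \<sigma> P))"
  shows "wcong (NSum E (NPre a P)) E"
  unfolding wcong_def'
proof (intro allI impI)
  fix \<sigma> :: "'b \<Rightarrow> ('a, 'b) nexp" assume closing: "closing \<sigma>"
  have c: "closed_n (subst_n \<sigma> G)" for G :: "('a, 'b) nexp" by (rule closed_subst[OF closing])
  have "wcong_half (subst_n \<sigma> (NSum E (NPre a P))) (subst_n \<sigma> E)"
    by (rule wcong_half_stp[OF c]) (use assms[OF closing] in \<open>auto simp: stp_sum stp_pre intro: WT_step\<close>)
  moreover have "wcong_half (subst_n \<sigma> E) (subst_n \<sigma> (NSum E (NPre a P)))"
    by (rule wcong_half_stp[OF c]) (simp add: WT_step stp_sum)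
  ultimately show "wcong_closed (subst_n \<sigma> (NSum E (NPre a P))) (subst_n \<sigma> E)" unfolding wcong_closed_iff ..
qed

lemma wcong_T3:
  assumes "valid_weights xs"
  shows "wcong (NSum (NPre Tau (bigoplus (map (\<lambda>(p, E, P). (p, PDirac (NSum E (NPre a P)))) xs)))
                 (NPre a (bigoplus (map (\<lambda>(p, E, P). (p, P)) xs))))
           (NPre Tau (bigoplus (map (\<lambda>(p, E, P). (p, PDirac (NSum E (NPre a P)))) xs)))"
proof (rule wcong_absorb)
  fix \<sigma> :: "'b \<Rightarrow> ('a, 'b) nexp" assume closing: "closing \<sigma>"
  obtain W where W: "\<And>\<sigma> (f :: real \<times> ('a, 'b) nexp \<times> ('a, 'b) pexp \<Rightarrow> ('a, 'b) pexp). pdist (subst_p \<sigma> (bigoplus (map (\<lambda>x. (fst x, f x)) xs))) =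
     bind_pmf W (\<lambda>i. pdist (subst_p \<sigma> (f (xs ! i))))" using pdist_subst_bigoplus[OF assms] by blast
  let ?f = "\<lambda>i. NSum (subst_n \<sigma> (fst (snd (xs ! i)))) (NPre a (subst_p \<sigma> (snd (snd (xs ! i)))))"
  have 1: "pdist (subst_p \<sigma> (bigoplus (map (\<lambda>(p, E, P). (p, PDirac (NSum E (NPre a P)))) xs))) = map_pmf ?f W"
    using W[of \<sigma> "\<lambda>x. PDirac (NSum (fst (snd x)) (NPre a (snd (snd x))))"] by (simp add: case_prod_beta' map_pmf_def)
  have 2: "pdist (subst_p \<sigma> (bigoplus (map (\<lambda>(p, E, P). (p, P)) xs))) = bind_pmf W (\<lambda>i. pdist (subst_p \<sigma> (snd (snd (xs ! i)))))"
    using W[of \<sigma> "\<lambda>x. snd (snd x)"] by (simp add: case_prod_beta')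
  show "WT a (subst_n \<sigma> (NPre Tau (bigoplus (map (\<lambda>(p, E, P). (p, PDirac (NSum E (NPre a P)))) xs))))
     (pdist (subst_p \<sigma> (bigoplus (map (\<lambda>(p, E, P). (p, P)) xs))))"
    unfolding 2
  \<comment> \<open>The continuation depends on the index: different indices may lead to the same
    state with different \<open>P\<close>.\<close>
  proof (rule WT_Tau_WTH_label[of _ ?f])
    show "WT Tau (subst_n \<sigma> (NPre Tau (bigoplus (map (\<lambda>(p, E, P). (p, PDirac (NSum E (NPre a P)))) xs)))) (map_pmf ?f W)"
      by (rule WT_step) (simp add: stp_pre 1)
  qed (auto intro!: WT_WTH WT_step simp: stp_sum stp_pre)
qed

lemma wcong_T4:
  assumes "valid_weights xs"
  shows "wcong (NSum (NPre a (bigoplus (map (\<lambda>(p, E, P). (p, PDirac (NSum E (NPre Tau P)))) xs)))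
                 (NPre a (bigoplus (map (\<lambda>(p, E, P). (p, P)) xs))))
           (NPre a (bigoplus (map (\<lambda>(p, E, P). (p, PDirac (NSum E (NPre Tau P)))) xs)))"
proof (rule wcong_absorb)
  fix \<sigma> :: "'b \<Rightarrow> ('a, 'b) nexp" assume closing: "closing \<sigma>"
  obtain W where W: "\<And>\<sigma> (f :: real \<times> ('a, 'b) nexp \<times> ('a, 'b) pexp \<Rightarrow> ('a, 'b) pexp). pdist (subst_p \<sigma> (bigoplus (map (\<lambda>x. (fst x, f x)) xs))) =
     bind_pmf W (\<lambda>i. pdist (subst_p \<sigma> (f (xs ! i))))" using pdist_subst_bigoplus[OF assms] by blast
  let ?f = "\<lambda>i. NSum (subst_n \<sigma> (fst (snd (xs ! i)))) (NPre Tau (subst_p \<sigma> (snd (snd (xs ! i)))))"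
  have 1: "pdist (subst_p \<sigma> (bigoplus (map (\<lambda>(p, E, P). (p, PDirac (NSum E (NPre Tau P)))) xs))) = map_pmf ?f W"
    using W[of \<sigma> "\<lambda>x. PDirac (NSum (fst (snd x)) (NPre Tau (snd (snd x))))"] by (simp add: case_prod_beta' map_pmf_def)
  have 2: "pdist (subst_p \<sigma> (bigoplus (map (\<lambda>(p, E, P). (p, P)) xs))) = bind_pmf W (\<lambda>i. pdist (subst_p \<sigma> (snd (snd (xs ! i)))))"
    using W[of \<sigma> "\<lambda>x. snd (snd x)"] by (simp add: case_prod_beta')
  show "WT a (subst_n \<sigma> (NPre a (bigoplus (map (\<lambda>(p, E, P). (p, PDirac (NSum E (NPre Tau P)))) xs))))
     (pdist (subst_p \<sigma> (bigoplus (map (\<lambda>(p, E, P). (p, P)) xs))))"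
    unfolding 2
  proof (rule WT_WK_label[of _ _ ?f])
    show "WT a (subst_n \<sigma> (NPre a (bigoplus (map (\<lambda>(p, E, P). (p, PDirac (NSum E (NPre Tau P)))) xs)))) (map_pmf ?f W)"
      by (rule WT_step) (simp add: stp_pre 1)
  qed (auto intro!: WK_step simp: stp_sum stp_pre)
qed

text \<open>The middle summand offers a convex combination of the two outer transitions, and
  combined transitions allow exactly that.\<close>

lemma wcong_C: "wcong (NSum (NPre a P) (NPre a Q)) (NSum (NSum (NPre a P) (NPre a (PChoice P p Q))) (NPre a Q))"
  unfolding wcong_def'
proof (intro allI impI)
  fix \<sigma> :: "'b \<Rightarrow> ('a, 'b) nexp" assume closing: "closing \<sigma>"
  let ?L = "subst_n \<sigma> (NSum (NPre a P) (NPre a Q))" and ?R = "subst_n \<sigma> (NSum (NSum (NPre a P) (NPre a (PChoice P p Q))) (NPre a Q))"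
  have "WT a ?L (pdist (subst_p \<sigma> (PChoice P p Q)))"
    unfolding subst_p.simps pdist.simps by (rule WT_mix) (auto simp: stp_sum stp_pre intro!: WT_step)
  then have "wcong_half ?R ?L"
    by (intro wcong_half_stp[OF closed_subst[OF closing]]) (auto simp: stp_sum stp_pre simp del: pdist.simps intro: WT_step)
  moreover have "wcong_half ?L ?R"
    by (rule wcong_half_stp[OF closed_subst[OF closing]]) (auto simp: stp_sum stp_pre intro!: WT_step)
  ultimately show "wcong_closed ?L ?R" unfolding wcong_closed_iff by blast
qed

text \<open>Two local checks remain: the recursion \<open>H\<close> of either side, whose
  transitions are given by its own body at \<open>H\<close>, must be congruent to the other body at
  \<open>H\<close>. The syntactic equation for \<open>B\<close> gives access to the number of
  unfoldings, as R4 requires.\<close>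

lemma wcong_recI:
  fixes E F :: "('a, 'v::infinite) nexp"
  assumes "\<And>\<sigma> H. closing \<sigma> \<Longrightarrow> closed_n H \<Longrightarrow> (\<exists>B. H = NRec X B \<and> subst1 B X H = subst_n (\<sigma>(X := H)) F) \<Longrightarrow>
       (\<And>a t. stp H a t \<longleftrightarrow> stp (subst_n (\<sigma>(X := H)) F) a t) \<Longrightarrow> wcong_closed H (subst_n (\<sigma>(X := H)) E)"
    and "\<And>\<sigma> H. closing \<sigma> \<Longrightarrow> closed_n H \<Longrightarrow> (\<exists>B. H = NRec X B \<and> subst1 B X H = subst_n (\<sigma>(X := H)) E) \<Longrightarrow>
       (\<And>a t. stp H a t \<longleftrightarrow> stp (subst_n (\<sigma>(X := H)) E) a t) \<Longrightarrow> wcong_closed H (subst_n (\<sigma>(X := H)) F)"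
  shows "wcong (NRec X E) (NRec X F)"
  unfolding wcong_def'
proof (intro allI impI)
  fix \<sigma> :: "'v \<Rightarrow> ('a, 'v) nexp" assume closing: "closing \<sigma>"
  have u: "subst1 (subst_n (\<sigma>(X := NVar X)) G) X H = subst_n (\<sigma>(X := H)) G" if "closed_n H" for G H by (rule unfold_subst[OF closing that])
  have c: "closed_n (NRec X (subst_n (\<sigma>(X := NVar X)) G))" for G by (rule closed_rec_subst[OF closing])
  have s: "stp (NRec X (subst_n (\<sigma>(X := NVar X)) G)) a t \<longleftrightarrow> stp (subst_n (\<sigma>(X := NRec X (subst_n (\<sigma>(X := NVar X)) G))) G) a t" for a t G
    by (subst stp_rec) (simp only: u[OF c])
  show "wcong_closed (subst_n \<sigma> (NRec X E)) (subst_n \<sigma> (NRec X F))"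
    unfolding subst_rec_sc[OF closing_semiclosing[OF closing]]
  proof (rule rec_mutual_solutions[OF c c], unfold u[OF c])
    show "wcong_closed (NRec X (subst_n (\<sigma>(X := NVar X)) F)) (subst_n (\<sigma>(X := NRec X (subst_n (\<sigma>(X := NVar X)) F))) E)"
      by (rule assms(1)[OF closing c _ s]) (use u[OF c] in blast)
    show "wcong_closed (NRec X (subst_n (\<sigma>(X := NVar X)) E)) (subst_n (\<sigma>(X := NRec X (subst_n (\<sigma>(X := NVar X)) E))) F)"
      by (rule assms(2)[OF closing c _ s]) (use u[OF c] in blast)
  qed
qed

text \<open>A transition that may lead back, with probability below 1, to states offering the same transition is
  repeated until it leaves them.\<close>
lemma WK_retry:
  assumes S: "stp S Tau t" and t: "\<And>u. ep t u = a u + b u" and a: "\<And>u. a u \<noteq> 0 \<Longrightarrow> stp u Tau t"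
    and \<rho>: "nsum a = ennreal \<rho>" "0 \<le> \<rho>" "\<rho> < 1" and m: "\<And>u. ep m u * ennreal (1 - \<rho>) = b u"
  shows "WK S m"
  unfolding WK_der flow_star_def
proof (intro exI conjI allI)
  define r where "r = ennreal \<rho>"
  \<comment> \<open>After the first step and \<open>j\<close> returns the mass \<open>r ^ j\<close>
    has arrived again; its share \<open>a\<close> tries once more and its share \<open>b\<close>
    leaves for good.\<close>
  let ?T = "\<lambda>j. case j of 0 \<Rightarrow> ep (return_pmf S) | Suc j \<Rightarrow> (\<lambda>u. r ^ j * a u)"
  let ?X = "\<lambda>j. case j of 0 \<Rightarrow> (\<lambda>_. 0) | Suc j \<Rightarrow> (\<lambda>u. r ^ j * b u)"
  show "flow_seq ?T ?X" unfolding flow_seq_def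
  proof
    fix j :: nat
    show "flow (Bst Tau) (?T j) (\<lambda>s. ?T (Suc j) s + ?X (Suc j) s)"
    proof (cases j)
      case 0
      have "flow (Bst Tau) (ep (return_pmf S)) (ep t)" using flow_base[of "(return_pmf S, t)" "Bst Tau"] S by (auto simp: Bst_def)
      then show ?thesis using 0 t by simp
    next
      case (Suc i)
      have "flow (Bst Tau) (\<lambda>s. nsum (\<lambda>u. (r ^ i * a u) * ep (return_pmf u) s)) (\<lambda>s. nsum (\<lambda>u. (r ^ i * a u) * ep t s))"
      proof (rule flow_nsum)
        fix u assume "r ^ i * a u \<noteq> 0"
        then have "(return_pmf u, t) \<in> Bst Tau" using a[of u] by (auto simp: Bst_def)
        from flow_base[OF this] show "flow (Bst Tau) (ep (return_pmf u)) (ep t)" by simp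
      qed
      moreover have "nsum (\<lambda>u. (r ^ i * a u) * ep t s) = r ^ Suc i * a s + r ^ Suc i * b s" for s
      proof -
        have "nsum (\<lambda>u. (r ^ i * a u) * ep t s) = r ^ i * nsum a * ep t s" by (simp only: nsum_multc nsum_cmult)
        then show ?thesis unfolding \<rho>(1) t r_def[symmetric] by (simp add: distrib_left ac_simps)
      qed
      ultimately show ?thesis unfolding nsum_ep_return' Suc by simp
    qed
  qed
  show "ep (return_pmf S) s = ?T 0 s + ?X 0 s" for s by simp
  have geo: "nsum (\<lambda>j. r ^ j) = ennreal (1 / (1 - \<rho>))"
  proof -
    have "(\<lambda>j. r ^ j) = (\<lambda>j. ennreal (\<rho> ^ j))" unfolding r_def using \<rho>(2) by (simp add: ennreal_power)
    then have "nsum (\<lambda>j. r ^ j) = (\<Sum>j. ennreal (\<rho> ^ j))" by (simp add: nn_integral_count_space_nat)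
    also have "\<dots> = ennreal (\<Sum>j. \<rho> ^ j)" by (rule suminf_ennreal2) (use \<rho> in \<open>auto intro: summable_geometric\<close>)
    also have "(\<Sum>j. \<rho> ^ j) = 1 / (1 - \<rho>)" by (rule suminf_geometric) (use \<rho> in auto)
    finally show ?thesis .
  qed
  have one: "ennreal (1 / (1 - \<rho>)) * ennreal (1 - \<rho>) = 1" using \<rho>(3) by (simp flip: ennreal_mult)
  show "ep m u = nsum (\<lambda>j. ?X j u)" for u
  proof -
    have "nsum (\<lambda>j. ?X j u) = nsum (\<lambda>j. r ^ j) * b u" by (subst nsum_nat_split) (simp add: nsum_multc)
    also have "\<dots> = ep m u * (ennreal (1 / (1 - \<rho>)) * ennreal (1 - \<rho>))" unfolding geo m[symmetric] by (simp only: ac_simps)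
    finally show ?thesis unfolding one by simp
  qed
qed

text \<open>Let \<open>?S\<close> be the state \<open>H + E\<close>, which can do whatever
  \<open>H\<close> can. If \<open>H\<close> solves the right side, \<open>?S\<close> reaches
  \<open>P\<close> in one step. If \<open>H\<close> solves the left side, \<open>?S\<close> returns
  to itself with probability \<open>p\<close>, and retrying until it leaves yields exactly
  \<open>P\<close>.\<close>

lemma wcong_R3:
  fixes E F :: "('a, 'v::infinite) nexp"
  shows "wcong (NRec X (NSum (NPre Tau (PChoice (PDirac (NSum (NVar X) E)) p P)) F))
             (NRec X (NSum (NSum (NPre Tau (PChoice (PDirac (NSum (NVar X) E)) p P)) (NPre Tau P)) F))"
proof (rule wcong_recI)
  fix \<sigma> and H :: "('a, 'v) nexp" assume closing: "closing \<sigma>" and H: "closed_n H"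
    and s: "\<And>a t. stp H a t \<longleftrightarrow> stp (subst_n (\<sigma>(X := H)) (NSum (NSum (NPre Tau (PChoice (PDirac (NSum (NVar X) E)) p P)) (NPre Tau P)) F)) a t"
  let ?B = "subst_n (\<sigma>(X := H)) (NSum (NPre Tau (PChoice (PDirac (NSum (NVar X) E)) p P)) F)"
  let ?P = "pdist (subst_p (\<sigma>(X := H)) P)" and ?S = "NSum H (subst_n (\<sigma>(X := H)) E)"
  have cB: "closed_n ?B" by (rule closed_subst[OF closing_upd[OF closing H]])
  \<comment> \<open>\<open>None\<close> marks the branch into \<open>?S\<close>. The mark is needed
    because \<open>?P\<close> may contain the state \<open>?S\<close> as well, and there it must not
    move.\<close>
  define \<zeta> where "\<zeta> = bind_pmf (bernoulli_pmf (Rep_prob p)) (\<lambda>b. if b then return_pmf None else map_pmf Some ?P)"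
  have 1: "map_pmf (case_option ?S id) \<zeta> = pdist (PChoice (PDirac ?S) p (subst_p (\<sigma>(X := H)) P))"
    unfolding \<zeta>_def map_bind_pmf pdist.simps by (intro bind_pmf_cong) (auto simp: map_pmf_comp)
  have "bind_pmf \<zeta> (case_option ?P return_pmf) = bind_pmf (bernoulli_pmf (Rep_prob p)) (\<lambda>b. ?P)"
    unfolding \<zeta>_def bind_assoc_pmf by (intro bind_pmf_cong) (auto simp: bind_return_pmf bind_map_pmf bind_return_pmf')
  then have 2: "bind_pmf \<zeta> (case_option ?P return_pmf) = ?P" by simp
  have "WT Tau ?B (bind_pmf \<zeta> (case_option ?P return_pmf))"
  proof (rule WT_WK_label[of _ _ "case_option ?S id"])
    show "WT Tau ?B (map_pmf (case_option ?S id) \<zeta>)" unfolding 1 by (rule WT_step) (simp add: stp_sum stp_pre)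
    fix y assume "y \<in> set_pmf \<zeta>"
    have "stp ?S Tau ?P" by (simp add: stp_sum s stp_pre)
    then show "WK (case_option ?S id y) (case_option ?P return_pmf y)" by (cases y) (auto intro: WK_step WK_return)
  qed
  then have wt: "WT Tau ?B ?P" unfolding 2 .
  have "wcong_half H ?B"
  proof (rule wcong_half_stp[OF H])
    fix a t assume "stp H a t"
    then have "stp ?B a t \<or> (a = Tau \<and> t = ?P)" unfolding s by (auto simp: stp_sum stp_pre)
    then show "WT a ?B t" using wt WT_step by blast
  qed
  moreover have "wcong_half ?B H" by (rule wcong_half_stp[OF cB], rule WT_step) (auto simp: s stp_sum)
  ultimately show "wcong_closed H ?B" unfolding wcong_closed_iff ..
next
  fix \<sigma> and H :: "('a, 'v) nexp" assume closing: "closing \<sigma>" and H: "closed_n H"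
    and s: "\<And>a t. stp H a t \<longleftrightarrow> stp (subst_n (\<sigma>(X := H)) (NSum (NPre Tau (PChoice (PDirac (NSum (NVar X) E)) p P)) F)) a t"
  let ?B = "subst_n (\<sigma>(X := H)) (NSum (NSum (NPre Tau (PChoice (PDirac (NSum (NVar X) E)) p P)) (NPre Tau P)) F)"
  let ?P = "pdist (subst_p (\<sigma>(X := H)) P)" and ?S = "NSum H (subst_n (\<sigma>(X := H)) E)"
  let ?t = "pdist (PChoice (PDirac ?S) p (subst_p (\<sigma>(X := H)) P))"
  have cB: "closed_n ?B" by (rule closed_subst[OF closing_upd[OF closing H]])
  have st: "stp H Tau ?t" unfolding s by (simp add: stp_sum stp_pre)
  have pb: "0 \<le> Rep_prob p" "Rep_prob p < 1" using Rep_prob_bounds[of p] by auto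
  have "WK ?S ?P"
  proof (rule WK_retry[where t = ?t and a = "\<lambda>u. ennreal (Rep_prob p) * ep (return_pmf ?S) u" and b = "\<lambda>u. ep ?P u * ennreal (1 - Rep_prob p)" and \<rho> = "Rep_prob p"])
    show "stp ?S Tau ?t" using st by (simp add: stp_sum)
    show "ep ?t u = ennreal (Rep_prob p) * ep (return_pmf ?S) u + ep ?P u * ennreal (1 - Rep_prob p)" for u
      unfolding pmf_pd_choice using pb by (simp add: ennreal_plus ennreal_mult mult.commute)
    show "stp u Tau ?t" if "ennreal (Rep_prob p) * ep (return_pmf ?S) u \<noteq> 0" for u
      using that \<open>stp ?S Tau ?t\<close> by (auto simp: ep_return split: if_splits)
    show "nsum (\<lambda>u. ennreal (Rep_prob p) * ep (return_pmf ?S) u) = ennreal (Rep_prob p)" by (simp add: nsum_cmult nsum_ep)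
  qed (use pb in auto)
  then have wk: "WK ?S ?P" .
  define \<zeta> where "\<zeta> = bind_pmf (bernoulli_pmf (Rep_prob p)) (\<lambda>b. if b then return_pmf None else map_pmf Some ?P)"
  have 1: "map_pmf (case_option ?S id) \<zeta> = ?t"
    unfolding \<zeta>_def map_bind_pmf pdist.simps by (intro bind_pmf_cong) (auto simp: map_pmf_comp)
  have "bind_pmf \<zeta> (case_option ?P return_pmf) = bind_pmf (bernoulli_pmf (Rep_prob p)) (\<lambda>b. ?P)"
    unfolding \<zeta>_def bind_assoc_pmf by (intro bind_pmf_cong) (auto simp: bind_return_pmf bind_map_pmf bind_return_pmf')
  then have 2: "bind_pmf \<zeta> (case_option ?P return_pmf) = ?P" by simp
  have "WT Tau H (bind_pmf \<zeta> (case_option ?P return_pmf))"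
  proof (rule WT_WK_label[of _ _ "case_option ?S id"])
    show "WT Tau H (map_pmf (case_option ?S id) \<zeta>)" unfolding 1 by (rule WT_step[OF st])
    show "WK (case_option ?S id y) (case_option ?P return_pmf y)" for y by (cases y) (auto intro: wk WK_return)
  qed
  then have wt: "WT Tau H ?P" unfolding 2 .
  have "wcong_half ?B H"
  proof (rule wcong_half_stp[OF cB])
    fix a t assume "stp ?B a t"
    then have "stp H a t \<or> (a = Tau \<and> t = ?P)" unfolding s by (auto simp: stp_sum stp_pre)
    then show "WT a H t" using wt WT_step by blast
  qed
  moreover have "wcong_half H ?B" by (rule wcong_half_stp[OF H], rule WT_step) (auto simp: s stp_sum)
  ultimately show "wcong_closed H ?B" unfolding wcong_closed_iff by blast
qed

text \<open>A transition through the summand \<open>X\<close> is a transition of the recursion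
  itself with one unfolding less, so after finitely many unfoldings it comes from
  \<open>E\<close>.\<close>

lemma wcong_R4:
  fixes E :: "('a, 'v::infinite) nexp"
  shows "wcong (NRec X (NSum (NVar X) E)) (NRec X E)"
proof (rule wcong_recI)
  fix \<sigma> and H :: "('a, 'v) nexp" assume closing: "closing \<sigma>" and H: "closed_n H"
    and s: "\<And>a t. stp H a t \<longleftrightarrow> stp (subst_n (\<sigma>(X := H)) E) a t"
  show "wcong_closed H (subst_n (\<sigma>(X := H)) (NSum (NVar X) E))"
    by (rule wcong_closed_stp[OF H closed_subst[OF closing_upd[OF closing H]]]) (auto simp: stp_sum s)
next
  fix \<sigma> and H :: "('a, 'v) nexp" assume closing: "closing \<sigma>" and H: "closed_n H"
    and ex: "\<exists>B. H = NRec X B \<and> subst1 B X H = subst_n (\<sigma>(X := H)) (NSum (NVar X) E)"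
    and s: "\<And>a t. stp H a t \<longleftrightarrow> stp (subst_n (\<sigma>(X := H)) (NSum (NVar X) E)) a t"
  obtain B where B: "H = NRec X B" "subst1 B X H = NSum H (subst_n (\<sigma>(X := H)) E)" using ex by auto
  have "stepn n H a t \<Longrightarrow> stp (subst_n (\<sigma>(X := H)) E) a t" for n a t
  proof (induction n rule: less_induct)
    case (less n)
    from less.prems obtain k where k: "n = Suc k" "stepn k (subst1 B X H) a t" unfolding B(1) by (cases rule: stepn.cases) auto
    from k(2)[unfolded B(2)] have "stepn k H a t \<or> stepn k (subst_n (\<sigma>(X := H)) E) a t" by (cases rule: stepn.cases) auto
    then show ?case using less.IH[of k] k(1) stp_stepn by blast
  qed
  then have 1: "stp H a t \<Longrightarrow> stp (subst_n (\<sigma>(X := H)) E) a t" for a t unfolding stp_stepn[of H] by blast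
  have 2: "stp (subst_n (\<sigma>(X := H)) E) a t \<Longrightarrow> stp H a t" for a t unfolding s[of a t] by (simp add: stp_sum)
  show "wcong_closed H (subst_n (\<sigma>(X := H)) E)"
    by (rule wcong_closed_stp[OF H closed_subst[OF closing_upd[OF closing H]]]) (use 1 2 in blast)
qed

text \<open>Everything rests on bisimilarity of \<open>H\<close> with \<open>G\<close>, the body
  \<open>E\<close> at \<open>H\<close>. On one side \<open>H\<close> has a single internal step to
  \<open>G\<close>; on the other it behaves as \<open>G\<close> with an added internal loop, which
  \<open>G\<close> matches by staying put.\<close>

lemma wcong_R5:
  fixes E :: "('a, 'v::infinite) nexp"
  shows "wcong (NRec X (NSum (npref Tau (NVar X)) E)) (NRec X (npref Tau E))"
proof (rule wcong_recI)
  fix \<sigma> and H :: "('a, 'v) nexp" assume closing: "closing \<sigma>" and H: "closed_n H"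
    and s': "\<And>a t. stp H a t \<longleftrightarrow> stp (subst_n (\<sigma>(X := H)) (npref Tau E)) a t"
  define G where "G = subst_n (\<sigma>(X := H)) E"
  have cG: "closed_n G" unfolding G_def by (rule closed_subst[OF closing_upd[OF closing H]])
  have s: "stp H a t \<longleftrightarrow> a = Tau \<and> t = return_pmf G" for a t unfolding s' by (simp add: stp_pre G_def)
  have i: "WT a H t" if "stp G a t" for a t by (rule item_tau[of _ "return_pmf G"]) (use that s in auto)
  have w: "wbisim H G"
  proof (rule wbisim_pairI[OF H cG])
    show "\<exists>n. WTH a G n \<and> rel_pmf (\<lambda>x y. wbisim x y \<or> (x = H \<and> y = G)) t n" if "stp H a t" for a t
      using that wbisim_refl[OF cG] by (intro exI[of _ "return_pmf G"]) (simp add: s WTH_def WK_return)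
    show "\<exists>n. WTH a H n \<and> rel_pmf (\<lambda>x y. wbisim x y \<or> (x = G \<and> y = H)) t n" if "stp G a t" for a t
      using rel_pair_refl[OF that cG] WT_WTH[OF i[OF that]] by (intro exI[of _ t] conjI)
  qed
  have "wcong_half H (NSum (npref Tau H) G)" unfolding wcong_half_def s
    using wbisim_sym[OF w] by (auto intro!: exI[of _ "return_pmf H"] WT_step simp: stp_sum stp_pre)
  moreover have "wcong_half (NSum (npref Tau H) G) H" unfolding wcong_half_def
  proof (intro allI impI)
    fix a t assume "stp (NSum (npref Tau H) G) a t"
    then consider "a = Tau" "t = return_pmf H" | "stp G a t" by (auto simp: stp_sum stp_pre)
    then show "\<exists>n. WT a H n \<and> rel_pmf wbisim t n"
    proof cases
      case 1 then show ?thesis using w by (intro exI[of _ "return_pmf G"]) (auto intro: WT_step simp: s)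
    next
      case 2 then show ?thesis using i[OF 2] rel_stp_refl[OF 2 cG] by blast
    qed
  qed
  ultimately show "wcong_closed H (subst_n (\<sigma>(X := H)) (NSum (npref Tau (NVar X)) E))"
    unfolding wcong_closed_iff by (simp add: G_def)
next
  fix \<sigma> and H :: "('a, 'v) nexp" assume closing: "closing \<sigma>" and H: "closed_n H"
    and s': "\<And>a t. stp H a t \<longleftrightarrow> stp (subst_n (\<sigma>(X := H)) (NSum (npref Tau (NVar X)) E)) a t"
  define G where "G = subst_n (\<sigma>(X := H)) E"
  have cG: "closed_n G" unfolding G_def by (rule closed_subst[OF closing_upd[OF closing H]])
  have s: "stp H a t \<longleftrightarrow> (a = Tau \<and> t = return_pmf H) \<or> stp G a t" for a t unfolding s' by (simp add: stp_pre stp_sum G_def)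
  have w: "wbisim H G"
  proof (rule wbisim_pairI[OF H cG])
    show "\<exists>n. WTH a G n \<and> rel_pmf (\<lambda>x y. wbisim x y \<or> (x = H \<and> y = G)) t n" if "stp H a t" for a t
    proof (cases "stp G a t")
      case True then show ?thesis using rel_pair_refl[OF True cG] WT_WTH[OF WT_step[OF True]] by (intro exI[of _ t] conjI)
    next
      case False then show ?thesis using that by (intro exI[of _ "return_pmf G"]) (simp add: s WTH_def WK_return)
    qed
    show "\<exists>n. WTH a H n \<and> rel_pmf (\<lambda>x y. wbisim x y \<or> (x = G \<and> y = H)) t n" if "stp G a t" for a t
    proof -
      have "stp H a t" using that s by blast
      from WT_WTH[OF WT_step[OF this]] show ?thesis using rel_pair_refl[OF that cG] by (intro exI[of _ t] conjI)
    qed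
  qed
  have "wcong_half H (npref Tau G)" unfolding wcong_half_def
  proof (intro allI impI)
    fix a t assume "stp H a t"
    then consider "a = Tau" "t = return_pmf H" | "stp G a t" by (auto simp: s)
    then show "\<exists>n. WT a (npref Tau G) n \<and> rel_pmf wbisim t n"
    proof cases
      case 1 then show ?thesis using w by (intro exI[of _ "return_pmf G"]) (auto intro: WT_step simp: stp_pre)
    next
      case 2
      have "WT a (npref Tau G) t" by (rule item_tau[of _ "return_pmf G"]) (use 2 in \<open>auto simp: stp_pre\<close>)
      then show ?thesis using rel_stp_refl[OF 2 cG] by blast
    qed
  qed
  moreover have "wcong_half (npref Tau G) H" unfolding wcong_half_def stp_pre
    using wbisim_sym[OF w] by (auto intro!: exI[of _ "return_pmf H"] WT_step simp: s)
  ultimately show "wcong_closed H (subst_n (\<sigma>(X := H)) (npref Tau E))"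
    unfolding wcong_closed_iff by (simp add: G_def)
qed

lemma stp_bigsum: "stp (bigsum Es) a t \<longleftrightarrow> (\<exists>E\<in>set Es. stp E a t)"
  by (induction Es rule: bigsum.induct) (auto simp: stp_sum stp_nil)

lemma subst_bigsum: "subst_n \<sigma> (bigsum Es) = bigsum (map (subst_n \<sigma>) Es)"
  by (induction Es rule: bigsum.induct) auto

lemma rel_return_map: "(\<And>y. y \<in> set_pmf W \<Longrightarrow> wbisim H (f y)) \<Longrightarrow> rel_pmf wbisim (return_pmf H) (map_pmf f W)"
  using rel_pmf_bind_set[of W wbisim "\<lambda>_. return_pmf H" "\<lambda>y. return_pmf (f y)"] by (simp add: map_pmf_def)

text \<open>Write \<open>f \<sigma> H i\<close> for \<open>H + E_i\<close>. If \<open>H\<close>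
  solves the right side, it already offers every \<open>E_i\<close>, so all these states have the
  transitions of \<open>H\<close>. If \<open>H\<close> solves the left side, each of them offers the
  same internal step again, so any chosen one is reached with probability 1 by retrying.\<close>

lemma wcong_R6:
  fixes F :: "('a, 'v::infinite) nexp"
  assumes "valid_weights xs"
  shows "wcong (NRec X (NSum (NPre Tau (bigoplus (map (\<lambda>(p, E). (p, PDirac (NSum (NVar X) E))) xs))) F))
           (NRec X (NSum (NSum (npref Tau (NVar X)) (bigsum (map snd xs))) F))"
proof -
  obtain W where W: "set_pmf W = {..<length xs}" "\<And>\<sigma> (f :: real \<times> ('a, 'v) nexp \<Rightarrow> ('a, 'v) pexp). pdist (subst_p \<sigma> (bigoplus (map (\<lambda>x. (fst x, f x)) xs))) =
     bind_pmf W (\<lambda>i. pdist (subst_p \<sigma> (f (xs ! i))))" using pdist_subst_bigoplus[OF assms] by blast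
  let ?B1 = "NSum (NPre Tau (bigoplus (map (\<lambda>(p, E). (p, PDirac (NSum (NVar X) E))) xs))) F"
  let ?B2 = "NSum (NSum (npref Tau (NVar X)) (bigsum (map snd xs))) F"
  define f where "f \<sigma> H i = NSum H (subst_n (\<sigma>(X := H)) (snd (xs ! i)))" for \<sigma> and H :: "('a, 'v) nexp" and i
  have p: "pdist (subst_p (\<sigma>(X := H)) (bigoplus (map (\<lambda>(p, E). (p, PDirac (NSum (NVar X) E))) xs))) = map_pmf (f \<sigma> H) W" for \<sigma> H
    using W(2)[of "\<sigma>(X := H)" "\<lambda>x. PDirac (NSum (NVar X) (snd x))"] by (simp add: case_prod_beta' map_pmf_def f_def)
  have st1: "stp (subst_n (\<sigma>(X := H)) ?B1) a t \<longleftrightarrow> (a = Tau \<and> t = map_pmf (f \<sigma> H) W) \<or> stp (subst_n (\<sigma>(X := H)) F) a t" for \<sigma> H a t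
    by (simp add: stp_sum stp_pre p)
  have st2: "stp (subst_n (\<sigma>(X := H)) ?B2) a t \<longleftrightarrow> (a = Tau \<and> t = return_pmf H) \<or>
      (\<exists>i<length xs. stp (subst_n (\<sigma>(X := H)) (snd (xs ! i))) a t) \<or> stp (subst_n (\<sigma>(X := H)) F) a t" for \<sigma> H a t
    by (auto simp: stp_sum stp_pre subst_bigsum stp_bigsum set_conv_nth)
  show ?thesis
  proof (rule wcong_recI)
    fix \<sigma> and H :: "('a, 'v) nexp" assume closing: "closing \<sigma>" and H: "closed_n H"
      and s: "\<And>a t. stp H a t \<longleftrightarrow> stp (subst_n (\<sigma>(X := H)) ?B2) a t"
    have c: "closed_n (subst_n (\<sigma>(X := H)) G)" for G :: "('a, 'v) nexp" by (rule closed_subst[OF closing_upd[OF closing H]])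
    have cf: "closed_n (f \<sigma> H i)" for i using H c[of "snd (xs ! i)"] by (simp add: f_def closed_n_def)
    have w: "wbisim H (f \<sigma> H i)" if "i < length xs" for i
    proof (rule wcong_closed_wbisim[OF wcong_closed_stp[OF H cf] H cf])
      fix a t
      have "stp (subst_n (\<sigma>(X := H)) (snd (xs ! i))) a t \<Longrightarrow> stp H a t" using that s st2 by blast
      then show "stp H a t \<longleftrightarrow> stp (f \<sigma> H i) a t" unfolding f_def stp_sum by blast
    qed
    have r: "rel_pmf wbisim (return_pmf H) (map_pmf (f \<sigma> H) W)" by (rule rel_return_map) (use w W(1) in auto)
    have "wcong_half H (subst_n (\<sigma>(X := H)) ?B1)" unfolding wcong_half_def
    proof (intro allI impI)
      fix a t assume st: "stp H a t"
      then consider "a = Tau" "t = return_pmf H" | i where "i < length xs" "stp (subst_n (\<sigma>(X := H)) (snd (xs ! i))) a t" | "stp (subst_n (\<sigma>(X := H)) F) a t"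
        unfolding s st2 by blast
      then show "\<exists>n. WT a (subst_n (\<sigma>(X := H)) ?B1) n \<and> rel_pmf wbisim t n"
      proof cases
        case 1
        have "WT Tau (subst_n (\<sigma>(X := H)) ?B1) (map_pmf (f \<sigma> H) W)" by (rule WT_step) (use st1 in blast)
        then show ?thesis using 1 r by blast
      next
        case (2 i)
        have "stp y a t" if "y \<in> set_pmf (map_pmf (f \<sigma> H) W)" for y using that st by (auto simp: f_def stp_sum)
        then have "WT a (subst_n (\<sigma>(X := H)) ?B1) t" using st1[of \<sigma> H Tau "map_pmf (f \<sigma> H) W"] by (intro item_tau) auto
        then show ?thesis using rel_stp_refl[OF st H] by blast
      next
        case 3
        then have "WT a (subst_n (\<sigma>(X := H)) ?B1) t" using st1 WT_step by blast
        then show ?thesis using rel_stp_refl[OF st H] by blast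
      qed
    qed
    moreover have "wcong_half (subst_n (\<sigma>(X := H)) ?B1) H" unfolding wcong_half_def
    proof (intro allI impI)
      fix a t assume st: "stp (subst_n (\<sigma>(X := H)) ?B1) a t"
      then consider "a = Tau" "t = map_pmf (f \<sigma> H) W" | "stp H a t" unfolding s st1 st2 by blast
      then show "\<exists>n. WT a H n \<and> rel_pmf wbisim t n"
      proof cases
        case 1
        have "WT Tau H (return_pmf H)" by (rule WT_step) (use s st2 in blast)
        then show ?thesis using 1 rel_wbisim_sym[OF r] by blast
      next
        case 2 then show ?thesis using rel_stp_refl[OF 2 H] WT_step by blast
      qed
    qed
    ultimately show "wcong_closed H (subst_n (\<sigma>(X := H)) ?B1)" unfolding wcong_closed_iff ..
  next
    fix \<sigma> and H :: "('a, 'v) nexp" assume closing: "closing \<sigma>" and H: "closed_n H"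
      and s: "\<And>a t. stp H a t \<longleftrightarrow> stp (subst_n (\<sigma>(X := H)) ?B1) a t"
    let ?t = "map_pmf (f \<sigma> H) W"
    have c: "closed_n (subst_n (\<sigma>(X := H)) G)" for G :: "('a, 'v) nexp" by (rule closed_subst[OF closing_upd[OF closing H]])
    have cf: "closed_n (f \<sigma> H i)" for i using H c[of "snd (xs ! i)"] by (simp add: f_def closed_n_def)
    have Ht: "stp H Tau ?t" unfolding s st1 by blast
    \<comment> \<open>All states other than the chosen one count as failures. The failure
      probability is taken from the distribution on states, as several indices may yield the same
      state.\<close>
    have wk: "WK H (return_pmf (f \<sigma> H i))" if "i < length xs" for i
    proof (rule WK_retry[OF Ht, where a = "\<lambda>u. if u = f \<sigma> H i then 0 else ep ?t u" and b = "\<lambda>u. if u = f \<sigma> H i then ep ?t u else 0"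
          and \<rho> = "1 - pmf ?t (f \<sigma> H i)"])
      have pos: "0 < pmf ?t (f \<sigma> H i)" by (rule pmf_positive) (use that W(1) in auto)
      then show "1 - pmf ?t (f \<sigma> H i) < 1" by simp
      show "stp u Tau ?t" if "(if u = f \<sigma> H i then 0 else ep ?t u) \<noteq> 0" for u
      proof -
        have "u \<in> set_pmf ?t" using that ep_nz[of ?t u] by (auto split: if_splits)
        then show ?thesis using Ht by (auto simp: f_def stp_sum)
      qed
      have "nsum (\<lambda>u. if u = f \<sigma> H i then 0 else ep ?t u) + ep ?t (f \<sigma> H i) = 1"
      proof -
        have "nsum (\<lambda>u. if u = f \<sigma> H i then ep ?t u else 0) = ep ?t (f \<sigma> H i)" by (subst nsum_single[of "f \<sigma> H i"]) auto
        then have "nsum (\<lambda>u. if u = f \<sigma> H i then 0 else ep ?t u) + ep ?t (f \<sigma> H i) =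
           nsum (\<lambda>u. (if u = f \<sigma> H i then 0 else ep ?t u) + (if u = f \<sigma> H i then ep ?t u else 0))" by (simp only: nsum_add)
        also have "\<dots> = nsum (ep ?t)" by (rule nsum_cong) auto
        finally show ?thesis unfolding nsum_ep .
      qed
      then have "nsum (\<lambda>u. if u = f \<sigma> H i then 0 else ep ?t u) = 1 - ep ?t (f \<sigma> H i)" by (metis ennreal_add_diff_cancel_right ennreal_neq_top)
      then show "nsum (\<lambda>u. if u = f \<sigma> H i then 0 else ep ?t u) = ennreal (1 - pmf ?t (f \<sigma> H i))" using ennreal_minus[of "pmf ?t (f \<sigma> H i)" 1] by simp
      show "ep (return_pmf (f \<sigma> H i)) u * ennreal (1 - (1 - pmf ?t (f \<sigma> H i))) = (if u = f \<sigma> H i then ep ?t u else 0)" for u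
        by (auto simp: ep_return)
    qed (auto simp: pmf_le_1)
    have wt: "WT a H t" if "i < length xs" "stp (subst_n (\<sigma>(X := H)) (snd (xs ! i))) a t" for i a t
    proof -
      have "WT a (f \<sigma> H i) t" by (rule WT_step) (use that in \<open>simp add: f_def stp_sum\<close>)
      then have "WT a H (bind_pmf (return_pmf (f \<sigma> H i)) (\<lambda>_. t))" by (intro WK_WT[OF wk[OF that(1)]]) auto
      then show ?thesis by (simp add: bind_return_pmf)
    qed
    have w: "wbisim H (f \<sigma> H i)" if "i < length xs" for i
    proof (rule wbisim_pairI[OF H cf])
      show "\<exists>n. WTH a (f \<sigma> H i) n \<and> rel_pmf (\<lambda>x y. wbisim x y \<or> (x = H \<and> y = f \<sigma> H i)) t n" if st: "stp H a t" for a t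
      proof -
        have "WT a (f \<sigma> H i) t" by (rule WT_step) (use st in \<open>simp add: f_def stp_sum\<close>)
        then show ?thesis using rel_pair_refl[OF st H] by (intro exI[of _ t] conjI WT_WTH)
      qed
      show "\<exists>n. WTH a H n \<and> rel_pmf (\<lambda>x y. wbisim x y \<or> (x = f \<sigma> H i \<and> y = H)) t n" if st: "stp (f \<sigma> H i) a t" for a t
      proof -
        have "stp H a t \<or> stp (subst_n (\<sigma>(X := H)) (snd (xs ! i))) a t" using st by (simp add: f_def stp_sum)
        then have "WT a H t" using wt[OF \<open>i < length xs\<close>] WT_step by blast
        then show ?thesis using rel_pair_refl[OF st cf] by (intro exI[of _ t] conjI WT_WTH)
      qed
    qed
    have r: "rel_pmf wbisim (return_pmf H) ?t" by (rule rel_return_map) (use w W(1) in auto)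
    have "wcong_half H (subst_n (\<sigma>(X := H)) ?B2)" unfolding wcong_half_def
    proof (intro allI impI)
      fix a t assume st: "stp H a t"
      then consider "a = Tau" "t = ?t" | "stp (subst_n (\<sigma>(X := H)) F) a t" unfolding s st1 by blast
      then show "\<exists>n. WT a (subst_n (\<sigma>(X := H)) ?B2) n \<and> rel_pmf wbisim t n"
      proof cases
        case 1
        have "WT Tau (subst_n (\<sigma>(X := H)) ?B2) (return_pmf H)" by (rule WT_step) (use st2 in blast)
        then show ?thesis using 1 rel_wbisim_sym[OF r] by blast
      next
        case 2
        have "WT a (subst_n (\<sigma>(X := H)) ?B2) t" by (rule WT_step) (use st2 2 in blast)
        then show ?thesis using rel_stp_refl[OF st H] by blast
      qed
    qed
    moreover have "wcong_half (subst_n (\<sigma>(X := H)) ?B2) H" unfolding wcong_half_def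
    proof (intro allI impI)
      fix a t assume st: "stp (subst_n (\<sigma>(X := H)) ?B2) a t"
      then consider "a = Tau" "t = return_pmf H" | i where "i < length xs" "stp (subst_n (\<sigma>(X := H)) (snd (xs ! i))) a t" | "stp H a t" unfolding s st1 st2 by blast
      then show "\<exists>n. WT a H n \<and> rel_pmf wbisim t n"
      proof cases
        case 1 then show ?thesis using WT_step[OF Ht] r by blast
      next
        case (2 i) then show ?thesis using wt[OF 2] rel_stp_refl[OF 2(2) c] by blast
      next
        case 3 then show ?thesis using rel_stp_refl[OF 3 H] WT_step by blast
      qed
    qed
    ultimately show "wcong_closed H (subst_n (\<sigma>(X := H)) ?B2)" unfolding wcong_closed_iff ..
  qed
qed

lemma peq_sound:
  fixes E F :: "('a, 'v::infinite) nexp" and P Q :: "('a, 'v) pexp"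
  shows "peq_n E F \<Longrightarrow> wcong E F" and "peq_p P Q \<Longrightarrow> pcong P Q"
proof (induction rule: peq_n_peq_p.inducts)
  case (refl_n E) show ?case by (rule wcong_stp) (rule refl)
next
  case (sym_n E F) then show ?case unfolding wcong_def' using wcong_closed_sym by blast
next
  case (sym_p P Q) then show ?case unfolding pcong_def using rel_wbisim_sym by blast
next
  case (trans_p P Q R) then show ?case unfolding pcong_def using rel_wbisim_trans by blast
next
  case trans_n show ?case by (rule wcong_trans) (fact trans_n)+
next
  case refl_p show ?case by (rule pcong_refl) (rule refl)
next
  case cong_pre show ?case by (rule wcong_pre) (fact cong_pre)+
next
  case cong_rec show ?case by (rule wcong_rec) (fact cong_rec)+
next
  case cong_sum show ?case by (rule wcong_sum) (fact cong_sum)+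
next
  case cong_dirac show ?case by (rule pcong_dirac) (fact cong_dirac)+
next
  case cong_choice show ?case by (rule pcong_choice) (fact cong_choice)+
next
  case alpha show ?case by (rule wcong_alpha) (fact alpha)+
next
  case P1 show ?case by (rule pcong_P1)
next
  case P2 show ?case by (rule pcong_P2) (fact P2)+
next
  case P3 show ?case by (rule pcong_P3)
next
  case T1 show ?case by (rule wcong_T1)
next
  case T2 show ?case by (rule wcong_T2) (fact T2)+
next
  case T3 show ?case by (rule wcong_T3) (fact T3)+
next
  case T4 show ?case by (rule wcong_T4) (fact T4)+
next
  case C show ?case by (rule wcong_C)
next
  case R1 show ?case by (rule wcong_unfold)
next
  case R2 show ?case by (rule wcong_unique) (fact R2)+
next
  case R3 show ?case by (rule wcong_R3)
next
  case R4 show ?case by (rule wcong_R4)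
next
  case R5 show ?case by (rule wcong_R5)
next
  case R6 show ?case by (rule wcong_R6) (fact R6)+
\<comment> \<open>The remaining cases are N1 to N4, where both sides have the same
  transitions.\<close>
qed (rule wcong_stp; auto simp: stp_sum stp_nil)+

theorem mainTheorem1:
  fixes E F :: "('a, 'v::infinite) nexp"
  assumes "peq_n E F"
  shows "wcong E F"
  using peq_sound(1)[OF assms] .

end
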